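(* Let $k$ be a field, $r\ge 1$, and let $\mathcal X\subset\mathbb Z^r$ be a Cubist subset. Then $U_{\mathcal X}\text{-mod}$ is a (graded) highest weight category with respect to the standard partial order $\succeq$ on $\mathcal X$, and the standard modules $\Delta_{U_{\mathcal X}}(x)$, $x\in\mathcal X$, possess linear projective resolutions.
   Context: Combinatorics. $\epsilon_1,\dots,\epsilon_r$ is the standard basis of $\mathbb Z^r$; $x\le y$ means $y-x$ has nonnegative coordinates; $x[n]=x+n(\epsilon_1+\cdots+\epsilon_r)$. A subset $\mathcal X\subset\mathbb Z^r$ is Cubist if $\mathcal X=\mathcal X^-\setminus\mathcal X^-[-1]$ for some nonempty proper ideal (down-closed subset) $\mathcal X^-$ of $(\mathbb Z^r,\le)$. For $1\le i\le r$ put $F_i=\{\sum_{j<i}a_j\epsilon_j-\sum_{j>i}a_j\epsilon_j : a_j\in\{0,1\}\}$. For each $x\in\mathcal X$ there is a unique $i$ with $x+F_i\subseteq\mathcal X$; put $\lambda x=x+F_i$. The standard partial order $\succeq$ on $\mathcal X$ is generated by $x\succeq y$ for $y\in\lambda x$. Algebras. Paths in quivers are composed from left to right; arrows have degree 1. $U_r$ is the $k$-algebra given by the quiver with vertices (idempotents) $e_x$, $x\in\mathbb Z^r$, arrows $a_{x,i}$ from $x$ to $x+\epsilon_i$ and $b_{x,i}$ from $x$ to $x-\epsilon_i$ ($1\le i\le r$), with relations, for all $x$: $a_{x,i}a_{x+\epsilon_i,i}=0$ and $b_{x,i}b_{x-\epsilon_i,i}=0$; for $i\neq j$: $a_{x,i}a_{x+\epsilon_i,j}+a_{x,j}a_{x+\epsilon_j,i}=0$,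 $b_{x,i}b_{x-\epsilon_i,j}+b_{x,j}b_{x-\epsilon_j,i}=0$, $a_{x,i}b_{x+\epsilon_i,j}+b_{x,j}a_{x-\epsilon_j,i}=0$; and for $1\le i<r$: $b_{x,i}a_{x-\epsilon_i,i}+a_{x,i}b_{x+\epsilon_i,i}=b_{x,i+1}a_{x-\epsilon_{i+1},i+1}+a_{x,i+1}b_{x+\epsilon_{i+1},i+1}$. Put $U_{\mathcal X}=U_r/\sum_{x\in\mathbb Z^r\setminus\mathcal X}U_re_xU_r$. Module conventions. Let $A=\bigoplus_{i\ge0}A_i$ be a graded $k$-algebra with orthogonal idempotents $e_s$ ($s\in\mathcal R$) forming a basis of $A_0$, $A=\bigoplus_{s,t}e_sAe_t$, and $\dim e_sA_i<\infty$. Modules are graded left modules $M=\bigoplus_i M_i$ with $M=\bigoplus_s e_sM$; $M\langle n\rangle_i=M_{i-n}$. $A\text{-mod}$ is the category of graded modules $M$ with $\dim e_sM_i<\infty$ for all $s,i$ and $M_i=0$ for $i\ll0$, with degree-preserving homomorphisms. Given a partial order $\preceq$ on $\mathcal R$, the standard module is $\Delta_A(s)=Ae_s/\sum_{t\succ s}Ae_tAe_s$. $A\text{-mod}$ is a graded highest weight category if for all $s$: (i) $e_t\Delta_A(s)=0$ whenever $t\not\preceq s$; (ii) $\ker(Ae_s\twoheadrightarrow\Delta_A(s))$ has a filtration in which each section is isomorphic to $\Delta_A(t)\langle n\rangle$ for some $t\succ s$ and $n\in\mathbb Z$. A projective resolution is linear if its $n$-th term is a direct sum of modules $Ae_t\langle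 n\rangle$. *)

theory Defs
  imports
    "HOL-Algebra.QuotRing"
    "HOL-Algebra.Module"
    "HOL-Algebra.Generated_Groups"
    "HOL-Algebra.Product_Groups"
    "HOL-Library.Function_Algebras"
    "Graph_Theory.Arc_Walk"
begin

section \<open>Graded algebras and graded modules\<close>

text \<open>
  Algebras here need not have a unit: the field \<open>one\<close> inherited from \<^type>\<open>ring\<close> is never used,
  and the orthogonal idempotents \<open>idem A s\<close>, \<open>s \<in> idx A\<close>, serve as local units.  Likewise
  the fields \<open>mult\<close> and \<open>one\<close> of a module are never used.
\<close>

record ('k, 'a, 's) galgebra = "('k, 'a) module" +
  agrade :: "nat \<Rightarrow> 'a set"
  idx :: "'s set"
  idem :: "'s \<Rightarrow> 'a"

record ('k, 'a, 'm) gmodule = "('k, 'm) module" +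
  act :: "'a \<Rightarrow> 'm \<Rightarrow> 'm"
  mgrade :: "int \<Rightarrow> 'm set"

definition direct_sum :: "('m, 'z) ring_scheme \<Rightarrow> 'i set \<Rightarrow> ('i \<Rightarrow> 'm set) \<Rightarrow> bool" where
  "direct_sum M I V \<longleftrightarrow>
     (\<forall>i\<in>I. subgroup (V i) (add_monoid M)) \<and>
     (\<forall>x\<in>carrier M. \<exists>!f. (\<forall>i\<in>I. f i \<in> V i) \<and> (\<forall>i. i \<notin> I \<longrightarrow> f i = \<zero>\<^bsub>M\<^esub>) \<and>
        finite {i. f i \<noteq> \<zero>\<^bsub>M\<^esub>} \<and> x = (\<Oplus>\<^bsub>M\<^esub>i\<in>{i. f i \<noteq> \<zero>\<^bsub>M\<^esub>}. f i))"

definition is_basis ::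
  "('k, 'y) ring_scheme \<Rightarrow> ('k, 'm, 'z) module_scheme \<Rightarrow> 'm set \<Rightarrow> 's set \<Rightarrow> ('s \<Rightarrow> 'm) \<Rightarrow> bool" where
  "is_basis K M V S b \<longleftrightarrow>
     (\<forall>s\<in>S. b s \<in> V) \<and>
     (\<forall>x\<in>V. \<exists>!c. (\<forall>s\<in>S. c s \<in> carrier K) \<and> (\<forall>s. s \<notin> S \<longrightarrow> c s = \<zero>\<^bsub>K\<^esub>) \<and>
        finite {s. c s \<noteq> \<zero>\<^bsub>K\<^esub>} \<and> x = (\<Oplus>\<^bsub>M\<^esub>s\<in>{s. c s \<noteq> \<zero>\<^bsub>K\<^esub>}. c s \<odot>\<^bsub>M\<^esub> b s))"

definition fin_dim ::
  "('k, 'y) ring_scheme \<Rightarrow> ('k, 'm, 'z) module_scheme \<Rightarrow> 'm set \<Rightarrow> bool" where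
  "fin_dim K M V \<longleftrightarrow>
     (\<exists>B. finite B \<and> B \<subseteq> V \<and>
       (\<forall>x\<in>V. \<exists>c\<in>B \<rightarrow> carrier K. x = (\<Oplus>\<^bsub>M\<^esub>b\<in>B. c b \<odot>\<^bsub>M\<^esub> b)))"

locale graded_algebra = field K + A?: Module.module K A
  for K :: "'k ring" (structure) and A :: "('k, 'a, 's) galgebra" (structure) +
  assumes mult_closed: "\<lbrakk>x \<in> carrier A; y \<in> carrier A\<rbrakk> \<Longrightarrow> x \<otimes>\<^bsub>A\<^esub> y \<in> carrier A"
    and mult_assoc: "\<lbrakk>x \<in> carrier A; y \<in> carrier A; z \<in> carrier A\<rbrakk>
      \<Longrightarrow> (x \<otimes>\<^bsub>A\<^esub> y) \<otimes>\<^bsub>A\<^esub> z = x \<otimes>\<^bsub>A\<^esub> (y \<otimes>\<^bsub>A\<^esub> z)"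
    and mult_add_left: "\<lbrakk>x \<in> carrier A; y \<in> carrier A; z \<in> carrier A\<rbrakk>
      \<Longrightarrow> (x \<oplus>\<^bsub>A\<^esub> y) \<otimes>\<^bsub>A\<^esub> z = x \<otimes>\<^bsub>A\<^esub> z \<oplus>\<^bsub>A\<^esub> y \<otimes>\<^bsub>A\<^esub> z"
    and mult_add_right: "\<lbrakk>x \<in> carrier A; y \<in> carrier A; z \<in> carrier A\<rbrakk>
      \<Longrightarrow> x \<otimes>\<^bsub>A\<^esub> (y \<oplus>\<^bsub>A\<^esub> z) = x \<otimes>\<^bsub>A\<^esub> y \<oplus>\<^bsub>A\<^esub> x \<otimes>\<^bsub>A\<^esub> z"
    and mult_smult_left: "\<lbrakk>c \<in> carrier K; x \<in> carrier A; y \<in> carrier A\<rbrakk>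
      \<Longrightarrow> (c \<odot>\<^bsub>A\<^esub> x) \<otimes>\<^bsub>A\<^esub> y = c \<odot>\<^bsub>A\<^esub> (x \<otimes>\<^bsub>A\<^esub> y)"
    and mult_smult_right: "\<lbrakk>c \<in> carrier K; x \<in> carrier A; y \<in> carrier A\<rbrakk>
      \<Longrightarrow> x \<otimes>\<^bsub>A\<^esub> (c \<odot>\<^bsub>A\<^esub> y) = c \<odot>\<^bsub>A\<^esub> (x \<otimes>\<^bsub>A\<^esub> y)"
    and agrade_submodule: "submodule (agrade A i) K A"
    and agrade_direct_sum: "direct_sum A UNIV (agrade A)"
    and agrade_mult: "\<lbrakk>x \<in> agrade A i; y \<in> agrade A j\<rbrakk> \<Longrightarrow> x \<otimes>\<^bsub>A\<^esub> y \<in> agrade A (i + j)"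
    and idem_orthogonal: "\<lbrakk>s \<in> idx A; t \<in> idx A\<rbrakk>
      \<Longrightarrow> idem A s \<otimes>\<^bsub>A\<^esub> idem A t = (if s = t then idem A s else \<zero>\<^bsub>A\<^esub>)"
    and idem_basis: "is_basis K A (agrade A 0) (idx A) (idem A)"
    and idem_direct_sum: "direct_sum A (idx A \<times> idx A)
      (\<lambda>(s, t). {idem A s \<otimes>\<^bsub>A\<^esub> x \<otimes>\<^bsub>A\<^esub> idem A t | x. x \<in> carrier A})"
    and idem_fin_dim: "s \<in> idx A \<Longrightarrow> fin_dim K A {idem A s \<otimes>\<^bsub>A\<^esub> x | x. x \<in> agrade A i}"

locale graded_module = Module.module K M
  for K :: "'k ring" (structure) and A :: "('k, 'a, 's) galgebra"
    and M :: "('k, 'a, 'm) gmodule" (structure) +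
  assumes act_closed: "\<lbrakk>a \<in> carrier A; x \<in> carrier M\<rbrakk> \<Longrightarrow> act M a x \<in> carrier M"
    and act_mult: "\<lbrakk>a \<in> carrier A; b \<in> carrier A; x \<in> carrier M\<rbrakk>
      \<Longrightarrow> act M (a \<otimes>\<^bsub>A\<^esub> b) x = act M a (act M b x)"
    and act_add_left: "\<lbrakk>a \<in> carrier A; b \<in> carrier A; x \<in> carrier M\<rbrakk>
      \<Longrightarrow> act M (a \<oplus>\<^bsub>A\<^esub> b) x = act M a x \<oplus>\<^bsub>M\<^esub> act M b x"
    and act_add_right: "\<lbrakk>a \<in> carrier A; x \<in> carrier M; y \<in> carrier M\<rbrakk>
      \<Longrightarrow> act M a (x \<oplus>\<^bsub>M\<^esub> y) = act M a x \<oplus>\<^bsub>M\<^esub> act M a y"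
    and act_smult_left: "\<lbrakk>c \<in> carrier K; a \<in> carrier A; x \<in> carrier M\<rbrakk>
      \<Longrightarrow> act M (c \<odot>\<^bsub>A\<^esub> a) x = c \<odot>\<^bsub>M\<^esub> act M a x"
    and act_smult_right: "\<lbrakk>c \<in> carrier K; a \<in> carrier A; x \<in> carrier M\<rbrakk>
      \<Longrightarrow> act M a (c \<odot>\<^bsub>M\<^esub> x) = c \<odot>\<^bsub>M\<^esub> act M a x"
    and mgrade_submodule: "submodule (mgrade M i) K M"
    and mgrade_direct_sum: "direct_sum M UNIV (mgrade M)"
    and act_mgrade: "\<lbrakk>a \<in> agrade A i; x \<in> mgrade M j\<rbrakk> \<Longrightarrow> act M a x \<in> mgrade M (int i + j)"
    and idem_act_direct_sum:
      "direct_sum M (idx A) (\<lambda>s. {act M (idem A s) x | x. x \<in> carrier M})"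

text \<open>The objects of the category \<open>A-mod\<close>.\<close>

definition in_mod ::
  "'k ring \<Rightarrow> ('k, 'a, 's) galgebra \<Rightarrow> ('k, 'a, 'm) gmodule \<Rightarrow> bool" where
  "in_mod K A M \<longleftrightarrow>
     graded_module K A M \<and>
     (\<forall>s\<in>idx A. \<forall>i. fin_dim K M {act M (idem A s) x | x. x \<in> mgrade M i}) \<and>
     (\<exists>n. \<forall>i<n. mgrade M i = {\<zero>\<^bsub>M\<^esub>})"

definition mod_hom ::
  "'k ring \<Rightarrow> ('k, 'a, 's) galgebra \<Rightarrow> ('k, 'a, 'm) gmodule \<Rightarrow> ('k, 'a, 'n) gmodule
     \<Rightarrow> ('m \<Rightarrow> 'n) set" where
  "mod_hom K A M N = {h \<in> carrier M \<rightarrow> carrier N.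
     (\<forall>x\<in>carrier M. \<forall>y\<in>carrier M. h (x \<oplus>\<^bsub>M\<^esub> y) = h x \<oplus>\<^bsub>N\<^esub> h y) \<and>
     (\<forall>c\<in>carrier K. \<forall>x\<in>carrier M. h (c \<odot>\<^bsub>M\<^esub> x) = c \<odot>\<^bsub>N\<^esub> h x) \<and>
     (\<forall>a\<in>carrier A. \<forall>x\<in>carrier M. h (act M a x) = act N a (h x)) \<and>
     (\<forall>i. h ` mgrade M i \<subseteq> mgrade N i)}"

definition mod_iso ::
  "'k ring \<Rightarrow> ('k, 'a, 's) galgebra \<Rightarrow> ('k, 'a, 'm) gmodule \<Rightarrow> ('k, 'a, 'n) gmodule \<Rightarrow> bool" where
  "mod_iso K A M N \<longleftrightarrow> (\<exists>h\<in>mod_hom K A M N. bij_betw h (carrier M) (carrier N))"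

definition sub_mod :: "('k, 'a, 'm) gmodule \<Rightarrow> 'm set \<Rightarrow> ('k, 'a, 'm) gmodule" where
  "sub_mod M N = M\<lparr>carrier := N, mgrade := (\<lambda>i. mgrade M i \<inter> N)\<rparr>"

definition graded_submodule ::
  "'k ring \<Rightarrow> ('k, 'a, 's) galgebra \<Rightarrow> ('k, 'a, 'm) gmodule \<Rightarrow> 'm set \<Rightarrow> bool" where
  "graded_submodule K A M N \<longleftrightarrow> N \<subseteq> carrier M \<and> graded_module K A (sub_mod M N)"

definition quot_mod :: "('k, 'a, 'm) gmodule \<Rightarrow> 'm set \<Rightarrow> ('k, 'a, 'm set) gmodule" where
  "quot_mod M N =
     \<lparr>carrier = a_rcosets\<^bsub>M\<^esub> N, mult = rcoset_mult M N, one = N +>\<^bsub>M\<^esub> \<one>\<^bsub>M\<^esub>,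
      zero = N, add = set_add M, smult = (\<lambda>c C. \<Union>x\<in>C. N +>\<^bsub>M\<^esub> (c \<odot>\<^bsub>M\<^esub> x)),
      act = (\<lambda>a C. \<Union>x\<in>C. N +>\<^bsub>M\<^esub> act M a x),
      mgrade = (\<lambda>i. (\<lambda>x. N +>\<^bsub>M\<^esub> x) ` mgrade M i)\<rparr>"

text \<open>The shift \<open>M\<langle>n\<rangle>\<close>.\<close>

definition shift_mod :: "('k, 'a, 'm) gmodule \<Rightarrow> int \<Rightarrow> ('k, 'a, 'm) gmodule" where
  "shift_mod M n = M\<lparr>mgrade := (\<lambda>i. mgrade M (i - n))\<rparr>"

text \<open>The external direct sum of a family of modules.\<close>

definition dsum_mod :: "'j set \<Rightarrow> ('j \<Rightarrow> ('k, 'a, 'm) gmodule) \<Rightarrow> ('k, 'a, 'j \<Rightarrow> 'm) gmodule" where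
  "dsum_mod J M =
     \<lparr>carrier = carrier (sum_group J (\<lambda>j. add_monoid (M j))),
      mult = (\<lambda>f g. \<lambda>j\<in>J. f j \<otimes>\<^bsub>M j\<^esub> g j), one = (\<lambda>j\<in>J. \<one>\<^bsub>M j\<^esub>),
      zero = (\<lambda>j\<in>J. \<zero>\<^bsub>M j\<^esub>), add = (\<lambda>f g. \<lambda>j\<in>J. f j \<oplus>\<^bsub>M j\<^esub> g j),
      smult = (\<lambda>c f. \<lambda>j\<in>J. c \<odot>\<^bsub>M j\<^esub> f j),
      act = (\<lambda>a f. \<lambda>j\<in>J. act (M j) a (f j)),
      mgrade = (\<lambda>i. {f \<in> carrier (sum_group J (\<lambda>j. add_monoid (M j))).
                       \<forall>j\<in>J. f j \<in> mgrade (M j) i})\<rparr>"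

text \<open>The projective module \<open>A e\<^sub>s\<close>.\<close>

definition proj_mod :: "('k, 'a, 's) galgebra \<Rightarrow> 's \<Rightarrow> ('k, 'a, 'a) gmodule" where
  "proj_mod A s =
     \<lparr>carrier = {a \<otimes>\<^bsub>A\<^esub> idem A s | a. a \<in> carrier A},
      mult = mult A, one = one A, zero = zero A, add = add A, smult = smult A,
      act = mult A,
      mgrade = (\<lambda>i. if i < 0 then {\<zero>\<^bsub>A\<^esub>} else {a \<otimes>\<^bsub>A\<^esub> idem A s | a. a \<in> agrade A (nat i)})\<rparr>"


section \<open>Standard modules, highest weight categories and linear resolutions\<close>

text \<open>
  A partial order \<open>leq\<close> is given as a relation: \<open>(s, t) \<in> leq\<close> means that \<open>s\<close> is below \<open>t\<close>.
  The submodule \<open>std_kernel A leq s\<close> is the sum of all \<open>A e\<^sub>t A e\<^sub>s\<close> with \<open>t\<close> strictly above \<open>s\<close>,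
  that is, the kernel of the projection from \<open>A e\<^sub>s\<close> to the standard module.
\<close>

definition std_kernel :: "('k, 'a, 's) galgebra \<Rightarrow> 's rel \<Rightarrow> 's \<Rightarrow> 'a set" where
  "std_kernel A leq s = generate (add_monoid A)
     {a \<otimes>\<^bsub>A\<^esub> idem A t \<otimes>\<^bsub>A\<^esub> b \<otimes>\<^bsub>A\<^esub> idem A s | a b t.
        a \<in> carrier A \<and> b \<in> carrier A \<and> t \<in> idx A \<and> (s, t) \<in> leq \<and> t \<noteq> s}"

definition std_mod :: "('k, 'a, 's) galgebra \<Rightarrow> 's rel \<Rightarrow> 's \<Rightarrow> ('k, 'a, 'a set) gmodule" where
  "std_mod A leq s = quot_mod (proj_mod A s) (std_kernel A leq s)"

definition graded_highest_weight ::
  "'k ring \<Rightarrow> ('k, 'a, 's) galgebra \<Rightarrow> 's rel \<Rightarrow> bool" where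
  "graded_highest_weight K A leq \<longleftrightarrow>
     graded_algebra K A \<and> partial_order_on (idx A) leq \<and>
     (\<forall>s\<in>idx A.
        (\<forall>t\<in>idx A. (t, s) \<notin> leq \<longrightarrow>
           {act (std_mod A leq s) (idem A t) x | x. x \<in> carrier (std_mod A leq s)}
             = {\<zero>\<^bsub>std_mod A leq s\<^esub>}) \<and>
        (\<exists>n N. N 0 = {\<zero>\<^bsub>A\<^esub>} \<and> N n = std_kernel A leq s \<and>
           (\<forall>i\<le>n. graded_submodule K A (proj_mod A s) (N i)) \<and>
           (\<forall>i<n. N i \<subseteq> N (Suc i) \<and>
              (\<exists>t\<in>idx A. (s, t) \<in> leq \<and> t \<noteq> s \<and>
                 (\<exists>m. mod_iso K A (quot_mod (sub_mod (proj_mod A s) (N (Suc i))) (N i))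
                                  (shift_mod (std_mod A leq t) m))))))"

text \<open>
  A linear projective resolution \<open>\<dots> \<rightarrow> P 1 \<rightarrow> P 0 \<rightarrow> M \<rightarrow> 0\<close> in \<open>A-mod\<close>, with differentials
  \<open>d n : P (n + 1) \<rightarrow> P n\<close> and augmentation \<open>p : P 0 \<rightarrow> M\<close>.  Direct sums of shifts of the
  modules \<open>A e\<^sub>t\<close> are automatically projective.
\<close>

definition linear_projective_resolution ::
  "'k ring \<Rightarrow> ('k, 'a, 's) galgebra \<Rightarrow> ('k, 'a, 'm) gmodule \<Rightarrow>
   (nat \<Rightarrow> ('k, 'a, 'j \<Rightarrow> 'a) gmodule) \<Rightarrow> (nat \<Rightarrow> ('j \<Rightarrow> 'a) \<Rightarrow> ('j \<Rightarrow> 'a)) \<Rightarrow> (('j \<Rightarrow> 'a) \<Rightarrow> 'm) \<Rightarrow> bool"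
where
  "linear_projective_resolution K A M P d p \<longleftrightarrow>
     (\<forall>n. in_mod K A (P n) \<and>
        (\<exists>J v. v ` J \<subseteq> idx A \<and> P n = dsum_mod J (\<lambda>j. shift_mod (proj_mod A (v j)) (int n)))) \<and>
     p \<in> mod_hom K A (P 0) M \<and> (\<forall>n. d n \<in> mod_hom K A (P (Suc n)) (P n)) \<and>
     p ` carrier (P 0) = carrier M \<and>
     d 0 ` carrier (P 1) = a_kernel (P 0) M p \<and>
     (\<forall>n. d (Suc n) ` carrier (P (Suc (Suc n))) = a_kernel (P (Suc n)) (P n) (d n))"

text \<open>
  If \<open>\<Oplus>\<^sub>j A e\<^bsub>v j\<^esub>\<langle>n\<rangle>\<close> lies in \<open>A-mod\<close>, then every \<open>t\<close> is attained by \<open>v\<close> only finitely often.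
  Hence up to isomorphism every such direct sum is indexed by a subset of \<open>idx A \<times> \<nat>\<close>, and it is
  no loss of generality to take that type for the indices.
\<close>

definition has_linear_projective_resolution ::
  "'k ring \<Rightarrow> ('k, 'a, 's) galgebra \<Rightarrow> ('k, 'a, 'm) gmodule \<Rightarrow> bool" where
  "has_linear_projective_resolution K A M \<longleftrightarrow>
     (\<exists>(P :: nat \<Rightarrow> ('k, 'a, 's \<times> nat \<Rightarrow> 'a) gmodule) d p. linear_projective_resolution K A M P d p)"


section \<open>Quiver algebras\<close>

text \<open>
  A quiver is a multi-digraph (\<^type>\<open>pre_digraph\<close>).  A path is recorded with its source
  and its target, so that there is one path of length zero at every vertex; paths compose from
  left to right.
\<close>

type_synonym ('v, 'e) path = "'v \<times> 'e list \<times> 'v"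

definition qpaths :: "('v, 'e) pre_digraph \<Rightarrow> ('v, 'e) path set" where
  "qpaths Q = {(u, es, v). pre_digraph.awalk Q u es v}"

definition path_algebra ::
  "'k ring \<Rightarrow> ('v, 'e) pre_digraph \<Rightarrow> ('k, ('v, 'e) path \<Rightarrow> 'k, 'v) galgebra" where
  "path_algebra K Q =
     (let C = {f. (\<forall>p. f p \<in> carrier K) \<and> (\<forall>p. p \<notin> qpaths Q \<longrightarrow> f p = \<zero>\<^bsub>K\<^esub>) \<and>
                  finite {p. f p \<noteq> \<zero>\<^bsub>K\<^esub>}}
      in \<lparr>carrier = C,
          mult = (\<lambda>f g (u, es, w).
            finsum K (\<lambda>(p, q). f p \<otimes>\<^bsub>K\<^esub> g q)
              {(p, q). \<exists>v es1 es2. p = (u, es1, v) \<and> q = (v, es2, w) \<and> es = es1 @ es2 \<and>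
                 p \<in> qpaths Q \<and> q \<in> qpaths Q}),
          one = (\<lambda>p. \<zero>\<^bsub>K\<^esub>), zero = (\<lambda>p. \<zero>\<^bsub>K\<^esub>),
          add = (\<lambda>f g p. f p \<oplus>\<^bsub>K\<^esub> g p),
          smult = (\<lambda>c f p. c \<otimes>\<^bsub>K\<^esub> f p),
          agrade = (\<lambda>n. {f \<in> C. \<forall>u es v. f (u, es, v) \<noteq> \<zero>\<^bsub>K\<^esub> \<longrightarrow> length es = n}),
          idx = verts Q,
          idem = (\<lambda>v p. if p = (v, [], v) then \<one>\<^bsub>K\<^esub> else \<zero>\<^bsub>K\<^esub>)\<rparr>)"

definition arrow_elem ::
  "'k ring \<Rightarrow> ('v, 'e) pre_digraph \<Rightarrow> 'e \<Rightarrow> ('v, 'e) path \<Rightarrow> 'k" where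
  "arrow_elem K Q e = (\<lambda>p. if p = (tail Q e, [e], head Q e) then \<one>\<^bsub>K\<^esub> else \<zero>\<^bsub>K\<^esub>)"

text \<open>\<^const>\<open>genideal\<close> is of no use here, as it refers to ideals of unital rings.\<close>

definition gen_ideal :: "'k ring \<Rightarrow> ('k, 'a, 's) galgebra \<Rightarrow> 'a set \<Rightarrow> 'a set" where
  "gen_ideal K A S = \<Inter>{I. submodule I K A \<and> S \<subseteq> I \<and>
     (\<forall>a\<in>carrier A. \<forall>x\<in>I. a \<otimes>\<^bsub>A\<^esub> x \<in> I \<and> x \<otimes>\<^bsub>A\<^esub> a \<in> I)}"

text \<open>
  The quotient of \<open>A\<close> by the ideal \<open>I\<close>; the parameter \<open>S\<close> is the set of indices of the
  idempotents that are kept, the others being understood to lie in \<open>I\<close>.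
\<close>

definition quot_algebra ::
  "('k, 'a, 's) galgebra \<Rightarrow> 'a set \<Rightarrow> 's set \<Rightarrow> ('k, 'a set, 's) galgebra" where
  "quot_algebra A I S =
     \<lparr>carrier = a_rcosets\<^bsub>A\<^esub> I, mult = rcoset_mult A I, one = I +>\<^bsub>A\<^esub> \<one>\<^bsub>A\<^esub>,
      zero = I, add = set_add A, smult = (\<lambda>c C. \<Union>x\<in>C. I +>\<^bsub>A\<^esub> (c \<odot>\<^bsub>A\<^esub> x)),
      agrade = (\<lambda>i. (\<lambda>x. I +>\<^bsub>A\<^esub> x) ` agrade A i),
      idx = S, idem = (\<lambda>s. I +>\<^bsub>A\<^esub> idem A s)\<rparr>"


section \<open>Cubist subsets\<close>

text \<open>
  \<open>\<int>\<^sup>r\<close> is the set of functions that vanish outside \<open>{1..r}\<close>; the order \<open>\<le>\<close> and the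
  addition on functions are pointwise.
\<close>

type_synonym point = "nat \<Rightarrow> int"

definition lattice_pts :: "nat \<Rightarrow> point set" where
  "lattice_pts r = {x. \<forall>j. j \<notin> {1..r} \<longrightarrow> x j = 0}"

definition eps :: "nat \<Rightarrow> point" where
  "eps i = (\<lambda>j. if j = i then 1 else 0)"

text \<open>The translate \<open>x[n]\<close>.\<close>

definition diag_shift :: "nat \<Rightarrow> point \<Rightarrow> int \<Rightarrow> point" where
  "diag_shift r x n = (\<lambda>j. if j \<in> {1..r} then x j + n else 0)"

definition cubist :: "nat \<Rightarrow> point set \<Rightarrow> bool" where
  "cubist r X \<longleftrightarrow>
     (\<exists>I. I \<subseteq> lattice_pts r \<and> I \<noteq> {} \<and> I \<noteq> lattice_pts r \<and>
        (\<forall>x\<in>I. \<forall>y\<in>lattice_pts r. y \<le> x \<longrightarrow> y \<in> I) \<and>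
        X = I - (\<lambda>x. diag_shift r x (- 1)) ` I)"

definition facet :: "nat \<Rightarrow> nat \<Rightarrow> point set" where
  "facet r i = {(\<Sum>j\<in>{1..<i}. (\<lambda>l. a j * eps j l)) - (\<Sum>j\<in>{i<..r}. (\<lambda>l. a j * eps j l)) | a.
     \<forall>j. a j \<in> {0, 1}}"

definition lam :: "nat \<Rightarrow> point set \<Rightarrow> point \<Rightarrow> point set" where
  "lam r X x =
     (\<lambda>f. x + f) ` facet r (THE i. i \<in> {1..r} \<and> (\<lambda>f. x + f) ` facet r i \<subseteq> X)"

text \<open>\<open>(y, x) \<in> std_order r X\<close> means that \<open>y\<close> is below \<open>x\<close> in the standard order.\<close>

definition std_order :: "nat \<Rightarrow> point set \<Rightarrow> point rel" where
  "std_order r X = {(y, x). x \<in> X \<and> y \<in> lam r X x}\<^sup>* \<inter> X \<times> X"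


section \<open>The algebras \<open>U\<^sub>r\<close> and \<open>U\<^sub>X\<close>\<close>

text \<open>\<open>ArrA x i\<close> and \<open>ArrB x i\<close> are the arrows \<open>a\<^bsub>x,i\<^esub>\<close> and \<open>b\<^bsub>x,i\<^esub>\<close>.\<close>

datatype arrow = ArrA point nat | ArrB point nat

fun arrow_tail :: "arrow \<Rightarrow> point" where
  "arrow_tail (ArrA x i) = x"
| "arrow_tail (ArrB x i) = x"

fun arrow_head :: "arrow \<Rightarrow> point" where
  "arrow_head (ArrA x i) = x + eps i"
| "arrow_head (ArrB x i) = x - eps i"

definition U_quiver :: "nat \<Rightarrow> (point, arrow) pre_digraph" where
  "U_quiver r =
     \<lparr>verts = lattice_pts r,
      arcs = {ArrA x i | x i. x \<in> lattice_pts r \<and> i \<in> {1..r}} \<union>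
             {ArrB x i | x i. x \<in> lattice_pts r \<and> i \<in> {1..r}},
      tail = arrow_tail, head = arrow_head\<rparr>"

definition U_relations :: "'k ring \<Rightarrow> nat \<Rightarrow> ((point, arrow) path \<Rightarrow> 'k) set" where
  "U_relations K r =
     (let A = path_algebra K (U_quiver r);
          a = (\<lambda>x i. arrow_elem K (U_quiver r) (ArrA x i));
          b = (\<lambda>x i. arrow_elem K (U_quiver r) (ArrB x i))
      in {a x i \<otimes>\<^bsub>A\<^esub> a (x + eps i) i | x i. x \<in> lattice_pts r \<and> i \<in> {1..r}} \<union>
         {b x i \<otimes>\<^bsub>A\<^esub> b (x - eps i) i | x i. x \<in> lattice_pts r \<and> i \<in> {1..r}} \<union>
         {a x i \<otimes>\<^bsub>A\<^esub> a (x + eps i) j \<oplus>\<^bsub>A\<^esub> a x j \<otimes>\<^bsub>A\<^esub> a (x + eps j) i | x i j.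
            x \<in> lattice_pts r \<and> i \<in> {1..r} \<and> j \<in> {1..r} \<and> i \<noteq> j} \<union>
         {b x i \<otimes>\<^bsub>A\<^esub> b (x - eps i) j \<oplus>\<^bsub>A\<^esub> b x j \<otimes>\<^bsub>A\<^esub> b (x - eps j) i | x i j.
            x \<in> lattice_pts r \<and> i \<in> {1..r} \<and> j \<in> {1..r} \<and> i \<noteq> j} \<union>
         {a x i \<otimes>\<^bsub>A\<^esub> b (x + eps i) j \<oplus>\<^bsub>A\<^esub> b x j \<otimes>\<^bsub>A\<^esub> a (x - eps j) i | x i j.
            x \<in> lattice_pts r \<and> i \<in> {1..r} \<and> j \<in> {1..r} \<and> i \<noteq> j} \<union>
         {(b x i \<otimes>\<^bsub>A\<^esub> a (x - eps i) i \<oplus>\<^bsub>A\<^esub> a x i \<otimes>\<^bsub>A\<^esub> b (x + eps i) i) \<ominus>\<^bsub>A\<^esub>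
          (b x (i + 1) \<otimes>\<^bsub>A\<^esub> a (x - eps (i + 1)) (i + 1) \<oplus>\<^bsub>A\<^esub>
           a x (i + 1) \<otimes>\<^bsub>A\<^esub> b (x + eps (i + 1)) (i + 1)) | x i.
            x \<in> lattice_pts r \<and> 1 \<le> i \<and> i < r})"

definition U_alg ::
  "'k ring \<Rightarrow> nat \<Rightarrow> ('k, ((point, arrow) path \<Rightarrow> 'k) set, point) galgebra" where
  "U_alg K r =
     (let A = path_algebra K (U_quiver r)
      in quot_algebra A (gen_ideal K A (U_relations K r)) (lattice_pts r))"

definition U_cubist ::
  "'k ring \<Rightarrow> nat \<Rightarrow> point set
     \<Rightarrow> ('k, ((point, arrow) path \<Rightarrow> 'k) set set, point) galgebra" where
  "U_cubist K r X =
     (let U = U_alg K r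
      in quot_algebra U
           (generate (add_monoid U) {u \<otimes>\<^bsub>U\<^esub> idem U x \<otimes>\<^bsub>U\<^esub> v | u v x.
              u \<in> carrier U \<and> v \<in> carrier U \<and> x \<in> lattice_pts r - X})
           X)"

end

theory Submission
 imports Defs
begin

text \<open>Let \<open>A = U\<^sub>X\<close>.  Up to signs there is one nonzero monotone path between any two points of a cube of
  \<open>X\<close>, and a path that leaves the cube may be rewritten so as to leave \<open>X\<close>.  Hence \<open>A e\<^sub>s\<close> is spanned by products
  through the tiles, which gives the filtration by standard modules as soon as the loop from a point around its tile is
  nonzero.  This is seen from a linear functional on the path algebra, a signed count of the boxes that contain a
  path, which vanishes on the relations and on the paths through points outside \<open>X\<close>.

  The standard module of \<open>z\<close> is resolved by the modules \<open>A e\<^sub>y\<close>, where \<open>y\<close> runs through a cone with vertex \<open>z\<close> and the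
  anticommuting arrows give the differential.  Filtering by tiles, the layer of each tile other than that of \<open>z\<close> has a
  coordinate in which it can be moved, and this coordinate contracts the layer.\<close>

text \<open>The index of a structure is written after a dot: \<open>x \<otimes>.A y\<close>.\<close>

syntax "_index" :: "logic => index" ("._" [1000] 1000)
notation monoid.mult (infixl "**\<index>" 70)

section \<open>Cubes in a Cubist subset\<close>

text \<open>Rewriting shows only that the products through tiles span; it never shows that something
  is nonzero. The missing lower bound is reduced to one element per tile: the loop from
  \<open>opp t\<close> to \<open>t\<close> and back, of length \<open>2 * (r - 1)\<close>. It
  suffices because every product through the tile of \<open>t\<close> extends to this loop, while
  any other tile containing \<open>opp t\<close> yields a loop there of smaller degree. Boxes enter
  because each box of side one carries a representation of \<open>U_r\<close> on its vertices: an
  arrow acts by a sign if both ends are vertices, and by zero otherwise. From a vertex exactly one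
  of the two steps in a given direction stays in the box, so the loop relations hold. A single box
  does not know \<open>X\<close>. The alternating sum over the boxes at \<open>opp t\<close> with
  top vertex outside the ideal does: a closed walk of length \<open>2 * (r - 1)\<close> leaves some
  coordinate fixed, and if it meets a point outside \<open>X\<close>, the boxes on the two sides of
  that coordinate cancel. The cone of \<open>z\<close> points away from the tile of \<open>z\<close>
  and meets it only in \<open>z\<close>. Hence the layer of \<open>z\<close> is the only one without
  a contraction.\<close>

definition box :: "point => point => point set" where
 "box x y = {v. ALL j. v j = x j \<or> v j = y j}"

text \<open>For \<open>x\<close> in \<open>X\<close> the points \<open>raise 0 x\<close>, ...,
  \<open>raise r x\<close> ascend from \<open>x\<close> to its translate \<open>x[1]\<close>; the
  step at which they leave the ideal is the type of \<open>x\<close>.\<close>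

definition raise :: "nat => point => point" where
 "raise k x = (%j. if 1 <= j & j <= k then x j + 1 else x j)"

definition vdist :: "nat => point => point => nat" where
 "vdist r x y = (\<Sum>j\<in>{1..r}. nat \<bar>x j - y j\<bar>)"

text \<open>Says that \<open>x\<close> and \<open>y\<close> are opposite vertices of a possibly
  degenerate unit cube, which is then \<open>box x y\<close>.\<close>

definition close :: "nat => point => point => bool" where
 "close r x y \<longleftrightarrow> x : lattice_pts r & y : lattice_pts r & (ALL j. \<bar>x j - y j\<bar> <= 1)"

lemma box_refl [simp]: "x : box x y" "y : box x y" by (auto simp: box_def)

lemma box_self [simp]: "box x x = {x}" by (auto simp: box_def)

lemma box_sym: "box x y = box y x" by (auto simp: box_def)

lemma box_mono: "[|u : box x y; v : box x y|] ==> box u v \<subseteq> box x y"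
 unfolding box_def by (auto, metis)

lemma close_refl [simp]: "close r x x \<longleftrightarrow> x : lattice_pts r" by (auto simp: close_def)

lemma close_sym: "close r x y \<longleftrightarrow> close r y x" by (auto simp: close_def abs_minus_commute)

lemma lattice_out: "[|x : lattice_pts r; j ~: {1..r}|] ==> x j = 0"
 unfolding lattice_pts_def by blast

lemma box_lattice: "[|x : lattice_pts r; y : lattice_pts r; v : box x y|] ==> v : lattice_pts r"
 unfolding box_def lattice_pts_def by (simp, metis)

lemma close_box: "[|close r x y; u : box x y; v : box x y|] ==> close r u v"
 using box_lattice[of x r y] unfolding close_def box_def
 by (auto, smt (verit, ccfv_SIG))

lemma lattice_upd: "[|x : lattice_pts r; j : {1..r}|] ==> x(j := a) : lattice_pts r"
 by (auto simp: lattice_pts_def)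

lemma lattice_eqI: "[|x : lattice_pts r; y : lattice_pts r; !!j. j : {1..r} ==> x j = y j|] ==> x = y"
 by (rule ext) (metis lattice_out)

lemma finite_close: "finite {x. close r x y}"
proof -
 have "{x. close r x y} \<subseteq> (%f j. if j : {1..r} then y j + f j else 0) ` ({1..r} \<rightarrow>\<^sub>E {-1,0,1})"
 proof
  fix x assume "x : {x. close r x y}"
  hence c: "close r x y" by simp
  hence b: "!!j. \<bar>x j - y j\<bar> <= 1" and l: "x : lattice_pts r" by (auto simp: close_def)
  have "x = (%j. if j : {1..r} then y j + restrict (%j. x j - y j) {1..r} j else 0)"
   using l by (auto simp: lattice_pts_def)
  moreover have "restrict (%j. x j - y j) {1..r} : {1..r} \<rightarrow>\<^sub>E {-1,0,1}"
  proof (rule restrict_PiE_iff[THEN iffD2], rule ballI)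
   fix j show "x j - y j : {-1,0,1}" using b[of j] by auto
  qed
  ultimately show "x : (%f j. if j : {1..r} then y j + f j else 0) ` ({1..r} \<rightarrow>\<^sub>E {-1,0,1})" by blast
 qed
 moreover have "finite ({1..r} \<rightarrow>\<^sub>E {-1,0,1::int})" by (intro finite_PiE) auto
 ultimately show ?thesis by (meson finite_imageI finite_subset)
qed

text \<open>The ideal from the definition of a Cubist subset is fixed, since types and tiles are
  read off from it rather than from \<open>X\<close>.\<close>

locale cubist_ideal =
 fixes r :: nat and I X :: "point set"
 assumes r1: "r \<ge> 1" and I_sub: "I \<subseteq> lattice_pts r"
  and I_down: "!!x y. [|x : I; y : lattice_pts r; !!j. y j <= x j|] ==> y : I"
  and X_eq: "X = I - (%x. diag_shift r x (- 1)) ` I"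
begin

text \<open>The vertex of the cube \<open>x + F_i\<close> farthest from \<open>x\<close>.\<close>

definition opp_at :: "nat => point => point" where
 "opp_at i x = (%j. if 1 <= j & j < i then x j + 1 else if i < j & j <= r then x j - 1 else x j)"

text \<open>For \<open>x\<close> in \<open>X\<close> this is the unique \<open>i\<close> with
  \<open>x + F_i\<close> contained in \<open>X\<close>, see \<open>box_opp_at_X\<close>. Expressed
  through the ideal, its uniqueness just says that an ascending chain leaves an ideal only
  once.\<close>

definition ty :: "point => nat" where
 "ty x = (THE i. i : {1..r} & raise (i - 1) x : I & raise i x ~: I)"

definition opp :: "point => point" where "opp x = opp_at (ty x) x"

definition lm :: "point => point set" where "lm x = box x (opp x)"

lemma raise_lattice: "[|x : lattice_pts r; k <= r|] ==> raise k x : lattice_pts r"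
 by (auto simp: lattice_pts_def raise_def)

lemma raise_0 [simp]: "raise 0 x = x" by (auto simp: raise_def)

text \<open>\<open>raise r x\<close> is the translate \<open>x[1]\<close>, so its absence from
  \<open>I\<close> means that \<open>x\<close> is not in \<open>I[-1]\<close>.\<close>

lemma mem_X: "x : X \<longleftrightarrow> x : I & raise r x ~: I"
proof -
 have 1: "diag_shift r (raise r x) (-1) = x" if "x : I"
  using that I_sub lattice_out[of x r] by (auto simp: diag_shift_def raise_def fun_eq_iff)
 have 2: "w = raise r x" if "w : I" "x = diag_shift r w (-1)" for w
  using that I_sub lattice_out[of w r] by (auto simp: diag_shift_def raise_def fun_eq_iff)
 show ?thesis unfolding X_eq image_iff Diff_iff using 1 2 by metis
qed

lemma X_I: "x : X ==> x : I" by (simp add: mem_X)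
lemma X_lattice: "x : X ==> x : lattice_pts r" using I_sub X_I by blast

lemma raise_mono_I: "[|raise k x : I; l <= k; x : lattice_pts r; k <= r|] ==> raise l x : I"
 by (rule I_down, assumption) (auto simp: raise_def lattice_pts_def)

lemma switch:
 assumes "G 0 : I" "G r ~: I"
 obtains i where "i : {1..r}" "G (i - 1) : I" "G i ~: I"
proof -
 have "EX i<r. (ALL j<=i. G j : I) & G (Suc i) ~: I"
  using assms ex_least_nat_less[of "%i. G i ~: I" r] by auto
 then obtain i where "i < r" "G i : I" "G (Suc i) ~: I" by auto
 thus ?thesis using that[of "Suc i"] by auto
qed

lemma ty_ex1: assumes "x : X" shows "EX! i. i : {1..r} & raise (i - 1) x : I & raise i x ~: I"
proof -
 have "raise 0 x : I" "raise r x ~: I" using assms by (auto simp: mem_X)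
 then obtain i where i: "i : {1..r}" "raise (i - 1) x : I" "raise i x ~: I"
  by (rule switch[of "%i. raise i x"])
 have "k = i" if "k : {1..r}" "raise (k - 1) x : I" "raise k x ~: I" for k
 proof (rule ccontr)
  assume "k ~= i"
  hence "k <= i - 1 \<or> i <= k - 1" by linarith
  moreover have "i - 1 <= r" "k - 1 <= r" using that(1) i(1) by auto
  ultimately show False using that(2,3) i(2,3) raise_mono_I[of "i-1" x k] raise_mono_I[of "k-1" x i] X_lattice[OF assms]
   by blast
 qed
 thus ?thesis using i by blast
qed

lemma ty: assumes "x : X"
 shows "ty x : {1..r}" "raise (ty x - 1) x : I" "raise (ty x) x ~: I"
 using theI'[OF ty_ex1[OF assms]] unfolding ty_def by auto

lemma ty_eqI: "[|x : X; i : {1..r}; raise (i - 1) x : I; raise i x ~: I|] ==> ty x = i"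
 using ty_ex1[of x] ty[of x] by blast

text \<open>A point is in \<open>X\<close> as soon as it lies below a point of the ideal while its
  translate by one lies above a point outside.\<close>

lemma X_betweenI: "[|x : lattice_pts r; u : I; !!j. x j <= u j; v ~: I; v : lattice_pts r; !!j. v j <= raise r x j|] ==> x : X"
 unfolding mem_X using I_down[of u x] I_down[of "raise r x" v] by blast

lemma opp_at_lattice: "x : lattice_pts r ==> i : {1..r} ==> opp_at i x : lattice_pts r"
 by (auto simp: lattice_pts_def opp_at_def)

text \<open>The top vertex of the cube is \<open>raise (i - 1) x\<close>, and its bottom vertex
  translated by one is \<open>raise i x\<close>. The cube lies in \<open>X\<close> exactly if the
  former is in the ideal and the latter is not.\<close>

lemma box_opp_at_X:
 assumes x: "x : lattice_pts r" and i: "i : {1..r}"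
 shows "box x (opp_at i x) \<subseteq> X \<longleftrightarrow> raise (i - 1) x : I & raise i x ~: I"
proof
 assume b: "box x (opp_at i x) \<subseteq> X"
 have "raise (i-1) x : box x (opp_at i x)" using i by (auto simp: box_def opp_at_def raise_def)
 hence 1: "raise (i-1) x : I" using b X_I by blast
 let ?l = "%j. if i < j & j <= r then x j - 1 else x j"
 have "?l : box x (opp_at i x)" by (auto simp: box_def opp_at_def)
 hence "raise r ?l ~: I" using b mem_X by blast
 moreover have "raise r ?l = raise i x" using i by (auto simp: raise_def)
 ultimately show "raise (i - 1) x : I & raise i x ~: I" using 1 by simp
next
 assume a: "raise (i - 1) x : I & raise i x ~: I"
 show "box x (opp_at i x) \<subseteq> X"
 proof
  fix y assume y: "y : box x (opp_at i x)"
  have yj: "y j = x j \<or> y j = opp_at i x j" for j using y by (auto simp: box_def)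
  show "y : X"
  proof (rule X_betweenI[of _ "raise (i-1) x" "raise i x"])
   show "y : lattice_pts r" using y box_lattice x opp_at_lattice i by blast
   show "y j <= raise (i-1) x j" for j using yj[of j] by (auto simp: raise_def opp_at_def split: if_splits)
   show "raise i x j <= raise r y j" for j using yj[of j] i by (auto simp: raise_def opp_at_def split: if_splits)
  qed (use a x i raise_lattice in auto)
 qed
qed

lemma facet_image: assumes i: "i : {1..r}"
 shows "(%f. x + f) ` facet r i = box x (opp_at i x)"
proof -
 have sum_app: "finite S ==> (\<Sum>j\<in>S. (%l. a j * eps j l)) l = (if l : S then a l else 0)"
  for S :: "nat set" and a :: "nat => int" and l
  by (induction S rule: finite_induct) (auto simp: eps_def)
 show ?thesis
 proof (intro equalityI subsetI)
  fix y assume "y : (%f. x + f) ` facet r i"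
  then obtain a where a: "!!j. a j = 0 \<or> a j = 1"
   and y: "y = x + ((\<Sum>j\<in>{1..<i}. (%l. a j * eps j l)) - (\<Sum>j\<in>{i<..r}. (%l. a j * eps j l)))"
   unfolding facet_def by auto
  have "y j = x j \<or> y j = opp_at i x j" for j using a[of j] by (auto simp: y sum_app opp_at_def)
  thus "y : box x (opp_at i x)" by (auto simp: box_def)
 next
  fix y assume y: "y : box x (opp_at i x)"
  have yj: "y j = x j \<or> y j = opp_at i x j" for j using y by (auto simp: box_def)
  define a where "a = (%j. if y j = x j then 0 else (1::int))"
  have "y = x + ((\<Sum>j\<in>{1..<i}. (%l. a j * eps j l)) - (\<Sum>j\<in>{i<..r}. (%l. a j * eps j l)))"
  proof
   fix j show "y j = (x + ((\<Sum>j\<in>{1..<i}. (%l. a j * eps j l)) - (\<Sum>j\<in>{i<..r}. (%l. a j * eps j l)))) j"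
    using yj[of j] i by (auto simp: sum_app a_def opp_at_def split: if_splits)
  qed
  moreover have "ALL j. a j : {0,1}" by (auto simp: a_def)
  ultimately show "y : (%f. x + f) ` facet r i" unfolding facet_def by blast
 qed
qed

lemma lam_eq: assumes "x : X" shows "lam r X x = lm x"
proof -
 have "(THE i. i : {1..r} & (%f. x + f) ` facet r i \<subseteq> X) = ty x"
  unfolding ty_def by (intro arg_cong[where f=The] ext conj_cong refl)
   (use facet_image box_opp_at_X[OF X_lattice[OF assms]] in simp)
 thus ?thesis unfolding lam_def lm_def opp_def using facet_image ty(1)[OF assms] by simp
qed

lemma lm_X: "x : X ==> lm x \<subseteq> X"
 unfolding lm_def opp_def using box_opp_at_X X_lattice ty by simp

lemma lm_self [simp]: "x : lm x" "opp x : lm x" by (auto simp: lm_def)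

lemma opp_X: "x : X ==> opp x : X" using lm_X[of x] lm_self(2)[of x] by blast

lemma close_opp: "x : X ==> close r x (opp x)"
 unfolding close_def using X_lattice opp_X by (auto simp: opp_def opp_at_def)

lemma lm_close: "[|t : X; x : lm t; y : lm t|] ==> close r x y"
 unfolding lm_def using close_box close_opp by blast

lemma finite_tiles: "finite {t : X. y : lm t}"
 by (rule finite_subset[OF _ finite_close[of r y]]) (auto intro: lm_close)

text \<open>Raising the coordinates transversal to the cube one after the other leads out of the ideal
  at exactly one step; this step is the type of the tile.\<close>

lemma cube_in_tile:
 assumes c: "close r x y" and b: "box x y \<subseteq> X"
 obtains t where "t : X" "t : box x y" "box x y \<subseteq> lm t"
proof -
 define hi lo where "hi = (%j. max (x j) (y j))" and "lo = (%j. min (x j) (y j))"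
 have hb: "hi : box x y" "lo : box x y" by (auto simp: hi_def lo_def box_def max_def min_def)
 have hlX: "hi : X" "lo : X" using hb b by auto
 have lat: "x : lattice_pts r" "y : lattice_pts r" and d: "!!j. \<bar>x j - y j\<bar> <= 1" using c by (auto simp: close_def)
 define G where "G k = (%j. if 1 <= j & j <= k & x j = y j then hi j + 1 else hi j)" for k
 have 0: "G 0 = hi" by (auto simp: G_def)
 have xy: "1 <= j & j <= r" if "x j ~= y j" for j
  using that lat by (cases "j : {1..r}") (auto simp: lattice_pts_def)
 have r: "G r = raise r lo"
 proof
  fix j show "G r j = raise r lo j" using d[of j] xy[of j] unfolding G_def raise_def hi_def lo_def
   by (cases "x j = y j") (auto simp: max_def min_def)
 qed
 have "G 0 : I" "G r ~: I" using hlX 0 r mem_X by auto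
 then obtain i where i: "i : {1..r}" "G (i-1) : I" "G i ~: I" by (rule switch)
 \<comment> \<open>\<open>G\<close> changes only in transversal coordinates, so the step that leaves
   \<open>I\<close> belongs to such a coordinate.\<close>
 have iD: "x i = y i"
 proof (rule ccontr)
  assume "x i ~= y i"
  have "G i j = G (i-1) j" for j using i(1) \<open>x i ~= y i\<close> unfolding G_def by (cases "j = i") auto
  hence "G i = G (i-1)" by (rule ext)
  thus False using i by simp
 qed
 \<comment> \<open>From this vertex the cube extends upwards before \<open>i\<close> and downwards
   after \<open>i\<close>, as a tile of type \<open>i\<close> does, and raising \<open>t\<close>
   retraces \<open>G\<close> at the steps \<open>i - 1\<close> and \<open>i\<close>.\<close>
 define t where "t = (%j. if j < i then lo j else hi j)"
 have tb: "t : box x y" using hb by (auto simp: t_def box_def)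
 hence tX: "t : X" using b by auto
 have e1: "raise (i-1) t = G (i-1)"
 proof
  fix j show "raise (i-1) t j = G (i-1) j" using d[of j] xy[of j] i(1) unfolding raise_def G_def t_def hi_def lo_def
   by (cases "x j = y j") (auto simp: max_def min_def)
 qed
 have e2: "raise i t = G i"
 proof
  fix j show "raise i t j = G i j" using d[of j] xy[of j] i(1) iD unfolding raise_def G_def t_def hi_def lo_def
   by (cases "x j = y j"; cases "j = i") (auto simp: max_def min_def)
 qed
 have ti: "ty t = i" using ty_eqI[OF tX i(1)] i e1 e2 by simp
 have "box x y \<subseteq> lm t"
 proof
  fix v assume v: "v : box x y"
  show "v : lm t" unfolding lm_def box_def opp_def ti
  proof (clarsimp)
   fix j assume n: "v j ~= opp_at i t j"
   have "v j = x j \<or> v j = y j" using v by (auto simp: box_def)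
   thus "v j = t j" using n d[of j] xy[of j] iD unfolding opp_at_def t_def hi_def lo_def
    by (cases "j = i") (auto simp: max_def min_def split: if_splits)
  qed
 qed
 thus ?thesis using that tX tb by blast
qed

text \<open>A tile can be recovered from the point opposite to its vertex: raising the coordinates
  of \<open>o'\<close> from the last one downwards leaves the ideal exactly when the type is
  reached, and the type together with \<open>o'\<close> determines the vertex.\<close>

lemma opp_inj: assumes s: "s : X" and t: "t : X" and e: "opp s = opp t" shows "s = t"
proof -
 define o' where "o' = opp s"
 have ol: "o' : lattice_pts r" using opp_X[OF s] X_lattice o'_def by auto
 have gen: "EX i:{1..r}. t = (%j. if 1<=j & j<i then o' j - 1 else if i<j & j<=r then o' j + 1 else o' j)
   & (%j. if i<j & j<=r then o' j + 1 else o' j) : I & (%j. if i<=j & j<=r then o' j + 1 else o' j) ~: I"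
  if "t : X" "opp t = o'" for t
 proof (rule bexI[OF _ ty(1)[OF that(1)]], intro conjI)
  let ?i = "ty t"
  have tout: "!!j. j ~: {1..r} ==> t j = 0" using that(1) X_lattice lattice_out by blast
  show "t = (%j. if 1<=j & j<?i then o' j - 1 else if ?i<j & j<=r then o' j + 1 else o' j)"
   using that(2) by (auto simp: opp_def opp_at_def)
  have "raise (?i - 1) t = (%j. if ?i<j & j<=r then o' j + 1 else o' j)"
   using ty(1)[OF that(1)] by (intro ext) (auto simp: raise_def that(2)[symmetric] opp_def opp_at_def)
  thus "(%j. if ?i<j & j<=r then o' j + 1 else o' j) : I" using ty(2)[OF that(1)] by simp
  have "raise ?i t = (%j. if ?i<=j & j<=r then o' j + 1 else o' j)"
   using ty(1)[OF that(1)] by (intro ext) (auto simp: raise_def that(2)[symmetric] opp_def opp_at_def)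
  thus "(%j. if ?i<=j & j<=r then o' j + 1 else o' j) ~: I" using ty(3)[OF that(1)] by simp
 qed
 obtain i where i: "s = (%j. if 1<=j & j<i then o' j - 1 else if i<j & j<=r then o' j + 1 else o' j)"
  "(%j. if i<j & j<=r then o' j + 1 else o' j) : I" "(%j. if i<=j & j<=r then o' j + 1 else o' j) ~: I"
  using gen[OF s] o'_def by blast
 obtain k where k: "t = (%j. if 1<=j & j<k then o' j - 1 else if k<j & j<=r then o' j + 1 else o' j)"
  "(%j. if k<j & j<=r then o' j + 1 else o' j) : I" "(%j. if k<=j & j<=r then o' j + 1 else o' j) ~: I"
  using gen[OF t] e o'_def by auto
 have down: False if "(%j. if k<j & j<=r then o' j + 1 else o' j) : I" "k < i" 
   "(%j. if i<=j & j<=r then o' j + 1 else o' j) ~: I" for k i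
  using that(3) by (rule notE, intro I_down[OF that(1)]) (use that(2) ol in \<open>auto simp: lattice_pts_def\<close>)
 have ik: "i = k" using down[OF i(2) _ k(3)] down[OF k(2) _ i(3)] by (meson linorder_neqE_nat)
 show ?thesis using i(1) k(1) unfolding ik by (rule trans[OF _ sym])
qed

subsection \<open>The standard order\<close>

abbreviation leq :: "point rel" where "leq \<equiv> std_order r X"

definition above :: "point => point set" where "above t = {u : X. (t, u) : leq & u ~= t}"

definition upset :: "point set => bool" where
 "upset U \<longleftrightarrow> U \<subseteq> X & (ALL u:U. ALL v:X. (u, v) : leq --> v : U)"

text \<open>The key increases lexicographically when one moves from a point to another point of its
  tile.  The flag at the odd place \<open>2 * l + 1\<close> tells whether the type is greater than \<open>l\<close>.\<close>

definition key :: "point => nat => int" where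
 "key x m = (let l = m div 2 in
  if even m then (if l <= ty x then x l else if l = ty x + 1 then - (\<Sum>j\<in>{1..r}. x j) else 0)
  else (if l < ty x then 1 else 0))"

definition klt :: "point => point => bool" where
 "klt x y \<longleftrightarrow> (EX m. key x m < key y m & (ALL m'<m. key x m' = key y m'))"

lemma klt_irrefl: "\<not> klt x x" by (auto simp: klt_def)

lemma klt_trans: assumes "klt x y" "klt y z" shows "klt x z"
proof -
 obtain m n where "key x m < key y m" "ALL m'<m. key x m' = key y m'" "key y n < key z n" "ALL m'<n. key y m' = key z m'"
  using assms by (auto simp: klt_def)
 thus ?thesis unfolding klt_def by (intro exI[of _ "min m n"]) (cases m n rule: linorder_cases; auto simp: min_def)
qed

text \<open>Inside the tile only coordinates before the type can rise, and those up to
  \<open>l\<close> have not moved. So \<open>raise l y\<close> stays below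
  \<open>raise (ty x - 1) x\<close> and is in the ideal.\<close>

lemma ty_gt: assumes x: "x : X" and y: "y : lm x" and l: "l < ty x" and e: "!!m. 1 <= m ==> m <= l ==> y m = x m"
 shows "l < ty y"
proof (rule ccontr)
 assume n: "\<not> l < ty y"
 have yX: "y : X" using lm_X[OF x] y by auto
 have b: "y j = x j \<or> y j = opp_at (ty x) x j" for j using y by (auto simp: lm_def box_def opp_def)
 have "raise l y : I"
 proof (rule I_down[OF ty(2)[OF x]])
  show "raise l y : lattice_pts r" using ty(1)[OF x] l yX X_lattice by (intro raise_lattice) auto
  show "raise l y j <= raise (ty x - 1) x j" for j
   using b[of j] e[of j] l by (auto simp: raise_def opp_at_def split: if_splits)
 qed
 hence "raise (ty y) y : I" using n ty(1)[OF x] l raise_mono_I[of l y "ty y"] X_lattice[OF yX] by auto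
 thus False using ty(3)[OF yX] by simp
qed

text \<open>If a coordinate before the type moves, the first such one rises, and the flags before it
  agree by \<open>ty_gt\<close>. Otherwise the type cannot drop: either it grows, which a flag
  records, or it stays and some later coordinate falls, which the negated coordinate sum
  records.\<close>

lemma klt_step: assumes x: "x : X" and y: "y : lm x" and ne: "y ~= x" shows "klt x y"
proof -
 have yX: "y : X" using lm_X[OF x] y by auto
 have b: "y j = x j \<or> y j = opp_at (ty x) x j" for j using y by (auto simp: lm_def box_def opp_def)
 have b0: "y 0 = x 0" using b[of 0] by (auto simp: opp_at_def)
 show ?thesis
 proof (cases "EX j. j < ty x & y j ~= x j")
  case True
  define j where "j = (LEAST j. j < ty x & y j ~= x j)"
  have j: "j < ty x" "y j ~= x j" using LeastI_ex[OF True] by (auto simp: j_def)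
  have jl: "y l = x l" if "l < j" for l using not_less_Least[of l "%j. j < ty x & y j ~= x j"] that j by (auto simp: j_def)
  have j1: "1 <= j" using j b0 by (cases j) auto
  have f: "l < ty y" if "l < j" for l using ty_gt[OF x y, of l] that jl j by auto
  hence tyj: "j <= ty y" using f[of "j - 1"] j1 by linarith
  have "key x (2*j) < key y (2*j)" using j tyj b[of j] j1 by (auto simp: key_def opp_at_def Let_def)
  moreover have "key x m = key y m" if "m < 2*j" for m
  proof -
   have "m div 2 < j" using that by auto
   thus ?thesis using j jl f[of "m div 2"] by (auto simp: key_def Let_def)
  qed
  ultimately show ?thesis unfolding klt_def by blast
 next
  case False
  hence eq: "y j = x j" if "j <= ty x" for j using that b[of j] by (cases "j = ty x") (auto simp: opp_at_def)
  have f: "l < ty y" if "l < ty x" for l using ty_gt[OF x y that] eq that by auto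
  hence tt: "ty x <= ty y" by (meson not_less less_irrefl)
  have lt: "(\<Sum>j\<in>{1..r}. y j) < (\<Sum>j\<in>{1..r}. x j)"
  proof (rule sum_strict_mono_ex1)
   have "y j <= x j" for j using b[of j] eq[of j] by (cases "j <= ty x") (auto simp: opp_at_def)
   thus "ALL j:{1..r}. y j <= x j" by blast
   obtain j where "y j ~= x j" using ne by auto
   moreover hence "ty x < j" using eq by (meson not_less)
   ultimately show "EX j:{1..r}. y j < x j" using b[of j] by (intro bexI[of _ j]) (auto simp: opp_at_def split: if_splits)
  qed simp
  show ?thesis
  proof (cases "ty x = ty y")
   case True
   have "key x (2 * (ty x + 1)) < key y (2 * (ty x + 1))" using lt True by (auto simp: key_def Let_def)
   moreover have "key x m = key y m" if "m < 2 * (ty x + 1)" for m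
    using that True eq[of "m div 2"] by (auto simp: key_def Let_def)
   ultimately show ?thesis unfolding klt_def by blast
  next
   case False
   have "key x (2 * ty x + 1) < key y (2 * ty x + 1)" using False tt by (auto simp: key_def Let_def)
   moreover have "key x m = key y m" if "m < 2 * ty x + 1" for m
   proof -
    have "m div 2 < ty x \<or> m div 2 = ty x & even m" using that by presburger
    thus ?thesis using tt False eq[of "m div 2"] by (auto simp: key_def Let_def)
   qed
   ultimately show ?thesis unfolding klt_def by blast
  qed
 qed
qed

text \<open>The key grows along every descent in the standard order, so a cycle would yield
  \<open>klt x x\<close>; this is the source of antisymmetry.\<close>

lemma leq_imp: assumes "(y, x) : leq" shows "y : X" "x : X" "y = x \<or> klt x y"
proof -
 show "y : X" "x : X" using assms by (auto simp: std_order_def)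
 have "(y, x) : {(y, x). x : X & y : lam r X x}\<^sup>*" using assms by (auto simp: std_order_def)
 thus "y = x \<or> klt x y"
 proof (induction rule: rtrancl_induct)
  case (step u v)
  hence "u = v \<or> klt v u" using klt_step[of v u] lam_eq by auto
  thus ?case using step.IH klt_trans by metis
 qed simp
qed

lemma leq_refl: "x : X ==> (x, x) : leq" by (auto simp: std_order_def)

lemma leq_trans: "[|(x, y) : leq; (y, z) : leq|] ==> (x, z) : leq" by (auto simp: std_order_def)

lemma leq_antisym: "[|(x, y) : leq; (y, x) : leq|] ==> x = y"
 using leq_imp(3) klt_trans klt_irrefl by metis

lemma lm_leq: "[|t : X; x : lm t|] ==> (x, t) : leq"
 unfolding std_order_def using lam_eq lm_X by auto

lemma partial_order_leq: "partial_order_on X leq"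
 unfolding partial_order_on_def preorder_on_def refl_on_def trans_def antisym_def
 using leq_refl leq_trans leq_antisym leq_imp(1,2) by (safe; blast)

lemma upset_above: "upset (above t)"
 unfolding upset_def above_def using leq_trans leq_antisym by blast

lemma upset_X: "upset X" by (auto simp: upset_def)

lemma lm_aboveI: "[|t : X; x : lm t; x ~= t|] ==> t : above x"
 using lm_leq by (auto simp: above_def)

lemma above_trans: "[|t : above x; u : above t|] ==> u : above x"
 unfolding above_def using leq_trans leq_antisym by blast

text \<open>Finite sets of tiles are taken apart from below; this supplies the tile to
  remove.\<close>

lemma minimal_ex:
 assumes "finite S" "S ~= {}" "S \<subseteq> X"
 obtains t where "t : S" "!!u. u : S ==> (u, t) : leq ==> u = t"
 using assms
proof (induction "card S" arbitrary: S thesis rule: less_induct)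
 case less
 obtain s where s: "s : S" using less.prems by auto
 let ?S = "{u : S. (u, s) : leq & u ~= s}"
 show ?case
 proof (cases "?S = {}")
  case True thus ?thesis using less.prems(1)[OF s] by auto
 next
  case False
  have "card ?S < card S" using less.prems s by (intro psubset_card_mono) auto
  then obtain t where t: "t : ?S" "!!u. u : ?S ==> (u, t) : leq ==> u = t"
   using less.hyps[of ?S] False less.prems by auto
  have "u = t" if u: "u : S" "(u, t) : leq" for u
  proof -
   have "(u, s) : leq" using u t(1) leq_trans by blast
   moreover have "u ~= s" using u t(1) leq_antisym by blast
   ultimately show ?thesis using t(2) u by blast
  qed
  thus ?thesis using t(1) less.prems(1)[of t] by blast
 qed
qed

subsection \<open>Cones\<close>

text \<open>The tile of \<open>z\<close> extends upwards before the type and downwards after it. The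
  cone takes the opposite directions and leaves the coordinate \<open>ty z\<close> free.\<close>

definition cone :: "point => point set" where
 "cone z = {y : X. (ALL j<ty z. y j <= z j) & (ALL j>ty z. z j <= y j)}"

lemma cone_self: "z : X ==> z : cone z" by (auto simp: cone_def)

lemma cone_lm: assumes "z : X" "y : cone z" "y : lm z" shows "y = z"
proof
 fix j
 have "y j = z j \<or> y j = opp_at (ty z) z j" using assms(3) by (auto simp: lm_def box_def opp_def)
 moreover have "j < ty z ==> y j <= z j" "j > ty z ==> z j <= y j" using assms(2) by (auto simp: cone_def)
 ultimately show "y j = z j" by (auto simp: opp_at_def split: if_splits)
qed

definition active :: "point => point => nat => bool" where
 "active z t j \<longleftrightarrow> j : {1..r} & ((j < ty t & j <= ty z & t j + 1 <= z j) \<or> (j > ty t & j \<ge> ty z & z j <= t j - 1))"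

text \<open>If no coordinate is active, the inequalities for \<open>y\<close> compare
  \<open>z\<close> and \<open>t\<close>: the point of smaller type, raised up to its type, lies
  below the other one raised just short of its type, hence in the ideal, which is absurd. For equal
  types the two points agree away from the type, and there too by the same argument.\<close>

lemma active_ex:
 assumes z: "z : X" and t: "t : X" and ne: "t ~= z" and y: "y : cone z" "y : lm t"
 shows "EX j. active z t j"
proof (rule ccontr)
 assume "\<not> ?thesis"
 hence na: "j : {1..r} ==> j < ty t ==> j <= ty z ==> z j <= t j" "j : {1..r} ==> j > ty t ==> j \<ge> ty z ==> t j <= z j" for j
  by (force simp: active_def)+
 have yt: "y j = t j \<or> 1 <= j & j < ty t & y j = t j + 1 \<or> ty t < j & j <= r & y j = t j - 1" for j
  using y(2) by (auto simp: lm_def box_def opp_def opp_at_def dest!: spec[of _ j] split: if_splits)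
 have yz: "j < ty z ==> y j <= z j" "j > ty z ==> z j <= y j" for j using y(1) by (auto simp: cone_def)
 have zl: "z : lattice_pts r" "t : lattice_pts r" using z t X_lattice by auto
 have out: "z j = t j" if "j ~: {1..r}" for j using zl that lattice_out by metis
 have na1: "z j <= t j" if "1 <= j" "j < ty t" "j <= ty z" for j using na(1)[of j] that ty(1)[OF z] by auto
 have na2: "t j <= z j" if "j <= r" "j > ty t" "j \<ge> ty z" for j using na(2)[of j] that ty(1)[OF z] by auto
 note tz = ty[OF z] and tt = ty[OF t]
 consider "ty z = ty t" | "ty z < ty t" | "ty t < ty z" by linarith
 thus False
 proof cases
  case 1
  have eq: "z j = t j" if "j ~= ty z" for j
  proof (cases "j : {1..r}")
   case True
   thus ?thesis using that na1[of j] na2[of j] yt[of j] yz[of j] 1 by (cases "j < ty z") auto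
  qed (rule out)
  have "z (ty z) = t (ty z)"
  proof (rule ccontr)
   assume "z (ty z) ~= t (ty z)"
   hence "z (ty z) + 1 <= t (ty z) \<or> t (ty z) + 1 <= z (ty z)" by linarith
   moreover have "raise (ty z) z : I" if "z (ty z) + 1 <= t (ty z)"
   proof (rule I_down[OF tt(2)])
    show "raise (ty z) z j <= raise (ty t - 1) t j" for j
     using that eq[of j] 1 by (cases "j = ty z") (auto simp: raise_def)
   qed (use tz zl raise_lattice in auto)
   moreover have "raise (ty t) t : I" if "t (ty z) + 1 <= z (ty z)"
   proof (rule I_down[OF tz(2)])
    show "raise (ty t) t j <= raise (ty z - 1) z j" for j
     using that eq[of j] 1 by (cases "j = ty z") (auto simp: raise_def)
   qed (use tt zl raise_lattice in auto)
   ultimately show False using tz tt by blast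
  qed
  hence "z = t" using eq by (intro ext) metis
  thus False using ne by simp
 next
  case 2
  have "raise (ty z) z : I"
  proof (rule I_down[OF tt(2)])
   show "raise (ty z) z j <= raise (ty t - 1) t j" for j
   proof (cases "j : {1..r}")
    case True
    hence "(j <= ty z --> z j + 1 <= t j + (if j < ty t then 1 else 0)) & (ty z < j --> z j <= t j + (if j < ty t then 1 else 0))"
     using 2 na1[of j] na2[of j] yt[of j] yz[of j]
     by (cases j "ty z" rule: linorder_cases; cases j "ty t" rule: linorder_cases; simp; linarith?)
    thus ?thesis using True by (auto simp: raise_def split: if_splits)
   qed (use tz(1) tt(1) out[of j] in \<open>auto simp: raise_def\<close>)
  qed (use tz zl raise_lattice in auto)
  thus False using tz by simp
 next
  case 3
  have "raise (ty t) t : I"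
  proof (rule I_down[OF tz(2)])
   show "raise (ty t) t j <= raise (ty z - 1) z j" for j
   proof (cases "j : {1..r}")
    case True
    hence "(j <= ty t --> t j + 1 <= z j + (if j < ty z then 1 else 0)) & (ty t < j --> t j <= z j + (if j < ty z then 1 else 0))"
     using 3 na1[of j] na2[of j] yt[of j] yz[of j]
     by (cases j "ty z" rule: linorder_cases; cases j "ty t" rule: linorder_cases; simp; linarith?)
    thus ?thesis using True by (auto simp: raise_def split: if_splits)
   qed (use tz(1) tt(1) out[of j] in \<open>auto simp: raise_def\<close>)
  qed (use tt zl raise_lattice in auto)
  thus False using tt by simp
 qed
qed

lemma active_opp: assumes "t : X" "active z t j" shows "j : {1..r}" "j ~= ty t" "\<bar>opp t j - t j\<bar> = 1"
  "\<bar>z j - t j\<bar> = \<bar>z j - opp t j\<bar> + 1"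
 using assms by (auto simp: active_def opp_def opp_at_def)

lemma active_lm: "[|y : lm t; a : {t j, opp t j}|] ==> y(j := a) : lm t"
 by (auto simp: lm_def box_def)

lemma active_cone: assumes "t : X" "active z t j" "y : lm t" "y : cone z" "a : {t j, opp t j}" shows "y(j := a) : cone z"
proof -
 have "y(j := a) : X" using active_lm assms lm_X by blast
 thus ?thesis using assms by (auto simp: cone_def active_def opp_def opp_at_def)
qed

lemma finite_vdist: "finite {y : lattice_pts r. vdist r z y = n}"
proof -
 let ?B = "{y. (ALL j:{1..r}. y j : {z j - int n..z j + int n}) & (ALL j. j ~: {1..r} --> y j = 0)}"
 have "{y : lattice_pts r. vdist r z y = n} \<subseteq> ?B"
 proof clarify
  fix y assume y: "y : lattice_pts r" and n: "n = vdist r z y"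
  show "(ALL j:{1..r}. y j : {z j - int (vdist r z y)..z j + int (vdist r z y)}) & (ALL j. j ~: {1..r} --> y j = 0)"
  proof (intro conjI ballI)
   fix j assume "j : {1..r}"
   hence "nat \<bar>z j - y j\<bar> <= vdist r z y" unfolding vdist_def by (intro member_le_sum) auto
   thus "y j : {z j - int (vdist r z y)..z j + int (vdist r z y)}" by auto
  qed (use y in \<open>auto simp: lattice_pts_def\<close>)
 qed
 moreover have "finite ?B"
 proof -
  have "?B \<subseteq> (%f j. if j : {1..r} then f j else 0) ` (PiE {1..r} (%j. {z j - int n..z j + int n}))"
  proof
   fix y assume y: "y : ?B"
   hence "y = (%j. if j : {1..r} then restrict y {1..r} j else 0)" by auto
   moreover have "restrict y {1..r} : PiE {1..r} (%j. {z j - int n..z j + int n})" using y by auto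
   ultimately show "y : (%f j. if j : {1..r} then f j else 0) ` (PiE {1..r} (%j. {z j - int n..z j + int n}))" by blast
  qed
  thus ?thesis by (rule finite_subset) (intro finite_imageI finite_PiE, auto)
 qed
 ultimately show ?thesis by (rule finite_subset)
qed

lemma vdist_upd: assumes "j : {1..r}"
 shows "vdist r z (y(j := a)) + nat \<bar>z j - y j\<bar> = vdist r z y + nat \<bar>z j - a\<bar>"
proof -
 have "vdist r z y = nat \<bar>z j - y j\<bar> + (\<Sum>k\<in>{1..r}-{j}. nat \<bar>z k - y k\<bar>)"
  unfolding vdist_def using assms by (intro sum.remove) auto
 moreover have "vdist r z (y(j := a)) = nat \<bar>z j - a\<bar> + (\<Sum>k\<in>{1..r}-{j}. nat \<bar>z k - y k\<bar>)"
  unfolding vdist_def using assms by (subst sum.remove[of _ j]) auto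
 ultimately show ?thesis by simp
qed

lemma vdist_0: "[|y : lattice_pts r; z : lattice_pts r; vdist r z y = 0|] ==> y = z"
 by (rule lattice_eqI) (auto simp: vdist_def)

end

section \<open>Graded algebras and their quotients\<close>

text \<open>A direct sum recorded by its projections. In contrast to the unique existence in
  \<open>direct_sum\<close>, this form restricts to submodules and passes to quotients
  directly.\<close>

definition projections ::
 "('m, 'z) ring_scheme => 'i set => ('i => 'm set) => ('i => 'm => 'm) => bool" where
 "projections M I V \<pi> \<longleftrightarrow>
  (ALL i:I. ALL x:carrier M. \<pi> i x : V i) &
  (ALL i:I. ALL x:carrier M. ALL y:carrier M. \<pi> i (x \<oplus>.M y) = \<pi> i x \<oplus>.M \<pi> i y) &
  (ALL i:I. ALL j:I. ALL x:V i. \<pi> j x = (if j = i then x else \<zero>.M)) &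
  (ALL x:carrier M. EX F. finite F & F \<subseteq> I & x = (\<Oplus>.M i\<in>F. \<pi> i x))"

lemma projectionsD:
 assumes "projections M I V \<pi>" "i : I"
 shows "x : carrier M ==> \<pi> i x : V i"
  and "[|x : carrier M; y : carrier M|] ==> \<pi> i (x \<oplus>.M y) = \<pi> i x \<oplus>.M \<pi> i y"
  and "[|j : I; x : V i|] ==> \<pi> j x = (if j = i then x else \<zero>.M)"
 using assms unfolding projections_def by blast+

lemma additive_zero:
 assumes "abelian_group G" "abelian_group H" "h : carrier G \<rightarrow> carrier H"
  and "!!x y. [|x : carrier G; y : carrier G|] ==> h (x \<oplus>.G y) = h x \<oplus>.H h y"
 shows "h \<zero>.G = \<zero>.H"
proof -
 interpret G: abelian_group G by fact
 interpret H: abelian_group H by fact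
 have "h \<zero>.G \<oplus>.H h \<zero>.G = h \<zero>.G" using assms(4)[of "\<zero>.G" "\<zero>.G"] by simp
 thus ?thesis using assms(3) by (metis G.zero_closed H.add.l_cancel_one' Pi_mem)
qed

lemma additive_finsum:
 assumes "abelian_group G" "abelian_group H" "h : carrier G \<rightarrow> carrier H"
  and add: "!!x y. [|x : carrier G; y : carrier G|] ==> h (x \<oplus>.G y) = h x \<oplus>.H h y"
  and "finite S" "f : S \<rightarrow> carrier G"
 shows "h (finsum G f S) = (\<Oplus>.H i\<in>S. h (f i))"
proof -
 interpret G: abelian_group G by fact
 interpret H: abelian_group H by fact
 show ?thesis using assms(5,6)
 proof (induction S rule: finite_induct)
  case empty thus ?case using additive_zero[OF assms(1-3)] add by simp
 next
  case (insert s S)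
  have "finsum G f S : carrier G" using insert.prems by (intro G.finsum_closed) auto
  moreover have "(%i. h (f i)) : S \<rightarrow> carrier H" "h (f s) : carrier H" using insert.prems assms(3) by auto
  ultimately show ?case using insert add by simp
 qed
qed

text \<open>The finite index set may be enlarged at will, so that several elements can be expanded
  over a common one.\<close>

lemma projections_sum:
 assumes G: "abelian_group G" and p: "projections G I V \<pi>" and V: "!!i. i : I ==> V i \<subseteq> carrier G"
  and x: "x : carrier G"
 obtains F where "finite F" "F \<subseteq> I" "!!i. i : I - F ==> \<pi> i x = \<zero>.G"
  "!!F'. [|finite F'; F \<subseteq> F'; F' \<subseteq> I|] ==> x = (\<Oplus>.G i\<in>F'. \<pi> i x)"
proof -
 interpret abelian_group G by fact
 obtain F where F: "finite F" "F \<subseteq> I" "x = (\<Oplus>.G i\<in>F. \<pi> i x)"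
  using p x unfolding projections_def by blast
 have pc: "\<pi> i y : carrier G" if "i : I" "y : carrier G" for i y using projectionsD(1)[OF p] V that by blast
 have z: "\<pi> i x = \<zero>.G" if i: "i : I - F" for i
 proof -
  have "\<pi> i (\<Oplus>.G j\<in>F. \<pi> j x) = (\<Oplus>.G j\<in>F. \<pi> i (\<pi> j x))"
   by (rule additive_finsum[OF G G]) (use F i pc x projectionsD[OF p] in auto)
  also have "... = (\<Oplus>.G j\<in>F. \<zero>.G)"
  proof (rule finsum_cong')
   fix j assume "j : F"
   thus "\<pi> i (\<pi> j x) = \<zero>.G" using projectionsD(3)[OF p, of j i "\<pi> j x"] projectionsD(1)[OF p] i F x by auto
  qed auto
  finally show ?thesis using F(3) by simp
 qed
 have "x = (\<Oplus>.G i\<in>F'. \<pi> i x)" if "finite F'" "F \<subseteq> F'" "F' \<subseteq> I" for F'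
 proof -
  have "(\<Oplus>.G i\<in>F. \<pi> i x) = (\<Oplus>.G i\<in>F'. \<pi> i x)"
   by (rule add.finprod_mono_neutral_cong_left) (use that z pc x in auto)
  thus ?thesis using F(3) by simp
 qed
 thus ?thesis using that F z by blast
qed

text \<open>Uniqueness makes the coefficients additive in the element; conversely, orthogonal
  projections read the coefficients off from any expansion.\<close>

lemma direct_sum_iff:
 assumes G: "abelian_group G"
 shows "direct_sum G I V \<longleftrightarrow> (ALL i:I. subgroup (V i) (add_monoid G)) & (EX \<pi>. projections G I V \<pi>)"
proof -
 interpret abelian_group G by fact
 have sub: "V i \<subseteq> carrier G" "\<zero>.G : V i" "!!x y. [|x : V i; y : V i|] ==> x \<oplus>.G y : V i"
  if "ALL i:I. subgroup (V i) (add_monoid G)" "i : I" for i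
  using subgroup.subset[of "V i" "add_monoid G"] subgroup.one_closed[of "V i" "add_monoid G"]
   subgroup.m_closed[of "V i" "add_monoid G"] that by auto
 let ?D = "%x f. (ALL i:I. f i : V i) & (ALL i. i ~: I --> f i = \<zero>.G) & finite {i. f i ~= \<zero>.G} &
  x = (\<Oplus>.G i\<in>{i. f i ~= \<zero>.G}. f i)"
 show ?thesis
 proof
  assume d: "direct_sum G I V"
  hence sg: "ALL i:I. subgroup (V i) (add_monoid G)" by (simp add: direct_sum_def)
  have ex: "EX! f. ?D x f" if "x : carrier G" for x using d that by (simp add: direct_sum_def)
  define c where "c x = (THE f. ?D x f)" for x
  define \<pi> where "\<pi> i x = c x i" for i x
  have D: "?D x (c x)" if "x : carrier G" for x unfolding c_def by (rule theI'[OF ex[OF that]])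
  have D1: "\<pi> i x : V i" if "x : carrier G" "i : I" for i x using D[OF that(1)] that(2) unfolding \<pi>_def by blast
  have D2: "\<pi> i x = \<zero>.G" if "x : carrier G" "i ~: I" for i x using D[OF that(1)] that(2) unfolding \<pi>_def by blast
  have D3: "finite {i. \<pi> i x ~= \<zero>.G}" if "x : carrier G" for x using D[OF that] unfolding \<pi>_def by blast
  have D4: "x = (\<Oplus>.G i\<in>{i. \<pi> i x ~= \<zero>.G}. \<pi> i x)" if "x : carrier G" for x using D[OF that] unfolding \<pi>_def by blast
  have U: "\<pi> i x = f i" if "x : carrier G" "?D x f" for x f i
  proof -
   have "c x = f" unfolding c_def by (rule the1_equality[where P = "?D x" and a = f, OF ex[OF that(1)] that(2)])
   thus ?thesis by (simp add: \<pi>_def)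
  qed
  have "projections G I V \<pi>"
   unfolding projections_def
  proof (intro conjI ballI)
   fix i x assume "i : I" "x : carrier G" thus "\<pi> i x : V i" using D1 by blast
  next
   fix i x y assume i: "i : I" and x: "x : carrier G" and y: "y : carrier G"
   let ?f = "%i. \<pi> i x \<oplus>.G \<pi> i y"
   let ?F = "{i. \<pi> i x ~= \<zero>.G} \<union> {i. \<pi> i y ~= \<zero>.G}"
   have fin: "finite ?F" by (rule finite_UnI[OF D3[OF x] D3[OF y]])
   have c: "\<pi> i x : carrier G" "\<pi> i y : carrier G" for i
   proof -
    have "\<pi> i w : carrier G" if "w : carrier G" for w
    proof (cases "i : I")
     case True thus ?thesis using D1[OF that True] sub(1)[OF sg True] by blast
    next
     case False
     show ?thesis using D2[OF that False] by simp
    qed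
    thus "\<pi> i x : carrier G" "\<pi> i y : carrier G" using x y by auto
   qed
   have su: "{i. ?f i ~= \<zero>.G} \<subseteq> ?F" by auto
   have sx: "x = (\<Oplus>.G i\<in>?F. \<pi> i x)" if "x : carrier G" "!!i. \<pi> i x : carrier G" "{i. \<pi> i x ~= \<zero>.G} \<subseteq> ?F" for x
   proof -
    have "(\<Oplus>.G i\<in>{i. \<pi> i x ~= \<zero>.G}. \<pi> i x) = (\<Oplus>.G i\<in>?F. \<pi> i x)"
     by (rule add.finprod_mono_neutral_cong_left) (use that fin in auto)
    thus ?thesis using D4[OF that(1)] by (rule trans[rotated])
   qed
   have "x \<oplus>.G y = (\<Oplus>.G i\<in>?F. \<pi> i x) \<oplus>.G (\<Oplus>.G i\<in>?F. \<pi> i y)"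
    using sx[OF x c(1)] sx[OF y c(2)] by (metis (no_types, lifting) Un_upper1 Un_upper2)
   also have "... = (\<Oplus>.G i\<in>?F. ?f i)" by (rule finsum_addf[symmetric]) (use c in auto)
   also have "... = (\<Oplus>.G i\<in>{i. ?f i ~= \<zero>.G}. ?f i)"
    by (rule add.finprod_mono_neutral_cong_right) (use c fin su in auto)
   finally have "?D (x \<oplus>.G y) ?f"
    using D1[OF x] D1[OF y] D2[OF x] D2[OF y] sub(3)[OF sg] finite_subset[OF su fin] by simp
   thus "\<pi> i (x \<oplus>.G y) = \<pi> i x \<oplus>.G \<pi> i y" using U[OF a_closed[OF x y], of ?f i] by blast
  next
   fix i j x assume i: "i : I" and j: "j : I" and x: "x : V i"
   have xc: "x : carrier G" using sub(1)[OF sg i] x by (rule subsetD)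
   let ?f = "%j. if j = i then x else \<zero>.G"
   have "?D x ?f"
   proof (cases "x = \<zero>.G")
    case True
    hence "{j. ?f j ~= \<zero>.G} = {}" by auto
    thus ?thesis using True sub(2)[OF sg] by simp
   next
    case False
    hence "{j. ?f j ~= \<zero>.G} = {i}" by auto
    thus ?thesis using x i sub(2)[OF sg] xc by auto
   qed
   thus "\<pi> j x = (if j = i then x else \<zero>.G)" using U[OF xc, of ?f j] by blast
  next
   fix x assume x: "x : carrier G"
   show "EX F. finite F & F \<subseteq> I & x = (\<Oplus>.G i\<in>F. \<pi> i x)"
    by (rule exI[of _ "{i. \<pi> i x ~= \<zero>.G}"]) (use D2[OF x] D3[OF x] D4[OF x] in blast)
  qed
  thus "(ALL i:I. subgroup (V i) (add_monoid G)) & (EX \<pi>. projections G I V \<pi>)" using sg by blast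
 next
  assume a: "(ALL i:I. subgroup (V i) (add_monoid G)) & (EX \<pi>. projections G I V \<pi>)"
  then obtain \<pi> where p: "projections G I V \<pi>" and sg: "ALL i:I. subgroup (V i) (add_monoid G)" by blast
  note sub = sub[OF sg]
  have pc: "\<pi> i y : carrier G" if "i : I" "y : carrier G" for i y using projectionsD(1)[OF p] sub(1) that by blast
  show "direct_sum G I V" unfolding direct_sum_def
  proof (intro conjI ballI sg[rule_format])
   fix x assume x: "x : carrier G"
   obtain F where F: "finite F" "F \<subseteq> I" "!!i. i : I - F ==> \<pi> i x = \<zero>.G"
    "!!F'. [|finite F'; F \<subseteq> F'; F' \<subseteq> I|] ==> x = (\<Oplus>.G i\<in>F'. \<pi> i x)"
    using projections_sum[OF G p sub(1) x] by blast
   define f where "f i = (if i : I then \<pi> i x else \<zero>.G)" for i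
   have fs: "{i. f i ~= \<zero>.G} \<subseteq> F" using F(3) by (auto simp: f_def)
   have "(\<Oplus>.G i\<in>F. \<pi> i x) = (\<Oplus>.G i\<in>{i. f i ~= \<zero>.G}. f i)"
    by (rule add.finprod_mono_neutral_cong_right) (use fs F pc x in \<open>auto simp: f_def\<close>)
   hence "?D x f" using F(4)[OF F(1)] F(2) finite_subset[OF fs F(1)] projectionsD(1)[OF p] x by (auto simp: f_def)
   moreover have "g = f" if g: "?D x g" for g
   proof
    fix i
    have gc: "g j : carrier G" for j using g sub(1) by (cases "j : I") auto
    show "g i = f i"
    proof (cases "i : I")
     case True
     let ?S = "{i. g i ~= \<zero>.G}"
     have SI: "?S \<subseteq> I" using g by auto
     have xs: "x = (\<Oplus>.G j\<in>?S. g j)" and fS: "finite ?S" using g by auto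
     have "\<pi> i x = \<pi> i (\<Oplus>.G j\<in>?S. g j)" using xs by (rule arg_cong)
     also have "... = (\<Oplus>.G j\<in>?S. \<pi> i (g j))"
      by (rule additive_finsum[OF G G]) (use fS True pc gc projectionsD[OF p] in auto)
     also have "... = (\<Oplus>.G j\<in>?S. if i = j then g j else \<zero>.G)"
     proof (rule finsum_cong')
      fix j assume "j : ?S"
      hence "j : I" "g j : V j" using g SI by auto
      thus "\<pi> i (g j) = (if i = j then g j else \<zero>.G)" using projectionsD(3)[OF p _ True] by auto
     qed (use gc in auto)
     also have "... = g i"
     proof (cases "i : ?S")
      case True thus ?thesis using finsum_singleton[OF True fS, of g] gc by auto
     next
      case False
      have "(\<Oplus>.G j\<in>?S. if i = j then g j else \<zero>.G) = (\<Oplus>.G j\<in>?S. \<zero>.G)"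
       by (rule finsum_cong') (use False in auto)
      thus ?thesis using False by simp
     qed
     finally show ?thesis using True by (simp add: f_def)
    next
     case False thus ?thesis using g by (auto simp: f_def)
    qed
   qed
   ultimately show "EX! f. ?D x f" by blast
  qed
 qed
qed

text \<open>The projections descend along \<open>h\<close> because they preserve its kernel;
  summands with index outside \<open>J\<close> are those annihilated by \<open>h\<close>.\<close>

lemma projections_image:
 assumes G: "abelian_group G" and H: "abelian_group H" and p: "projections G I V \<pi>"
  and V: "!!i. i : I ==> V i \<subseteq> carrier G"
  and h: "h ` carrier G = carrier H"
   "!!x y. [|x : carrier G; y : carrier G|] ==> h (x \<oplus>.G y) = h x \<oplus>.H h y"
  and ker: "!!i x. [|i : I; x : carrier G; h x = \<zero>.H |] ==> h (\<pi> i x) = \<zero>.H"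
  and J: "J \<subseteq> I" "!!i. i : I - J ==> h ` V i \<subseteq> {\<zero>.H}"
 shows "EX \<rho>. projections H J (%i. h ` V i) \<rho>"
proof -
 interpret G: abelian_group G by fact
 interpret H: abelian_group H by fact
 have hc: "h : carrier G \<rightarrow> carrier H" using h(1) by auto
 have h0: "h \<zero>.G = \<zero>.H" by (rule additive_zero[OF G H hc h(2)])
 have hm: "h (\<ominus>.G x) = \<ominus>.H h x" if "x : carrier G" for x
  using h(2)[of "\<ominus>.G x" x] that h0 hc by (intro H.minus_equality[symmetric]) (auto simp: G.l_neg)
 have pc: "\<pi> i y : carrier G" if "i : I" "y : carrier G" for i y using projectionsD(1)[OF p] V that by blast
 define s where "s y = (SOME x. x : carrier G & h x = y)" for y
 have s: "s y : carrier G" "h (s y) = y" if "y : carrier H" for y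
 proof -
  have "EX x. x : carrier G & h x = y" using that h(1) by (metis imageE)
  thus "s y : carrier G" "h (s y) = y" unfolding s_def by (metis (mono_tags, lifting) someI_ex)+
 qed
 have wd: "h (\<pi> i x) = h (\<pi> i y)" if i: "i : I" and x: "x : carrier G" and y: "y : carrier G" and e: "h x = h y" for i x y
 proof -
  have "h (x \<ominus>.G y) = \<zero>.H" using x y e hm h(2) hc by (simp add: G.minus_eq Pi_iff H.r_neg)
  hence 1: "h (\<pi> i (x \<ominus>.G y)) = \<zero>.H" using ker i x y by simp
  have "x = (x \<ominus>.G y) \<oplus>.G y" using x y by (simp add: G.minus_eq G.a_assoc G.l_neg)
  hence "\<pi> i x = \<pi> i (x \<ominus>.G y) \<oplus>.G \<pi> i y" using projectionsD(2)[OF p i] x y by (metis G.minus_closed)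
  thus ?thesis using 1 h(2) pc i x y hc by (simp add: Pi_iff)
 qed
 define \<rho> where "\<rho> i y = h (\<pi> i (s y))" for i y
 have rh: "\<rho> i (h x) = h (\<pi> i x)" if "i : I" "x : carrier G" for i x
  unfolding \<rho>_def using wd[of i "s (h x)" x] s[of "h x"] that hc by auto
 have "projections H J (%i. h ` V i) \<rho>" unfolding projections_def
 proof (intro conjI ballI)
  fix i y assume "i : J" "y : carrier H"
  thus "\<rho> i y : h ` V i" unfolding \<rho>_def using projectionsD(1)[OF p] s J by blast
 next
  fix i x y assume i: "i : J" and x: "x : carrier H" and y: "y : carrier H"
  have "\<rho> i (h (s x) \<oplus>.H h (s y)) = h (\<pi> i (s x \<oplus>.G s y))" using rh[of i "s x \<oplus>.G s y"] s x y i J h(2) by auto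
  also have "... = \<rho> i x \<oplus>.H \<rho> i y" unfolding \<rho>_def using projectionsD(2)[OF p] i J s x y h(2) pc by (simp add: subset_iff)
  finally show "\<rho> i (x \<oplus>.H y) = \<rho> i x \<oplus>.H \<rho> i y" using s x y by simp
 next
  fix i j y assume i: "i : J" and j: "j : J" and y: "y : h ` V i"
  then obtain x where x: "x : V i" "y = h x" by auto
  have "x : carrier G" using V x i J by blast
  moreover have "\<pi> j x = (if j = i then x else \<zero>.G)" using projectionsD(3)[OF p, of i j x] x i j J by blast
  ultimately show "\<rho> j y = (if j = i then y else \<zero>.H)" using rh[of j x] x j J h0 by auto
 next
  fix y assume y: "y : carrier H"
  obtain F where F: "finite F" "F \<subseteq> I" "s y = (\<Oplus>.G i\<in>F. \<pi> i (s y))"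
   using projections_sum[OF G p V s(1)[OF y]] by (metis subset_refl)
  have "y = h (\<Oplus>.G i\<in>F. \<pi> i (s y))" using F(3) s[OF y] by simp
  also have "... = (\<Oplus>.H i\<in>F. h (\<pi> i (s y)))"
   by (rule additive_finsum[OF G H hc h(2)]) (use F s[OF y] pc in auto)
  also have "... = (\<Oplus>.H i\<in>F \<inter> J. \<rho> i y)"
  proof (rule H.add.finprod_mono_neutral_cong_right)
   show "h (\<pi> i (s y)) = \<zero>.H" if "i : F - F \<inter> J" for i
    using that J(2)[of i] F projectionsD(1)[OF p, of i "s y"] s[OF y] by blast
  qed (use F s[OF y] pc hc in \<open>auto simp: \<rho>_def\<close>)
  finally show "EX F. finite F & F \<subseteq> J & y = (\<Oplus>.H i\<in>F. \<rho> i y)" using F by (intro exI[of _ "F \<inter> J"]) auto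
 qed
 thus ?thesis by blast
qed

subsection \<open>Cosets\<close>

context Module.module
begin

lemma submoduleI':
 assumes "H \<subseteq> carrier M" "\<zero>.M : H" "!!a b. [|a : H; b : H|] ==> a \<oplus>.M b : H"
  "!!a x. [|a : carrier R; x : H|] ==> a \<odot>.M x : H"
 shows "submodule H R M"
proof (rule submoduleI[OF assms(1,2) _ assms(3,4)])
 fix a assume a: "a : H"
 hence "\<ominus>.M a = (\<ominus>.R \<one>.R) \<odot>.M a" using assms(1) smult_l_minus[of "\<one>.R" a] by auto
 thus "\<ominus>.M a : H" using assms(4) a by simp
qed

lemma submoduleD:
 assumes "submodule H R M"
 shows "H \<subseteq> carrier M" "\<zero>.M : H" "!!a b. [|a : H; b : H|] ==> a \<oplus>.M b : H"
  "!!a x. [|a : carrier R; x : H|] ==> a \<odot>.M x : H" "!!a. a : H ==> \<ominus>.M a : H"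
  "!!a b. [|a : H; b : H|] ==> a \<ominus>.M b : H"
proof -
 note E = submoduleE[OF assms]
 show "H \<subseteq> carrier M" "!!a b. [|a : H; b : H|] ==> a \<oplus>.M b : H"
  "!!a x. [|a : carrier R; x : H|] ==> a \<odot>.M x : H" "!!a. a : H ==> \<ominus>.M a : H"
  using E by blast+
 show "\<zero>.M : H" using submodule.axioms(1)[OF assms, THEN subgroup.one_closed] by simp
 show "!!a b. [|a : H; b : H|] ==> a \<ominus>.M b : H" unfolding a_minus_def using E(3,5) by blast
qed

lemma submodule_finsum: "[|submodule H R M; !!i. i : S ==> f i : H|] ==> (\<Oplus>.M i\<in>S. f i) : H"
proof (induction S rule: infinite_finite_induct)
 case (insert s S)
 have "f : S \<rightarrow> carrier M" "f s : carrier M" using insert submoduleD(1) by blast+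
 thus ?case using insert submoduleD(3) by simp
qed (auto simp: submoduleD)

lemma submodule_subgroup: "submodule H R M ==> subgroup H (add_monoid M)" by (rule submodule.axioms)

lemma submodule_vimage:
 assumes N: "Module.module R N" and h: "h : carrier M \<rightarrow> carrier N"
  "!!x y. [|x : carrier M; y : carrier M|] ==> h (x \<oplus>.M y) = h x \<oplus>.N h y"
  "!!c x. [|c : carrier R; x : carrier M|] ==> h (c \<odot>.M x) = c \<odot>.N h x"
  and W: "submodule W R N"
 shows "submodule {x : carrier M. h x : W} R M"
proof -
 interpret N: Module.module R N by fact
 have "h \<zero>.M = \<zero>.N" by (rule additive_zero[OF _ _ h(1,2)]) unfold_locales
 thus ?thesis using N.submoduleD[OF W] h by (intro submoduleI') auto
qed

text \<open>A spanning condition free of coefficients. It is carried along a linear map by taking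
  preimages of submodules.\<close>

lemma fin_dim_iff: assumes V: "V \<subseteq> carrier M"
 shows "fin_dim R M V \<longleftrightarrow> (EX B. finite B & B \<subseteq> V & (ALL W. submodule W R M --> B \<subseteq> W --> V \<subseteq> W))"
proof
 assume "fin_dim R M V"
 then obtain B where B: "finite B" "B \<subseteq> V" "ALL x:V. EX c:B \<rightarrow> carrier R. x = (\<Oplus>.M b\<in>B. c b \<odot>.M b)"
  unfolding fin_dim_def by blast
 show "EX B. finite B & B \<subseteq> V & (ALL W. submodule W R M --> B \<subseteq> W --> V \<subseteq> W)"
 proof (intro exI[of _ B] conjI allI impI B(1,2), rule subsetI)
  fix W x assume "submodule W R M" "B \<subseteq> W" "x : V"
  moreover then obtain c where "c : B \<rightarrow> carrier R" "x = (\<Oplus>.M b\<in>B. c b \<odot>.M b)" using B by blast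
  ultimately show "x : W" using submodule_finsum[of W B "%b. c b \<odot>.M b"] submoduleD(4) by blast
 qed
next
 assume "EX B. finite B & B \<subseteq> V & (ALL W. submodule W R M --> B \<subseteq> W --> V \<subseteq> W)"
 then obtain B where B: "finite B" "B \<subseteq> V" "!!W. submodule W R M ==> B \<subseteq> W ==> V \<subseteq> W" by blast
 let ?W = "{x. EX c:B \<rightarrow> carrier R. x = (\<Oplus>.M b\<in>B. c b \<odot>.M b)}"
 have BC: "!!b. b : B ==> b : carrier M" using B V by auto
 have "submodule ?W R M"
 proof (rule submoduleI')
  show "?W \<subseteq> carrier M" using BC by (auto intro!: finsum_closed simp: Pi_iff)
  show "\<zero>.M : ?W"
  proof (clarify, rule bexI[of _ "%_. \<zero>.R"])
   have "(\<Oplus>.M b\<in>B. \<zero>.R \<odot>.M b) = (\<Oplus>.M b\<in>B. \<zero>.M)" by (rule M.finsum_cong') (use BC in auto)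
   thus "\<zero>.M = (\<Oplus>.M b\<in>B. \<zero>.R \<odot>.M b)" by simp
  qed auto
  fix x y assume "x : ?W" "y : ?W"
  then obtain c d where c: "c : B \<rightarrow> carrier R" "x = (\<Oplus>.M b\<in>B. c b \<odot>.M b)"
   and d: "d : B \<rightarrow> carrier R" "y = (\<Oplus>.M b\<in>B. d b \<odot>.M b)" by auto
  have "x \<oplus>.M y = (\<Oplus>.M b\<in>B. c b \<odot>.M b \<oplus>.M d b \<odot>.M b)"
   unfolding c(2) d(2) by (rule M.finsum_addf[symmetric]) (use c d BC in auto)
  also have "... = (\<Oplus>.M b\<in>B. (c b \<oplus>.R d b) \<odot>.M b)"
   by (rule M.finsum_cong') (use c d BC in \<open>auto simp: smult_l_distr Pi_iff\<close>)
  finally show "x \<oplus>.M y : ?W" using c d by (auto intro!: bexI[of _ "%b. c b \<oplus>.R d b"])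
 next
  fix a x assume a: "a : carrier R" and "x : ?W"
  then obtain c where c: "c : B \<rightarrow> carrier R" "x = (\<Oplus>.M b\<in>B. c b \<odot>.M b)" by auto
  have "a \<odot>.M x = (\<Oplus>.M b\<in>B. a \<odot>.M (c b \<odot>.M b))"
   unfolding c(2) by (rule finsum_smult_ldistr) (use B a c BC in auto)
  also have "... = (\<Oplus>.M b\<in>B. (a **.R c b) \<odot>.M b)"
   by (rule M.finsum_cong') (use a c BC in \<open>auto simp: smult_assoc1 Pi_iff\<close>)
  finally show "a \<odot>.M x : ?W" using a c by (auto intro!: bexI[of _ "%b. a **.R c b"])
 qed
 moreover have "B \<subseteq> ?W"
 proof
  fix b assume b: "b : B"
  have "(\<Oplus>.M b'\<in>B. (if b = b' then \<one>.R else \<zero>.R) \<odot>.M b') = (\<Oplus>.M b'\<in>B. if b = b' then b' else \<zero>.M)"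
   by (rule M.finsum_cong') (use BC in auto)
  also have "... = b" using M.finsum_singleton[OF b B(1), of "%b. b"] BC by auto
  finally show "b : ?W" by (auto intro!: bexI[of _ "%b'. if b = b' then \<one>.R else \<zero>.R"])
 qed
 ultimately have "V \<subseteq> ?W" by (rule B(3))
 thus "fin_dim R M V" unfolding fin_dim_def using B(1,2) by blast
qed

lemma coset_eq_iff:
 assumes "submodule H R M" "x : carrier M" "y : carrier M"
 shows "H +>.M x = H +>.M y \<longleftrightarrow> x \<ominus>.M y : H"
proof -
 note H = submoduleD[OF assms(1)]
 have sg: "subgroup H (add_monoid M)" using assms(1) by (rule submodule_subgroup)
 show ?thesis
 proof
  assume "H +>.M x = H +>.M y"
  moreover have "x : H +>.M x" using H assms by (auto simp: a_r_coset_def' intro!: bexI[of _ "\<zero>.M"])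
  ultimately obtain h where "h : H" "x = h \<oplus>.M y" by (auto simp: a_r_coset_def')
  thus "x \<ominus>.M y : H" using H(1) assms(3) by (simp add: M.minus_eq M.a_assoc M.r_neg subset_iff)
 next
  assume a: "x \<ominus>.M y : H"
  have "x = (x \<ominus>.M y) \<oplus>.M y" using assms by (simp add: M.minus_eq M.a_assoc M.l_neg)
  hence "x : H +>.M y" using a by (auto simp: a_r_coset_def')
  thus "H +>.M x = H +>.M y" using M.a_repr_independence[OF _ assms(3) sg] by simp
 qed
qed

lemma coset_zero: "submodule H R M ==> H +>.M \<zero>.M = H"
 using submoduleD(1)[of H] by (force simp: a_r_coset_def' subset_iff)

lemma coset_mem: "[|submodule H R M; x : carrier M|] ==> H +>.M x = H \<longleftrightarrow> x : H"
proof -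
 assume a: "submodule H R M" "x : carrier M"
 have "\<ominus>.M \<zero>.M = \<zero>.M" using M.r_neg[OF M.zero_closed] M.l_zero[of "\<ominus>.M \<zero>.M"] by simp
 hence "x \<ominus>.M \<zero>.M = x" using a by (simp add: a_minus_def)
 thus ?thesis using coset_eq_iff[OF a, of "\<zero>.M"] by (simp add: coset_zero[OF a(1)])
qed

lemma coset_self: "[|submodule H R M; x : carrier M|] ==> x : H +>.M x"
 using submoduleD(2)[of H] by (force simp: a_r_coset_def')

lemma cosets_image: "a_rcosets\<^bsub>M\<^esub> H = (%x. H +>.M x) ` carrier M"
 by (auto simp: A_RCOSETS_def' a_r_coset_def')

lemma coset_add:
 assumes "submodule H R M" "x : carrier M" "y : carrier M"
 shows "(H +>.M x) <+>.M (H +>.M y) = H +>.M (x \<oplus>.M y)"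
proof -
 interpret abelian_subgroup H M
  by (rule abelian_subgroupI3[OF additive_subgroup.intro[OF submodule_subgroup[OF assms(1)]]]) unfold_locales
 show ?thesis by (rule a_rcos_sum[OF assms(2,3)])
qed

lemma coset_memD: "[|submodule H R M; x : carrier M; u : H +>.M x|] ==> u : carrier M & u \<ominus>.M x : H"
 using submoduleD(1)[of H] by (auto simp: a_r_coset_def' M.minus_eq M.a_assoc M.r_neg subset_iff)

text \<open>Operations on quotients are defined as unions over all representatives; such a union is
  a single coset once the operation respects the submodules.\<close>

lemma coset_UN:
 assumes H: "submodule H R M" and x: "x : carrier M"
  and f: "!!u. u : carrier M ==> f u : carrier N"
  and N: "Module.module R N" and H': "submodule H' R N"
  and d: "!!u. [|u : carrier M; u \<ominus>.M x : H|] ==> f u \<ominus>.N f x : H'"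
 shows "(\<Union>u\<in>H +>.M x. H' +>.N f u) = H' +>.N f x"
proof -
 have "H' +>.N f u = H' +>.N f x" if "u : H +>.M x" for u
  using coset_memD[OF H x that] d[of u] module.coset_eq_iff[OF N H'] f x by simp
 thus ?thesis using coset_self[OF H x] by blast
qed

end

lemma module_image:
 assumes B: "Module.module K B" and h: "h ` carrier B = carrier A" "h \<zero>.B = \<zero>.A"
  "!!x y. [|x : carrier B; y : carrier B|] ==> h (x \<oplus>.B y) = h x \<oplus>.A h y"
  "!!c x. [|c : carrier K; x : carrier B|] ==> h (c \<odot>.B x) = c \<odot>.A h x"
 shows "Module.module K A"
proof -
 interpret B: Module.module K B by fact
 have ex: "EX b:carrier B. x = h b" if "x : carrier A" for x using that h(1) by blast
 have hc: "!!b. b : carrier B ==> h b : carrier A" using h(1) by blast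
 note hs = h(3)[symmetric] h(4)[symmetric] h(2)[symmetric]
 show ?thesis
 proof (rule moduleI)
  show "cring K" by (rule B.R.is_cring)
  show "abelian_group A"
  proof (rule abelian_groupI)
   fix x y z assume "x : carrier A" "y : carrier A" "z : carrier A"
   then obtain a b c where "a : carrier B" "b : carrier B" "c : carrier B" "x = h a" "y = h b" "z = h c" using ex by metis
   thus "x \<oplus>.A y \<oplus>.A z = x \<oplus>.A (y \<oplus>.A z)" by (simp add: hs B.M.a_assoc)
  next
   fix x y assume "x : carrier A" "y : carrier A"
   then obtain a b where ab: "a : carrier B" "b : carrier B" "x = h a" "y = h b" using ex by metis
   thus "x \<oplus>.A y = y \<oplus>.A x" by (simp add: hs B.M.a_comm)
   show "x \<oplus>.A y : carrier A" using ab by (simp add: hs hc)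
  next
   show "\<zero>.A : carrier A" by (simp add: hs hc)
  next
   fix x assume "x : carrier A"
   then obtain a where a: "a : carrier B" "x = h a" using ex by metis
   thus "\<zero>.A \<oplus>.A x = x" by (simp add: hs)
   show "EX y:carrier A. y \<oplus>.A x = \<zero>.A"
    using a by (intro bexI[of _ "h (\<ominus>.B a)"]) (auto simp: hs B.M.l_neg hc)
  qed
  fix c d x y assume c: "c : carrier K" and d: "d : carrier K" and "x : carrier A" "y : carrier A"
  then obtain a b where ab: "a : carrier B" "b : carrier B" "x = h a" "y = h b" using ex by metis
  show "(c \<oplus>.K d) \<odot>.A x = c \<odot>.A x \<oplus>.A d \<odot>.A x" using ab c d by (simp add: hs B.smult_l_distr)
  show "c \<odot>.A (x \<oplus>.A y) = c \<odot>.A x \<oplus>.A c \<odot>.A y" using ab c d by (simp add: hs B.smult_r_distr)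
  show "(c **.K d) \<odot>.A x = c \<odot>.A (d \<odot>.A x)" using ab c d by (simp add: hs B.smult_assoc1)
  show "c \<odot>.A x : carrier A" using ab c by (simp add: hs hc)
 next
  fix x assume "x : carrier A"
  then obtain a where a: "a : carrier B" "x = h a" using ex by metis
  thus "\<one>.K \<odot>.A x = x" by (simp add: hs)
 qed
qed

lemma module_restrict:
 assumes B: "Module.module K B" and N: "submodule N K B"
  and M: "carrier M = N" "!!x y. x \<oplus>.M y = x \<oplus>.B y" "\<zero>.M = \<zero>.B" "!!c x. c \<odot>.M x = c \<odot>.B x"
 shows "Module.module K M"
proof -
 interpret B: Module.module K B by fact
 note D = B.submoduleD[OF N]
 have c: "!!x. x : N ==> x : carrier B" using D(1) by blast
 show ?thesis
 proof (rule moduleI)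
  show "abelian_group M"
  proof (rule abelian_groupI)
   fix x assume x: "x : carrier M"
   show "EX y:carrier M. y \<oplus>.M x = \<zero>.M"
    by (rule bexI[of _ "\<ominus>.B x"]) (use x c D(5) in \<open>simp_all add: M B.M.l_neg\<close>)
  qed (simp_all add: M c D(2,3) B.M.a_ac)
 qed (simp_all add: M c D(4) B.R.is_cring B.smult_l_distr B.smult_r_distr B.smult_assoc1)
qed

section \<open>Homogeneous components and decompositions by idempotents\<close>

context graded_algebra begin

lemma agA: "abelian_group A" by (rule A.M.abelian_group_axioms)
lemma modA: "Module.module K A" by (rule A.module_axioms)

lemma agrade_carrier: "x : agrade A i ==> x : carrier A"
 using A.submoduleD(1)[OF agrade_submodule] by blast

lemma idem_grade: "s : idx A ==> idem A s : agrade A 0"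
 using idem_basis unfolding is_basis_def by blast

lemma idem_closed [simp]: "s : idx A ==> idem A s : carrier A"
 using idem_grade agrade_carrier by blast

lemma mult_closed' [simp]: "[|x : carrier A; y : carrier A|] ==> x **.A y : carrier A"
 by (rule mult_closed)

lemma mult_zero_left [simp]: "x : carrier A ==> \<zero>.A **.A x = \<zero>.A"
 by (rule additive_zero[OF agA agA, of "%y. y **.A x"]) (auto simp: mult_add_left)

lemma mult_zero_right [simp]: "x : carrier A ==> x **.A \<zero>.A = \<zero>.A"
 by (rule additive_zero[OF agA agA, of "%y. x **.A y"]) (auto simp: mult_add_right)

lemma mult_finsum_left: "[|x : carrier A; finite S; f : S \<rightarrow> carrier A|] ==>
  (\<Oplus>.A i\<in>S. f i) **.A x = (\<Oplus>.A i\<in>S. f i **.A x)"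
 by (rule additive_finsum[OF agA agA, of "%y. y **.A x"]) (auto simp: mult_add_left)

lemma mult_finsum_right: "[|x : carrier A; finite S; f : S \<rightarrow> carrier A|] ==>
  x **.A (\<Oplus>.A i\<in>S. f i) = (\<Oplus>.A i\<in>S. x **.A f i)"
 by (rule additive_finsum[OF agA agA, of "%y. x **.A y"]) (auto simp: mult_add_right)

text \<open>The choice is harmless: additivity and \<open>comp_homog\<close> determine the
  projections.\<close>

definition comp :: "nat => 'a => 'a" where
 "comp = (SOME \<pi>. projections A UNIV (agrade A) \<pi>)"

lemma comp: "projections A UNIV (agrade A) comp"
 unfolding comp_def using direct_sum_iff[OF agA, of UNIV "agrade A"] agrade_direct_sum by (metis someI_ex)

lemma comp_grade: "x : carrier A ==> comp n x : agrade A n"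
 by (rule projectionsD(1)[OF comp UNIV_I])

lemma comp_closed [simp]: "x : carrier A ==> comp n x : carrier A"
 using comp_grade agrade_carrier by blast

lemma comp_add: "[|x : carrier A; y : carrier A|] ==> comp n (x \<oplus>.A y) = comp n x \<oplus>.A comp n y"
 by (rule projectionsD(2)[OF comp UNIV_I])

lemma comp_homog: "x : agrade A i ==> comp n x = (if n = i then x else \<zero>.A)"
 by (rule projectionsD(3)[OF comp UNIV_I UNIV_I])

lemma comp_zero [simp]: "comp n \<zero>.A = \<zero>.A"
 using comp_homog[of "\<zero>.A" n n] A.submoduleD(2)[OF agrade_submodule] by simp

text \<open>Acts as an induction principle: the elements satisfying a linear identity form a
  submodule, so the identity need only be checked on homogeneous elements.\<close>

lemma homog_split:
 assumes "submodule V K A" "x : carrier A" "!!n. comp n x : V"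
 shows "x : V"
proof -
 have "!!i. agrade A i \<subseteq> carrier A" using agrade_carrier by blast
 then obtain F where "x = (\<Oplus>.A i\<in>F. comp i x)" using projections_sum[OF agA comp _ assms(2)] by (metis subset_refl subset_UNIV)
 thus ?thesis using A.submodule_finsum[OF assms(1), of F "%i. comp i x"] assms(3) by simp
qed

lemma comp_smult: assumes c: "c : carrier K" and x: "x : carrier A" shows "comp n (c \<odot>.A x) = c \<odot>.A comp n x"
proof -
 let ?W = "{x : carrier A. ALL c:carrier K. comp n (c \<odot>.A x) = c \<odot>.A comp n x}"
 have "submodule ?W K A"
  by (rule A.submoduleI') (auto simp: A.smult_r_distr comp_add A.smult_assoc1[symmetric])
 moreover have "comp m x : ?W" for m
 proof -
  have g: "comp m x : agrade A m" by (rule comp_grade[OF x])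
  have h: "c \<odot>.A comp m x : agrade A m" if "c : carrier K" for c
   using A.submoduleD(4)[OF agrade_submodule that g] .
  show ?thesis using x by (simp add: comp_homog[OF g] comp_homog[OF h])
 qed
 ultimately show ?thesis using homog_split[of ?W x] x c by blast
qed

lemma comp_mult_right:
 assumes y: "y : agrade A m" and x: "x : carrier A"
 shows "comp n (x **.A y) = (if m <= n then comp (n - m) x **.A y else \<zero>.A)"
proof -
 have yc: "y : carrier A" using y agrade_carrier by blast
 let ?W = "{x : carrier A. comp n (x **.A y) = (if m <= n then comp (n - m) x **.A y else \<zero>.A)}"
 have "submodule ?W K A"
  by (rule A.submoduleI') (use yc in \<open>auto simp: mult_add_left mult_smult_left comp_add comp_smult\<close>)
 moreover have "comp i x : ?W" for i
  using x yc agrade_mult[OF comp_grade[OF x, of i] y] comp_grade[OF x, of i] by (auto simp: comp_homog)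
 ultimately show ?thesis using homog_split[of ?W x] x by blast
qed

lemma comp_mult_left:
 assumes y: "y : agrade A m" and x: "x : carrier A"
 shows "comp n (y **.A x) = (if m <= n then y **.A comp (n - m) x else \<zero>.A)"
proof -
 have yc: "y : carrier A" using y agrade_carrier by blast
 let ?W = "{x : carrier A. comp n (y **.A x) = (if m <= n then y **.A comp (n - m) x else \<zero>.A)}"
 have "submodule ?W K A"
  by (rule A.submoduleI') (use yc in \<open>auto simp: mult_add_right mult_smult_right comp_add comp_smult\<close>)
 moreover have "comp i x : ?W" for i
  using x yc agrade_mult[OF y comp_grade[OF x, of i]] comp_grade[OF x, of i] by (auto simp: comp_homog)
 ultimately show ?thesis using homog_split[of ?W x] x by blast
qed

text \<open>Orthogonality of the idempotents shows that the summands of \<open>x\<close> in the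
  given decomposition are the products of \<open>x\<close> with an idempotent on either
  side.\<close>

lemma idem_split:
 assumes V: "submodule V K A" and x: "x : carrier A"
  and st: "!!s t. [|s : idx A; t : idx A|] ==> idem A s **.A x **.A idem A t : V"
 shows "x : V"
proof -
 let ?V = "%(s, t). {idem A s **.A x **.A idem A t | x. x : carrier A}"
 have "EX \<pi>. projections A (idx A \<times> idx A) ?V \<pi>" using idem_direct_sum by (simp only: direct_sum_iff[OF agA])
 then obtain \<pi> where p: "projections A (idx A \<times> idx A) ?V \<pi>" ..
 have Vc: "!!i. i : idx A \<times> idx A ==> ?V i \<subseteq> carrier A" by auto
 obtain F where F: "finite F" "F \<subseteq> idx A \<times> idx A" "x = (\<Oplus>.A i\<in>F. \<pi> i x)"
  using projections_sum[OF agA p Vc x] by (metis subset_refl)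
 have pc: "\<pi> i x : carrier A" if "i : F" for i
  by (rule subsetD[OF Vc projectionsD(1)[OF p]]) (use that F(2) x in auto)
 have "\<pi> q x : V" if q: "q : F" for q
 proof -
  obtain s t where st': "q = (s, t)" "s : idx A" "t : idx A" using q F by auto
  have e: "idem A s **.A \<pi> i x **.A idem A t = (if q = i then \<pi> i x else \<zero>.A)" if i: "i : F" for i
  proof -
   obtain s' t' where i': "i = (s', t')" "s' : idx A" "t' : idx A" using i F by auto
   obtain u where u: "u : carrier A" "\<pi> i x = idem A s' **.A u **.A idem A t'"
    using projectionsD(1)[OF p, of i x] i' x by auto
   have "idem A s **.A \<pi> i x **.A idem A t = (idem A s **.A idem A s') **.A u **.A (idem A t' **.A idem A t)"
    unfolding u(2) using u st' i' by (simp add: mult_assoc)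
   thus ?thesis using idem_orthogonal st' i' u by auto
  qed
  have "idem A s **.A x **.A idem A t = idem A s **.A (\<Oplus>.A i\<in>F. \<pi> i x) **.A idem A t" using F(3) by (rule arg_cong)
  also have "... = (\<Oplus>.A i\<in>F. idem A s **.A \<pi> i x **.A idem A t)"
   using F(1) pc st' by (simp add: mult_finsum_right mult_finsum_left Pi_iff)
  also have "... = (\<Oplus>.A i\<in>F. if q = i then \<pi> i x else \<zero>.A)"
   by (rule A.M.finsum_cong') (use e pc in auto)
  also have "... = \<pi> q x" by (rule A.M.finsum_singleton[OF q F(1)]) (use pc in auto)
  finally show ?thesis using st[OF st'(2,3)] by simp
 qed
 thus ?thesis using A.submodule_finsum[OF V, of F "%i. \<pi> i x"] F(3) by simp
qed

lemma left_split:
 assumes V: "submodule V K A" and x: "x : carrier A" and t: "t : idx A" "x **.A idem A t = x"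
  and s: "!!s. s : idx A ==> idem A s **.A x : V"
 shows "x : V"
proof (rule idem_split[OF V x])
 fix s u assume su: "s : idx A" "u : idx A"
 have "idem A s **.A x **.A idem A u = idem A s **.A (x **.A idem A t) **.A idem A u" using t by simp
 also have "... = idem A s **.A x **.A (idem A t **.A idem A u)" using x t(1) su by (simp add: mult_assoc)
 also have "... = (if t = u then idem A s **.A x else \<zero>.A)"
 proof (cases "t = u")
  case True
  have "idem A s **.A x **.A (idem A t **.A idem A t) = idem A s **.A (x **.A idem A t)"
   using su t(1) x by (simp add: idem_orthogonal mult_assoc)
  thus ?thesis using True t(2) by simp
 qed (use su t(1) x in \<open>simp add: idem_orthogonal\<close>)
 finally show "idem A s **.A x **.A idem A u : V" using s[OF su(1)] A.submoduleD(2)[OF V] by simp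
qed

text \<open>There is no unit, but a finite sum of idempotents acts as one on a given element, and on
  several at once since the sum may be enlarged.\<close>

lemma local_unit:
 assumes x: "x : carrier A"
 obtains F where "finite F" "F \<subseteq> idx A" "!!F'. [|finite F'; F \<subseteq> F'; F' \<subseteq> idx A|] ==> x = (\<Oplus>.A s\<in>F'. idem A s **.A x)"
proof -
 let ?W = "{x : carrier A. EX F. finite F & F \<subseteq> idx A & (ALL F'. finite F' --> F \<subseteq> F' --> F' \<subseteq> idx A --> x = (\<Oplus>.A s\<in>F'. idem A s **.A x))}"
 have "submodule ?W K A"
 proof (rule A.submoduleI')
  have "(\<Oplus>.A s\<in>F'. idem A s **.A \<zero>.A) = \<zero>.A" if "F' \<subseteq> idx A" for F'
   by (rule A.M.add.finprod_one_eqI) (use that in auto)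
  thus "\<zero>.A : ?W" by auto
 next
  fix x y assume "x : ?W" "y : ?W"
  then obtain F1 F2 where F: "x : carrier A" "y : carrier A" "finite F1" "F1 \<subseteq> idx A" "finite F2" "F2 \<subseteq> idx A"
   "!!F'. [|finite F'; F1 \<subseteq> F'; F' \<subseteq> idx A|] ==> x = (\<Oplus>.A s\<in>F'. idem A s **.A x)"
   "!!F'. [|finite F'; F2 \<subseteq> F'; F' \<subseteq> idx A|] ==> y = (\<Oplus>.A s\<in>F'. idem A s **.A y)" by blast
  have "x \<oplus>.A y = (\<Oplus>.A s\<in>F'. idem A s **.A (x \<oplus>.A y))" if F': "finite F'" "F1 \<union> F2 \<subseteq> F'" "F' \<subseteq> idx A" for F'
  proof -
   have "(\<Oplus>.A s\<in>F'. idem A s **.A (x \<oplus>.A y)) = (\<Oplus>.A s\<in>F'. idem A s **.A x \<oplus>.A idem A s **.A y)"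
    by (rule A.M.finsum_cong') (use F(1,2) F' in \<open>auto simp: mult_add_right\<close>)
   also have "... = (\<Oplus>.A s\<in>F'. idem A s **.A x) \<oplus>.A (\<Oplus>.A s\<in>F'. idem A s **.A y)"
    by (rule A.M.finsum_addf) (use F(1,2) F' in auto)
   also have "... = x \<oplus>.A y" using F(7)[of F'] F(8)[of F'] F' by simp
   finally show ?thesis by simp
  qed
  thus "x \<oplus>.A y : ?W" using F(1-6) by (intro CollectI conjI exI[of _ "F1 \<union> F2"]) auto
 next
  fix a x assume a: "a : carrier K" and "x : ?W"
  then obtain F where F: "x : carrier A" "finite F" "F \<subseteq> idx A"
   "!!F'. [|finite F'; F \<subseteq> F'; F' \<subseteq> idx A|] ==> x = (\<Oplus>.A s\<in>F'. idem A s **.A x)" by blast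
  have "a \<odot>.A x = (\<Oplus>.A s\<in>F'. idem A s **.A (a \<odot>.A x))" if F': "finite F'" "F \<subseteq> F'" "F' \<subseteq> idx A" for F'
  proof -
   have "(\<Oplus>.A s\<in>F'. idem A s **.A (a \<odot>.A x)) = (\<Oplus>.A s\<in>F'. a \<odot>.A (idem A s **.A x))"
    by (rule A.M.finsum_cong') (use F(1) F' a in \<open>auto simp: mult_smult_right\<close>)
   also have "... = a \<odot>.A (\<Oplus>.A s\<in>F'. idem A s **.A x)"
    by (rule A.finsum_smult_ldistr[symmetric]) (use F(1) F' a in auto)
   finally show ?thesis using F(4)[OF F'] by simp
  qed
  thus "a \<odot>.A x : ?W" using F(1-3) a by (intro CollectI conjI exI[of _ F]) auto
 qed auto
 moreover have "idem A s **.A x **.A idem A t : ?W" if st: "s : idx A" "t : idx A" for s t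
 proof (intro CollectI conjI exI[of _ "{s}"] allI impI)
  let ?y = "idem A s **.A x **.A idem A t"
  fix F' assume F': "finite F'" "{s} \<subseteq> F'" "F' \<subseteq> idx A"
  have "(\<Oplus>.A u\<in>F'. idem A u **.A ?y) = (\<Oplus>.A u\<in>F'. if s = u then ?y else \<zero>.A)"
  proof (rule A.M.finsum_cong')
   fix u assume u: "u : F'"
   have "idem A u **.A ?y = (idem A u **.A idem A s) **.A (x **.A idem A t)"
    using st x u F' by (simp add: mult_assoc subset_iff)
   thus "idem A u **.A ?y = (if s = u then ?y else \<zero>.A)"
    using st x u F' idem_orthogonal[of u s] by (auto simp: mult_assoc)
  qed (use st x in auto)
  also have "... = ?y" by (rule A.M.finsum_singleton) (use F' st x in auto)
  finally show "?y = (\<Oplus>.A u\<in>F'. idem A u **.A ?y)" by simp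
 qed (use st x in auto)
 ultimately have "x : ?W" using idem_split[of ?W x] x by blast
 thus ?thesis using that by blast
qed

lemma idem_idem: "[|s : idx A; t : idx A; x : carrier A|] ==>
  idem A s **.A (idem A t **.A x) = (if s = t then idem A t **.A x else \<zero>.A)"
 by (simp add: mult_assoc[symmetric] idem_orthogonal)

subsection \<open>Projective modules and their submodules\<close>

text \<open>The left ideal \<open>A e_s\<close>, as a set of fixed points so that membership is an
  equation.\<close>

definition lid :: "'s => 'a set" where "lid s = {x : carrier A. x **.A idem A s = x}"

lemma lidI: "[|s : idx A; a : carrier A|] ==> a **.A idem A s : lid s"
 by (simp add: lid_def mult_assoc idem_orthogonal)

lemma lid_image: "s : idx A ==> {a **.A idem A s | a. a : carrier A} = lid s"
 using lidI unfolding lid_def by (auto; metis)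

lemma lid_image_grade: "s : idx A ==> {a **.A idem A s | a. a : agrade A n} = agrade A n \<inter> lid s"
proof (intro equalityI subsetI)
 fix x assume s: "s : idx A" and "x : {a **.A idem A s | a. a : agrade A n}"
 then obtain a where a: "a : agrade A n" "x = a **.A idem A s" by blast
 have "x : agrade A n" using agrade_mult[OF a(1) idem_grade[OF s]] a(2) by simp
 thus "x : agrade A n \<inter> lid s" using a lidI[OF s] agrade_carrier by blast
next
 fix x assume "x : agrade A n \<inter> lid s"
 thus "x : {a **.A idem A s | a. a : agrade A n}" unfolding lid_def by force
qed

lemma lid_submodule: "s : idx A ==> submodule (lid s) K A"
 by (rule A.submoduleI') (auto simp: lid_def mult_add_left mult_smult_left)

lemma lid_carrier: "x : lid s ==> x : carrier A" by (simp add: lid_def)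

lemma lid_left: "[|s : idx A; x : lid s; a : carrier A|] ==> a **.A x : lid s"
 by (simp add: lid_def mult_assoc)

lemma lid_comp: "[|s : idx A; x : lid s|] ==> comp n x : lid s"
 using comp_mult_right[OF idem_grade, of s x n] by (simp add: lid_def)

lemma lid_idem: "s : idx A ==> idem A s : lid s" by (simp add: lid_def idem_orthogonal)

text \<open>The algebra is graded by natural numbers and modules by integers; \<open>zgrade\<close>
  and \<open>zcomp\<close> extend degrees and components by zero.\<close>

definition zgrade :: "int => 'a set" where "zgrade i = (if i < 0 then {\<zero>.A} else agrade A (nat i))"

definition zcomp :: "int => 'a => 'a" where "zcomp i x = (if i < 0 then \<zero>.A else comp (nat i) x)"

lemma zgrade_submodule: "submodule (zgrade i) K A"
 unfolding zgrade_def using agrade_submodule by (auto intro: A.submoduleI')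

lemma zgrade_carrier: "x : zgrade i ==> x : carrier A"
 using A.submoduleD(1)[OF zgrade_submodule] by blast

lemma zgrade_mult: "[|a : agrade A i; x : zgrade j|] ==> a **.A x : zgrade (int i + j)"
proof (cases "j < 0")
 case True
 assume "a : agrade A i" "x : zgrade j"
 hence "a **.A x = \<zero>.A" using True agrade_carrier by (simp add: zgrade_def)
 thus ?thesis using A.submoduleD(2)[OF zgrade_submodule] by simp
next
 case False
 assume "a : agrade A i" "x : zgrade j"
 hence "a **.A x : agrade A (i + nat j)" using False agrade_mult by (simp add: zgrade_def)
 thus ?thesis using False by (simp add: zgrade_def nat_add_distrib)
qed

lemma zcomp_props:
 assumes x: "x : carrier A"
 shows "zcomp i x : zgrade i" "y : carrier A ==> zcomp i (x \<oplus>.A y) = zcomp i x \<oplus>.A zcomp i y"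
  "x : zgrade i ==> zcomp j x = (if j = i then x else \<zero>.A)"
proof -
 show "zcomp i x : zgrade i" "y : carrier A ==> zcomp i (x \<oplus>.A y) = zcomp i x \<oplus>.A zcomp i y"
 using comp_grade[OF x] comp_add[OF x] by (auto simp: zcomp_def zgrade_def)[2]
 assume a: "x : zgrade i"
 show "zcomp j x = (if j = i then x else \<zero>.A)"
 proof (cases "i < 0")
  case True thus ?thesis using a by (auto simp: zcomp_def zgrade_def)
 next
  case False
  hence "nat j = nat i \<longleftrightarrow> j = i" if "\<not> j < 0" using that by (simp add: eq_nat_nat_iff)
  thus ?thesis using a False comp_homog[of x "nat i" "nat j"] by (auto simp: zcomp_def zgrade_def)
 qed
qed

lemma zcomp_sum:
 assumes x: "x : carrier A"
 obtains F where "finite F" "!!F'. [|finite F'; F \<subseteq> F'|] ==> x = (\<Oplus>.A i\<in>F'. zcomp (i - n) x)"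
proof -
 have "!!i. agrade A i \<subseteq> carrier A" using agrade_carrier by blast
 then obtain F where F: "finite F" "!!i. i ~: F ==> comp i x = \<zero>.A" "x = (\<Oplus>.A i\<in>F. comp i x)"
  using projections_sum[OF agA comp _ x] by (metis subset_refl subset_UNIV DiffI UNIV_I)
 let ?h = "%m. int m + n"
 have e: "x = (\<Oplus>.A i\<in>F'. zcomp (i - n) x)" if F': "finite F'" "?h ` F \<subseteq> F'" for F'
 proof -
  have "(\<Oplus>.A i\<in>F. comp i x) = (\<Oplus>.A i\<in>?h ` F. zcomp (i - n) x)"
   by (subst A.M.finsum_reindex) (use x in \<open>auto simp: inj_on_def zcomp_def\<close>)
  also have "... = (\<Oplus>.A i\<in>F'. zcomp (i - n) x)"
  proof (rule A.M.add.finprod_mono_neutral_cong_left[OF F'])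
   fix i assume i: "i : F' - ?h ` F"
   have "nat (i - n) ~: F" if "i - n \<ge> 0"
   proof
    assume "nat (i - n) : F"
    hence "int (nat (i - n)) + n : ?h ` F" by (rule imageI)
    thus False using i that by simp
   qed
   thus "zcomp (i - n) x = \<zero>.A" using F(2) by (auto simp: zcomp_def)
  qed (use x in \<open>auto simp: zcomp_def\<close>)
  finally show ?thesis using F(3) by simp
 qed
 show ?thesis by (rule that[of "?h ` F"]) (use F(1) e in auto)
qed

lemma proj_carrier: "s : idx A ==> carrier (proj_mod A s) = lid s"
 by (simp add: proj_mod_def lid_image)

lemma proj_grade: "s : idx A ==> mgrade (proj_mod A s) i = zgrade i \<inter> lid s"
 using A.submoduleD(2)[OF lid_submodule[of s]] by (auto simp: proj_mod_def lid_image_grade zgrade_def)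

lemma proj_simps: "add (proj_mod A s) = add A" "zero (proj_mod A s) = zero A" "smult (proj_mod A s) = smult A"
 "act (proj_mod A s) = mult A"
 by (simp_all add: proj_mod_def)

lemma sub_proj_simps: "add (sub_mod (proj_mod A s) N) = add A" "zero (sub_mod (proj_mod A s) N) = zero A"
 "smult (sub_mod (proj_mod A s) N) = smult A" "act (sub_mod (proj_mod A s) N) = mult A"
 "carrier (sub_mod (proj_mod A s) N) = N" "mgrade (sub_mod (proj_mod A s) N) i = mgrade (proj_mod A s) i \<inter> N"
 by (simp_all add: sub_mod_def proj_simps)

definition homog_left_ideal :: "'s => 'a set => bool" where
 "homog_left_ideal s N \<longleftrightarrow> submodule N K A & N \<subseteq> lid s &
  (ALL a:carrier A. ALL x:N. a **.A x : N) & (ALL n. ALL x:N. comp n x : N)"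

lemma sub_proj_module: "submodule N K A ==> Module.module K (sub_mod (proj_mod A s) N)"
 by (rule module_restrict[OF modA]) (simp_all add: sub_proj_simps)

lemma proj_module: "s : idx A ==> Module.module K (proj_mod A s)"
 by (rule module_restrict[OF modA lid_submodule]) (simp_all add: proj_carrier proj_simps)

text \<open>Taking components and multiplying by idempotents from the left both preserve
  \<open>N\<close>, so the two decompositions of the algebra restrict to it.\<close>

lemma sub_proj_graded:
 assumes s: "s \<in> idx A" and N: "homog_left_ideal s N"
 shows "graded_submodule K A (proj_mod A s) N"
proof -
 let ?M = "sub_mod (proj_mod A s) N"
 have sm: "submodule N K A" and Nl: "N \<subseteq> lid s" and lm: "\<And>a x. \<lbrakk>a \<in> carrier A; x \<in> N\<rbrakk> \<Longrightarrow> a \<otimes>\<^bsub>A\<^esub> x \<in> N"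
  and cN: "\<And>n x. x \<in> N \<Longrightarrow> comp n x \<in> N" using N by (auto simp: homog_left_ideal_def)
 interpret M: Module.module K ?M by (rule sub_proj_module[OF sm])
 note D = A.submoduleD[OF sm]
 have c: "\<And>x. x \<in> N \<Longrightarrow> x \<in> carrier A" using D(1) by blast
 have zN: "zcomp i x \<in> N" if "x \<in> N" for i x using cN that D(2) by (auto simp: zcomp_def)
 have fs: "finsum ?M f S = finsum A f S" if "finite S" "f \<in> S \<rightarrow> N" for f and S :: "'j set"
  by (rule additive_finsum[of ?M A "\<lambda>x. x"]) (use that c in \<open>auto simp: sub_proj_simps intro: M.abelian_group_axioms agA\<close>)
 have g: "mgrade ?M i = zgrade i \<inter> N" for i using Nl by (auto simp: sub_proj_simps proj_grade[OF s])
 have gs: "submodule (mgrade ?M i) K ?M" for i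
  unfolding g by (rule M.submoduleI') (use A.submoduleD(2-4)[OF zgrade_submodule[of i]] D(2-4) in \<open>simp_all add: sub_proj_simps(1-5)\<close>)
 have "projections ?M UNIV (mgrade ?M) zcomp"
  unfolding projections_def
 proof (intro conjI ballI)
  fix x assume "x \<in> carrier ?M"
  hence x: "x \<in> N" by (simp add: sub_proj_simps)
  obtain F where F: "finite F" "x = (\<Oplus>\<^bsub>A\<^esub>i\<in>F. zcomp (i - 0) x)" using zcomp_sum[OF c[OF x], of 0] by (metis subset_refl)
  have "x = (\<Oplus>\<^bsub>?M\<^esub>i\<in>F. zcomp i x)" using F fs[OF F(1), of "\<lambda>i. zcomp i x"] zN[OF x] by simp
  thus "\<exists>F. finite F \<and> F \<subseteq> UNIV \<and> x = (\<Oplus>\<^bsub>?M\<^esub>i\<in>F. zcomp i x)" using F(1) by blast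
 qed (use zcomp_props zN c in \<open>auto simp: g sub_proj_simps(1-5)\<close>)
 hence ds: "direct_sum ?M UNIV (mgrade ?M)"
  using direct_sum_iff[OF M.abelian_group_axioms] M.submodule_subgroup[OF gs] by blast
 let ?V = "\<lambda>u. {act ?M (idem A u) x | x. x \<in> carrier ?M}"
 have V: "?V u = {x \<in> N. idem A u \<otimes>\<^bsub>A\<^esub> x = x}" if u: "u \<in> idx A" for u
 proof (intro equalityI subsetI)
  fix x assume "x \<in> ?V u" thus "x \<in> {x \<in> N. idem A u \<otimes>\<^bsub>A\<^esub> x = x}"
   using u lm c idem_idem[OF u u] by (auto simp: sub_proj_simps)
 next
  fix x assume "x \<in> {x \<in> N. idem A u \<otimes>\<^bsub>A\<^esub> x = x}" thus "x \<in> ?V u" by (force simp: sub_proj_simps)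
 qed
 have vs: "submodule (?V u) K ?M" if u: "u \<in> idx A" for u
  unfolding V[OF u] by (rule M.submoduleI') (use D u c in \<open>auto simp: sub_proj_simps mult_add_right mult_smult_right\<close>)
 have "projections ?M (idx A) ?V (\<lambda>u x. idem A u \<otimes>\<^bsub>A\<^esub> x)"
  unfolding projections_def
 proof (intro conjI ballI)
  fix u x assume "u \<in> idx A" "x \<in> carrier ?M" thus "idem A u \<otimes>\<^bsub>A\<^esub> x \<in> ?V u" by (auto simp: sub_proj_simps)
 next
  fix u w x assume u: "u \<in> idx A" and w: "w \<in> idx A" and "x \<in> ?V u"
  hence x: "x \<in> N" "idem A u \<otimes>\<^bsub>A\<^esub> x = x" using V by auto
  have "idem A w \<otimes>\<^bsub>A\<^esub> x = idem A w \<otimes>\<^bsub>A\<^esub> (idem A u \<otimes>\<^bsub>A\<^esub> x)" using x by simp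
  also have "\<dots> = (if w = u then idem A u \<otimes>\<^bsub>A\<^esub> x else \<zero>\<^bsub>A\<^esub>)" by (rule idem_idem[OF w u c[OF x(1)]])
  finally show "idem A w \<otimes>\<^bsub>A\<^esub> x = (if w = u then x else \<zero>\<^bsub>?M\<^esub>)" using x by (simp add: sub_proj_simps)
 next
  fix x assume "x \<in> carrier ?M"
  hence x: "x \<in> N" by (simp add: sub_proj_simps)
  obtain F where F: "finite F" "F \<subseteq> idx A" "x = (\<Oplus>\<^bsub>A\<^esub>u\<in>F. idem A u \<otimes>\<^bsub>A\<^esub> x)" using local_unit[OF c[OF x]] by (metis subset_refl)
  have "x = (\<Oplus>\<^bsub>?M\<^esub>u\<in>F. idem A u \<otimes>\<^bsub>A\<^esub> x)" using F fs[OF F(1), of "\<lambda>u. idem A u \<otimes>\<^bsub>A\<^esub> x"] lm x by (auto simp: subset_iff)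
  thus "\<exists>F. finite F \<and> F \<subseteq> idx A \<and> x = (\<Oplus>\<^bsub>?M\<^esub>u\<in>F. idem A u \<otimes>\<^bsub>A\<^esub> x)" using F(1,2) by blast
 qed (use c in \<open>auto simp: sub_proj_simps mult_add_right\<close>)
 hence ids: "direct_sum ?M (idx A) ?V"
  using direct_sum_iff[OF M.abelian_group_axioms] M.submodule_subgroup[OF vs] by blast
 have "graded_module K A ?M"
  by (intro graded_module.intro M.module_axioms graded_module_axioms.intro gs ds ids)
   (use lm c zgrade_mult in \<open>auto simp: sub_proj_simps(1-5) g mult_assoc mult_add_left mult_add_right
    mult_smult_left mult_smult_right agrade_carrier\<close>)
 thus ?thesis unfolding graded_submodule_def using Nl proj_carrier[OF s] by blast
qed

lemma coset_proj: "a_r_coset (proj_mod A s) = a_r_coset A" "a_r_coset (sub_mod (proj_mod A s) N) = a_r_coset A"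
 "set_add (proj_mod A s) = set_add A" "set_add (sub_mod (proj_mod A s) N) = set_add A"
 by (intro ext; simp add: a_r_coset_def' set_add_def' proj_simps sub_proj_simps)+

end

section \<open>Finite direct sums of shifted projective modules\<close>

context graded_algebra begin

context
 fixes J :: "'j set" and v :: "'j => 's" and n :: int
 assumes J: "finite J" "v ` J \<subseteq> idx A"
begin

abbreviation (input) "Q \<equiv> dsum_mod J (%j. shift_mod (proj_mod A (v j)) n)"

lemma dsum_proj_simps:
 "carrier Q = (\<Pi>\<^sub>E j\<in>J. lid (v j))"
 "f \<oplus>.Q g = (\<lambda>j\<in>J. f j \<oplus>.A g j)" "\<zero>.Q = (\<lambda>j\<in>J. \<zero>.A)"
 "c \<odot>.Q f = (\<lambda>j\<in>J. c \<odot>.A f j)" "act Q a f = (\<lambda>j\<in>J. a **.A f j)"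
 "mgrade Q i = {f : (\<Pi>\<^sub>E j\<in>J. lid (v j)). ALL j:J. f j : zgrade (i - n)}"
proof -
 have vi: "!!j. j : J ==> v j : idx A" using J by auto
 have g: "group (add_monoid (shift_mod (proj_mod A (v j)) n))" if "j : J" for j
 proof -
  have "group (add_monoid (proj_mod A (v j)))"
   using abelian_group.a_group[OF module.axioms(2)[OF proj_module[OF vi[OF that]]]] .
  thus ?thesis by (simp add: shift_mod_def)
 qed
 have "carrier Q = (\<Pi>\<^sub>E j\<in>J. carrier (proj_mod A (v j)))"
 proof -
  have "carrier (sum_group J (%j. add_monoid (shift_mod (proj_mod A (v j)) n)))
    = {x : \<Pi>\<^sub>E j\<in>J. carrier (add_monoid (shift_mod (proj_mod A (v j)) n)). finite {j : J. x j ~= \<one>\<^bsub>add_monoid (shift_mod (proj_mod A (v j)) n)\<^esub>}}"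
   by (rule carrier_sum_group) (rule g)
  also have "... = (\<Pi>\<^sub>E j\<in>J. carrier (add_monoid (shift_mod (proj_mod A (v j)) n)))" using J(1) by simp
  finally show ?thesis by (simp add: dsum_mod_def shift_mod_def)
 qed
 also have "... = (\<Pi>\<^sub>E j\<in>J. lid (v j))" by (rule PiE_cong) (simp add: proj_carrier vi)
 finally show c: "carrier Q = (\<Pi>\<^sub>E j\<in>J. lid (v j))" .
 have "carrier (sum_group J (%j. add_monoid (shift_mod (proj_mod A (v j)) n))) = (\<Pi>\<^sub>E j\<in>J. lid (v j))"
  using c by (simp add: dsum_mod_def)
 thus "mgrade Q i = {f : (\<Pi>\<^sub>E j\<in>J. lid (v j)). ALL j:J. f j : zgrade (i - n)}"
  by (auto simp: dsum_mod_def shift_mod_def proj_grade vi PiE_iff)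
qed (simp_all add: dsum_mod_def shift_mod_def proj_simps)

lemma PiE_lid: "[|f : (\<Pi>\<^sub>E j\<in>J. lid (v j)); j : J|] ==> f j : carrier A & f j : lid (v j)"
 using lid_carrier by (auto simp: PiE_iff)

lemma PiE_lid_eqI: "[|f : (\<Pi>\<^sub>E j\<in>J. lid (v j)); g : (\<Pi>\<^sub>E j\<in>J. lid (v j)); !!j. j : J ==> f j = g j|] ==> f = g"
 by (rule PiE_ext)

lemma dsum_proj_module: "Module.module K Q"
proof -
 have vi: "!!j. j : J ==> v j : idx A" using J by auto
 note L = A.submoduleD[OF lid_submodule[OF vi]]
 have cl: "(\<lambda>j\<in>J. f j \<oplus>.A g j) : (\<Pi>\<^sub>E j\<in>J. lid (v j))" if "f : (\<Pi>\<^sub>E j\<in>J. lid (v j))" "g : (\<Pi>\<^sub>E j\<in>J. lid (v j))" for f g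
  using PiE_lid[OF that(1)] PiE_lid[OF that(2)] L(3) by auto
 show ?thesis
 proof (rule moduleI)
  show "abelian_group Q"
  proof (rule abelian_groupI; unfold dsum_proj_simps(1-3))
   fix f assume f: "f : (\<Pi>\<^sub>E j\<in>J. lid (v j))"
   show "EX y:(\<Pi>\<^sub>E j\<in>J. lid (v j)). (\<lambda>j\<in>J. y j \<oplus>.A f j) = (\<lambda>j\<in>J. \<zero>.A)"
    by (rule bexI[of _ "\<lambda>j\<in>J. \<ominus>.A f j"]) (use PiE_lid[OF f] L(5) in \<open>auto simp: A.M.l_neg intro: restrict_ext\<close>)
   show "(\<lambda>j\<in>J. (\<lambda>j\<in>J. \<zero>.A) j \<oplus>.A f j) = f"
    using PiE_lid[OF f] f by (auto simp: fun_eq_iff PiE_iff extensional_def)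
  next
   show "(\<lambda>j\<in>J. \<zero>.A) : (\<Pi>\<^sub>E j\<in>J. lid (v j))" using L(2) by auto
  next
   fix f g h assume "f : (\<Pi>\<^sub>E j\<in>J. lid (v j))" "g : (\<Pi>\<^sub>E j\<in>J. lid (v j))" "h : (\<Pi>\<^sub>E j\<in>J. lid (v j))"
   note f = PiE_lid[OF this(1)] PiE_lid[OF this(2)] PiE_lid[OF this(3)]
   show "(\<lambda>j\<in>J. (\<lambda>j\<in>J. f j \<oplus>.A g j) j \<oplus>.A h j) = (\<lambda>j\<in>J. f j \<oplus>.A (\<lambda>j\<in>J. g j \<oplus>.A h j) j)"
    using f by (auto simp: A.M.a_assoc intro: restrict_ext)
  next
   fix f g assume "f : (\<Pi>\<^sub>E j\<in>J. lid (v j))" "g : (\<Pi>\<^sub>E j\<in>J. lid (v j))"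
   note f = PiE_lid[OF this(1)] PiE_lid[OF this(2)]
   show "(\<lambda>j\<in>J. f j \<oplus>.A g j) = (\<lambda>j\<in>J. g j \<oplus>.A f j)"
    using f by (auto simp: A.M.a_comm intro: restrict_ext)
  qed (rule cl)
 next
  fix a f assume a: "a : carrier K" and "f : carrier Q"
  hence f: "f : (\<Pi>\<^sub>E j\<in>J. lid (v j))" by (simp add: dsum_proj_simps)
  show "a \<odot>.Q f : carrier Q" using PiE_lid[OF f] a L(4) by (auto simp: dsum_proj_simps)
 next
  fix a b f assume a: "a : carrier K" "b : carrier K" and "f : carrier Q"
  hence f: "f : (\<Pi>\<^sub>E j\<in>J. lid (v j))" by (simp add: dsum_proj_simps)
  show "(a \<oplus>.K b) \<odot>.Q f = a \<odot>.Q f \<oplus>.Q b \<odot>.Q f" "(a **.K b) \<odot>.Q f = a \<odot>.Q (b \<odot>.Q f)"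
   using PiE_lid[OF f] a by (auto simp: dsum_proj_simps A.smult_l_distr A.smult_assoc1 intro: restrict_ext)
 next
  fix a f g assume a: "a : carrier K" and "f : carrier Q" "g : carrier Q"
  hence f: "f : (\<Pi>\<^sub>E j\<in>J. lid (v j))" "g : (\<Pi>\<^sub>E j\<in>J. lid (v j))" by (simp_all add: dsum_proj_simps)
  show "a \<odot>.Q (f \<oplus>.Q g) = a \<odot>.Q f \<oplus>.Q a \<odot>.Q g"
   using PiE_lid[OF f(1)] PiE_lid[OF f(2)] a by (auto simp: dsum_proj_simps A.smult_r_distr intro: restrict_ext)
 next
  fix f assume "f : carrier Q"
  hence f: "f : (\<Pi>\<^sub>E j\<in>J. lid (v j))" by (simp add: dsum_proj_simps)
  show "\<one>.K \<odot>.Q f = f" using PiE_lid[OF f] f by (auto simp: dsum_proj_simps fun_eq_iff PiE_iff extensional_def)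
 qed (rule module.axioms(1)[OF modA])
qed

lemma dsum_proj_finsum:
 assumes "finite S" "!!i. i : S ==> f i : (\<Pi>\<^sub>E j\<in>J. lid (v j))" "j : J"
 shows "(\<Oplus>.Q i\<in>S. f i) j = (\<Oplus>.A i\<in>S. f i j)"
proof (rule additive_finsum[OF _ agA, of Q "%f. f j"])
 show "abelian_group Q" by (rule module.axioms(2)[OF dsum_proj_module])
qed (use assms PiE_lid in \<open>auto simp: dsum_proj_simps(1,2)\<close>)

text \<open>All structure is coordinatewise. As \<open>J\<close> is finite, one finite set of
  degrees, and one of idempotents, serves all coordinates of an element.\<close>

lemma dsum_proj_in_mod: "in_mod K A Q"
proof -
 let ?P = "\<Pi>\<^sub>E j\<in>J. lid (v j)"
 have vi: "!!j. j : J ==> v j : idx A" using J by auto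
 interpret Q: Module.module K Q by (rule dsum_proj_module)
 note S = dsum_proj_simps
 note L = A.submoduleD[OF lid_submodule[OF vi]]
 note Z = A.submoduleD[OF zgrade_submodule]
 have c: "f j : carrier A" "f j : lid (v j)" if "f : ?P" "j : J" for f j using PiE_lid[OF that] by auto
 have zl: "zcomp i x : lid (v j)" if "j : J" "x : lid (v j)" for i j x
  using lid_comp[OF vi[OF that(1)] that(2)] L(2)[OF that(1)] by (simp add: zcomp_def)
 have gs: "submodule (mgrade Q i) K Q" for i
  by (rule Q.submoduleI') (use Z(2-4) L(2-4) c in \<open>auto simp: S\<close>)
 have fin: "EX F. finite F & (ALL j:J. f j = (\<Oplus>.A i\<in>F. zcomp (i - n) (f j)))" if f: "f : ?P" for f
 proof -
  have "EX F. finite F & (ALL F'. finite F' --> F \<subseteq> F' --> f j = (\<Oplus>.A i\<in>F'. zcomp (i - n) (f j)))" if "j : J" for j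
   using zcomp_sum[OF c(1)[OF f that], of n] by metis
  then obtain F where F: "!!j. j : J ==> finite (F j)"
   "!!j F'. j : J ==> finite F' ==> F j \<subseteq> F' ==> f j = (\<Oplus>.A i\<in>F'. zcomp (i - n) (f j))" by metis
  have fF: "finite (\<Union>j\<in>J. F j)" using F(1) J(1) by blast
  thus ?thesis using F(2)[OF _ fF] by blast
 qed
 have fin2: "EX F. finite F & F \<subseteq> idx A & (ALL j:J. f j = (\<Oplus>.A s\<in>F. idem A s **.A f j))" if f: "f : ?P" for f
 proof -
  have "EX F. finite F & F \<subseteq> idx A & (ALL F'. finite F' --> F \<subseteq> F' --> F' \<subseteq> idx A --> f j = (\<Oplus>.A s\<in>F'. idem A s **.A f j))" if "j : J" for j
   using local_unit[OF c(1)[OF f that]] by metis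
  then obtain F where F: "!!j. j : J ==> finite (F j) & F j \<subseteq> idx A"
   "!!j F'. j : J ==> finite F' ==> F j \<subseteq> F' ==> F' \<subseteq> idx A ==> f j = (\<Oplus>.A s\<in>F'. idem A s **.A f j)" by metis
  have fF: "finite (\<Union>j\<in>J. F j)" "(\<Union>j\<in>J. F j) \<subseteq> idx A" using F(1) J(1) by blast+
  thus ?thesis using F(2)[OF _ fF(1) _ fF(2)] by blast
 qed
 have "projections Q UNIV (mgrade Q) (%i f. \<lambda>j\<in>J. zcomp (i - n) (f j))"
  unfolding projections_def
 proof (intro conjI ballI)
  fix f assume "f : carrier Q"
  hence f: "f : ?P" by (simp add: S)
  obtain F where F: "finite F" "!!j. j : J ==> f j = (\<Oplus>.A i\<in>F. zcomp (i - n) (f j))" using fin[OF f] by blast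
  let ?g = "%i. \<lambda>j\<in>J. zcomp (i - n) (f j)"
  have g: "?g i : ?P" for i using zl c(2)[OF f] by auto
  have "f = (\<Oplus>.Q i\<in>F. ?g i)"
  proof (rule PiE_lid_eqI[OF f])
   show "(\<Oplus>.Q i\<in>F. ?g i) : ?P" using Q.M.finsum_closed[of ?g F] g by (simp add: S(1))
   show "f j = (\<Oplus>.Q i\<in>F. ?g i) j" if "j : J" for j
    using dsum_proj_finsum[OF F(1) g that] F(2)[OF that] that by simp
  qed
  thus "EX F. finite F & F \<subseteq> UNIV & f = (\<Oplus>.Q i\<in>F. ?g i)" using F(1) by blast
 next
  fix i f assume "f : carrier Q" thus "(\<lambda>j\<in>J. zcomp (i - n) (f j)) : mgrade Q i"
   using zl c zcomp_props(1) by (auto simp: S)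
 next
  fix i f g assume "f : carrier Q" "g : carrier Q"
  thus "(\<lambda>j\<in>J. zcomp (i - n) ((f \<oplus>.Q g) j)) = (\<lambda>j\<in>J. zcomp (i - n) (f j)) \<oplus>.Q (\<lambda>j\<in>J. zcomp (i - n) (g j))"
   using c zcomp_props(2) by (auto simp: S intro: restrict_ext)
 next
  fix i k f assume "f : mgrade Q i"
  hence f: "f : ?P" "!!j. j : J ==> f j : zgrade (i - n)" by (auto simp: S)
  show "(\<lambda>j\<in>J. zcomp (k - n) (f j)) = (if k = i then f else \<zero>.Q)"
   using zcomp_props(3)[OF c(1)[OF f(1)] f(2)] f(1) by (auto simp: S fun_eq_iff PiE_iff extensional_def)
 qed
 hence ds: "direct_sum Q UNIV (mgrade Q)"
  using direct_sum_iff[OF Q.abelian_group_axioms] Q.submodule_subgroup[OF gs] by blast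
 let ?V = "%u. {act Q (idem A u) x | x. x : carrier Q}"
 have ac: "act Q a f : ?P" if "a : carrier A" "f : ?P" for a f
  using that c lid_left[OF vi] by (auto simp: S)
 have V: "?V u = {f : ?P. ALL j:J. idem A u **.A f j = f j}" if u: "u : idx A" for u
 proof (intro equalityI subsetI)
  fix f assume "f : ?V u"
  then obtain g where g: "g : ?P" "f = act Q (idem A u) g" by (auto simp: S(1))
  thus "f : {f : ?P. ALL j:J. idem A u **.A f j = f j}"
   using ac[OF idem_closed[OF u] g(1)] c[OF g(1)] idem_idem[OF u u] by (simp add: S(5))
 next
  fix f assume f: "f : {f : ?P. ALL j:J. idem A u **.A f j = f j}"
  hence "f = act Q (idem A u) f" by (auto simp: S(5) fun_eq_iff PiE_iff extensional_def)
  thus "f : ?V u" using f by (auto simp: S(1))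
 qed
 have vs: "submodule (?V u) K Q" if u: "u : idx A" for u
  unfolding V[OF u] by (rule Q.submoduleI') (use L(2-4) u c in \<open>auto simp: S mult_add_right mult_smult_right\<close>)
 have "projections Q (idx A) ?V (%u f. act Q (idem A u) f)"
  unfolding projections_def
 proof (intro conjI ballI)
  fix u f assume "u : idx A" "f : carrier Q" thus "act Q (idem A u) f : ?V u" by blast
 next
  fix u f g assume "u : idx A" "f : carrier Q" "g : carrier Q"
  thus "act Q (idem A u) (f \<oplus>.Q g) = act Q (idem A u) f \<oplus>.Q act Q (idem A u) g"
   using c by (auto simp: S mult_add_right intro: restrict_ext)
 next
  fix u w f assume u: "u : idx A" and w: "w : idx A" and "f : ?V u"
  hence f: "f : ?P" "!!j. j : J ==> idem A u **.A f j = f j" using V by auto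
  have "idem A w **.A f j = (if w = u then f j else \<zero>.A)" if "j : J" for j
   using idem_idem[OF w u c(1)[OF f(1) that]] f(2)[OF that] by simp
  thus "act Q (idem A w) f = (if w = u then f else \<zero>.Q)"
   using f(1) by (auto simp: S fun_eq_iff PiE_iff extensional_def)
 next
  fix f assume "f : carrier Q"
  hence f: "f : ?P" by (simp add: S)
  obtain F where F: "finite F" "F \<subseteq> idx A" "!!j. j : J ==> f j = (\<Oplus>.A s\<in>F. idem A s **.A f j)" using fin2[OF f] by blast
  let ?g = "%s. act Q (idem A s) f"
  have g: "s : F ==> ?g s : ?P" for s using ac[OF idem_closed f] F(2) by blast
  have "f = (\<Oplus>.Q s\<in>F. ?g s)"
  proof (rule PiE_lid_eqI[OF f])
   show "(\<Oplus>.Q s\<in>F. ?g s) : ?P" using Q.M.finsum_closed[of ?g F] g by (simp add: S(1))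
   show "f j = (\<Oplus>.Q s\<in>F. ?g s) j" if "j : J" for j
    using dsum_proj_finsum[OF F(1) g that] F(3)[OF that] that by (simp add: S(5))
  qed
  thus "EX F. finite F & F \<subseteq> idx A & f = (\<Oplus>.Q s\<in>F. ?g s)" using F(1,2) by blast
 qed
 hence ids: "direct_sum Q (idx A) ?V"
  using direct_sum_iff[OF Q.abelian_group_axioms] Q.submodule_subgroup[OF vs] by blast
 have gm: "graded_module K A Q"
 proof (intro graded_module.intro Q.module_axioms graded_module_axioms.intro gs ds ids)
  fix a i f k assume a: "a : agrade A i" and f: "f : mgrade Q k"
  have "f : ?P" "!!j. j : J ==> f j : zgrade (k - n)" using f by (auto simp: S)
  moreover have "a **.A x : zgrade (int i + k - n)" if "x : zgrade (k - n)" for x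
   using zgrade_mult[OF a that] by (simp add: algebra_simps)
  ultimately show "act Q a f : mgrade Q (int i + k)"
   using ac[OF agrade_carrier[OF a]] by (simp add: S(5,6))
 next
  fix a f assume "a : carrier A" "f : carrier Q"
  thus "act Q a f : carrier Q" unfolding S(1) by (rule ac)
 next
  fix a b f assume a: "a : carrier A" "b : carrier A" and "f : carrier Q"
  hence f: "f : ?P" by (simp only: S(1))
  show "act Q (a **.A b) f = act Q a (act Q b f)" "act Q (a \<oplus>.A b) f = act Q a f \<oplus>.Q act Q b f"
   using c(1)[OF f] a by (simp_all add: S(2,5) mult_assoc mult_add_left cong: restrict_cong)
 next
  fix a f g assume a: "a : carrier A" and "f : carrier Q" "g : carrier Q"
  hence f: "f : ?P" "g : ?P" by (simp_all only: S(1))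
  show "act Q a (f \<oplus>.Q g) = act Q a f \<oplus>.Q act Q a g"
   using c(1)[OF f(1)] c(1)[OF f(2)] a by (simp add: S(2,5) mult_add_right cong: restrict_cong)
 next
  fix b a f assume b: "b : carrier K" and a: "a : carrier A" and "f : carrier Q"
  hence f: "f : ?P" by (simp only: S(1))
  show "act Q (b \<odot>.A a) f = b \<odot>.Q act Q a f" "act Q a (b \<odot>.Q f) = b \<odot>.Q act Q a f"
   using c(1)[OF f] a b by (simp_all add: S(4,5) mult_smult_left mult_smult_right cong: restrict_cong)
 qed
 have fd: "fin_dim K Q {act Q (idem A s) x | x. x : mgrade Q i}" if s: "s : idx A" for s i
 proof -
  let ?U = "{act Q (idem A s) x | x. x : mgrade Q i}"
  let ?E = "{idem A s **.A x | x. x : zgrade (i - n)}"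
  have Ec: "?E \<subseteq> carrier A"
  proof clarify
   fix x assume "x : zgrade (i - n)"
   thus "idem A s **.A x : carrier A" by (intro mult_closed idem_closed s) (rule zgrade_carrier)
  qed
  have fE: "fin_dim K A ?E"
  proof (cases "i - n < 0")
   case True
   hence "?E = {\<zero>.A}" using s by (auto simp: zgrade_def)
   moreover have "ALL W. submodule W K A --> \<zero>.A : W" using A.submoduleD(2) by blast
   ultimately show ?thesis using A.fin_dim_iff[OF Ec] by (auto intro!: exI[of _ "{\<zero>.A}"])
  next
   case False thus ?thesis using idem_fin_dim[OF s, of "nat (i - n)"] by (simp add: zgrade_def)
  qed
  obtain B where B: "finite B" "B \<subseteq> ?E" "!!W. submodule W K A ==> B \<subseteq> W ==> ?E \<subseteq> W"
   using fE unfolding A.fin_dim_iff[OF Ec] by blast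
  \<comment> \<open>Right multiplication by the idempotent defines the insertion on the whole
    algebra, so a finite set spanning \<open>e_s A\<close> in one degree also yields one for each
    summand.\<close>
  define \<iota> where "\<iota> j x = (\<lambda>k\<in>J. if k = j then x **.A idem A (v j) else \<zero>.A)" for j x
  have iP: "\<iota> j x : ?P" if "j : J" "x : carrier A" for j x
   using that lidI[OF vi] L(2) by (auto simp: \<iota>_def)
  have ZI: "x **.A idem A (v j) : zgrade k" if "x : zgrade k" "j : J" for x j k
  proof (cases "k < 0")
   case True thus ?thesis using that vi by (simp add: zgrade_def)
  next
   case False
   thus ?thesis using that agrade_mult[OF _ idem_grade[OF vi], of x "nat k" j] by (simp add: zgrade_def)
  qed
  have iU: "\<iota> j x : ?U" if j: "j : J" and x: "x : ?E" for j x
  proof -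
   obtain y where y: "y : zgrade (i - n)" "x = idem A s **.A y" using x by blast
   have yc: "y : carrier A" by (rule zgrade_carrier[OF y(1)])
   have "\<iota> j x = act Q (idem A s) (\<iota> j y)" using y s j vi yc by (auto simp: \<iota>_def S mult_assoc intro!: restrict_ext)
   moreover have "\<iota> j y : mgrade Q i" using iP[OF j yc] ZI[OF y(1) j] Z(2) by (auto simp: S \<iota>_def)
   ultimately show ?thesis by blast
  qed
  have Uc: "?U \<subseteq> carrier Q" using ac[OF idem_closed[OF s]] by (auto simp: S(1,6))
  show ?thesis unfolding Q.fin_dim_iff[OF Uc]
  proof (intro exI[of _ "\<Union>j\<in>J. \<iota> j ` B"] conjI allI impI)
   show "finite (\<Union>j\<in>J. \<iota> j ` B)" using B J by blast
   show "(\<Union>j\<in>J. \<iota> j ` B) \<subseteq> ?U" using iU B(2) by blast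
   fix W assume W: "submodule W K Q" and BW: "(\<Union>j\<in>J. \<iota> j ` B) \<subseteq> W"
   show "?U \<subseteq> W"
   proof
    fix f assume "f : ?U"
    then obtain g where g: "g : ?P" "!!j. j : J ==> g j : zgrade (i - n)" "f = act Q (idem A s) g" by (auto simp: S(6))
    have fP: "f : ?P" using ac[OF idem_closed[OF s] g(1)] g(3) by simp
    have fj: "f j = idem A s **.A g j" if "j : J" for j using that g(3) by (simp add: S(5))
    have "\<iota> j (f j) : W" if j: "j : J" for j
    proof -
     have "submodule {x : carrier A. \<iota> j x : W} K A"
     proof (rule A.submodule_vimage[OF Q.module_axioms _ _ _ W])
      show "\<iota> j : carrier A \<rightarrow> carrier Q" using iP[OF j] by (auto simp: S(1))
     qed (use vi[OF j] in \<open>auto simp: \<iota>_def S mult_add_left mult_smult_left intro!: restrict_ext\<close>)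
     hence "?E \<subseteq> {x : carrier A. \<iota> j x : W}" by (rule B(3)) (use BW B(2) Ec j in blast)
     thus ?thesis using fj[OF j] g(2)[OF j] by blast
    qed
    moreover have "f = (\<Oplus>.Q j\<in>J. \<iota> j (f j))"
    proof (rule PiE_lid_eqI[OF fP])
     have i: "\<iota> j (f j) : ?P" if "j : J" for j using iP that c(1)[OF fP that] by blast
     show "(\<Oplus>.Q j\<in>J. \<iota> j (f j)) : ?P" using Q.M.finsum_closed[of "%j. \<iota> j (f j)" J] i by (simp add: S(1) Pi_iff)
     show "f k = (\<Oplus>.Q j\<in>J. \<iota> j (f j)) k" if k: "k : J" for k
     proof -
      have "(\<Oplus>.Q j\<in>J. \<iota> j (f j)) k = (\<Oplus>.A j\<in>J. \<iota> j (f j) k)" by (rule dsum_proj_finsum[OF J(1) i k])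
      also have "... = (\<Oplus>.A j\<in>J. if k = j then f j else \<zero>.A)"
       by (rule A.M.finsum_cong') (use k c[OF fP] in \<open>auto simp: \<iota>_def lid_def\<close>)
      also have "... = f k" by (rule A.M.finsum_singleton) (use k J(1) c[OF fP] in auto)
      finally show ?thesis by simp
     qed
    qed
    ultimately show "f : W" using Q.submodule_finsum[OF W, of J "%j. \<iota> j (f j)"] by simp
   qed
  qed
 qed
 have "mgrade Q i = {\<zero>.Q}" if "i < n" for i
  using that L(2) by (auto simp: S zgrade_def PiE_iff extensional_def fun_eq_iff)
 thus ?thesis unfolding in_mod_def using gm fd by blast
qed

end

end

lemma smult_cancel:
 assumes F: "field K" and M: "Module.module K M"
  and c: "c : carrier K" "d : carrier K" and x: "x : carrier M" "x ~= \<zero>.M" and e: "c \<odot>.M x = d \<odot>.M x"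
 shows "c = d"
proof (rule ccontr)
 interpret K: field K by fact
 interpret M: Module.module K M by fact
 assume "c ~= d"
 define a where "a = c \<oplus>.K \<ominus>.K d"
 have a: "a : carrier K" using c by (simp add: a_def)
 have "a ~= \<zero>.K"
 proof
  assume "a = \<zero>.K"
  hence "c = \<ominus>.K (\<ominus>.K d)" unfolding a_def using c by (intro K.minus_equality[symmetric]) auto
  thus False using \<open>c ~= d\<close> c by simp
 qed
 hence i: "inv\<^bsub>K\<^esub> a : carrier K" "inv\<^bsub>K\<^esub> a **.K a = \<one>.K" using a K.field_Units by auto
 have "a \<odot>.M x = c \<odot>.M x \<oplus>.M \<ominus>.M (d \<odot>.M x)" unfolding a_def using c x by (simp add: M.smult_l_distr M.smult_l_minus)
 also have "... = \<zero>.M" unfolding e using c x by (simp add: M.M.r_neg)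
 finally have "inv\<^bsub>K\<^esub> a \<odot>.M (a \<odot>.M x) = \<zero>.M" using i by simp
 hence "(inv\<^bsub>K\<^esub> a **.K a) \<odot>.M x = \<zero>.M" using M.smult_assoc1[OF i(1) a x(1)] by simp
 thus False using i x by simp
qed

section \<open>Subquotients of projective modules\<close>

context graded_algebra begin

lemma mult_minus_left: "[|x : carrier A; y : carrier A; z : carrier A|] ==>
  (x \<ominus>.A y) **.A z = x **.A z \<ominus>.A y **.A z"
 using mult_add_left[of "\<ominus>.A y" y z] A.M.minus_equality[of "(\<ominus>.A y) **.A z" "y **.A z"]
 by (simp add: a_minus_def mult_add_left A.M.l_neg)

lemma mult_minus_right: "[|x : carrier A; y : carrier A; z : carrier A|] ==>
  x **.A (y \<ominus>.A z) = x **.A y \<ominus>.A x **.A z"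
 using mult_add_right[of x "\<ominus>.A z" z] A.M.minus_equality[of "x **.A (\<ominus>.A z)" "x **.A z"]
 by (simp add: a_minus_def mult_add_right A.M.l_neg)

lemma zcomp_mult:
 assumes p: "p : agrade A m" and w: "w : carrier A"
 shows "zcomp i (w **.A p) = zcomp (i - int m) w **.A p"
proof -
 have pc: "p : carrier A" using p agrade_carrier by blast
 show ?thesis
 proof (cases "i < int m")
  case True
  thus ?thesis using comp_mult_right[OF p w, of "nat i"] pc by (auto simp: zcomp_def)
 next
  case False
  hence "nat (i - int m) = nat i - m" by simp
  thus ?thesis using comp_mult_right[OF p w, of "nat i"] False by (auto simp: zcomp_def)
 qed
qed

lemma quot_carrier:
 "submodule N' K A ==> carrier (quot_mod (sub_mod (proj_mod A s) N') N) = (%x. N +>.A x) ` N'"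
 "s : idx A ==> carrier (quot_mod (proj_mod A s) N) = (%x. N +>.A x) ` lid s"
 using module.cosets_image[where M = "sub_mod (proj_mod A s) N'" and H = N, OF sub_proj_module]
  module.cosets_image[where M = "proj_mod A s" and H = N, OF proj_module]
 by (simp_all add: quot_mod_def coset_proj sub_proj_simps proj_carrier)

lemma quot_ops:
 assumes M: "M = proj_mod A s \<or> M = sub_mod (proj_mod A s) N'"
  and N: "submodule N K A" "!!a x. [|a : carrier A; x : N|] ==> a **.A x : N"
  and x: "x : carrier A" and y: "y : carrier A"
 shows "(N +>.A x) \<oplus>\<^bsub>quot_mod M N\<^esub> (N +>.A y) = N +>.A (x \<oplus>.A y)"
  "c : carrier K ==> c \<odot>\<^bsub>quot_mod M N\<^esub> (N +>.A x) = N +>.A (c \<odot>.A x)"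
  "a : carrier A ==> act (quot_mod M N) a (N +>.A x) = N +>.A (a **.A x)"
proof -
 have e: "a_r_coset M = a_r_coset A" "set_add M = set_add A" "smult M = smult A" "act M = mult A"
  using M by (auto simp: coset_proj proj_simps sub_proj_simps)
 note D = A.submoduleD[OF N(1)]
 show "(N +>.A x) \<oplus>\<^bsub>quot_mod M N\<^esub> (N +>.A y) = N +>.A (x \<oplus>.A y)"
  using A.coset_add[OF N(1) x y] by (simp add: quot_mod_def e)
 show "c \<odot>\<^bsub>quot_mod M N\<^esub> (N +>.A x) = N +>.A (c \<odot>.A x)" if c: "c : carrier K"
 proof -
  have "(\<Union>u\<in>N +>.A x. N +>.A (c \<odot>.A u)) = N +>.A (c \<odot>.A x)"
  proof (rule A.coset_UN[OF N(1) x _ modA N(1)])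
   fix u assume u: "u : carrier A" "u \<ominus>.A x : N"
   have "c \<odot>.A (u \<ominus>.A x) = c \<odot>.A u \<ominus>.A c \<odot>.A x"
    using u(1) x c by (simp add: a_minus_def A.smult_r_distr A.smult_r_minus)
   thus "c \<odot>.A u \<ominus>.A c \<odot>.A x : N" using D(4)[OF c u(2)] by simp
  qed (use c in simp)
  thus ?thesis by (simp add: quot_mod_def e)
 qed
 show "act (quot_mod M N) a (N +>.A x) = N +>.A (a **.A x)" if a: "a : carrier A"
 proof -
  have "(\<Union>u\<in>N +>.A x. N +>.A (a **.A u)) = N +>.A (a **.A x)"
  proof (rule A.coset_UN[OF N(1) x _ modA N(1)])
   fix u assume u: "u : carrier A" "u \<ominus>.A x : N"
   have "a **.A (u \<ominus>.A x) = a **.A u \<ominus>.A a **.A x"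
    by (rule mult_minus_right[OF a u(1) x])
   thus "a **.A u \<ominus>.A a **.A x : N" using N(2)[OF a u(2)] by simp
  qed (use a in simp)
  thus ?thesis by (simp add: quot_mod_def e)
 qed
qed

text \<open>Right multiplication by \<open>p\<close> identifies \<open>A e_t / L\<close> with
  \<open>N' / N\<close> and raises degrees by \<open>m\<close>. The isomorphism is built in the
  inverse direction: a coset is sent to the set of all \<open>w\<close> for which \<open>w p\<close>
  lies in it, which is a coset of \<open>L\<close> and involves no choice.\<close>

lemma quot_iso_shift:
 assumes s: "s : idx A" and t: "t : idx A"
  and N: "homog_left_ideal s N" and N': "homog_left_ideal s N'" and L: "homog_left_ideal t L"
  and p: "p : agrade A m"
  and sur: "!!x. x : N' ==> EX w:lid t. x \<ominus>.A w **.A p : N"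
  and cl: "!!w. w : lid t ==> w **.A p : N'"
  and inj: "!!w. w : lid t ==> w **.A p : N \<longleftrightarrow> w : L"
 shows "mod_iso K A (quot_mod (sub_mod (proj_mod A s) N') N) (shift_mod (quot_mod (proj_mod A t) L) (int m))"
proof -
 let ?M = "quot_mod (sub_mod (proj_mod A s) N') N" and ?Q = "quot_mod (proj_mod A t) L"
 have pc: "p : carrier A" using p agrade_carrier by blast
 have Ns: "submodule N K A" and N's: "submodule N' K A" and Ls: "submodule L K A" and Ll: "L \<subseteq> lid t"
  and Nm: "!!a x. [|a : carrier A; x : N|] ==> a **.A x : N"
  and Lm: "!!a x. [|a : carrier A; x : L|] ==> a **.A x : L"
  and Nc: "!!n x. x : N ==> comp n x : N"
  using N N' L by (auto simp: homog_left_ideal_def)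
 note lc = lid_carrier
 note Dl = A.submoduleD[OF lid_submodule[OF t]]
 define h where "h C = {w : lid t. w **.A p : C}" for C
 have mm: "w **.A p \<ominus>.A w' **.A p = (w \<ominus>.A w') **.A p" if "w : lid t" "w' : lid t" for w w'
  using mult_minus_left[OF lc[OF that(1)] lc[OF that(2)] pc] by simp
 have iff: "u : H +>.A x \<longleftrightarrow> u \<ominus>.A x : H" if "submodule H K A" "u : carrier A" "x : carrier A" for H u x
  using A.coset_eq_iff[OF that] A.coset_self[OF that(1,2)] A.coset_memD[OF that(1,3), of u] by auto
 have h: "h (N +>.A (w **.A p)) = L +>.A w" if w: "w : lid t" for w
 proof (intro equalityI subsetI)
  fix u assume "u : h (N +>.A (w **.A p))"
  hence u: "u : lid t" "u **.A p : N +>.A (w **.A p)" by (auto simp: h_def)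
  hence "(u \<ominus>.A w) **.A p : N" using iff[OF Ns] mm[OF u(1) w] lc[OF w] lc[OF u(1)] pc by simp
  hence "u \<ominus>.A w : L" using inj Dl(6) u(1) w by blast
  thus "u : L +>.A w" using iff[OF Ls lc[OF u(1)] lc[OF w]] by simp
 next
  fix u assume u: "u : L +>.A w"
  hence u': "u : carrier A" "u \<ominus>.A w : L" using A.coset_memD[OF Ls lc[OF w] u] by auto
  have "u = (u \<ominus>.A w) \<oplus>.A w" using u'(1) lc[OF w] by (simp add: a_minus_def A.M.a_assoc A.M.l_neg)
  hence ul: "u : lid t" using Dl(3)[of "u \<ominus>.A w" w] Ll u'(2) w by auto
  have "u **.A p \<ominus>.A w **.A p : N" using mm[OF ul w] inj Dl(6) ul w u'(2) by auto
  thus "u : h (N +>.A (w **.A p))" unfolding h_def using ul iff[OF Ns] u'(1) lc[OF w] pc by simp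
 qed
 have cM: "carrier ?M = (%w. N +>.A (w **.A p)) ` lid t"
 proof (unfold quot_carrier(1)[OF N's], intro equalityI subsetI)
  fix C assume "C : (%x. N +>.A x) ` N'"
  then obtain x where x: "x : N'" "C = N +>.A x" by blast
  obtain w where w: "w : lid t" "x \<ominus>.A w **.A p : N" using sur[OF x(1)] by blast
  have "N +>.A x = N +>.A (w **.A p)"
  proof (subst A.coset_eq_iff[OF Ns])
   show "x : carrier A" using x(1) A.submoduleD(1)[OF N's] by blast
  qed (use w lc[OF w(1)] pc in auto)
  thus "C : (%w. N +>.A (w **.A p)) ` lid t" using x(2) w(1) by blast
 qed (use cl in blast)
 have cQ: "carrier (shift_mod ?Q (int m)) = (%w. L +>.A w) ` lid t"
  using quot_carrier(2)[OF t] by (simp add: shift_mod_def)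
 note qN = quot_ops[OF disjI2[OF refl] Ns Nm] and qL = quot_ops[OF disjI1[OF refl] Ls Lm]
 have sh: "add (shift_mod ?Q (int m)) = add ?Q" "smult (shift_mod ?Q (int m)) = smult ?Q" "act (shift_mod ?Q (int m)) = act ?Q"
  "mgrade (shift_mod ?Q (int m)) i = mgrade ?Q (i - int m)" for i
  by (simp_all add: shift_mod_def)
 have "h : mod_hom K A ?M (shift_mod ?Q (int m))"
  unfolding mod_hom_def
 proof (intro CollectI conjI ballI allI)
  show "h : carrier ?M \<rightarrow> carrier (shift_mod ?Q (int m))" unfolding cM cQ using h by auto
 next
  fix x y assume "x : carrier ?M" "y : carrier ?M"
  then obtain u w where u: "u : lid t" "x = N +>.A (u **.A p)" and w: "w : lid t" "y = N +>.A (w **.A p)" unfolding cM by blast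
  have uw: "u \<oplus>.A w : lid t" using Dl(3) u w by blast
  have "x \<oplus>\<^bsub>?M\<^esub> y = N +>.A ((u \<oplus>.A w) **.A p)"
   using qN(1)[of "u **.A p" "w **.A p"] u w lc pc by (simp add: mult_add_left)
  thus "h (x \<oplus>\<^bsub>?M\<^esub> y) = h x \<oplus>\<^bsub>shift_mod ?Q (int m)\<^esub> h y"
   using h[OF uw] h[OF u(1)] h[OF w(1)] qL(1)[of u w] u w lc by (simp add: sh)
 next
  fix c x assume c: "c : carrier K" and "x : carrier ?M"
  then obtain u where u: "u : lid t" "x = N +>.A (u **.A p)" unfolding cM by blast
  have cu: "c \<odot>.A u : lid t" using Dl(4) u c by blast
  have "c \<odot>\<^bsub>?M\<^esub> x = N +>.A ((c \<odot>.A u) **.A p)"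
   using qN(2)[of "u **.A p" "u **.A p" c] u c lc pc by (simp add: mult_smult_left)
  thus "h (c \<odot>\<^bsub>?M\<^esub> x) = c \<odot>\<^bsub>shift_mod ?Q (int m)\<^esub> h x"
   using h[OF cu] h[OF u(1)] qL(2)[of u u c] u c lc by (simp add: sh)
 next
  fix a x assume a: "a : carrier A" and "x : carrier ?M"
  then obtain u where u: "u : lid t" "x = N +>.A (u **.A p)" unfolding cM by blast
  have au: "a **.A u : lid t" using lid_left[OF t u(1) a] .
  have "act ?M a x = N +>.A ((a **.A u) **.A p)"
   using qN(3)[of "u **.A p" "u **.A p" a] u a lc pc by (simp add: mult_assoc)
  thus "h (act ?M a x) = act (shift_mod ?Q (int m)) a (h x)"
   using h[OF au] h[OF u(1)] qL(3)[of u u a] u a lc by (simp add: sh)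
 next
  fix i show "h ` mgrade ?M i \<subseteq> mgrade (shift_mod ?Q (int m)) i"
  proof (rule image_subsetI)
   fix C assume "C : mgrade ?M i"
   then obtain x where x: "x : N'" "x : zgrade i" "C = N +>.A x"
    using N' s by (auto simp: quot_mod_def coset_proj sub_proj_simps proj_grade homog_left_ideal_def)
   have xc: "x : carrier A" using x(1) A.submoduleD(1)[OF N's] by blast
   obtain w where w: "w : lid t" "x \<ominus>.A w **.A p : N" using sur[OF x(1)] by blast
   \<comment> \<open>The \<open>w\<close> found for a homogeneous \<open>x\<close> need not be
     homogeneous. Its component of degree \<open>i - m\<close> does equally well, because
     \<open>N\<close> contains the components of its elements.\<close>
   let ?d = "x \<ominus>.A w **.A p" and ?w = "zcomp (i - int m) w"
   have wl: "?w : lid t" using lid_comp[OF t w(1)] Dl(2) by (simp add: zcomp_def)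
   have zd: "zcomp i ?d : N" using Nc[OF w(2)] A.submoduleD(2)[OF Ns] by (simp add: zcomp_def)
   have dc: "?d : carrier A" using xc lc[OF w(1)] pc by simp
   have "x = ?d \<oplus>.A w **.A p" using xc lc[OF w(1)] pc by (simp add: a_minus_def A.M.a_assoc A.M.l_neg)
   hence "zcomp i x = zcomp i ?d \<oplus>.A zcomp i (w **.A p)"
    using zcomp_props(2)[OF dc, of "w **.A p" i] lc[OF w(1)] pc by simp
   hence "x = zcomp i ?d \<oplus>.A ?w **.A p"
    using zcomp_props(3)[OF xc x(2), of i] zcomp_mult[OF p lc[OF w(1)], of i] by simp
   hence "x \<ominus>.A ?w **.A p = (zcomp i ?d \<oplus>.A ?w **.A p) \<ominus>.A ?w **.A p" by (rule arg_cong)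
   also have "... = zcomp i ?d"
    using subsetD[OF A.submoduleD(1)[OF Ns] zd] lc[OF wl] pc by (simp add: a_minus_def A.M.a_assoc A.M.r_neg)
   finally have "x \<ominus>.A ?w **.A p = zcomp i ?d" .
   hence "N +>.A x = N +>.A (?w **.A p)" using A.coset_eq_iff[OF Ns xc, of "?w **.A p"] zd lc[OF wl] pc by simp
   hence "h C = L +>.A ?w" using h[OF wl] x(3) by simp
   thus "h C : mgrade (shift_mod ?Q (int m)) i"
    using wl zcomp_props(1)[OF lc[OF w(1)], of "i - int m"] t
    by (subst sh(4)) (auto simp: quot_mod_def coset_proj proj_grade)
  qed
 qed
 moreover have "bij_betw h (carrier ?M) (carrier (shift_mod ?Q (int m)))"
  unfolding bij_betw_def
 proof
  show "inj_on h (carrier ?M)"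
  proof (rule inj_onI)
   fix x y assume "x : carrier ?M" "y : carrier ?M" and e: "h x = h y"
   then obtain u w where u: "u : lid t" "x = N +>.A (u **.A p)" and w: "w : lid t" "y = N +>.A (w **.A p)" unfolding cM by blast
   have "L +>.A u = L +>.A w" using e h u w by simp
   hence "u \<ominus>.A w : L" using A.coset_eq_iff[OF Ls lc[OF u(1)] lc[OF w(1)]] by simp
   hence "u **.A p \<ominus>.A w **.A p : N" using mm[OF u(1) w(1)] inj Dl(6) u(1) w(1) by auto
   thus "x = y" using A.coset_eq_iff[OF Ns, of "u **.A p" "w **.A p"] lc u w pc by simp
  qed
  show "h ` carrier ?M = carrier (shift_mod ?Q (int m))" unfolding cM cQ using h by force
 qed
 ultimately show ?thesis unfolding mod_iso_def by blast
qed

end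

subsection \<open>Quotients of graded algebras\<close>

lemma quot_algebra_ops:
 assumes B: "graded_algebra K B" and I: "submodule I K B"
  and Ia: "ALL a:carrier B. ALL x:I. a **.B x : I & x **.B a : I"
 shows "carrier (quot_algebra B I S) = (%x. I +>.B x) ` carrier B"
  "!!x y. [|x : carrier B; y : carrier B|] ==> I +>.B (x \<oplus>.B y) = (I +>.B x) \<oplus>\<^bsub>quot_algebra B I S\<^esub> (I +>.B y)"
  "!!x y. [|x : carrier B; y : carrier B|] ==> I +>.B (x **.B y) = (I +>.B x) \<otimes>\<^bsub>quot_algebra B I S\<^esub> (I +>.B y)"
  "!!c x. [|c : carrier K; x : carrier B|] ==> I +>.B (c \<odot>.B x) = c \<odot>\<^bsub>quot_algebra B I S\<^esub> (I +>.B x)"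
  "I +>.B \<zero>.B = \<zero>\<^bsub>quot_algebra B I S\<^esub>"
  "!!x. x : carrier B ==> I +>.B x = \<zero>\<^bsub>quot_algebra B I S\<^esub> \<longleftrightarrow> x : I"
  "agrade (quot_algebra B I S) n = (%x. I +>.B x) ` agrade B n"
  "idx (quot_algebra B I S) = S" "idem (quot_algebra B I S) s = I +>.B idem B s"
proof -
 interpret B: graded_algebra K B by fact
 note D = B.A.submoduleD[OF I]
 have Il: "!!a x. [|a : carrier B; x : I|] ==> a **.B x : I" and Ir: "!!a x. [|a : carrier B; x : I|] ==> x **.B a : I"
  using Ia by blast+
 show "carrier (quot_algebra B I S) = (%x. I +>.B x) ` carrier B" by (simp add: quot_algebra_def B.A.cosets_image)
 show "I +>.B (x \<oplus>.B y) = (I +>.B x) \<oplus>\<^bsub>quot_algebra B I S\<^esub> (I +>.B y)" if "x : carrier B" "y : carrier B" for x y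
  using B.A.coset_add[OF I that] by (simp add: quot_algebra_def)
 show "I +>.B (x **.B y) = (I +>.B x) \<otimes>\<^bsub>quot_algebra B I S\<^esub> (I +>.B y)" if x: "x : carrier B" and y: "y : carrier B" for x y
 proof -
  have "I +>.B (a **.B b) = I +>.B (x **.B y)" if "a : I +>.B x" "b : I +>.B y" for a b
  proof -
   have a: "a : carrier B" "a \<ominus>.B x : I" and b: "b : carrier B" "b \<ominus>.B y : I"
    using B.A.coset_memD[OF I x that(1)] B.A.coset_memD[OF I y that(2)] by auto
   have "(a \<ominus>.B x) **.B b \<oplus>.B x **.B (b \<ominus>.B y) = a **.B b \<ominus>.B x **.B y"
    unfolding B.mult_minus_left[OF a(1) x b(1)] B.mult_minus_right[OF x b(1) y]
    using a(1) b(1) x y by (simp add: a_minus_def B.A.M.a_assoc B.A.M.a_lcomm[of "\<ominus>.B (x **.B b)"] B.A.M.r_neg2 B.A.M.r_neg1)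
   moreover have "(a \<ominus>.B x) **.B b \<oplus>.B x **.B (b \<ominus>.B y) : I"
    using D(3) Il[OF x b(2)] Ir[OF b(1) a(2)] by blast
   ultimately show ?thesis using B.A.coset_eq_iff[OF I, of "a **.B b" "x **.B y"] a b x y by simp
  qed
  hence "(\<Union>a\<in>I +>.B x. \<Union>b\<in>I +>.B y. I +>.B (a **.B b)) = I +>.B (x **.B y)"
   using B.A.coset_self[OF I x] B.A.coset_self[OF I y] by blast
  thus ?thesis by (simp add: quot_algebra_def rcoset_mult_def)
 qed
 show "I +>.B (c \<odot>.B x) = c \<odot>\<^bsub>quot_algebra B I S\<^esub> (I +>.B x)" if c: "c : carrier K" and x: "x : carrier B" for c x
 proof -
  have "(\<Union>u\<in>I +>.B x. I +>.B (c \<odot>.B u)) = I +>.B (c \<odot>.B x)"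
  proof (rule B.A.coset_UN[OF I x _ B.modA I])
   fix u assume u: "u : carrier B" "u \<ominus>.B x : I"
   have "c \<odot>.B (u \<ominus>.B x) = c \<odot>.B u \<ominus>.B c \<odot>.B x"
    using u(1) x c by (simp add: a_minus_def B.A.smult_r_distr B.A.smult_r_minus)
   thus "c \<odot>.B u \<ominus>.B c \<odot>.B x : I" using D(4)[OF c u(2)] by simp
  qed (use c in simp)
  thus ?thesis by (simp add: quot_algebra_def)
 qed
 show "I +>.B \<zero>.B = \<zero>\<^bsub>quot_algebra B I S\<^esub>" by (simp add: quot_algebra_def B.A.coset_zero[OF I])
 show "I +>.B x = \<zero>\<^bsub>quot_algebra B I S\<^esub> \<longleftrightarrow> x : I" if "x : carrier B" for x
  using B.A.coset_mem[OF I that] by (simp add: quot_algebra_def)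
qed (simp_all add: quot_algebra_def)

lemma image_Collect_comp: "(%x. q (f x)) ` S = q ` {f x | x. x : S}" by blast

text \<open>The ideal is homogeneous and contains an idempotent exactly if it is not kept. So both
  decompositions descend, and the kept idempotents stay independent: multiplying by one of them
  extracts its coefficient, up to the nonzero idempotent itself.\<close>

lemma quot_algebra_graded:
 assumes B: "graded_algebra K B" and I: "submodule I K B"
  and Ia: "\<forall>a\<in>carrier B. \<forall>x\<in>I. a \<otimes>\<^bsub>B\<^esub> x \<in> I \<and> x \<otimes>\<^bsub>B\<^esub> a \<in> I"
  and Ih: "\<And>n x. x \<in> I \<Longrightarrow> graded_algebra.comp B n x \<in> I"
  and S: "S \<subseteq> idx B" "\<And>s. s \<in> idx B - S \<Longrightarrow> idem B s \<in> I" "\<And>s. s \<in> S \<Longrightarrow> idem B s \<notin> I"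
 shows "graded_algebra K (quot_algebra B I S)"
proof -
 interpret B: graded_algebra K B by fact
 let ?Q = "quot_algebra B I S"
 have Il: "\<And>a x. \<lbrakk>a \<in> carrier B; x \<in> I\<rbrakk> \<Longrightarrow> a \<otimes>\<^bsub>B\<^esub> x \<in> I" and Ir: "\<And>a x. \<lbrakk>a \<in> carrier B; x \<in> I\<rbrakk> \<Longrightarrow> x \<otimes>\<^bsub>B\<^esub> a \<in> I"
  using Ia by blast+
 define q where "q x = I +>\<^bsub>B\<^esub> x" for x
 note O = quot_algebra_ops[OF B I Ia, where S = S, folded q_def]
 have qc: "\<And>x. x \<in> carrier B \<Longrightarrow> q x \<in> carrier ?Q" using O(1) by simp
 have ex: "\<exists>b\<in>carrier B. x = q b" if "x \<in> carrier ?Q" for x using that O(1) by blast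
 note qs = O(2)[symmetric] O(3)[symmetric] O(4)[symmetric] O(9)
 have modQ: "Module.module K ?Q"
  by (rule module_image[OF B.modA O(1)[symmetric] O(5) O(2) O(4)])
 interpret Q: Module.module K ?Q by fact
 have agQ: "abelian_group ?Q" by (rule Q.abelian_group_axioms)
 have img: "submodule (q ` V) K ?Q" if V: "submodule V K B" for V
 proof (rule Q.submoduleI')
  note D = B.A.submoduleD[OF V]
  have c: "x \<in> V \<Longrightarrow> x \<in> carrier B" for x using D(1) by blast
  show "q ` V \<subseteq> carrier ?Q" using c qc by blast
  show "\<zero>\<^bsub>?Q\<^esub> \<in> q ` V" using D(2) O(5) by force
  show "a \<oplus>\<^bsub>?Q\<^esub> b \<in> q ` V" if "a \<in> q ` V" "b \<in> q ` V" for a b using that c D(3) by (auto simp: qs)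
  show "a \<odot>\<^bsub>?Q\<^esub> b \<in> q ` V" if "a \<in> carrier K" "b \<in> q ` V" for a b using that c D(4) by (auto simp: qs)
 qed
 have qadd: "\<And>x y. \<lbrakk>x \<in> carrier B; y \<in> carrier B\<rbrakk> \<Longrightarrow> q (x \<oplus>\<^bsub>B\<^esub> y) = q x \<oplus>\<^bsub>?Q\<^esub> q y" by (rule O(2))
 have dsQ: "direct_sum ?Q UNIV (agrade ?Q)"
 proof -
  have "\<exists>\<rho>. projections ?Q UNIV (\<lambda>i. q ` agrade B i) \<rho>"
  proof (rule projections_image[OF B.agA agQ B.comp _ O(1)[symmetric] qadd])
   show "agrade B i \<subseteq> carrier B" for i using B.agrade_carrier by blast
   show "q (B.comp i x) = \<zero>\<^bsub>?Q\<^esub>" if "x \<in> carrier B" "q x = \<zero>\<^bsub>?Q\<^esub>" for i x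
    using that O(6) Ih by simp
  qed auto
  moreover have "agrade ?Q = (\<lambda>i. q ` agrade B i)" using O(7) by auto
  ultimately show ?thesis unfolding direct_sum_iff[OF agQ]
   using Q.submodule_subgroup[OF img[OF B.agrade_submodule]] by simp
 qed
 let ?V = "\<lambda>(s, t). {idem B s \<otimes>\<^bsub>B\<^esub> x \<otimes>\<^bsub>B\<^esub> idem B t | x. x \<in> carrier B}"
 have V: "(\<lambda>(s, t). {idem ?Q s \<otimes>\<^bsub>?Q\<^esub> x \<otimes>\<^bsub>?Q\<^esub> idem ?Q t | x. x \<in> carrier ?Q}) p = q ` ?V p" if p: "p \<in> S \<times> S" for p
 proof -
  obtain s t where st: "p = (s, t)" "s \<in> idx B" "t \<in> idx B" using p S(1) by auto
  have e: "idem ?Q s \<otimes>\<^bsub>?Q\<^esub> q x \<otimes>\<^bsub>?Q\<^esub> idem ?Q t = q (idem B s \<otimes>\<^bsub>B\<^esub> x \<otimes>\<^bsub>B\<^esub> idem B t)" if "x \<in> carrier B" for x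
   using that st by (simp add: qs)
  show ?thesis unfolding st(1) prod.case using e O(1) by (auto; force)
 qed
 have dsV: "direct_sum ?Q (S \<times> S) (\<lambda>(s, t). {idem ?Q s \<otimes>\<^bsub>?Q\<^esub> x \<otimes>\<^bsub>?Q\<^esub> idem ?Q t | x. x \<in> carrier ?Q})"
 proof -
  have "\<exists>\<pi>. projections B (idx B \<times> idx B) ?V \<pi>" using B.idem_direct_sum by (simp only: direct_sum_iff[OF B.agA])
  then obtain \<pi> where p: "projections B (idx B \<times> idx B) ?V \<pi>" ..
  have Vc: "\<And>i. i \<in> idx B \<times> idx B \<Longrightarrow> ?V i \<subseteq> carrier B" by auto
  have pe: "\<pi> (s, t) x = idem B s \<otimes>\<^bsub>B\<^esub> x \<otimes>\<^bsub>B\<^esub> idem B t" if st: "s \<in> idx B" "t \<in> idx B" and x: "x \<in> carrier B" for s t x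
  proof -
   let ?W = "{x \<in> carrier B. \<pi> (s, t) x = idem B s \<otimes>\<^bsub>B\<^esub> x \<otimes>\<^bsub>B\<^esub> idem B t}"
   have i: "(s, t) \<in> idx B \<times> idx B" using st by simp
   obtain F where F: "finite F" "F \<subseteq> idx B \<times> idx B" "x = (\<Oplus>\<^bsub>B\<^esub>i\<in>F. \<pi> i x)"
    using projections_sum[OF B.agA p Vc x] by (metis subset_refl)
   have pc: "\<pi> i y \<in> carrier B" if "i \<in> idx B \<times> idx B" "y \<in> carrier B" for i y
    by (rule subsetD[OF Vc projectionsD(1)[OF p]]) (use that in auto)
   have e: "\<pi> (s, t) (\<pi> j x) = idem B s \<otimes>\<^bsub>B\<^esub> \<pi> j x \<otimes>\<^bsub>B\<^esub> idem B t" if j: "j \<in> F" for j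
   proof -
    obtain s' t' where j': "j = (s', t')" "s' \<in> idx B" "t' \<in> idx B" using j F by auto
    have jI: "j \<in> idx B \<times> idx B" using j F by auto
    obtain u where u: "u \<in> carrier B" "\<pi> j x = idem B s' \<otimes>\<^bsub>B\<^esub> u \<otimes>\<^bsub>B\<^esub> idem B t'"
     using projectionsD(1)[OF p jI x] j' by auto
    have "idem B s \<otimes>\<^bsub>B\<^esub> \<pi> j x \<otimes>\<^bsub>B\<^esub> idem B t = (idem B s \<otimes>\<^bsub>B\<^esub> idem B s') \<otimes>\<^bsub>B\<^esub> u \<otimes>\<^bsub>B\<^esub> (idem B t' \<otimes>\<^bsub>B\<^esub> idem B t)"
     unfolding u(2) using u st j' by (simp add: B.mult_assoc)
    thus ?thesis using projectionsD(3)[OF p jI i projectionsD(1)[OF p jI x]] B.idem_orthogonal st j' u by auto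
   qed
   have "\<pi> (s, t) x = \<pi> (s, t) (\<Oplus>\<^bsub>B\<^esub>j\<in>F. \<pi> j x)" using F(3) by (rule arg_cong)
   also have "\<dots> = (\<Oplus>\<^bsub>B\<^esub>j\<in>F. \<pi> (s, t) (\<pi> j x))"
    by (rule additive_finsum[OF B.agA B.agA _ projectionsD(2)[OF p i] F(1)]) (use pc i F(2) x in auto)
   also have "\<dots> = (\<Oplus>\<^bsub>B\<^esub>j\<in>F. idem B s \<otimes>\<^bsub>B\<^esub> \<pi> j x \<otimes>\<^bsub>B\<^esub> idem B t)"
   proof (rule B.A.M.finsum_cong')
    show "(\<lambda>j. idem B s \<otimes>\<^bsub>B\<^esub> \<pi> j x \<otimes>\<^bsub>B\<^esub> idem B t) \<in> F \<rightarrow> carrier B"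
     using pc F(2) x st by (intro Pi_I B.mult_closed B.idem_closed) auto
   qed (use e in auto)
   also have "\<dots> = idem B s \<otimes>\<^bsub>B\<^esub> (\<Oplus>\<^bsub>B\<^esub>j\<in>F. \<pi> j x) \<otimes>\<^bsub>B\<^esub> idem B t"
   proof -
    have "(\<lambda>j. \<pi> j x) \<in> F \<rightarrow> carrier B" "(\<lambda>j. idem B s \<otimes>\<^bsub>B\<^esub> \<pi> j x) \<in> F \<rightarrow> carrier B"
     using pc F(2) x st by (intro Pi_I B.mult_closed B.idem_closed; auto)+
    thus ?thesis using F(1) st by (simp add: B.mult_finsum_right B.mult_finsum_left)
   qed
   finally show ?thesis using F(3) by simp
  qed
  have "\<exists>\<rho>. projections ?Q (S \<times> S) (\<lambda>i. q ` ?V i) \<rho>"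
  proof (rule projections_image[OF B.agA agQ p Vc O(1)[symmetric] qadd])
   show "q (\<pi> i x) = \<zero>\<^bsub>?Q\<^esub>" if i: "i \<in> idx B \<times> idx B" and x: "x \<in> carrier B" "q x = \<zero>\<^bsub>?Q\<^esub>" for i x
   proof -
    obtain s t where st: "i = (s, t)" "s \<in> idx B" "t \<in> idx B" using i by auto
    have "idem B s \<otimes>\<^bsub>B\<^esub> x \<otimes>\<^bsub>B\<^esub> idem B t \<in> I" using x st O(6) Il Ir by simp
    thus ?thesis using pe[OF st(2,3) x(1)] st x O(6) by simp
   qed
   show "q ` ?V i \<subseteq> {\<zero>\<^bsub>?Q\<^esub>}" if i: "i \<in> idx B \<times> idx B - S \<times> S" for i
   proof -
    obtain s t where st: "i = (s, t)" "s \<in> idx B" "t \<in> idx B" "s \<in> idx B - S \<or> t \<in> idx B - S" using i by auto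
    have "idem B s \<otimes>\<^bsub>B\<^esub> x \<otimes>\<^bsub>B\<^esub> idem B t \<in> I" if x: "x \<in> carrier B" for x
     using st(4)
    proof
     assume "s \<in> idx B - S"
     hence "idem B s \<otimes>\<^bsub>B\<^esub> x \<in> I" using S(2) Ir x by blast
     thus ?thesis by (rule Ir[rotated]) (use st in simp)
    next
     assume "t \<in> idx B - S"
     thus ?thesis using S(2) Il[of "idem B s \<otimes>\<^bsub>B\<^esub> x"] x st by simp
    qed
    hence "q (idem B s \<otimes>\<^bsub>B\<^esub> x \<otimes>\<^bsub>B\<^esub> idem B t) = \<zero>\<^bsub>?Q\<^esub>" if "x \<in> carrier B" for x
     using st that O(6) by simp
    thus ?thesis unfolding st(1) prod.case by blast
   qed
  qed (use S(1) in auto)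
  then obtain \<rho> where r: "projections ?Q (S \<times> S) (\<lambda>i. q ` ?V i) \<rho>" ..
  have pr: "projections ?Q (S \<times> S) (\<lambda>(s, t). {idem ?Q s \<otimes>\<^bsub>?Q\<^esub> x \<otimes>\<^bsub>?Q\<^esub> idem ?Q t | x. x \<in> carrier ?Q}) \<rho>"
   using r V unfolding projections_def by simp
  have "submodule (q ` ?V i) K ?Q" if i: "i \<in> S \<times> S" for i
  proof (rule img)
   obtain s t where st: "i = (s, t)" "s \<in> idx B" "t \<in> idx B" using i S(1) by auto
   show "submodule (?V i) K B" unfolding st(1) prod.case
   proof (rule B.A.submoduleI')
    show "\<zero>\<^bsub>B\<^esub> \<in> {idem B s \<otimes>\<^bsub>B\<^esub> x \<otimes>\<^bsub>B\<^esub> idem B t | x. x \<in> carrier B}"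
     using st by (intro CollectI exI[of _ "\<zero>\<^bsub>B\<^esub>"]) simp
   next
    fix a b assume "a \<in> {idem B s \<otimes>\<^bsub>B\<^esub> x \<otimes>\<^bsub>B\<^esub> idem B t | x. x \<in> carrier B}" "b \<in> {idem B s \<otimes>\<^bsub>B\<^esub> x \<otimes>\<^bsub>B\<^esub> idem B t | x. x \<in> carrier B}"
    then obtain x y where "x \<in> carrier B" "y \<in> carrier B" "a = idem B s \<otimes>\<^bsub>B\<^esub> x \<otimes>\<^bsub>B\<^esub> idem B t" "b = idem B s \<otimes>\<^bsub>B\<^esub> y \<otimes>\<^bsub>B\<^esub> idem B t" by blast
    thus "a \<oplus>\<^bsub>B\<^esub> b \<in> {idem B s \<otimes>\<^bsub>B\<^esub> x \<otimes>\<^bsub>B\<^esub> idem B t | x. x \<in> carrier B}"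
     using st by (intro CollectI exI[of _ "x \<oplus>\<^bsub>B\<^esub> y"]) (simp add: B.mult_add_left B.mult_add_right)
   next
    fix c a assume "c \<in> carrier K" "a \<in> {idem B s \<otimes>\<^bsub>B\<^esub> x \<otimes>\<^bsub>B\<^esub> idem B t | x. x \<in> carrier B}"
    moreover then obtain x where "x \<in> carrier B" "a = idem B s \<otimes>\<^bsub>B\<^esub> x \<otimes>\<^bsub>B\<^esub> idem B t" by blast
    ultimately show "c \<odot>\<^bsub>B\<^esub> a \<in> {idem B s \<otimes>\<^bsub>B\<^esub> x \<otimes>\<^bsub>B\<^esub> idem B t | x. x \<in> carrier B}"
     using st by (intro CollectI exI[of _ "c \<odot>\<^bsub>B\<^esub> x"]) (simp add: B.mult_smult_left B.mult_smult_right)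
   qed (use st in auto)
  qed
  note sm = this
  have "subgroup ((\<lambda>(s, t). {idem ?Q s \<otimes>\<^bsub>?Q\<^esub> x \<otimes>\<^bsub>?Q\<^esub> idem ?Q t | x. x \<in> carrier ?Q}) i) (add_monoid ?Q)" if "i \<in> S \<times> S" for i
   unfolding V[OF that] by (rule Q.submodule_subgroup[OF sm[OF that]])
  thus ?thesis unfolding direct_sum_iff[OF agQ] using pr by blast
 qed
 have basis: "is_basis K ?Q (agrade ?Q 0) S (idem ?Q)"
  unfolding is_basis_def
 proof (intro conjI ballI)
  show "idem ?Q s \<in> agrade ?Q 0" if "s \<in> S" for s
   unfolding O(7,9) using that S(1) by (intro imageI B.idem_grade) blast
 next
  fix x assume "x \<in> agrade ?Q 0"
  then obtain b where b: "b \<in> agrade B 0" "x = q b" unfolding O(7) by blast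
  obtain c where c: "\<And>s. s \<in> idx B \<Longrightarrow> c s \<in> carrier K" "\<And>s. s \<notin> idx B \<Longrightarrow> c s = \<zero>\<^bsub>K\<^esub>" "finite {s. c s \<noteq> \<zero>\<^bsub>K\<^esub>}"
   "b = (\<Oplus>\<^bsub>B\<^esub>s\<in>{s. c s \<noteq> \<zero>\<^bsub>K\<^esub>}. c s \<odot>\<^bsub>B\<^esub> idem B s)"
   using B.idem_basis b(1) unfolding is_basis_def by blast
  let ?P = "\<lambda>c. (\<forall>s\<in>S. c s \<in> carrier K) \<and> (\<forall>s. s \<notin> S \<longrightarrow> c s = \<zero>\<^bsub>K\<^esub>) \<and> finite {s. c s \<noteq> \<zero>\<^bsub>K\<^esub>} \<and>
    x = (\<Oplus>\<^bsub>?Q\<^esub>s\<in>{s. c s \<noteq> \<zero>\<^bsub>K\<^esub>}. c s \<odot>\<^bsub>?Q\<^esub> idem ?Q s)"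
  have ic: "idem ?Q s \<in> carrier ?Q" if "s \<in> S" for s using that S(1) qc by (auto simp: O(9))
  have sup: "s \<in> idx B" if "c s \<noteq> \<zero>\<^bsub>K\<^esub>" for s using that c(2) by blast
  have ex0: "?P (\<lambda>s. if s \<in> S then c s else \<zero>\<^bsub>K\<^esub>)"
  proof (intro conjI)
   have e: "{s. (if s \<in> S then c s else \<zero>\<^bsub>K\<^esub>) \<noteq> \<zero>\<^bsub>K\<^esub>} = {s. c s \<noteq> \<zero>\<^bsub>K\<^esub>} \<inter> S" by auto
   show "finite {s. (if s \<in> S then c s else \<zero>\<^bsub>K\<^esub>) \<noteq> \<zero>\<^bsub>K\<^esub>}" unfolding e using c(3) by blast
   have "x = (\<Oplus>\<^bsub>?Q\<^esub>s\<in>{s. c s \<noteq> \<zero>\<^bsub>K\<^esub>}. q (c s \<odot>\<^bsub>B\<^esub> idem B s))"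
    unfolding b(2) c(4) by (rule additive_finsum[OF B.agA agQ _ qadd]) (use qc c(1,3) sup in auto)
   also have "\<dots> = (\<Oplus>\<^bsub>?Q\<^esub>s\<in>{s. c s \<noteq> \<zero>\<^bsub>K\<^esub>} \<inter> S. (if s \<in> S then c s else \<zero>\<^bsub>K\<^esub>) \<odot>\<^bsub>?Q\<^esub> idem ?Q s)"
   proof (rule Q.M.add.finprod_mono_neutral_cong_right)
    fix s assume "s \<in> {s. c s \<noteq> \<zero>\<^bsub>K\<^esub>} - {s. c s \<noteq> \<zero>\<^bsub>K\<^esub>} \<inter> S"
    hence s: "s \<in> idx B - S" "c s \<in> carrier K" using sup c(1) by auto
    have "c s \<odot>\<^bsub>B\<^esub> idem B s \<in> I" using B.A.submoduleD(4)[OF I s(2) S(2)[OF s(1)]] .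
    thus "q (c s \<odot>\<^bsub>B\<^esub> idem B s) = \<zero>\<^bsub>?Q\<^esub>" using O(6) s by simp
   next
    fix s assume "s \<in> {s. c s \<noteq> \<zero>\<^bsub>K\<^esub>} \<inter> S"
    thus "q (c s \<odot>\<^bsub>B\<^esub> idem B s) = (if s \<in> S then c s else \<zero>\<^bsub>K\<^esub>) \<odot>\<^bsub>?Q\<^esub> idem ?Q s"
     using sup c(1) by (simp add: O(4,9))
   qed (use c(1,3) sup qc in auto)
   finally show "x = (\<Oplus>\<^bsub>?Q\<^esub>s\<in>{s. (if s \<in> S then c s else \<zero>\<^bsub>K\<^esub>) \<noteq> \<zero>\<^bsub>K\<^esub>}. (if s \<in> S then c s else \<zero>\<^bsub>K\<^esub>) \<odot>\<^bsub>?Q\<^esub> idem ?Q s)"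
    unfolding e .
  qed (use c(1) S(1) in auto)
  have "d s = d' s" if d: "?P d" and d': "?P d'" for d d' s
  proof (cases "s \<in> S")
   case s: True
   have key: "idem ?Q s \<otimes>\<^bsub>?Q\<^esub> x = d s \<odot>\<^bsub>?Q\<^esub> idem ?Q s" if d: "?P d" for d
   proof -
    let ?S = "{s. d s \<noteq> \<zero>\<^bsub>K\<^esub>}"
    have sS: "u \<in> S" "d u \<in> carrier K" if "u \<in> ?S" for u using d that by auto
    have fS: "finite ?S" and xs: "x = (\<Oplus>\<^bsub>?Q\<^esub>s\<in>?S. d s \<odot>\<^bsub>?Q\<^esub> idem ?Q s)" using d by auto
    have "idem ?Q s \<otimes>\<^bsub>?Q\<^esub> x = (\<Oplus>\<^bsub>?Q\<^esub>u\<in>?S. idem ?Q s \<otimes>\<^bsub>?Q\<^esub> (d u \<odot>\<^bsub>?Q\<^esub> idem ?Q u))"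
     unfolding xs
    proof (rule additive_finsum[OF agQ agQ])
     show "(\<otimes>\<^bsub>?Q\<^esub>) (idem ?Q s) \<in> carrier ?Q \<rightarrow> carrier ?Q"
      using s S(1) qc by (auto simp: O(1,9) O(3)[symmetric] subset_iff)
     fix y z assume "y \<in> carrier ?Q" "z \<in> carrier ?Q"
     thus "idem ?Q s \<otimes>\<^bsub>?Q\<^esub> (y \<oplus>\<^bsub>?Q\<^esub> z) = idem ?Q s \<otimes>\<^bsub>?Q\<^esub> y \<oplus>\<^bsub>?Q\<^esub> idem ?Q s \<otimes>\<^bsub>?Q\<^esub> z"
      using s S(1) by (auto simp: O(1) qs B.mult_add_right subset_iff)
    qed (use fS sS ic in auto)
    also have "\<dots> = (\<Oplus>\<^bsub>?Q\<^esub>u\<in>?S. if s = u then d u \<odot>\<^bsub>?Q\<^esub> idem ?Q u else \<zero>\<^bsub>?Q\<^esub>)"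
    proof (rule Q.M.finsum_cong')
     fix u assume u: "u \<in> ?S"
     have "idem ?Q s \<otimes>\<^bsub>?Q\<^esub> (d u \<odot>\<^bsub>?Q\<^esub> idem ?Q u) = q (d u \<odot>\<^bsub>B\<^esub> (idem B s \<otimes>\<^bsub>B\<^esub> idem B u))"
      using sS[OF u] s S(1) by (simp add: qs B.mult_smult_right subset_iff)
     also have "\<dots> = (if s = u then q (d u \<odot>\<^bsub>B\<^esub> idem B u) else q \<zero>\<^bsub>B\<^esub>)"
      using sS[OF u] s S(1) by (auto simp: B.idem_orthogonal subset_iff)
     finally show "idem ?Q s \<otimes>\<^bsub>?Q\<^esub> (d u \<odot>\<^bsub>?Q\<^esub> idem ?Q u) = (if s = u then d u \<odot>\<^bsub>?Q\<^esub> idem ?Q u else \<zero>\<^bsub>?Q\<^esub>)"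
      using sS[OF u] S(1) by (simp add: O(4,5,9) subset_iff)
    qed (use sS ic in auto)
    also have "\<dots> = d s \<odot>\<^bsub>?Q\<^esub> idem ?Q s"
    proof (cases "s \<in> ?S")
     case True show ?thesis by (rule Q.M.finsum_singleton[OF True fS]) (use sS ic in auto)
    next
     case False
     have "(\<Oplus>\<^bsub>?Q\<^esub>u\<in>?S. if s = u then d u \<odot>\<^bsub>?Q\<^esub> idem ?Q u else \<zero>\<^bsub>?Q\<^esub>) = \<zero>\<^bsub>?Q\<^esub>"
      by (rule Q.M.add.finprod_one_eqI) (use False in auto)
     thus ?thesis using False ic[OF s] by simp
    qed
    finally show ?thesis .
   qed
   have "idem ?Q s \<noteq> \<zero>\<^bsub>?Q\<^esub>" using S(3)[OF s] S(1) s O(6) by (auto simp: O(9))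
   moreover have "d s \<odot>\<^bsub>?Q\<^esub> idem ?Q s = d' s \<odot>\<^bsub>?Q\<^esub> idem ?Q s" using key[OF d] key[OF d'] by simp
   moreover have "d s \<in> carrier K" "d' s \<in> carrier K" using d d' s by auto
   ultimately show ?thesis using smult_cancel[OF B.field_axioms modQ] ic[OF s] by blast
  next
   case False
   have "d s = \<zero>\<^bsub>K\<^esub>" using d False by blast
   moreover have "d' s = \<zero>\<^bsub>K\<^esub>" using d' False by blast
   ultimately show ?thesis by simp
  qed
  note un = this
  show "\<exists>!c. ?P c"
  proof (rule ex1I[where P = ?P, OF ex0])
   fix d assume "?P d"
   thus "d = (\<lambda>s. if s \<in> S then c s else \<zero>\<^bsub>K\<^esub>)" by (intro ext un[OF _ ex0])
  qed
 qed
 have fd: "fin_dim K ?Q {idem ?Q s \<otimes>\<^bsub>?Q\<^esub> x | x. x \<in> agrade ?Q i}" if s: "s \<in> S" for s i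
 proof -
  have sB: "s \<in> idx B" using s S(1) by auto
  let ?E = "{idem B s \<otimes>\<^bsub>B\<^esub> x | x. x \<in> agrade B i}"
  have Ec: "?E \<subseteq> carrier B" using B.mult_closed[OF B.idem_closed[OF sB] B.agrade_carrier] by blast
  have E: "{idem ?Q s \<otimes>\<^bsub>?Q\<^esub> x | x. x \<in> agrade ?Q i} = q ` ?E"
  proof -
   have "idem ?Q s \<otimes>\<^bsub>?Q\<^esub> q x = q (idem B s \<otimes>\<^bsub>B\<^esub> x)" if "x \<in> agrade B i" for x
    using sB B.agrade_carrier[OF that] by (simp add: qs)
   hence e: "(\<lambda>x. idem ?Q s \<otimes>\<^bsub>?Q\<^esub> q x) ` agrade B i = (\<lambda>x. q (idem B s \<otimes>\<^bsub>B\<^esub> x)) ` agrade B i" by (rule image_cong[OF refl])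
   have "{idem ?Q s \<otimes>\<^bsub>?Q\<^esub> x | x. x \<in> agrade ?Q i} = (\<lambda>x. idem ?Q s \<otimes>\<^bsub>?Q\<^esub> q x) ` agrade B i" unfolding O(7) by (auto simp: image_iff)
   also have "\<dots> = q ` ?E" unfolding e by (rule image_Collect_comp)
   finally show ?thesis .
  qed
  obtain F where F': "finite F \<and> F \<subseteq> ?E \<and> (\<forall>W. submodule W K B \<longrightarrow> F \<subseteq> W \<longrightarrow> ?E \<subseteq> W)"
   using B.idem_fin_dim[OF sB, of i] unfolding B.A.fin_dim_iff[OF Ec] ..
  note F = F'[THEN conjunct1] F'[THEN conjunct2, THEN conjunct1] F'[THEN conjunct2, THEN conjunct2, THEN spec, THEN mp, THEN mp]
  have qEc: "q ` ?E \<subseteq> carrier ?Q" by (rule image_subsetI, rule qc, rule subsetD[OF Ec])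
  show ?thesis unfolding E Q.fin_dim_iff[OF qEc]
  proof (intro exI[of _ "q ` F"] conjI allI impI)
   fix W assume W: "submodule W K ?Q" "q ` F \<subseteq> W"
   have "submodule {x \<in> carrier B. q x \<in> W} K B"
    by (rule B.A.submodule_vimage[OF modQ Pi_I[OF qc] O(2) O(4) W(1)])
   hence "?E \<subseteq> {x \<in> carrier B. q x \<in> W}" by (rule F(3)) (use W(2) subset_trans[OF F(2) Ec] in blast)
   thus "q ` ?E \<subseteq> W" by (intro image_subsetI) (drule subsetD, assumption, simp)
  next
   show "q ` F \<subseteq> q ` ?E" by (rule image_mono[OF F(2)])
  qed (rule finite_imageI[OF F(1)])
 qed
 show ?thesis
 proof (intro graded_algebra.intro B.field_axioms modQ graded_algebra_axioms.intro dsQ)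
  fix x y z assume "x \<in> carrier ?Q" "y \<in> carrier ?Q" "z \<in> carrier ?Q"
  then obtain a b c where abc: "a \<in> carrier B" "b \<in> carrier B" "c \<in> carrier B" "x = q a" "y = q b" "z = q c" using ex by metis
  show "x \<otimes>\<^bsub>?Q\<^esub> y \<otimes>\<^bsub>?Q\<^esub> z = x \<otimes>\<^bsub>?Q\<^esub> (y \<otimes>\<^bsub>?Q\<^esub> z)" using abc by (simp add: qs B.mult_assoc)
  show "(x \<oplus>\<^bsub>?Q\<^esub> y) \<otimes>\<^bsub>?Q\<^esub> z = x \<otimes>\<^bsub>?Q\<^esub> z \<oplus>\<^bsub>?Q\<^esub> y \<otimes>\<^bsub>?Q\<^esub> z" using abc by (simp add: qs B.mult_add_left)
  show "x \<otimes>\<^bsub>?Q\<^esub> (y \<oplus>\<^bsub>?Q\<^esub> z) = x \<otimes>\<^bsub>?Q\<^esub> y \<oplus>\<^bsub>?Q\<^esub> x \<otimes>\<^bsub>?Q\<^esub> z" using abc by (simp add: qs B.mult_add_right)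
 next
  fix x y assume "x \<in> carrier ?Q" "y \<in> carrier ?Q"
  then obtain a b where ab: "a \<in> carrier B" "b \<in> carrier B" "x = q a" "y = q b" using ex by metis
  show "x \<otimes>\<^bsub>?Q\<^esub> y \<in> carrier ?Q" using ab by (simp add: qs qc)
  fix c assume c: "c \<in> carrier K"
  show "(c \<odot>\<^bsub>?Q\<^esub> x) \<otimes>\<^bsub>?Q\<^esub> y = c \<odot>\<^bsub>?Q\<^esub> (x \<otimes>\<^bsub>?Q\<^esub> y)" "x \<otimes>\<^bsub>?Q\<^esub> (c \<odot>\<^bsub>?Q\<^esub> y) = c \<odot>\<^bsub>?Q\<^esub> (x \<otimes>\<^bsub>?Q\<^esub> y)"
   using ab c by (simp_all add: qs B.mult_smult_left B.mult_smult_right)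
 next
  show "submodule (agrade ?Q i) K ?Q" for i unfolding O(7) by (rule img[OF B.agrade_submodule])
 next
  fix x y i j assume "x \<in> agrade ?Q i" "y \<in> agrade ?Q j"
  then obtain a b where ab: "a \<in> agrade B i" "b \<in> agrade B j" "x = q a" "y = q b" by (auto simp: O(7))
  have "q (a \<otimes>\<^bsub>B\<^esub> b) \<in> q ` agrade B (i + j)" using B.agrade_mult[OF ab(1,2)] by blast
  thus "x \<otimes>\<^bsub>?Q\<^esub> y \<in> agrade ?Q (i + j)" using ab B.agrade_carrier by (simp add: qs O(7))
 next
  fix s t assume "s \<in> idx ?Q" "t \<in> idx ?Q"
  hence "s \<in> idx B" "t \<in> idx B" using S(1) by (auto simp: O(8))
  thus "idem ?Q s \<otimes>\<^bsub>?Q\<^esub> idem ?Q t = (if s = t then idem ?Q s else \<zero>\<^bsub>?Q\<^esub>)"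
   using O(5) by (simp add: qs B.idem_orthogonal)
 qed (use basis dsV fd in \<open>simp_all add: O(8)\<close>)
qed

context graded_algebra begin

subsection \<open>The ideals generated by idempotents\<close>

definition IU :: "'s set => 'a set" where
 "IU U = generate (add_monoid A) {a **.A idem A t **.A b | a b t. a : carrier A & b : carrier A & t : U}"

text \<open>\<open>generate\<close> closes only under addition and negatives; scalars come from the
  generating set.\<close>

lemma generate_submodule:
 assumes S: "S \<subseteq> carrier A" and sm: "!!c x. [|c : carrier K; x : S|] ==> c \<odot>.A x : S"
 shows "submodule (generate (add_monoid A) S) K A"
proof -
 have sg: "subgroup (generate (add_monoid A) S) (add_monoid A)"
  by (rule group.generate_is_subgroup[OF A.M.a_group]) (use S in simp)
 have c: "x : generate (add_monoid A) S ==> x : carrier A" for x using subgroup.mem_carrier[OF sg] by simp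
 have "c \<odot>.A x : generate (add_monoid A) S" if k: "c : carrier K" and "x : generate (add_monoid A) S" for c x
  using that(2)
 proof (induction rule: generate.induct)
  case one thus ?case using generate.one[of "add_monoid A" S] k by simp
 next
  case (incl h) thus ?case using generate.incl[OF sm[OF k]] by blast
 next
  case (inv h)
  have "c \<odot>.A inv\<^bsub>add_monoid A\<^esub> h = inv\<^bsub>add_monoid A\<^esub> (c \<odot>.A h)"
   using k inv S A.smult_r_minus[OF k, of h] by (auto simp: a_inv_def)
  thus ?case using generate.inv[OF sm[OF k inv]] by simp
 next
  case (eng a b)
  thus ?case using k c generate.eng[of "c \<odot>.A a" "add_monoid A" S "c \<odot>.A b"] by (simp add: A.smult_r_distr)
 qed
 thus ?thesis using sg by (intro submodule.intro submodule_axioms.intro) auto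
qed

lemma generate_least: assumes V: "submodule V K A" and "S \<subseteq> V" shows "generate (add_monoid A) S \<subseteq> V"
 by (rule group.generate_subgroup_incl[OF A.M.a_group assms(2) A.submodule_subgroup[OF V]])

lemma IU_submodule: assumes "U \<subseteq> idx A" shows "submodule (IU U) K A"
 unfolding IU_def
proof (rule generate_submodule)
 have "a **.A idem A t **.A b : carrier A" if "a : carrier A" "b : carrier A" "t : U" for a b t
  using that assms by (simp add: subset_iff)
 thus "{a **.A idem A t **.A b | a b t. a : carrier A & b : carrier A & t : U} \<subseteq> carrier A" by blast
next
 fix c x assume c: "c : carrier K" and "x : {a **.A idem A t **.A b | a b t. a : carrier A & b : carrier A & t : U}"
 then obtain a b t where x: "x = a **.A idem A t **.A b" "a : carrier A" "b : carrier A" "t : U" by blast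
 have "c \<odot>.A x = (c \<odot>.A a) **.A idem A t **.A b" using x c assms by (simp add: mult_smult_left subset_iff)
 moreover have "c \<odot>.A a : carrier A" using x c by simp
 ultimately show "c \<odot>.A x : {a **.A idem A t **.A b | a b t. a : carrier A & b : carrier A & t : U}" using x by blast
qed

lemma IU_memI: "[|a : carrier A; b : carrier A; t : U|] ==> a **.A idem A t **.A b : IU U"
 unfolding IU_def by (rule generate.incl) blast

lemma IU_least: assumes "submodule V K A" "!!a b t. [|a : carrier A; b : carrier A; t : U|] ==> a **.A idem A t **.A b : V"
 shows "IU U \<subseteq> V"
 unfolding IU_def by (rule generate_least[OF assms(1)]) (use assms(2) in blast)

lemma IU_mono: "[|U \<subseteq> W; W \<subseteq> idx A|] ==> IU U \<subseteq> IU W"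
 by (rule IU_least[OF IU_submodule]) (auto intro: IU_memI)

lemma vimage_left: "[|submodule V K A; a : carrier A|] ==> submodule {x : carrier A. a **.A x : V} K A"
 by (rule A.submodule_vimage[OF modA]) (auto simp: mult_add_right mult_smult_right)

lemma vimage_right: "[|submodule V K A; a : carrier A|] ==> submodule {x : carrier A. x **.A a : V} K A"
 by (rule A.submodule_vimage[OF modA]) (auto simp: mult_add_left mult_smult_left)

lemma IU_carrier: "[|U \<subseteq> idx A; v : IU U|] ==> v : carrier A"
 by (rule subsetD[OF A.submoduleD(1)[OF IU_submodule]])

lemma IU_left: assumes U: "U \<subseteq> idx A" and a: "a : carrier A" and v: "v : IU U" shows "a **.A v : IU U"
proof -
 have "IU U \<subseteq> {x : carrier A. a **.A x : IU U}"
 proof (rule IU_least[OF vimage_left[OF IU_submodule[OF U] a]])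
  fix b c t assume bct: "b : carrier A" "c : carrier A" "t : U"
  have "a **.A (b **.A idem A t **.A c) = (a **.A b) **.A idem A t **.A c" using a bct U by (simp add: mult_assoc subset_iff)
  thus "b **.A idem A t **.A c : {x : carrier A. a **.A x : IU U}" using IU_memI[of "a **.A b" c t U] a bct U by (simp add: subset_iff)
 qed
 thus ?thesis using v by blast
qed

lemma IU_right: assumes U: "U \<subseteq> idx A" and a: "a : carrier A" and v: "v : IU U" shows "v **.A a : IU U"
proof -
 have "IU U \<subseteq> {x : carrier A. x **.A a : IU U}"
 proof (rule IU_least[OF vimage_right[OF IU_submodule[OF U] a]])
  fix b c t assume bct: "b : carrier A" "c : carrier A" "t : U"
  have "b **.A idem A t **.A c **.A a = b **.A idem A t **.A (c **.A a)" using a bct U by (simp add: mult_assoc subset_iff)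
  thus "b **.A idem A t **.A c : {x : carrier A. x **.A a : IU U}" using IU_memI[of b "c **.A a" t U] a bct U by (simp add: subset_iff)
 qed
 thus ?thesis using v by blast
qed

text \<open>A generator \<open>a e_t b\<close> need not be homogeneous, but if \<open>a\<close> is,
  its components have the same form, and in general it is the sum over the components of
  \<open>a\<close>.\<close>

lemma IU_comp: assumes U: "U \<subseteq> idx A" and v: "v : IU U" shows "comp n v : IU U"
proof -
 let ?S = "%V. {x : carrier A. ALL n. comp n x : V}"
 have cs: "submodule (?S V) K A" if V: "submodule V K A" for V
  by (rule A.submoduleI') (use A.submoduleD[OF V] in \<open>auto simp: comp_add comp_smult\<close>)
 note Z = A.submoduleD(2)[OF IU_submodule[OF U]]
 have "IU U \<subseteq> ?S (IU U)"
 proof (rule IU_least[OF cs[OF IU_submodule[OF U]]])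
  fix a b t assume abt: "a : carrier A" "b : carrier A" "t : U"
  have tX: "t : idx A" using abt U by auto
  have 1: "comp n (comp i a **.A idem A t **.A b) : IU U" for n i
  proof -
   have "comp i a **.A idem A t : agrade A i"
    using agrade_mult[OF comp_grade[OF abt(1), of i] idem_grade[of t]] tX by simp
   thus ?thesis using comp_mult_left[OF _ abt(2), of "comp i a **.A idem A t" i n] Z IU_memI[of "comp i a" "comp (n - i) b" t U] abt by simp
  qed
  let ?W = "{a : carrier A. a **.A (idem A t **.A b) : ?S (IU U)}"
  have W: "submodule ?W K A" by (rule vimage_right[OF cs[OF IU_submodule[OF U]]]) (use abt tX in simp)
  have "a : ?W"
   by (rule homog_split[OF W abt(1)]) (use 1 abt tX in \<open>simp add: mult_assoc\<close>)
  thus "a **.A idem A t **.A b : ?S (IU U)" using abt tX by (simp add: mult_assoc)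
 qed
 thus ?thesis using v by blast
qed

end

section \<open>Cubist algebras\<close>

text \<open>The element \<open>g x y\<close> is the arrow from \<open>x\<close> to \<open>y\<close>, multiplied by a sign so that squares
  commute instead of anticommuting.\<close>

locale cubist_presentation = cubist_ideal r I X + graded_algebra K A
 for r I X and K :: "'k ring" (structure) and A :: "('k, 'a, point) galgebra" (structure) +
 fixes g :: "point => point => 'a"
 assumes idxA: "idx A = X"
  and g_grade: "g x y : agrade A 1"
  and g_left: "x : X ==> idem A x **.A g x y = g x y"
  and g_right: "y : X ==> g x y **.A idem A y = g x y"
  and g_out: "x ~: X \<or> y ~: X ==> g x y = \<zero>.A"
  and g_adj: "g x y ~= \<zero>.A ==> EX j:{1..r}. EX d. \<bar>d\<bar> = 1 & y = x(j := x j + d)"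
  and g_straight: "[|j : {1..r}; \<bar>d\<bar> = 1; x : X|] ==>
   g x (x(j := x j + d)) **.A g (x(j := x j + d)) (x(j := x j + d + d)) = \<zero>.A"
  and g_square: "[|i : {1..r}; j : {1..r}; i ~= j; \<bar>a - x i\<bar> = 1; \<bar>b - x j\<bar> = 1; x : X|] ==>
   g x (x(i := a)) **.A g (x(i := a)) (x(i := a, j := b)) = g x (x(j := b)) **.A g (x(j := b)) (x(i := a, j := b))"
  and g_loop: "[|i : {1..r}; j : {1..r}; x : X|] ==>
   g x (x(i := x i + 1)) **.A g (x(i := x i + 1)) x \<oplus>.A g x (x(i := x i - 1)) **.A g (x(i := x i - 1)) x
   = g x (x(j := x j + 1)) **.A g (x(j := x j + 1)) x \<oplus>.A g x (x(j := x j - 1)) **.A g (x(j := x j - 1)) x"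
  and gen: "[|submodule V K A; !!x. x : X ==> idem A x : V; !!x y v. v : V ==> g x y **.A v : V|] ==> carrier A \<subseteq> V"
begin

lemma g_closed [simp]: "g x y : carrier A" by (rule agrade_carrier[OF g_grade])

lemma e_closed [simp]: "x : X ==> idem A x : carrier A" by (simp add: idxA)

lemma e_orth: "[|x : X; y : X|] ==> idem A x **.A idem A y = (if x = y then idem A x else \<zero>.A)"
 by (rule idem_orthogonal) (simp_all add: idxA)

lemma g_square': "[|i : {1..r}; j : {1..r}; i ~= j; \<bar>a - x i\<bar> = 1; \<bar>b - x j\<bar> = 1|] ==>
  g x (x(i := a)) **.A g (x(i := a)) (x(i := a, j := b)) = g x (x(j := b)) **.A g (x(j := b)) (x(i := a, j := b))"
 using g_square[of i j a x b] g_out[of x] by (cases "x : X") simp_all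

lemma g_straight': assumes "j : {1..r}" "\<bar>b - x j\<bar> = 1" "c - b = b - x j"
 shows "g x (x(j := b)) **.A g (x(j := b)) (x(j := c)) = \<zero>.A"
proof (cases "x : X")
 case True
 have e: "x j + (b - x j) = b" "b + (b - x j) = c" using assms(3) by auto
 show ?thesis using g_straight[OF assms(1,2) True] unfolding e .
qed (simp add: g_out)

subsection \<open>Monotone paths in cubes\<close>

text \<open>The coordinates \<open>n\<close>, ..., \<open>1\<close> are changed in this order.
  Fixing an order makes the path a function of its ends; by \<open>pth_step\<close> every other
  order gives the same element.\<close>

fun pth :: "nat => point => point => 'a" where
 "pth 0 x y = (if y : X then idem A y else \<zero>.A)"
| "pth (Suc n) x y = (if x (Suc n) = y (Suc n) then pth n x y
  else g x (x(Suc n := y (Suc n))) **.A pth n (x(Suc n := y (Suc n))) y)"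

definition p :: "point => point => 'a" where "p x y = pth r x y"

lemma pth_closed [simp]: "pth n x y : carrier A"
 by (induction n arbitrary: x) auto

lemma p_closed [simp]: "p x y : carrier A" by (simp add: p_def)

text \<open>Commuting squares carry the arrow in direction \<open>j\<close> past the others to the
  front.\<close>

lemma pth_step:
 assumes "n <= r" "1 <= j" "j <= n" "x j ~= y j" "!!j. \<bar>x j - y j\<bar> <= 1"
 shows "pth n x y = g x (x(j := y j)) **.A pth n (x(j := y j)) y"
 using assms
proof (induction n arbitrary: x j)
 case (Suc n)
 let ?k = "Suc n"
 show ?case
 proof (cases "j = ?k")
  case True thus ?thesis using Suc.prems(4) by (simp add: fun_upd_same del: fun_upd_apply)
 next
  case False
  hence j: "j <= n" "1 <= j" "j : {1..r}" using Suc.prems by auto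
  show ?thesis
  proof (cases "x ?k = y ?k")
   case True
   have "pth n x y = g x (x(j := y j)) **.A pth n (x(j := y j)) y" by (rule Suc.IH) (use Suc.prems j in auto)
   moreover have "(x(j := y j)) ?k = y ?k" using True False by simp
   ultimately show ?thesis using True by (simp del: fun_upd_apply)
  next
   case False2: False
   have d1: "\<bar>y j - x j\<bar> = 1" "\<bar>y ?k - x ?k\<bar> = 1" using Suc.prems(4) Suc.prems(5)[of j] False2 Suc.prems(5)[of ?k] by linarith+
   have ih: "pth n (x(?k := y ?k)) y = g (x(?k := y ?k)) (x(?k := y ?k, j := y j)) **.A pth n (x(?k := y ?k, j := y j)) y"
    by (rule Suc.IH) (use Suc.prems j False in auto)
   have tw: "x(?k := y ?k, j := y j) = x(j := y j, ?k := y ?k)" using False by (rule fun_upd_twist[symmetric])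
   have sq: "g x (x(?k := y ?k)) **.A g (x(?k := y ?k)) (x(j := y j, ?k := y ?k)) = g x (x(j := y j)) **.A g (x(j := y j)) (x(j := y j, ?k := y ?k))"
    by (rule g_square'[symmetric]) (use j False d1 Suc.prems in auto)
   have "pth ?k x y = g x (x(?k := y ?k)) **.A pth n (x(?k := y ?k)) y" using False2 by simp
   also have "... = (g x (x(?k := y ?k)) **.A g (x(?k := y ?k)) (x(j := y j, ?k := y ?k))) **.A pth n (x(j := y j, ?k := y ?k)) y"
    unfolding ih tw by (simp add: mult_assoc del: fun_upd_apply)
   also have "... = g x (x(j := y j)) **.A (g (x(j := y j)) (x(j := y j, ?k := y ?k)) **.A pth n (x(j := y j, ?k := y ?k)) y)"
    unfolding sq by (simp add: mult_assoc del: fun_upd_apply)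
   also have "... = g x (x(j := y j)) **.A pth ?k (x(j := y j)) y"
   proof -
    have "(x(j := y j)) ?k ~= y ?k" using False False2 by simp
    thus ?thesis by (simp del: fun_upd_apply)
   qed
   finally show ?thesis .
  qed
 qed
qed simp

lemma close_dir: assumes "close r x y" "x j ~= y j" shows "j : {1..r}" "\<bar>x j - y j\<bar> = 1"
proof -
 show "j : {1..r}" using assms lattice_out[of x r j] lattice_out[of y r j] unfolding close_def by metis
 have "\<bar>x j - y j\<bar> <= 1" using assms(1) by (simp add: close_def)
 thus "\<bar>x j - y j\<bar> = 1" using assms(2) by linarith
qed

lemma p_step: assumes c: "close r x y" and j: "x j ~= y j"
 shows "p x y = g x (x(j := y j)) **.A p (x(j := y j)) y"
 unfolding p_def by (rule pth_step) (use close_dir[OF c j] c j in \<open>auto simp: close_def\<close>)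

lemma pth_eq: "(!!j. [|1 <= j; j <= n|] ==> x j = y j) ==> pth n x y = (if y : X then idem A y else \<zero>.A)"
 by (induction n) auto

lemma p_self: "p x x = (if x : X then idem A x else \<zero>.A)"
 unfolding p_def by (rule pth_eq) simp

lemma p_out_right: "y ~: X ==> p x y = \<zero>.A"
proof -
 assume "y ~: X"
 hence "pth n x y = \<zero>.A" for n by (induction n arbitrary: x) auto
 thus ?thesis by (simp add: p_def)
qed

lemma p_right: "y : X ==> p x y **.A idem A y = p x y"
proof -
 assume y: "y : X"
 have "pth n x y **.A idem A y = pth n x y" for n
  by (induction n arbitrary: x) (use y in \<open>auto simp: e_orth mult_assoc\<close>)
 thus ?thesis by (simp add: p_def)
qed

lemma p_out_left: assumes c: "close r x y" and x: "x ~: X" shows "p x y = \<zero>.A"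
proof (cases "x = y")
 case False
 then obtain j where "x j ~= y j" by auto
 thus ?thesis using p_step[OF c] x by (simp add: g_out)
qed (use x in \<open>simp add: p_self\<close>)

lemma p_left: assumes c: "close r x y" and x: "x : X" shows "idem A x **.A p x y = p x y"
proof (cases "x = y")
 case False
 then obtain j where "x j ~= y j" by auto
 thus ?thesis using p_step[OF c] x by (simp add: mult_assoc[symmetric] g_left)
qed (use x in \<open>simp add: p_self e_orth\<close>)

text \<open>Every vertex of the cube lies on some monotone path between the two ends, and all of
  these paths are equal.\<close>

lemma p_comp: "[|close r x y; v : box x y|] ==> p x v **.A p v y = p x y"
proof (induction "vdist r x v" arbitrary: x rule: less_induct)
 case less
 have cv: "close r x v" "close r v y" using less.prems by (auto intro: close_box)
 show ?case
 proof (cases "x = v")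
  case True
  show ?thesis
  proof (cases "v : X")
   case vX: True
   show ?thesis unfolding True using p_left[OF cv(2) vX] vX by (simp add: p_self)
  next
   case vX: False
   show ?thesis unfolding True using p_out_left[OF cv(2) vX] vX by (simp add: p_self)
  qed
 next
  case False
  then obtain j where j: "x j ~= v j" by auto
  hence vy: "v j = y j" using less.prems(2) unfolding box_def by (metis (mono_tags, lifting) mem_Collect_eq)
  have xy: "x j ~= y j" using j vy by simp
  let ?x = "x(j := v j)"
  have jr: "j : {1..r}" using close_dir[OF cv(1) j] by simp
  have "vdist r v ?x + nat \<bar>v j - x j\<bar> = vdist r v x + nat \<bar>v j - v j\<bar>" by (rule vdist_upd[OF jr])
  moreover have "vdist r a b = vdist r b a" for a b by (simp add: vdist_def abs_minus_commute)
  ultimately have lt: "vdist r ?x v < vdist r x v" using j by simp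
  have xb: "?x : box x y" "v : box ?x y" using vy less.prems(2) by (auto simp: box_def)
  have c: "close r ?x y" using close_box[OF less.prems(1) xb(1)] by simp
  have "p x v **.A p v y = g x ?x **.A (p ?x v **.A p v y)" using p_step[OF cv(1) j] by (simp add: mult_assoc)
  also have "... = g x ?x **.A p ?x y" using less.hyps[OF lt c xb(2)] by simp
  also have "... = p x y" using p_step[OF less.prems(1) xy] vy by simp
  finally show ?thesis .
 qed
qed

text \<open>The path can be rerouted through \<open>v\<close>, where everything vanishes. In this
  way the shape of \<open>X\<close> enters the relations.\<close>

lemma p_zero: "[|close r x y; v : box x y; v ~: X|] ==> p x y = \<zero>.A"
 using p_comp[of x y v] p_out_right[of v x] by simp

lemma p_adj: assumes "j : {1..r}" "\<bar>a - x j\<bar> = 1" "x : lattice_pts r" shows "p x (x(j := a)) = g x (x(j := a))"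
proof -
 have c: "close r x (x(j := a))" using assms by (auto simp: close_def lattice_upd)
 have "x j ~= (x(j := a)) j" using assms by auto
 from p_step[OF c this, unfolded fun_upd_same] have "p x (x(j := a)) = g x (x(j := a)) **.A p (x(j := a)) (x(j := a))" .
 thus ?thesis using g_right[of "x(j := a)" x] g_out[of x "x(j := a)"] by (cases "x(j := a) : X") (simp_all add: p_self)
qed

lemma p_adj': assumes "j : {1..r}" "\<bar>a - x j\<bar> = 1" "x : lattice_pts r" shows "p (x(j := a)) x = g (x(j := a)) x"
 using p_adj[of j "x j" "x(j := a)"] assms by (simp add: lattice_upd abs_minus_commute)

lemma p_step_right: assumes c: "close r x y" and j: "x j ~= y j"
 shows "p x y = p x (y(j := x j)) **.A g (y(j := x j)) y"
proof -
 have b: "y(j := x j) : box x y" by (auto simp: box_def)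
 have "g (y(j := x j)) y = p (y(j := x j)) y"
  by (rule p_adj'[symmetric]) (use close_dir[OF c j] c in \<open>auto simp: close_def\<close>)
 thus ?thesis using p_comp[OF c b] by simp
qed

lemma p_grade: assumes c: "close r x y" shows "p x y : agrade A (vdist r x y)"
proof -
 have "pth n x y : agrade A (\<Sum>j=1..n. if x j = y j then 0 else 1)" for n
 proof (induction n arbitrary: x)
  case 0 thus ?case using A.submoduleD(2)[OF agrade_submodule] idem_grade[of y] by (simp add: idxA)
 next
  case (Suc n)
  have e: "(\<Sum>j=1..n. if (x(Suc n := y (Suc n))) j = y j then 0 else 1) = (\<Sum>j=1..n. if x j = y j then 0 else (1::nat))"
   by (rule sum.cong) auto
  show ?case
  proof (cases "x (Suc n) = y (Suc n)")
   case True thus ?thesis using Suc.IH[of x] by simp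
  next
   case False
   thus ?thesis using agrade_mult[OF g_grade[of x "x(Suc n := y (Suc n))"] Suc.IH[of "x(Suc n := y (Suc n))"]]
    unfolding e by (simp del: fun_upd_apply)
  qed
 qed
 moreover have "vdist r x y = (\<Sum>j=1..r. if x j = y j then 0 else 1)"
  unfolding vdist_def
 proof (rule sum.cong)
  fix j show "nat \<bar>x j - y j\<bar> = (if x j = y j then 0 else 1)" using c[unfolded close_def] close_dir(2)[OF c, of j] by auto
 qed simp
 ultimately show ?thesis by (simp add: p_def)
qed

lemmas IU_submodule = IU_submodule[unfolded idxA]
 and IU_mono = IU_mono[unfolded idxA]
 and IU_carrier = IU_carrier[unfolded idxA]
 and IU_left = IU_left[unfolded idxA]
 and IU_right = IU_right[unfolded idxA]
 and IU_comp = IU_comp[unfolded idxA]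

lemma above_X: "above t \<subseteq> X" by (auto simp: above_def)

lemma IU_through_left: assumes "U \<subseteq> X" "u : U" "v : carrier A" "idem A u **.A v = v" shows "v : IU U"
proof -
 have u: "u : X" using assms by auto
 have "idem A u **.A idem A u **.A v = v" using assms u by (simp add: e_orth)
 thus ?thesis using IU_memI[of "idem A u" v u U] assms u by simp
qed

lemma IU_through_right: assumes "U \<subseteq> X" "u : U" "v : carrier A" "v **.A idem A u = v" shows "v : IU U"
proof -
 have u: "u : X" using assms by auto
 have "v **.A idem A u **.A idem A u = v" using assms u by simp
 thus ?thesis using IU_memI[of v "idem A u" u U] assms u by simp
qed

text \<open>An edge in \<open>X\<close> lies in the tile of one of its ends. If that is not
  \<open>t\<close>, it is the other end, which is therefore above \<open>t\<close>.\<close>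

lemma g_above: assumes t: "t : X" and j: "j : {1..r}" "\<bar>a - t j\<bar> = 1" and n: "a ~= opp t j"
 shows "t(j := a) ~: X \<or> t(j := a) : above t"
proof (cases "t(j := a) : X")
 case True
 let ?v = "t(j := a)"
 have c: "close r ?v t" using t j X_lattice[OF t] X_lattice[OF True] by (auto simp: close_def)
 have "box ?v t \<subseteq> {?v, t}"
 proof
  fix w assume w: "w : box ?v t"
  have "w = (if w j = a then ?v else t)" using w by (auto simp: box_def fun_eq_iff split: if_splits)
  thus "w : {?v, t}" by (auto split: if_splits)
 qed
 hence b: "box ?v t \<subseteq> X" "box ?v t \<subseteq> {?v, t}" using t True by auto
 obtain u where u: "u : X" "u : box ?v t" "box ?v t \<subseteq> lm u" by (rule cube_in_tile[OF c b(1)])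
 have "?v ~: lm t" using j n by (auto simp: lm_def box_def)
 have "u : {?v, t}" using u(2) b(2) by (rule subsetD[rotated])
 moreover have "?v : lm u" using u(3) by (rule subsetD) simp
 ultimately have "u = ?v" using \<open>?v ~: lm t\<close> by (metis insertE singletonD)
 hence "t : lm ?v" using u(3) by auto
 thus ?thesis using lm_aboveI[OF True, of t] j by (auto simp: fun_eq_iff)
qed simp

lemma g_above_left: assumes "t : X" "j : {1..r}" "\<bar>a - t j\<bar> = 1" "a ~= opp t j"
 shows "g (t(j := a)) t : IU (above t)"
proof (cases "t(j := a) : X")
 case True
 thus ?thesis using g_above[OF assms] IU_through_left[OF above_X _ g_closed g_left] by blast
next
 case False
 thus ?thesis using A.submoduleD(2)[OF IU_submodule[OF above_X]] by (simp add: g_out)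
qed

lemma g_above_right: assumes "t : X" "j : {1..r}" "\<bar>a - t j\<bar> = 1" "a ~= opp t j"
 shows "g t (t(j := a)) : IU (above t)"
proof (cases "t(j := a) : X")
 case True
 thus ?thesis using g_above[OF assms] IU_through_right[OF above_X _ g_closed g_right] by blast
next
 case False
 thus ?thesis using A.submoduleD(2)[OF IU_submodule[OF above_X]] by (simp add: g_out)
qed

end

section \<open>Spanning sets of the projective modules and of the ideals of upsets\<close>

context cubist_presentation begin

lemma lm_dir: "[|t : X; s : lm t; s j ~= t j|] ==> s j = opp t j & j : {1..r} & \<bar>opp t j - t j\<bar> = 1"
proof -
 assume a: "t : X" "s : lm t" "s j ~= t j"
 have "s j = opp t j" using a(2,3) unfolding lm_def box_def by (metis (mono_tags, lifting) mem_Collect_eq)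
 moreover have "j : {1..r} & \<bar>t j - s j\<bar> = 1" using close_dir[of t s j] lm_close[OF a(1) _ a(2)] a(3) by auto
 ultimately show ?thesis by (simp add: abs_minus_commute)
qed

lemma lm_upd_mem: "[|t : X; s : lm t; x = s(j := a)|] ==> x : lm t \<longleftrightarrow> a = t j \<or> a = opp t j"
 by (auto simp: lm_def box_def)

lemma lm_upd_close: assumes "t : X" "s : lm t" "j : {1..r}" "\<bar>a - t j\<bar> <= 1" "s j = t j \<or> a = t j"
 shows "close r (s(j := a)) t"
 using lm_close[OF assms(1) assms(2) lm_self(1)] assms unfolding close_def by (auto simp: lattice_upd)

text \<open>Both sides are the monotone path from \<open>s(j := a)\<close> to \<open>t\<close>, with
  the coordinate \<open>j\<close> changed first or last.\<close>

lemma leave_left: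
 assumes t: "t : X" and s: "s : lm t" and j: "j : {1..r}" "s j = t j" "\<bar>a - t j\<bar> = 1" "a ~= opp t j"
 shows "g (s(j := a)) s **.A p s t = p (s(j := a)) (t(j := a)) **.A g (t(j := a)) t"
proof -
 have c: "close r (s(j := a)) t" by (rule lm_upd_close[OF t s j(1)]) (use j in auto)
 have ne: "(s(j := a)) j ~= t j" using j by simp
 have "p (s(j := a)) t = g (s(j := a)) ((s(j := a))(j := t j)) **.A p ((s(j := a))(j := t j)) t" by (rule p_step[OF c ne])
 moreover have "(s(j := a))(j := t j) = s" using j(2) by auto
 moreover have "p (s(j := a)) t = p (s(j := a)) (t(j := (s(j := a)) j)) **.A g (t(j := (s(j := a)) j)) t" by (rule p_step_right[OF c ne])
 ultimately show ?thesis by (simp only: fun_upd_same)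
qed

lemma leave_right:
 assumes t: "t : X" and s: "s : lm t" and j: "j : {1..r}" "s j = t j" "\<bar>a - t j\<bar> = 1" "a ~= opp t j"
 shows "p t s **.A g s (s(j := a)) = g t (t(j := a)) **.A p (t(j := a)) (s(j := a))"
proof -
 have c: "close r t (s(j := a))" using lm_upd_close[OF t s j(1), of a] j by (simp add: close_sym)
 have ne: "t j ~= (s(j := a)) j" using j by simp
 have "p t (s(j := a)) = p t ((s(j := a))(j := t j)) **.A g ((s(j := a))(j := t j)) (s(j := a))" by (rule p_step_right[OF c ne])
 moreover have "(s(j := a))(j := t j) = s" using j(2) by auto
 moreover have "p t (s(j := a)) = g t (t(j := (s(j := a)) j)) **.A p (t(j := (s(j := a)) j)) (s(j := a))" by (rule p_step[OF c ne])
 ultimately show ?thesis by (simp only: fun_upd_same)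
qed

text \<open>The loop relation expresses each of the four loops at \<open>x\<close> in the directions
  \<open>i\<close> and \<open>j\<close> by the other three.\<close>

lemma loop_subset:
 assumes V: "submodule V K A" and i: "i : {1..r}" and j: "j : {1..r}" and x: "x : X" and d: "\<bar>d\<bar> = 1"
  and u: "u : carrier A" and w: "w : carrier A"
  and 1: "w **.A (g x (x(i := x i + 1)) **.A g (x(i := x i + 1)) x) **.A u : V"
  and 2: "w **.A (g x (x(i := x i - 1)) **.A g (x(i := x i - 1)) x) **.A u : V"
  and 3: "w **.A (g x (x(j := x j - d)) **.A g (x(j := x j - d)) x) **.A u : V"
 shows "w **.A (g x (x(j := x j + d)) **.A g (x(j := x j + d)) x) **.A u : V"
proof -
 let ?l = "%k c. g x (x(k := x k + c)) **.A g (x(k := x k + c)) x"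
 let ?f = "%v. w **.A v **.A u"
 note D = A.submoduleD[OF V]
 have e: "?l i 1 \<oplus>.A ?l i (-1) = ?l j 1 \<oplus>.A ?l j (-1)" using g_loop[OF i j x] by simp
 have d': "d = 1 \<or> d = -1" using d by auto
 have c: "?l k c : carrier A" for k c by simp
 have e2: "?l j d \<oplus>.A ?l j (-d) = ?l i 1 \<oplus>.A ?l i (-1)"
  using d'
 proof
  assume "d = 1" thus ?thesis using e by simp
 next
  assume d: "d = -1"
  show ?thesis unfolding e d by (simp add: A.M.a_comm)
 qed
 have fc: "?f (?l k c) : carrier A" for k c using u w by simp
 have "?f (?l j d) \<oplus>.A ?f (?l j (-d)) = ?f (?l i 1) \<oplus>.A ?f (?l i (-1))"
  using arg_cong[OF e2, of ?f] u w c by (simp add: mult_add_left mult_add_right)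
 hence "?f (?l j d) = (?f (?l i 1) \<oplus>.A ?f (?l i (-1))) \<ominus>.A ?f (?l j (-d))"
  using fc[of j d] fc[of j "-d"] by (metis A.M.add.inv_solve_right' A.M.minus_eq A.M.a_closed)
 moreover have "(?f (?l i 1) \<oplus>.A ?f (?l i (-1))) \<ominus>.A ?f (?l j (-d)) : V"
 proof (intro D(6) D(3))
  show "?f (?l i 1) : V" using 1 .
  show "?f (?l i (-1)) : V" using 2 by simp
  show "?f (?l j (-d)) : V" using 3 by simp
 qed
 ultimately show ?thesis by simp
qed

definition left_closed :: "'a set => bool" where
 "left_closed V \<longleftrightarrow> submodule V K A & (ALL a:carrier A. ALL x:V. a **.A x : V)"

text \<open>Arrows into \<open>t\<close> from points outside its tile. Modulo these only the
  monotone paths inside the tile survive, see \<open>proj_span\<close>.\<close>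

definition leaving :: "point => 'a set" where
 "leaving t = {g (t(j := a)) t | j a. j : {1..r} & \<bar>a - t j\<bar> = 1 & a ~= opp t j}"

text \<open>An arrow prepended to the path inside the tile lengthens it, and one that enters from
  outside can be moved to the end at \<open>t\<close>, where it belongs to \<open>V\<close>. If the
  direction has already been used, either two steps go straight on, which gives zero, or they form a
  loop at \<open>x\<close>, which the loop relation rewrites.\<close>

lemma step_left:
 assumes V: "left_closed V" and L: "leaving t \<subseteq> V" and t: "t : X" and s: "s : lm t"
  and j: "j : {1..r}" "\<bar>d\<bar> = 1" and x: "x = s(j := s j + d)"
 shows "g x s **.A p s t = p x t & x : lm t \<or> g x s **.A p s t : V"
proof -
 have sV: "submodule V K A" and lV: "!!a x. [|a : carrier A; x : V|] ==> a **.A x : V" using V by (auto simp: left_closed_def)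
 note D = A.submoduleD[OF sV]
 have out: "g (s(j := a)) s **.A p s t : V" if "s : lm t" "j : {1..r}" "s j = t j" "\<bar>a - t j\<bar> = 1" "a ~= opp t j" for s j a
 proof -
  have "g (t(j := a)) t : V" using L that unfolding leaving_def by blast
  thus ?thesis unfolding leave_left[OF t that] by (rule lV[OF p_closed])
 qed
 show ?thesis
 proof (cases "s j = t j")
  case True
  show ?thesis
  proof (cases "x : lm t")
   case xl: True
   have c: "close r x t" by (rule lm_close[OF t xl lm_self(1)])
   have ne: "x j ~= t j" using True j x by auto
   have "x(j := t j) = s" using x True by auto
   thus ?thesis using p_step[OF c ne] xl by simp
  next
   case False
   hence "s j + d ~= opp t j" using lm_upd_mem[OF t s x] by simp
   hence "g x s **.A p s t : V" unfolding x using out[OF s j(1) True] True j(2) by simp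
   thus ?thesis ..
  qed
 next
  case False
  note sj = lm_dir[OF t s False]
  have cs: "close r s t" by (rule lm_close[OF t s lm_self(1)])
  show ?thesis
  proof (cases "s j + d = t j")
   case True
   have xl: "x : lm t" using lm_upd_mem[OF t s x] True by simp
   have xX: "x : X" using lm_X[OF t] xl by blast
   have xj: "x j = t j" using x True by simp
   have sx: "s = x(j := x j + - d)" using x by auto
   have "p s t = g s (s(j := t j)) **.A p (s(j := t j)) t" by (rule p_step[OF cs False])
   hence ps: "p s t = g s x **.A p x t" using x True by simp
   have o1: "g (x(k := a)) x **.A p x t : V" if "k : {1..r}" "x k = t k" "\<bar>a - t k\<bar> = 1" "a ~= opp t k" for k a
    by (rule out[OF xl that])
   have o2: "idem A x **.A (g x (x(k := a)) **.A g (x(k := a)) x) **.A p x t : V"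
    if "k : {1..r}" "x k = t k" "\<bar>a - t k\<bar> = 1" "a ~= opp t k" for k a
    using lV[OF _ o1[OF that], of "idem A x **.A g x (x(k := a))"] xX by (simp add: mult_assoc)
   have ti: "opp t (ty t) = t (ty t)" by (simp add: opp_def opp_at_def)
   have xi: "x (ty t) = t (ty t)" using lm_dir[OF t xl, of "ty t"] ti by auto
   \<comment> \<open>A tile does not extend in the direction of its type, so both loops in that
     direction leave it. So does the loop on the other side in direction \<open>j\<close>; hence
     three of the four loops are in \<open>V\<close>.\<close>
   have "idem A x **.A (g x (x(j := x j + - d)) **.A g (x(j := x j + - d)) x) **.A p x t : V"
   proof (rule loop_subset[OF sV ty(1)[OF t] j(1) xX])
    show "\<bar>- d\<bar> = 1" using j by simp
    show "idem A x **.A (g x (x(ty t := x (ty t) + 1)) **.A g (x(ty t := x (ty t) + 1)) x) **.A p x t : V"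
     by (rule o2[OF ty(1)[OF t] xi]) (use xi ti in auto)
    show "idem A x **.A (g x (x(ty t := x (ty t) - 1)) **.A g (x(ty t := x (ty t) - 1)) x) **.A p x t : V"
     by (rule o2[OF ty(1)[OF t] xi]) (use xi ti in auto)
    show "idem A x **.A (g x (x(j := x j - - d)) **.A g (x(j := x j - - d)) x) **.A p x t : V"
     by (rule o2[OF j(1) xj]) (use xj sj True j in auto)
   qed (use xX in simp_all)
   hence "idem A x **.A (g x s **.A g s x) **.A p x t : V" by (simp only: sx[symmetric])
   hence "g x s **.A p s t : V" unfolding ps using xX by (simp add: mult_assoc[symmetric] g_left)
   thus ?thesis ..
  next
   case tj: False
   have "p s t = g s (s(j := t j)) **.A p (s(j := t j)) t" by (rule p_step[OF cs False])
   hence "g x s **.A p s t = (g x s **.A g s (s(j := t j))) **.A p (s(j := t j)) t" by (simp add: mult_assoc)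
   also have "g x s **.A g s (s(j := t j)) = \<zero>.A"
   proof -
    have "g x (x(j := s j)) **.A g (x(j := s j)) (x(j := t j)) = \<zero>.A"
    proof (rule g_straight'[OF j(1)])
     show "\<bar>s j - x j\<bar> = 1" using x j by simp
     have "\<bar>s j - t j\<bar> = 1" using sj by auto
     thus "t j - s j = s j - x j" using x j tj by auto
    qed
    moreover have "x(j := s j) = s" "x(j := t j) = s(j := t j)" using x by auto
    ultimately show ?thesis by simp
   qed
   finally show ?thesis using D(2) by simp
  qed
 qed
qed

lemma leaving_carrier: "leaving t \<subseteq> carrier A" by (auto simp: leaving_def)

lemma leaving_above: "t : X ==> leaving t \<subseteq> IU (above t)"
 using g_above_left unfolding leaving_def by blast

definition base :: "point => point => 'a" where "base t x = (if x : lm t then p x t else \<zero>.A)"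

lemma base_closed [simp]: "base t x : carrier A" by (simp add: base_def)

text \<open>By \<open>step_left\<close> multiplication by a generator preserves the span of the
  \<open>base t s\<close> modulo \<open>V\<close>. The choice of \<open>IU (above t)\<close> for
  \<open>V\<close> describes the standard module; other choices serve the induction in
  \<open>span_step\<close>.\<close>

lemma proj_span:
 assumes V: "left_closed V" and L: "leaving t \<subseteq> V" and t: "t : X" and x: "x : X" and w: "w : carrier A"
 shows "EX c:carrier K. EX b:V. idem A x **.A w **.A idem A t = c \<odot>.A base t x \<oplus>.A b"
proof -
 have sV: "submodule V K A" and lV: "!!a x. [|a : carrier A; x : V|] ==> a **.A x : V" using V by (auto simp: left_closed_def)
 note D = A.submoduleD[OF sV]
 have vc: "b : V ==> b : carrier A" for b using D(1) by blast
 define P where "P x v \<longleftrightarrow> (EX c:carrier K. EX b:V. v = c \<odot>.A base t x \<oplus>.A b)" for x v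
 have P0: "P x b" if "b : V" for x b unfolding P_def
  by (rule bexI[of _ "\<zero>.K"], rule bexI[of _ b]) (use that vc in auto)
 have P1: "P x (base t x)" for x unfolding P_def
  by (rule bexI[of _ "\<one>.K"], rule bexI[of _ "\<zero>.A"]) (use D(2) in auto)
 have Padd: "P x (u \<oplus>.A v)" if Pu: "P x u" and Pv: "P x v" for x u v
 proof -
  obtain c b c' b' where e: "c : carrier K" "b : V" "u = c \<odot>.A base t x \<oplus>.A b"
   "c' : carrier K" "b' : V" "v = c' \<odot>.A base t x \<oplus>.A b'" using Pu Pv unfolding P_def by metis
  have "u \<oplus>.A v = (c \<oplus>.K c') \<odot>.A base t x \<oplus>.A (b \<oplus>.A b')"
   unfolding e(3,6) using e vc by (simp add: A.smult_l_distr A.M.a_ac)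
  moreover have "c \<oplus>.K c' : carrier K" using e(1,4) by simp
  ultimately show ?thesis unfolding P_def using D(3)[OF e(2,5)] by metis
 qed
 have Psm: "P x (k \<odot>.A u)" if Pu: "P x u" and k: "k : carrier K" for x u k
 proof -
  obtain c b where e: "c : carrier K" "b : V" "u = c \<odot>.A base t x \<oplus>.A b" using Pu unfolding P_def by metis
  have "k \<odot>.A u = (k **.K c) \<odot>.A base t x \<oplus>.A k \<odot>.A b"
   unfolding e(3) using e vc k by (simp add: A.smult_r_distr A.smult_assoc1)
  moreover have "k **.K c : carrier K" using k e(1) by simp
  ultimately show ?thesis unfolding P_def using D(4)[OF k e(2)] by metis
 qed
 have Pg: "P x (g x s **.A v)" if v: "P s v" for x s v
 proof -
  obtain c b where e: "c : carrier K" "b : V" "v = c \<odot>.A base t s \<oplus>.A b" using v unfolding P_def by metis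
  have "P x (g x s **.A base t s)"
  proof (cases "g x s = \<zero>.A \<or> s ~: lm t")
   case True
   hence "g x s **.A base t s = \<zero>.A" by (auto simp: base_def)
   thus ?thesis using P0[OF D(2)] by simp
  next
   case False
   hence s: "s : lm t" and nz: "g x s ~= \<zero>.A" by auto
   obtain j d where j: "j : {1..r}" "\<bar>d\<bar> = 1" "s = x(j := x j + d)" using g_adj[OF nz] by blast
   have x: "x = s(j := s j + - d)" using j(3) by auto
   have bs: "base t s = p s t" using s by (simp add: base_def)
   have "\<bar>- d\<bar> = 1" using j(2) by simp
   from step_left[OF V L t s j(1) this x] show ?thesis
   proof (elim disjE conjE)
    assume "g x s **.A p s t = p x t" "x : lm t"
    thus ?thesis using P1[of x] unfolding bs by (simp add: base_def)
   next
    assume "g x s **.A p s t : V" thus ?thesis unfolding bs by (rule P0)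
   qed
  qed
  moreover have "g x s **.A v = c \<odot>.A (g x s **.A base t s) \<oplus>.A g x s **.A b"
   unfolding e(3) using e vc by (simp add: mult_add_right mult_smult_right)
  ultimately show ?thesis using Padd Psm e(1) P0[OF lV[OF g_closed e(2)]] by simp
 qed
 let ?W = "{w : carrier A. ALL x:X. P x (idem A x **.A w **.A idem A t)}"
 have "carrier A \<subseteq> ?W"
 proof (rule gen)
  show "submodule ?W K A"
  proof (rule A.submoduleI')
   show "\<zero>.A : ?W" using P0[OF D(2)] t by simp
  next
   fix a b assume "a : ?W" "b : ?W"
   thus "a \<oplus>.A b : ?W" using Padd t by (simp add: mult_add_right mult_add_left)
  next
   fix a b assume "a : carrier K" "b : ?W"
   thus "a \<odot>.A b : ?W" using Psm t by (simp add: mult_smult_right mult_smult_left)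
  qed simp
 next
  fix s assume s: "s : X"
  have "P x (idem A x **.A idem A s **.A idem A t)" if x: "x : X" for x
  proof (cases "x = s & s = t")
   case True
   have "base t t = idem A t" using t by (simp add: base_def p_self)
   thus ?thesis using P1[of t] True t by (simp add: e_orth)
  next
   case False
   hence "idem A x **.A idem A s **.A idem A t = \<zero>.A" using x s t by (auto simp: e_orth)
   thus ?thesis using P0[OF D(2)] by simp
  qed
  thus "idem A s : ?W" using s by simp
 next
  fix u s v assume v: "v : ?W"
  have "P x (idem A x **.A (g u s **.A v) **.A idem A t)" if x: "x : X" for x
  proof (cases "u : X & s : X & x = u")
   case True
   have vc: "v : carrier A" using v by simp
   have "idem A x **.A (g u s **.A v) **.A idem A t = (idem A x **.A g x s) **.A v **.A idem A t"
    using True vc t by (simp add: mult_assoc)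
   also have "... = (g x s **.A idem A s) **.A v **.A idem A t" using True by (simp add: g_left g_right)
   also have "... = g x s **.A (idem A s **.A v **.A idem A t)" using True vc t by (simp add: mult_assoc)
   finally show ?thesis using Pg v True by simp
  next
   case False
   have "idem A x **.A (g u s **.A v) = \<zero>.A"
   proof (cases "u : X & s : X")
    case True
    have "idem A x **.A (g u s **.A v) = (idem A x **.A idem A u) **.A (g u s **.A v)"
     using True x v g_left[of u s] by (simp add: mult_assoc[symmetric]) (simp add: mult_assoc)
    thus ?thesis using False True x v by (auto simp: e_orth)
   qed (use v x in \<open>auto simp: g_out\<close>)
   thus ?thesis using P0[OF D(2)] t by simp
  qed
  thus "g u s **.A v : ?W" using v by simp
 qed
 hence "P x (idem A x **.A w **.A idem A t)" using x w by blast
 thus ?thesis unfolding P_def .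
qed

lemma IU_left_closed: "U \<subseteq> X ==> left_closed (IU U)"
 unfolding left_closed_def using IU_submodule IU_left by blast

text \<open>Followed by the path to \<open>y\<close>, the arrow becomes the monotone path from its
  source \<open>v\<close> to \<open>y\<close>. If the cube between them is not contained in
  \<open>X\<close>, this is zero; otherwise the cube lies in the tile of some \<open>t'\<close>,
  which differs from \<open>t\<close> because it contains \<open>v\<close>. If the path to
  \<open>y\<close> moves in direction \<open>j\<close> as well, two straight steps give
  zero.\<close>

lemma leaving_mult:
 assumes t: "t : X" and y: "y : lm t" and u: "u : leaving t"
 shows "u **.A p t y = \<zero>.A \<or> (EX t':above t. y : lm t' & (EX a:carrier A. u **.A p t y = a **.A p t' y))"
proof -
 obtain j a where j: "j : {1..r}" "\<bar>a - t j\<bar> = 1" "a ~= opp t j" "u = g (t(j := a)) t" using u unfolding leaving_def by blast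
 let ?v = "t(j := a)"
 have cy: "close r t y" by (rule lm_close[OF t lm_self(1) y])
 show ?thesis
 proof (cases "y j = t j")
  case True
  have lv: "?v : lattice_pts r" using X_lattice[OF t] j(1) by (rule lattice_upd)
  have c: "close r ?v y" using cy lv j True unfolding close_def by auto
  have ne: "?v j ~= y j" using True j by auto
  have "p ?v y = g ?v (?v(j := y j)) **.A p (?v(j := y j)) y" by (rule p_step[OF c ne])
  moreover have "?v(j := y j) = t" using True by auto
  ultimately have e: "u **.A p t y = p ?v y" using j(4) by simp
  show ?thesis
  proof (cases "box ?v y \<subseteq> X")
   case bX: True
   obtain t' where t': "t' : X" "t' : box ?v y" "box ?v y \<subseteq> lm t'" by (rule cube_in_tile[OF c bX])
   have "t : box ?v y" "y : box ?v y" "?v : box ?v y" using True by (auto simp: box_def)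
   hence m: "t : lm t'" "y : lm t'" "?v : lm t'" using t'(3) by blast+
   have "?v ~: lm t" using lm_upd_mem[OF t lm_self(1) refl, of j a] j by auto
   hence "t' : above t" using m lm_aboveI[OF t'(1) m(1)] by blast
   moreover have "p ?v y = p ?v t' **.A p t' y" by (rule p_comp[OF c t'(2), symmetric])
   moreover have "u **.A p t y = p ?v t' **.A p t' y" unfolding e calculation(2) ..
   ultimately show ?thesis using m(2) p_closed[of ?v t'] by (intro disjI2 bexI[of _ t'] conjI bexI[of _ "p ?v t'"])
  next
   case False
   then obtain w where "w : box ?v y" "w ~: X" by blast
   hence "p ?v y = \<zero>.A" using p_zero[OF c] by blast
   thus ?thesis using e by simp
  qed
 next
  case False
  have "p t y = g t (t(j := y j)) **.A p (t(j := y j)) y" by (rule p_step[OF cy]) (use False in auto)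
  hence "u **.A p t y = (g ?v t **.A g t (t(j := y j))) **.A p (t(j := y j)) y" by (simp add: j(4) mult_assoc)
  also have "g ?v t **.A g t (t(j := y j)) = \<zero>.A"
  proof -
   have "g ?v (?v(j := t j)) **.A g (?v(j := t j)) (?v(j := y j)) = \<zero>.A"
   proof (rule g_straight'[OF j(1)])
    show "\<bar>t j - ?v j\<bar> = 1" using j(2) by simp
    have "\<bar>y j - t j\<bar> = 1" "y j ~= a" using lm_dir[OF t y False] j(3) by auto
    thus "y j - t j = t j - ?v j" using j(2) by auto
   qed
   moreover have "?v(j := t j) = t" "?v(j := y j) = t(j := y j)" by auto
   ultimately show ?thesis by simp
  qed
  finally show ?thesis by simp
 qed
qed

text \<open>Induction on the number of tiles above \<open>t\<close> that contain \<open>y\<close>.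
  \<open>proj_span\<close> is applied to the left ideal of all \<open>b\<close> whose left multiples
  satisfy the claim; by \<open>leaving_mult\<close> and the induction hypothesis it contains the
  arrows that enter \<open>t\<close> from outside its tile.\<close>

lemma span_step:
 assumes U: "upset U" and y: "y : X" and VV: "!!x. x : X ==> submodule (VV x) K A"
  and C: "!!t x. [|t : U; x : lm t; y : lm t|] ==> p x t **.A p t y : VV x"
  and t: "t : U" "y : lm t" and w: "w : carrier A" and x: "x : X"
 shows "idem A x **.A w **.A p t y : VV x"
 using t w x
proof (induction "card {t' : X. y : lm t' & t' : above t}" arbitrary: t w x rule: less_induct)
 case less
 have UX: "U \<subseteq> X" using U by (simp add: upset_def)
 have tX: "t : X" using less.prems UX by auto
 have fin: "finite {t' : X. y : lm t' & t' : above t}" by (rule finite_subset[OF _ finite_tiles[of y]]) auto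
 have ih: "idem A x **.A w **.A p t' y : VV x" if t': "t' : above t" "y : lm t'" and w: "w : carrier A" and x: "x : X" for t' w x
 proof (rule less.hyps[OF _ _ t'(2) w x])
  have t'X: "t' : X" using t'(1) above_X by blast
  have "{t'' : X. y : lm t'' & t'' : above t'} \<subset> {t'' : X. y : lm t'' & t'' : above t}"
  proof
   show "{t'' : X. y : lm t'' & t'' : above t'} \<subseteq> {t'' : X. y : lm t'' & t'' : above t}" using above_trans[OF t'(1)] by blast
   have "t' : {t'' : X. y : lm t'' & t'' : above t}" using t' t'X by simp
   moreover have "t' ~: {t'' : X. y : lm t'' & t'' : above t'}" by (simp add: above_def)
   ultimately show "{t'' : X. y : lm t'' & t'' : above t'} ~= {t'' : X. y : lm t'' & t'' : above t}" by blast
  qed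
  thus "card {t'' : X. y : lm t'' & t'' : above t'} < card {t'' : X. y : lm t'' & t'' : above t}" by (rule psubset_card_mono[OF fin])
  show "t' : U" using U less.prems(1) t'(1) by (auto simp: upset_def above_def)
 qed
 let ?V = "{b : carrier A. ALL a:carrier A. ALL x:X. idem A x **.A (a **.A b) **.A p t y : VV x}"
 have lc: "left_closed ?V" unfolding left_closed_def
 proof (intro conjI ballI)
  show "submodule ?V K A"
  proof (rule A.submoduleI')
   show "\<zero>.A : ?V" using A.submoduleD(2)[OF VV] by simp
  next
   fix a b assume "a : ?V" "b : ?V"
   thus "a \<oplus>.A b : ?V" using A.submoduleD(3)[OF VV] by (simp add: mult_add_right mult_add_left)
  next
   fix a b assume "a : carrier K" "b : ?V"
   thus "a \<odot>.A b : ?V" using A.submoduleD(4)[OF VV] by (simp add: mult_smult_right mult_smult_left)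
  qed simp
 next
  fix a b assume a: "a : carrier A" and b: "b : ?V"
  have "idem A x **.A (a' **.A (a **.A b)) **.A p t y : VV x" if "a' : carrier A" "x : X" for a' x
  proof -
   have "a' **.A (a **.A b) = (a' **.A a) **.A b" using a b that by (simp add: mult_assoc)
   thus ?thesis using b a that mult_closed[OF that(1) a] by simp
  qed
  thus "a **.A b : ?V" using a b by simp
 qed
 have L: "leaving t \<subseteq> ?V"
 proof
  fix u assume u: "u : leaving t"
  have uc: "u : carrier A" using u leaving_carrier by blast
  have "idem A x **.A (a **.A u) **.A p t y : VV x" if a: "a : carrier A" and x: "x : X" for a x
  proof -
   have e: "idem A x **.A (a **.A u) **.A p t y = idem A x **.A a **.A (u **.A p t y)" using a x uc by (simp add: mult_assoc)
   show ?thesis using leaving_mult[OF tX less.prems(2) u]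
   proof
    assume "u **.A p t y = \<zero>.A"
    thus ?thesis unfolding e using a x A.submoduleD(2)[OF VV[OF x]] by simp
   next
    assume "EX t':above t. y : lm t' & (EX a:carrier A. u **.A p t y = a **.A p t' y)"
    then obtain t' a' where t': "t' : above t" "y : lm t'" "a' : carrier A" "u **.A p t y = a' **.A p t' y" by blast
    have "idem A x **.A (a **.A a') **.A p t' y : VV x" by (rule ih[OF t'(1,2) mult_closed[OF a t'(3)] x])
    thus ?thesis unfolding e t'(4) using a t'(3) x by (simp add: mult_assoc)
   qed
  qed
  thus "u : ?V" using uc by simp
 qed
 obtain c b where cb: "c : carrier K" "b : ?V" "idem A x **.A w **.A idem A t = c \<odot>.A base t x \<oplus>.A b"
  using proj_span[OF lc L tX less.prems(4,3)] by blast
 have xX: "x : X" by fact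
 have bc: "b : carrier A" using cb(2) by simp
 note D = A.submoduleD[OF VV[OF xX]]
 have pt: "idem A t **.A p t y = p t y" by (rule p_left[OF lm_close[OF tX lm_self(1) less.prems(2)] tX])
 have "idem A x **.A w **.A p t y = idem A x **.A (idem A x **.A w **.A idem A t) **.A p t y"
  using less.prems(3) xX tX pt by (simp add: mult_assoc idem_idem idxA)
 also have "... = c \<odot>.A (idem A x **.A base t x **.A p t y) \<oplus>.A idem A x **.A b **.A p t y"
  unfolding cb(3) using cb(1) bc xX by (simp add: mult_add_right mult_add_left mult_smult_left mult_smult_right)
 also have "... : VV x"
 proof (intro D(3) D(4) cb(1))
  show "idem A x **.A base t x **.A p t y : VV x"
  proof (cases "x : lm t")
   case True
   have "idem A x **.A p x t = p x t" by (rule p_left[OF lm_close[OF tX True lm_self(1)] xX])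
   thus ?thesis using C[OF less.prems(1) True less.prems(2)] True by (simp add: base_def)
  qed (use xX D(2) in \<open>simp add: base_def\<close>)
  have "idem A x **.A (idem A x **.A b) **.A p t y : VV x" using cb(2) xX by simp
  thus "idem A x **.A b **.A p t y : VV x" using bc xX by (simp add: idem_idem idxA)
 qed
 finally show ?case .
qed

text \<open>The products \<open>p x t p t y\<close> with \<open>t\<close> in \<open>U\<close> span
  the ideal between \<open>x\<close> and \<open>y\<close>. For \<open>a e_u b\<close> the factor
  \<open>b\<close> is first expanded over all tiles; those that contain \<open>u\<close> belong to
  \<open>U\<close>, as their vertices are above \<open>u\<close>. Then the left factor is expanded
  over the tiles in \<open>U\<close>.\<close>

lemma IU_elim:
 assumes U: "upset U" and x: "x : X" and y: "y : X" and VV: "!!x. x : X ==> submodule (VV x) K A"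
  and C: "!!t x. [|t : U; x : lm t; y : lm t|] ==> p x t **.A p t y : VV x"
  and v: "v : IU U"
 shows "idem A x **.A v **.A idem A y : VV x"
proof -
 have UX: "U \<subseteq> X" using U by (simp add: upset_def)
 let ?W = "{v : carrier A. idem A x **.A v **.A idem A y : VV x}"
 have "IU U \<subseteq> ?W"
 proof (rule IU_least)
  show "submodule ?W K A"
   by (rule A.submodule_vimage[OF modA _ _ _ VV[OF x]]) (use x y in \<open>auto simp: mult_add_left mult_add_right mult_smult_left mult_smult_right\<close>)
  fix a b u assume a: "a : carrier A" and b: "b : carrier A" and u: "u : U"
  have uX: "u : X" using u UX by auto
  \<comment> \<open>\<open>span_step\<close> treats all left ends at once. Only \<open>u\<close>
    matters here, so every other target is the whole algebra.\<close>
  define W where "W z = (if z = u then {w : carrier A. idem A x **.A a **.A w : VV x} else carrier A)" for z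
  have "idem A u **.A b **.A p y y : W u"
  proof (rule span_step[OF upset_X y _ _ y lm_self(1) b uX])
   show "submodule (W z) K A" for z
    unfolding W_def using vimage_left[OF VV[OF x], of "idem A x **.A a"] x a A.carrier_is_submodule by simp
   fix t z assume t: "t : X" "z : lm t" "y : lm t"
   show "p z t **.A p t y : W z"
   proof (cases "z = u")
    case True
    have "t : U" using U u lm_leq[OF t(1,2)] t(1) True by (auto simp: upset_def)
    hence "idem A x **.A (a **.A p u t) **.A p t y : VV x"
     using span_step[OF U y VV C _ t(3) _ x, of "a **.A p u t"] a by simp
    thus ?thesis unfolding W_def using True a x by (simp add: mult_assoc)
   qed (simp add: W_def)
  qed
  hence "idem A x **.A a **.A (idem A u **.A b **.A idem A y) : VV x" unfolding W_def p_self using y by simp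
  thus "a **.A idem A u **.A b : ?W" using a b uX x y by (simp add: mult_assoc)
 qed
 thus ?thesis using v by blast
qed

lemma IU_elim_left:
 assumes U: "upset U" and y: "y : X" and V: "submodule V K A"
  and C: "!!t x. [|t : U; x : lm t; y : lm t|] ==> p x t **.A p t y : V"
  and v: "v : IU U" "v : lid y"
 shows "v : V"
proof (rule left_split[OF V])
 show "v : carrier A" "y : idx A" "v **.A idem A y = v" using v(2) y by (auto simp: lid_def idxA)
 fix x assume "x : idx A"
 hence x: "x : X" by (simp add: idxA)
 have "idem A x **.A v **.A idem A y : V" by (rule IU_elim[OF U x y V C v(1)])
 thus "idem A x **.A v : V" using v(2) x y by (simp add: lid_def mult_assoc)
qed

end

text \<open>The relations bound the algebra from above. The nonvanishing loop gives the bound from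
  below: it keeps the products through a tile out of the ideal of any upset without that tile, see
  \<open>cell_notin\<close>.\<close>

locale cubist_algebra = cubist_presentation r I X K A g
 for r I X and K :: "'k ring" (structure) and A :: "('k, 'a, point) galgebra" (structure) and g +
 assumes nz: "t : X ==> p (opp t) t **.A p t (opp t) ~= \<zero>.A"
begin

lemma vdist_sym: "vdist r a b = vdist r b a" by (simp add: vdist_def abs_minus_commute)

text \<open>The coordinate \<open>ty t\<close> is constant on the tile, which leaves
  \<open>r - 1\<close> coordinates; all of them differ from those of \<open>t\<close> only at the
  opposite point.\<close>

lemma vdist_lm: assumes t: "t : X" and x: "x : lm t" shows "vdist r x t <= r - 1" "vdist r x t = r - 1 ==> x = opp t"
proof -
 have c: "close r x t" by (rule lm_close[OF t x lm_self(1)])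
 have ti: "opp t (ty t) = t (ty t)" by (simp add: opp_def opp_at_def)
 let ?D = "{j : {1..r}. x j ~= t j}"
 have "vdist r x t = (\<Sum>j\<in>{1..r}. if x j ~= t j then 1 else 0)"
  unfolding vdist_def
 proof (rule sum.cong)
  fix j show "nat \<bar>x j - t j\<bar> = (if x j ~= t j then 1 else 0)" using close_dir(2)[OF c, of j] by auto
 qed simp
 also have "... = card ?D" by (simp add: sum.If_cases Int_def)
 finally have v: "vdist r x t = card ?D" .
 have sub: "?D \<subseteq> {1..r} - {ty t}" using lm_dir[OF t x, of "ty t"] ti by auto
 have card: "card ({1..r} - {ty t}) = r - 1" using ty(1)[OF t] by simp
 show "vdist r x t <= r - 1" unfolding v card[symmetric] by (rule card_mono[OF _ sub]) simp
 assume "vdist r x t = r - 1"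
 hence D: "?D = {1..r} - {ty t}" unfolding v using card by (intro card_subset_eq[OF _ sub]) simp_all
 show "x = opp t"
 proof
  fix j show "x j = opp t j"
  proof (cases "x j = t j")
   case True
   hence "j ~: {1..r} \<or> j = ty t" using D by blast
   moreover have "j ~: {1..r} ==> opp t j = t j" using lattice_out[OF X_lattice[OF t]] lattice_out[OF X_lattice[OF opp_X[OF t]]] by simp
   ultimately show ?thesis using True ti by auto
  next
   case False thus ?thesis using lm_dir[OF t x False] by simp
  qed
 qed
qed

lemma vdist_opp: assumes t: "t : X" shows "vdist r (opp t) t = r - 1"
proof -
 have "vdist r (opp t) t = (\<Sum>j\<in>{1..r}. if j = ty t then 0 else 1)"
  unfolding vdist_def
 proof (rule sum.cong)
  fix j assume "j : {1..r}"
  thus "nat \<bar>opp t j - t j\<bar> = (if j = ty t then 0 else 1)" by (auto simp: opp_def opp_at_def)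
 qed simp
 also have "... = card ({1..r} - {ty t})" by (simp add: sum.If_cases Diff_eq)
 also have "... = r - 1" using ty(1)[OF t] by simp
 finally show ?thesis .
qed

text \<open>Monotone paths on both sides extend the product to the loop at \<open>o = opp t\<close>,
  of degree \<open>2 * (r - 1)\<close>. By \<open>IU_elim\<close> the ideal between \<open>o\<close>
  and \<open>o\<close> is spanned by loops from \<open>o\<close> to some \<open>u\<close> in
  \<open>U\<close>. They have smaller degree unless \<open>o\<close> is opposite to
  \<open>u\<close>, and then \<open>u = t\<close> by \<open>opp_inj\<close>.\<close>

lemma cell_notin:
 assumes U: "upset U" and t: "t : X" "t ~: U" and x: "x : lm t" and y: "y : lm t"
 shows "p x t **.A p t y ~: IU U"
proof
 assume m: "p x t **.A p t y : IU U"
 have UX: "U \<subseteq> X" using U by (simp add: upset_def)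
 let ?o = "opp t" and ?n = "(r - 1) + (r - 1)"
 have oX: "?o : X" by (rule opp_X[OF t(1)])
 have cl: "close r ?o t" "close r t ?o" using close_opp[OF t(1)] close_sym by blast+
 have xb: "x : box ?o t" "y : box t ?o" using x y by (auto simp: lm_def box_sym)
 have "p ?o x **.A (p x t **.A p t y) **.A p y ?o : IU U"
  by (rule IU_right[OF UX p_closed IU_left[OF UX p_closed m]])
 moreover have "p ?o x **.A (p x t **.A p t y) **.A p y ?o = (p ?o x **.A p x t) **.A (p t y **.A p y ?o)" by (simp add: mult_assoc)
 ultimately have in_U: "p ?o t **.A p t ?o : IU U" using p_comp[OF cl(1) xb(1)] p_comp[OF cl(2) xb(2)] by simp
 let ?V = "{v : carrier A. comp ?n v = \<zero>.A}"
 have V: "submodule ?V K A" by (rule A.submoduleI') (auto simp: comp_add comp_smult)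
 have deg: "p ?o u **.A p u ?o : agrade A (vdist r ?o u + vdist r ?o u)" if u: "u : X" "?o : lm u" for u
  using agrade_mult[OF p_grade p_grade] lm_close[OF u(1) u(2) lm_self(1)] lm_close[OF u(1) lm_self(1) u(2)] vdist_sym by metis
 define VV where "VV x = (if x = ?o then ?V else carrier A)" for x
 have "idem A ?o **.A (p ?o t **.A p t ?o) **.A idem A ?o : VV ?o"
 proof (rule IU_elim[OF U oX oX _ _ in_U])
  show "submodule (VV x) K A" for x using V A.carrier_is_submodule by (simp add: VV_def)
  fix u x assume u: "u : U" "x : lm u" "?o : lm u"
  have uX: "u : X" using u UX by auto
  show "p x u **.A p u ?o : VV x"
  proof (cases "x = ?o")
   case True
   have "vdist r ?o u ~= r - 1"
   proof
    assume "vdist r ?o u = r - 1"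
    hence "?o = opp u" by (rule vdist_lm(2)[OF uX u(3)])
    hence "t = u" by (rule opp_inj[OF t(1) uX])
    thus False using u t by simp
   qed
   hence "?n ~= vdist r ?o u + vdist r ?o u" using vdist_lm(1)[OF uX u(3)] by linarith
   hence "comp ?n (p ?o u **.A p u ?o) = \<zero>.A" using comp_homog[OF deg[OF uX u(3)], of ?n] by simp
   thus ?thesis unfolding VV_def using True by simp
  qed (simp add: VV_def)
 qed
 moreover have "idem A ?o **.A (p ?o t **.A p t ?o) **.A idem A ?o = p ?o t **.A p t ?o"
  using p_left[OF cl(1) oX] p_right[OF oX, of t] oX by (simp add: mult_assoc[symmetric]) (simp add: mult_assoc)
 ultimately have "comp ?n (p ?o t **.A p t ?o) = \<zero>.A" by (simp add: VV_def)
 moreover have "comp ?n (p ?o t **.A p t ?o) = p ?o t **.A p t ?o"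
  using comp_homog[OF deg[OF t(1) lm_self(2)], of ?n] vdist_opp[OF t(1)] by simp
 ultimately show False using nz[OF t(1)] by simp
qed

text \<open>Modulo the ideal of \<open>above t\<close>, each \<open>e_x w\<close> is a multiple of
  \<open>p x t\<close>. The factor vanishes, since \<open>p x t p t y\<close> is not in the ideal of
  \<open>U\<close>.\<close>

lemma layer_inj:
 assumes U: "upset U" "above t \<subseteq> U" and t: "t : X" "t ~: U" and y: "y : lm t"
  and w: "w : lid t" "w **.A p t y : IU U"
 shows "w : IU (above t)"
proof -
 have UX: "U \<subseteq> X" using U by (simp add: upset_def)
 have wc: "w : carrier A" by (rule lid_carrier[OF w(1)])
 have we: "w **.A idem A t = w" using w(1) by (simp add: lid_def)
 note Du = A.submoduleD[OF IU_submodule[OF UX]] and Da = A.submoduleD[OF IU_submodule[OF above_X[of t]]]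
 show ?thesis
 proof (rule left_split[OF IU_submodule[OF above_X] wc _ we])
  show "t : idx A" using t by (simp add: idxA)
  fix x assume "x : idx A"
  hence x: "x : X" by (simp add: idxA)
  obtain c b where cb: "c : carrier K" "b : IU (above t)" "idem A x **.A w **.A idem A t = c \<odot>.A base t x \<oplus>.A b"
   using proj_span[OF IU_left_closed[OF above_X] leaving_above[OF t(1)] t(1) x wc] by blast
  have bc: "b : carrier A" by (rule IU_carrier[OF above_X cb(2)])
  have ew: "idem A x **.A w = c \<odot>.A base t x \<oplus>.A b"
   using cb(3) x wc t we by (simp add: mult_assoc)
  have "c \<odot>.A base t x : IU (above t)"
  proof (cases "x : lm t & c ~= \<zero>.K")
   case False
   hence "c \<odot>.A base t x = \<zero>.A" using cb(1) by (auto simp: base_def)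
   thus ?thesis using Da(2) by simp
  next
   case True
   have ib: "b **.A p t y : IU U" using subsetD[OF IU_mono[OF U(2) UX] cb(2)] by (rule IU_right[OF UX p_closed])
   have "idem A x **.A (w **.A p t y) : IU U" by (rule IU_left[OF UX _ w(2)]) (use x in simp)
   moreover have "idem A x **.A (w **.A p t y) = (idem A x **.A w) **.A p t y" using x wc by (simp add: mult_assoc)
   moreover have "... = c \<odot>.A (p x t **.A p t y) \<oplus>.A b **.A p t y"
    unfolding ew using True cb(1) bc by (simp add: base_def mult_add_left mult_smult_left)
   ultimately have "c \<odot>.A (p x t **.A p t y) \<oplus>.A b **.A p t y : IU U" by simp
   from Du(6)[OF this ib] have "c \<odot>.A (p x t **.A p t y) : IU U"
    using cb(1) bc by (simp add: a_minus_def A.M.a_assoc A.M.r_neg)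
   moreover have i: "inv\<^bsub>K\<^esub> c : carrier K" "inv\<^bsub>K\<^esub> c **.K c = \<one>.K" using cb(1) True field_Units by auto
   ultimately have "inv\<^bsub>K\<^esub> c \<odot>.A (c \<odot>.A (p x t **.A p t y)) : IU U" using Du(4) by blast
   hence "(inv\<^bsub>K\<^esub> c **.K c) \<odot>.A (p x t **.A p t y) : IU U" using A.smult_assoc1[OF i(1) cb(1)] by simp
   hence "p x t **.A p t y : IU U" using i by simp
   thus ?thesis using cell_notin[OF U(1) t _ y] True by blast
  qed
  thus "idem A x **.A w : IU (above t)" unfolding ew using Da(3) cb(2) by blast
 qed
qed

lemma layer_through:
 assumes W: "W \<subseteq> X" and u: "u : X" "u : W" "y : lm u"
 shows "a : carrier A ==> a **.A p u y : IU W"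
 using IU_left[OF W _ IU_through_left[OF W u(2) p_closed p_left[OF lm_close[OF u(1) lm_self(1) u(3)] u(1)]]] .

text \<open>At the right end \<open>y\<close> only the tiles through \<open>y\<close> contribute to
  the ideal of an upset.\<close>

lemma layer_skip:
 assumes U: "upset U" and W: "W \<subseteq> X" and y: "y : X"
  and UW: "!!u. [|u : U; y : lm u|] ==> u : W" and v: "v : IU U" "v : lid y"
 shows "v : IU W"
proof (rule IU_elim_left[OF U y IU_submodule[OF W] _ v])
 fix u x assume u: "u : U" "y : lm u"
 have uW: "u : W" by (rule UW[OF u])
 show "p x u **.A p u y : IU W" by (rule layer_through[OF W subsetD[OF W uW] uW u(2) p_closed])
qed

text \<open>Of the products that span the ideal at \<open>y\<close>, all except those through
  \<open>t\<close> are in the ideal of \<open>W\<close>.\<close>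

lemma layer_decomp:
 assumes U: "upset U" and W: "W \<subseteq> X" and t: "t : X" and y: "y : lm t"
  and UW: "!!u. [|u : U; y : lm u; u ~= t|] ==> u : W" and v: "v : IU U" "v : lid y"
 shows "EX w:lid t. v \<ominus>.A w **.A p t y : IU W"
proof -
 have ti: "t : idx A" using t by (simp add: idxA)
 have y': "y : X" using lm_X[OF t] y by blast
 note DW = A.submoduleD[OF IU_submodule[OF W]] and Lt = A.submoduleD[OF lid_submodule[OF ti]]
 let ?V = "{v : carrier A. EX w:lid t. v \<ominus>.A w **.A p t y : IU W}"
 have V: "submodule ?V K A"
 proof (rule A.submoduleI')
  show "\<zero>.A : ?V" using Lt(2) DW(2) DW(6)[OF DW(2) DW(2)] by (intro CollectI conjI bexI[of _ "\<zero>.A"]) simp_all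
 next
  fix a b assume "a : ?V" "b : ?V"
  then obtain u w where h: "a : carrier A" "b : carrier A" "u : lid t" "w : lid t"
   "a \<ominus>.A u **.A p t y : IU W" "b \<ominus>.A w **.A p t y : IU W" by blast
  have "(a \<oplus>.A b) \<ominus>.A (u \<oplus>.A w) **.A p t y = (a \<ominus>.A u **.A p t y) \<oplus>.A (b \<ominus>.A w **.A p t y)"
   using h lid_carrier by (simp add: mult_add_left a_minus_def A.M.minus_add A.M.a_ac)
  hence "(a \<oplus>.A b) \<ominus>.A (u \<oplus>.A w) **.A p t y : IU W" using DW(3)[OF h(5,6)] by simp
  thus "a \<oplus>.A b : ?V" using h(1,2) Lt(3)[OF h(3,4)] by blast
 next
  fix c a assume c: "c : carrier K" and "a : ?V"
  then obtain u where h: "a : carrier A" "u : lid t" "a \<ominus>.A u **.A p t y : IU W" by blast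
  have "(c \<odot>.A a) \<ominus>.A (c \<odot>.A u) **.A p t y = c \<odot>.A (a \<ominus>.A u **.A p t y)"
   using h lid_carrier c by (simp add: mult_smult_left a_minus_def A.smult_r_distr A.smult_r_minus)
  hence "(c \<odot>.A a) \<ominus>.A (c \<odot>.A u) **.A p t y : IU W" using DW(4)[OF c h(3)] by simp
  moreover have "c \<odot>.A a : carrier A" using c h by simp
  ultimately show "c \<odot>.A a : ?V" using Lt(4)[OF c h(2)] by blast
 qed simp
 have "v : ?V"
 proof (rule IU_elim_left[OF U y' V _ v])
  fix u z assume u: "u : U" "z : lm u" "y : lm u"
  show "p z u **.A p u y : ?V"
  proof (cases "u = t")
   case True
   have "p z t : lid t" using p_right[OF t, of z] by (simp add: lid_def)
   moreover have "p z t **.A p t y \<ominus>.A p z t **.A p t y : IU W"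
    using DW(2) by (simp add: a_minus_def A.M.r_neg)
   ultimately show ?thesis unfolding True by (intro CollectI conjI bexI[of _ "p z t"]) simp_all
  next
   case False
   have uW: "u : W" by (rule UW[OF u(1,3) False])
   have "p z u **.A p u y : IU W" by (rule layer_through[OF W subsetD[OF W uW] uW u(3) p_closed])
   moreover have "p z u **.A p u y \<ominus>.A \<zero>.A **.A p t y = p z u **.A p u y"
    using A.M.minus_equality[of "\<zero>.A" "\<zero>.A"] by (simp add: a_minus_def)
   ultimately show ?thesis using Lt(2) by (intro CollectI conjI bexI[of _ "\<zero>.A"]) simp_all
  qed
 qed
 thus ?thesis by blast
qed

subsection \<open>The highest weight structure\<close>

lemma IU_lid_ideal: assumes U: "U \<subseteq> X" and s: "s : X" shows "homog_left_ideal s (IU U \<inter> lid s)"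
proof -
 have si: "s : idx A" using s by (simp add: idxA)
 have "submodule (IU U \<inter> lid s) K A"
  by (rule A.submoduleI') (use A.submoduleD[OF IU_submodule[OF U]] A.submoduleD[OF lid_submodule[OF si]] in auto)
 thus ?thesis unfolding homog_left_ideal_def using IU_left[OF U] IU_comp[OF U] lid_left[OF si] lid_comp[OF si] by blast
qed

lemma std_kernel_eq: assumes s: "s : X" shows "std_kernel A leq s = IU (above s) \<inter> lid s"
proof -
 have si: "s : idx A" using s by (simp add: idxA)
 let ?S = "{a **.A idem A t **.A b **.A idem A s | a b t. a : carrier A & b : carrier A & t : idx A & (s, t) : leq & t ~= s}"
 have ab: "t : above s \<longleftrightarrow> t : idx A & (s, t) : leq & t ~= s" for t by (auto simp: above_def idxA)
 have sub: "submodule (IU (above s) \<inter> lid s) K A" using IU_lid_ideal[OF above_X s] by (simp add: homog_left_ideal_def)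
 have inS: "x : IU (above s) \<inter> lid s" if xS: "x : ?S" for x
 proof -
  obtain a b t where x: "x = a **.A idem A t **.A b **.A idem A s" "a : carrier A" "b : carrier A" "t : above s" using xS ab by blast
  have tX: "t : X" using x(4) above_X by blast
  show ?thesis unfolding x(1) using IU_right[OF above_X _ IU_memI[OF x(2,3,4)], of "idem A s"] s
   lidI[OF si, of "a **.A idem A t **.A b"] x tX by simp
 qed
 have G: "submodule (generate (add_monoid A) ?S) K A"
 proof (rule generate_submodule)
  show "?S \<subseteq> carrier A" using inS lid_carrier by blast
  fix c x assume c: "c : carrier K" and "x : ?S"
  then obtain a b t where x: "x = a **.A idem A t **.A b **.A idem A s" "a : carrier A" "b : carrier A" "t : idx A & (s, t) : leq & t ~= s" by blast
  have "c \<odot>.A x = (c \<odot>.A a) **.A idem A t **.A b **.A idem A s" using x c s by (simp add: mult_smult_left)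
  moreover have "c \<odot>.A a : carrier A" using x c by simp
  ultimately show "c \<odot>.A x : ?S" using x(3,4) by blast
 qed
 show ?thesis
 proof
  show "std_kernel A leq s \<subseteq> IU (above s) \<inter> lid s" unfolding std_kernel_def
   by (rule generate_least[OF sub]) (use inS in blast)
  show "IU (above s) \<inter> lid s \<subseteq> std_kernel A leq s" unfolding std_kernel_def
  proof
   fix v assume v: "v : IU (above s) \<inter> lid s"
   have "IU (above s) \<subseteq> {v : carrier A. v **.A idem A s : generate (add_monoid A) ?S}"
   proof (rule IU_least[OF vimage_right[OF G]])
    show "idem A s : carrier A" using s by simp
    fix a b t assume abt: "a : carrier A" "b : carrier A" "t : above s"
    have "a **.A idem A t **.A b **.A idem A s : ?S" using abt ab by blast
    hence "a **.A idem A t **.A b **.A idem A s : generate (add_monoid A) ?S" by (rule generate.incl)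
    thus "a **.A idem A t **.A b : {v : carrier A. v **.A idem A s : generate (add_monoid A) ?S}"
     using abt above_X by (simp add: subset_iff)
   qed
   moreover have "v **.A idem A s = v" using v by (simp add: lid_def)
   ultimately show "v : generate (add_monoid A) ?S" using v by force
  qed
 qed
qed

text \<open>By \<open>proj_span\<close> the standard module lives on the points of the tile of
  \<open>s\<close>, and these are below \<open>s\<close>.\<close>

lemma std_weight:
 assumes s: "s : X" and t: "t : X" "(t, s) ~: leq"
 shows "{act (std_mod A leq s) (idem A t) x | x. x : carrier (std_mod A leq s)} = {\<zero>\<^bsub>std_mod A leq s\<^esub>}"
proof -
 let ?N = "std_kernel A leq s"
 have si: "s : idx A" using s by (simp add: idxA)
 have N: "submodule ?N K A" "!!a x. [|a : carrier A; x : ?N|] ==> a **.A x : ?N"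
  using IU_lid_ideal[OF above_X s] unfolding std_kernel_eq[OF s] homog_left_ideal_def by blast+
 have tl: "t ~: lm s" using lm_leq[OF s] t by blast
 have e: "act (std_mod A leq s) (idem A t) (?N +>.A x) = ?N" if x: "x : lid s" for x
 proof -
  have xc: "x : carrier A" by (rule lid_carrier[OF x])
  have "act (std_mod A leq s) (idem A t) (?N +>.A x) = ?N +>.A (idem A t **.A x)"
   unfolding std_mod_def by (rule quot_ops(3)[OF disjI1[OF refl] N xc xc]) (use t in simp_all)
  moreover have "idem A t **.A x : ?N"
  proof -
   obtain c b where cb: "c : carrier K" "b : IU (above s)" "idem A t **.A x **.A idem A s = c \<odot>.A base s t \<oplus>.A b"
    using proj_span[OF IU_left_closed[OF above_X] leaving_above[OF s] s t(1) xc] by blast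
   have "idem A t **.A x **.A idem A s = idem A t **.A x" using x xc t s by (simp add: lid_def mult_assoc)
   hence "idem A t **.A x = b" using cb tl IU_carrier[OF above_X cb(2)] by (simp add: base_def)
   moreover have "idem A t **.A x : lid s" by (rule lid_left[OF si x]) (use t in simp)
   ultimately show ?thesis using cb(2) unfolding std_kernel_eq[OF s] by simp
  qed
  ultimately show ?thesis using A.coset_mem[OF N(1), of "idem A t **.A x"] t xc by simp
 qed
 have c: "carrier (std_mod A leq s) = (%x. ?N +>.A x) ` lid s" unfolding std_mod_def by (rule quot_carrier(2)[OF si])
 have z: "\<zero>\<^bsub>std_mod A leq s\<^esub> = ?N" by (simp add: std_mod_def quot_mod_def)
 have ne: "idem A s : lid s" by (rule lid_idem[OF si])
 show ?thesis unfolding c z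
 proof (intro equalityI subsetI)
  fix y assume "y : {act (std_mod A leq s) (idem A t) x | x. x : (%x. ?N +>.A x) ` lid s}"
  then obtain x where "x : lid s" "y = act (std_mod A leq s) (idem A t) (?N +>.A x)" by blast
  thus "y : {?N}" using e by simp
 next
  fix y assume "y : {?N}"
  hence "y = act (std_mod A leq s) (idem A t) (?N +>.A idem A s)" using e[OF ne] by simp
  thus "y : {act (std_mod A leq s) (idem A t) x | x. x : (%x. ?N +>.A x) ` lid s}" using ne by blast
 qed
qed

definition upc :: "point set => point set" where "upc F = {u : X. EX f:F. (f, u) : leq}"

lemma upc_X: "upc F \<subseteq> X" by (auto simp: upc_def)

lemma upset_upc: "upset (upc F)" unfolding upset_def upc_def using leq_trans by blast

lemma upc_incl: "F \<subseteq> X ==> F \<subseteq> upc F" using leq_refl by (auto simp: upc_def)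

text \<open>\<open>T\<close> indexes the sections to be found, one for each tile through
  \<open>s\<close> other than its own. A minimal \<open>t\<close> of the upper part \<open>F\<close>
  is split off; its section is generated by \<open>p t s\<close>, and the length of this path is the
  shift.\<close>

lemma kernel_filtration:
 assumes s: "s : X" and T: "T = {t : X. s : lm t & t ~= s}"
  and F: "F \<subseteq> T" "!!f t. [|f : F; t : T; (f, t) : leq|] ==> t : F"
 shows "EX n N. N 0 = {\<zero>.A} & N n = IU (upc F) \<inter> lid s &
  (ALL i<=n. graded_submodule K A (proj_mod A s) (N i)) &
  (ALL i<n. N i \<subseteq> N (Suc i) &
    (EX t:idx A. (s, t) : leq & t ~= s &
     (EX m. mod_iso K A (quot_mod (sub_mod (proj_mod A s) (N (Suc i))) (N i)) (shift_mod (std_mod A leq t) m))))"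
 using F
proof (induction "card F" arbitrary: F rule: less_induct)
 case less
 have si: "s : idx A" using s by (simp add: idxA)
 have TX: "T \<subseteq> X" "finite T" using T by (auto intro: finite_subset[OF _ finite_tiles[of s]])
 have finF: "finite F" using finite_subset[OF less.prems(1) TX(2)] .
 have FX: "F \<subseteq> X" using less.prems(1) TX by auto
 have gs: "graded_submodule K A (proj_mod A s) (IU U \<inter> lid s)" if "U \<subseteq> X" for U
  by (rule sub_proj_graded[OF si IU_lid_ideal[OF that s]])
 show ?case
 proof (cases "F = {}")
  case True
  have u: "upc F = {}" using True by (simp add: upc_def)
  have z: "submodule {\<zero>.A} K A" by (rule A.submoduleI') auto
  have "IU {} \<inter> lid s = {\<zero>.A}"
  proof -
   have "IU {} \<subseteq> {\<zero>.A}" by (rule IU_least[OF z]) simp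
   moreover have "\<zero>.A : IU {} \<inter> lid s" using A.submoduleD(2)[OF IU_submodule] A.submoduleD(2)[OF lid_submodule[OF si]] by simp
   ultimately show ?thesis by blast
  qed
  thus ?thesis using gs[of "{}"] unfolding u by (intro exI[of _ 0] exI[of _ "%_. {\<zero>.A}"]) simp
 next
  case False
  obtain t where t: "t : F" and min: "!!u. u : F ==> (u, t) : leq ==> u = t"
   by (rule minimal_ex[OF finF False FX]) blast
  let ?F = "F - {t}"
  have tT: "t : T" "t : X" "s : lm t" "t ~= s" using t less.prems(1) T by auto
  have ti: "t : idx A" using tT by (simp add: idxA)
  have up': "u : ?F" if "f : ?F" "u : T" "(f, u) : leq" for f u
  proof -
   have "u : F" using less.prems(2) that by blast
   moreover have "u ~= t" using min[of f] that by auto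
   ultimately show ?thesis by simp
  qed
  have "card ?F < card F" using t finF by (intro psubset_card_mono) auto
  have FT: "?F \<subseteq> T" using less.prems(1) by auto
  from less.hyps[OF \<open>card ?F < card F\<close> FT up'] obtain n where "EX N. N 0 = {\<zero>.A} & N n = IU (upc ?F) \<inter> lid s &
   (ALL i<=n. graded_submodule K A (proj_mod A s) (N i)) &
   (ALL i<n. N i \<subseteq> N (Suc i) & (EX t:idx A. (s, t) : leq & t ~= s &
     (EX m. mod_iso K A (quot_mod (sub_mod (proj_mod A s) (N (Suc i))) (N i)) (shift_mod (std_mod A leq t) m))))"
   by (rule exE)
  from this obtain N where N': "N 0 = {\<zero>.A} & N n = IU (upc ?F) \<inter> lid s &
   (ALL i<=n. graded_submodule K A (proj_mod A s) (N i)) &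
   (ALL i<n. N i \<subseteq> N (Suc i) & (EX t:idx A. (s, t) : leq & t ~= s &
     (EX m. mod_iso K A (quot_mod (sub_mod (proj_mod A s) (N (Suc i))) (N i)) (shift_mod (std_mod A leq t) m))))"
   by (rule exE)
  note N = N'[THEN conjunct1] N'[THEN conjunct2, THEN conjunct1] N'[THEN conjunct2, THEN conjunct2, THEN conjunct1]
   N'[THEN conjunct2, THEN conjunct2, THEN conjunct2]
  have sub: "upc ?F \<subseteq> upc F" by (auto simp: upc_def)
  have pt: "idem A t **.A p t s = p t s" by (rule p_left[OF lm_close[OF tT(2) lm_self(1) tT(3)] tT(2)])
  have pl: "p t s : lid s" using p_right[OF s, of t] by (simp add: lid_def)
  have pF: "p t s : IU (upc F)" using IU_through_left[OF upc_X _ p_closed pt] upc_incl[OF FX] t by blast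
  note IF' = A.submoduleD[OF IU_submodule[OF upc_X[of ?F]]] and IL = A.submoduleD[OF lid_submodule[OF si]]
   and Lt = A.submoduleD[OF lid_submodule[OF ti]]
  have in_F: "u : F" if "u : upc F" "s : lm u" for u
  proof -
   obtain f where f: "f : F" "(f, u) : leq" "u : X" using \<open>u : upc F\<close> by (auto simp: upc_def)
   have fT: "f : X" "s : lm f" "f ~= s" using f(1) less.prems(1) T by auto
   have "u ~= s" using f(2) lm_leq[OF fT(1,2)] leq_antisym fT(3) by blast
   hence "u : T" using that(2) f(3) T by simp
   thus ?thesis using less.prems(2) f by blast
  qed
  have iso: "mod_iso K A (quot_mod (sub_mod (proj_mod A s) (IU (upc F) \<inter> lid s)) (IU (upc ?F) \<inter> lid s))
    (shift_mod (quot_mod (proj_mod A t) (IU (above t) \<inter> lid t)) (int (vdist r t s)))"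
  proof (rule quot_iso_shift[OF si ti IU_lid_ideal[OF upc_X s] IU_lid_ideal[OF upc_X s] IU_lid_ideal[OF above_X tT(2)]])
   show "p t s : agrade A (vdist r t s)" by (rule p_grade[OF lm_close[OF tT(2) lm_self(1) tT(3)]])
  next
   fix x assume x: "x : IU (upc F) \<inter> lid s"
   have "EX w:lid t. x \<ominus>.A w **.A p t s : IU (upc ?F)"
   proof (rule layer_decomp[OF upset_upc upc_X tT(2,3)])
    fix u assume "u : upc F" "s : lm u" "u ~= t"
    thus "u : upc ?F" using in_F upc_incl[of ?F] FX by blast
   qed (use x in auto)
   then obtain w where w: "w : lid t" "x \<ominus>.A w **.A p t s : IU (upc ?F)" by blast
   have "x \<ominus>.A w **.A p t s : lid s" using x lid_left[OF si pl lid_carrier[OF w(1)]] IL(6) by blast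
   thus "EX w:lid t. x \<ominus>.A w **.A p t s : IU (upc ?F) \<inter> lid s" using w by blast
  next
   fix w assume w: "w : lid t"
   have wl: "w **.A p t s : lid s" by (rule lid_left[OF si pl lid_carrier[OF w]])
   thus "w **.A p t s : IU (upc F) \<inter> lid s" using IU_left[OF upc_X lid_carrier[OF w] pF] by blast
   \<comment> \<open>\<open>layer_inj\<close> wants an upset that contains all of
     \<open>above t\<close>. The enlargement still avoids \<open>t\<close>, by minimality in
     \<open>F\<close>.\<close>
   let ?U = "upc ?F \<union> above t"
   have UX: "?U \<subseteq> X" using upc_X above_X by blast
   show "w **.A p t s : IU (upc ?F) \<inter> lid s \<longleftrightarrow> w : IU (above t) \<inter> lid t"
   proof
    assume a: "w **.A p t s : IU (upc ?F) \<inter> lid s"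
    have U: "upset ?U" using upset_upc[of ?F] upset_above[of t] unfolding upset_def by blast
    have tU: "t ~: ?U" using min by (auto simp: upc_def above_def)
    have "w **.A p t s : IU ?U" using a IU_mono[of "upc ?F" ?U] UX by blast
    hence "w : IU (above t)" by (intro layer_inj[OF U _ tT(2) tU tT(3) w]) blast+
    thus "w : IU (above t) \<inter> lid t" using w by simp
   next
    assume a: "w : IU (above t) \<inter> lid t"
    have "w **.A p t s : IU (upc ?F)"
    proof (rule layer_skip[OF upset_above upc_X s _ _ wl])
     show "w **.A p t s : IU (above t)" using IU_right[OF above_X p_closed] a by blast
     fix u assume u: "u : above t" "s : lm u"
     have "u : upc F" using u(1) t by (auto simp: upc_def above_def)
     hence "u : F" using u(2) by (rule in_F)
     thus "u : upc ?F" using u(1) upc_incl[of ?F] FX by (auto simp: above_def)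
    qed
    thus "w **.A p t s : IU (upc ?F) \<inter> lid s" using wl by simp
   qed
  qed
  hence iso': "mod_iso K A (quot_mod (sub_mod (proj_mod A s) (IU (upc F) \<inter> lid s)) (IU (upc ?F) \<inter> lid s))
    (shift_mod (std_mod A leq t) (int (vdist r t s)))"
   unfolding std_mod_def std_kernel_eq[OF tT(2)] .
  let ?N = "%i. if i <= n then N i else IU (upc F) \<inter> lid s"
  have st: "(s, t) : leq" by (rule lm_leq[OF tT(2,3)])
  have mono: "IU (upc ?F) \<inter> lid s \<subseteq> IU (upc F) \<inter> lid s" using IU_mono[OF sub upc_X] by blast
  have "?N i \<subseteq> ?N (Suc i) & (EX t:idx A. (s, t) : leq & t ~= s &
     (EX m. mod_iso K A (quot_mod (sub_mod (proj_mod A s) (?N (Suc i))) (?N i)) (shift_mod (std_mod A leq t) m)))" if i: "i < Suc n" for i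
  proof (cases "i < n")
   case True thus ?thesis using N(4) by simp
  next
   case False
   hence "i = n" using i by simp
   thus ?thesis using iso' mono st tT(4) ti N(2) by (simp, intro conjI bexI[of _ t] exI[of _ "int (vdist r t s)"]) auto
  qed
  moreover have "?N 0 = {\<zero>.A}" "?N (Suc n) = IU (upc F) \<inter> lid s" using N(1) by simp_all
  moreover have "graded_submodule K A (proj_mod A s) (?N i)" if "i <= Suc n" for i
   using N(3) gs[OF upc_X] by simp
  ultimately show ?thesis by (intro exI[of _ "Suc n"] exI[of _ ?N] conjI allI impI) simp_all
 qed
qed

lemma highest_weight: "graded_highest_weight K A leq"
 unfolding graded_highest_weight_def
proof (intro conjI ballI impI)
 show "graded_algebra K A" by (rule graded_algebra_axioms)
 show "partial_order_on (idx A) leq" using partial_order_leq by (simp add: idxA)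
next
 fix s t assume "s : idx A" "t : idx A" "(t, s) ~: leq"
 thus "{act (std_mod A leq s) (idem A t) x | x. x : carrier (std_mod A leq s)} = {\<zero>\<^bsub>std_mod A leq s\<^esub>}"
  by (intro std_weight) (simp_all add: idxA)
next
 fix s assume "s : idx A"
 hence s: "s : X" by (simp add: idxA)
 let ?T = "{t : X. s : lm t & t ~= s}"
 have Ta: "?T \<subseteq> above s" using lm_leq by (auto simp: above_def)
 \<comment> \<open>\<open>upc ?T\<close> may be smaller than \<open>above s\<close>, but at the
   right end \<open>s\<close> only the tiles through \<open>s\<close> count.\<close>
 have "IU (upc ?T) \<inter> lid s = std_kernel A leq s"
  unfolding std_kernel_eq[OF s]
 proof
  have "upc ?T \<subseteq> above s"
  proof
   fix u assume "u : upc ?T"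
   then obtain f where f: "f : ?T" "(f, u) : leq" "u : X" by (auto simp: upc_def)
   have "f : above s" using f(1) Ta by blast
   thus "u : above s" using f upset_above[of s] unfolding upset_def by blast
  qed
  thus "IU (upc ?T) \<inter> lid s \<subseteq> IU (above s) \<inter> lid s" using IU_mono[OF _ above_X] by blast
 next
  show "IU (above s) \<inter> lid s \<subseteq> IU (upc ?T) \<inter> lid s"
  proof
   fix v assume v: "v : IU (above s) \<inter> lid s"
   have "v : IU (upc ?T)"
   proof (rule layer_skip[OF upset_above upc_X s])
    fix u assume "u : above s" "s : lm u"
    thus "u : upc ?T" using upc_incl[of ?T] by (auto simp: above_def)
   qed (use v in auto)
   thus "v : IU (upc ?T) \<inter> lid s" using v by simp
  qed
 qed
 thus "EX n N. N 0 = {\<zero>.A} & N n = std_kernel A leq s &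
  (ALL i<=n. graded_submodule K A (proj_mod A s) (N i)) &
  (ALL i<n. N i \<subseteq> N (Suc i) &
    (EX t:idx A. (s, t) : leq & t ~= s &
     (EX m. mod_iso K A (quot_mod (sub_mod (proj_mod A s) (N (Suc i))) (N i)) (shift_mod (std_mod A leq t) m))))"
  using kernel_filtration[OF s refl subset_refl] by simp
qed

end

section \<open>The linear resolution of a standard module\<close>

definition ksign :: "('k, 'z) ring_scheme => int => 'k" where
 "ksign K n = (if even n then \<one>.K else \<ominus>.K \<one>.K)"

text \<open>For neighbours \<open>y\<close> and \<open>y'\<close> that differ in the \<open>j\<close>th coordinate, the parity of \<open>qexp r y y'\<close> is that of
  \<open>y 1 + \<dots> + y (j - 1)\<close>.\<close>

definition qexp :: "nat => point => point => int" where
 "qexp r y y' = (\<Sum>j\<in>{1..r}. (y' j - y j) * (\<Sum>l\<in>{1..<j}. y l))"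

lemma qexp_upd: assumes "j : {1..r}" shows "qexp r y (y(j := a)) = (a - y j) * (\<Sum>l\<in>{1..<j}. y l)"
proof -
 have "qexp r y (y(j := a)) = (\<Sum>k\<in>{j}. ((y(j := a)) k - y k) * (\<Sum>l\<in>{1..<k}. y l))"
  unfolding qexp_def by (rule sum.mono_neutral_right) (use assms in auto)
 thus ?thesis by simp
qed

text \<open>Of two coordinates one precedes the other. Moving the earlier one by one changes the
  parity of the partial sum in front of the later one, but not conversely.\<close>

lemma qexp_square:
 assumes "i : {1..r}" "j : {1..r}" "i ~= j" "\<bar>a - y i\<bar> = 1" "\<bar>b - y j\<bar> = 1"
 shows "odd (qexp r y (y(i := a)) + qexp r (y(i := a)) (y(i := a, j := b))
  - (qexp r y (y(j := b)) + qexp r (y(j := b)) (y(j := b, i := a))))"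
proof -
 have s: "(\<Sum>l\<in>{1..<k}. (y(m := c)) l) = (\<Sum>l\<in>{1..<k}. y l) + (if m : {1..<k} then c - y m else 0)" for k m and c :: int
 proof (cases "m : {1..<k}")
  case True
  have "(\<Sum>l\<in>{1..<k}-{m}. (y(m := c)) l) = (\<Sum>l\<in>{1..<k}-{m}. y l)" by (rule sum.cong) auto
  thus ?thesis using True sum.remove[of "{1..<k}" m y] sum.remove[of "{1..<k}" m "y(m := c)"] by simp
 next
  case False
  have "(\<Sum>l\<in>{1..<k}. (y(m := c)) l) = (\<Sum>l\<in>{1..<k}. y l)" by (rule sum.cong) (use False in auto)
  thus ?thesis by (simp only: False if_False add_0_right)
 qed
 have "odd (a - y i)" "odd (b - y j)" using assms(4,5) by presburger+
 hence od: "odd ((a - y i) * (b - y j))" by simp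
 have ji: "(y(i := a)) j = y j" "(y(j := b)) i = y i" using assms(3) by auto
 define S where "S k = (\<Sum>l\<in>{1..<k}. y l)" for k
 have e: "qexp r y (y(i := a)) + qexp r (y(i := a)) (y(i := a, j := b)) - (qexp r y (y(j := b)) + qexp r (y(j := b)) (y(j := b, i := a)))
  = (a - y i) * S i + (b - y j) * (S j + (if i : {1..<j} then a - y i else 0)) - ((b - y j) * S j + (a - y i) * (S i + (if j : {1..<i} then b - y j else 0)))"
  unfolding qexp_upd[OF assms(1)] qexp_upd[OF assms(2)] s ji S_def ..
 show ?thesis
 proof (cases "i < j")
  case True
  hence "i : {1..<j}" "j ~: {1..<i}" using assms(1) by auto
  hence q: "qexp r y (y(i := a)) + qexp r (y(i := a)) (y(i := a, j := b)) - (qexp r y (y(j := b)) + qexp r (y(j := b)) (y(j := b, i := a))) = (a - y i) * (b - y j)"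
   unfolding e by (simp add: algebra_simps)
  show ?thesis unfolding q by (rule od)
 next
  case False
  hence "i ~: {1..<j}" "j : {1..<i}" using assms(2,3) by auto
  hence q: "qexp r y (y(i := a)) + qexp r (y(i := a)) (y(i := a, j := b)) - (qexp r y (y(j := b)) + qexp r (y(j := b)) (y(j := b, i := a))) = - ((a - y i) * (b - y j))"
   unfolding e by (simp add: algebra_simps)
  show ?thesis unfolding q dvd_minus_iff by (rule od)
 qed
qed

context cubist_algebra begin

lemma finsum_swap:
 assumes "finite S" "finite T" "!!i j. [|i : S; j : T|] ==> f i j : carrier A"
 shows "(\<Oplus>.A i\<in>S. \<Oplus>.A j\<in>T. f i j) = (\<Oplus>.A j\<in>T. \<Oplus>.A i\<in>S. f i j)"
 using assms(1,3)
proof (induction S)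
 case (insert s S)
 have c: "f i : T \<rightarrow> carrier A" if "i : insert s S" for i using insert.prems that by auto
 have "(\<Oplus>.A i\<in>insert s S. \<Oplus>.A j\<in>T. f i j) = (\<Oplus>.A j\<in>T. f s j) \<oplus>.A (\<Oplus>.A i\<in>S. \<Oplus>.A j\<in>T. f i j)"
  by (rule A.M.finsum_insert) (use insert.hyps insert.prems in \<open>auto intro!: A.M.finsum_closed\<close>)
 also have "... = (\<Oplus>.A j\<in>T. f s j) \<oplus>.A (\<Oplus>.A j\<in>T. \<Oplus>.A i\<in>S. f i j)"
  by (subst insert.IH) (use insert.prems in auto)
 also have "... = (\<Oplus>.A j\<in>T. f s j \<oplus>.A (\<Oplus>.A i\<in>S. f i j))"
  by (rule A.M.finsum_addf[symmetric]) (use insert.prems in \<open>auto intro!: A.M.finsum_closed\<close>)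
 also have "... = (\<Oplus>.A j\<in>T. \<Oplus>.A i\<in>insert s S. f i j)"
  by (rule A.M.finsum_cong') (use insert.hyps insert.prems in \<open>auto intro!: A.M.finsum_closed\<close>)
 finally show ?case .
qed simp

lemma ksign_closed [simp]: "ksign K n : carrier K" by (simp add: ksign_def)

lemma ksign_add: "ksign K m **.K ksign K n = ksign K (m + n)"
 by (simp add: ksign_def l_minus r_minus)

lemma ksign_odd: "odd (m - n) ==> ksign K m = \<ominus>.K ksign K n"
 by (auto simp: ksign_def)

lemma ksign_square: "ksign K m **.K ksign K m = \<one>.K"
 by (simp add: ksign_add) (simp add: ksign_def)

text \<open>The original arrows, for which squares anticommute.\<close>

definition arr :: "point => point => 'a" where "arr x y = ksign K (qexp r x y) \<odot>.A g x y"

lemma arr_closed [simp]: "arr x y : carrier A" by (simp add: arr_def)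

lemma arr_grade: "arr x y : agrade A 1"
 unfolding arr_def by (rule A.submoduleD(4)[OF agrade_submodule _ g_grade]) simp

lemma arr_right: "y : X ==> arr x y **.A idem A y = arr x y"
 by (simp add: arr_def mult_smult_left g_right)

lemma arr_lid: "[|y : X; a : carrier A|] ==> a **.A arr x y : lid y"
 by (simp add: lid_def mult_assoc arr_right)

lemma arr_adj: "arr x y ~= \<zero>.A ==> EX j:{1..r}. EX d. \<bar>d\<bar> = 1 & y = x(j := x j + d)"
proof -
 assume "arr x y ~= \<zero>.A"
 hence "g x y ~= \<zero>.A" unfolding arr_def by (metis A.smult_r_null ksign_closed)
 thus ?thesis by (rule g_adj)
qed

lemma arr_out: "y ~: X ==> arr x y = \<zero>.A"
 by (simp add: arr_def g_out)

lemma arr_square: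
 assumes "i : {1..r}" "j : {1..r}" "i ~= j" "\<bar>a - x i\<bar> = 1" "\<bar>b - x j\<bar> = 1"
 shows "arr x (x(i := a)) **.A arr (x(i := a)) (x(i := a, j := b)) = \<ominus>.A (arr x (x(j := b)) **.A arr (x(j := b)) (x(i := a, j := b)))"
proof -
 let ?G = "g x (x(j := b)) **.A g (x(j := b)) (x(i := a, j := b))"
 have tw: "x(j := b, i := a) = x(i := a, j := b)" using assms(3) by (rule fun_upd_twist[symmetric])
 have sg: "ksign K (qexp r x (x(i := a)) + qexp r (x(i := a)) (x(i := a, j := b)))
   = \<ominus>.K ksign K (qexp r x (x(j := b)) + qexp r (x(j := b)) (x(i := a, j := b)))"
  using ksign_odd[OF qexp_square[OF assms]] unfolding tw .
 have m: "arr x y **.A arr y w = ksign K (qexp r x y + qexp r y w) \<odot>.A (g x y **.A g y w)" for x y w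
  by (simp add: arr_def mult_smult_left mult_smult_right ksign_add[symmetric] A.smult_assoc1[symmetric] m_comm)
 show ?thesis unfolding m sg g_square'[OF assms] by (simp add: A.smult_l_minus del: fun_upd_apply)
qed

lemma arr_straight: "[|j : {1..r}; \<bar>b - x j\<bar> = 1; c - b = b - x j|] ==> arr x (x(j := b)) **.A arr (x(j := b)) (x(j := c)) = \<zero>.A"
 using g_straight'[of j b x c] by (simp add: arr_def mult_smult_left mult_smult_right del: fun_upd_apply)

lemma right_stay:
 assumes t: "t : X" and y: "y : lm t" and y': "y(j := a) : lm t" and j: "y j = t j" "a ~= t j"
 shows "p t y **.A g y (y(j := a)) = p t (y(j := a))"
proof -
 have c: "close r t (y(j := a))" by (rule lm_close[OF t lm_self(1) y'])
 have "p t (y(j := a)) = p t (y(j := a, j := t j)) **.A g (y(j := a, j := t j)) (y(j := a))"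
  by (rule p_step_right[OF c]) (use j in simp)
 moreover have "y(j := a, j := t j) = y" using j by auto
 ultimately show ?thesis by simp
qed

text \<open>If \<open>y j = t j\<close>, the arrow can be moved to the front, where it leaves the
  tile at \<open>t\<close>. Otherwise it continues a step already made in direction
  \<open>j\<close>, and the product is zero.\<close>

lemma right_leave:
 assumes t: "t : X" and y: "y : lm t" and j: "j : {1..r}" "\<bar>a - y j\<bar> = 1" and y': "y(j := a) ~: lm t"
 shows "p t y **.A g y (y(j := a)) : IU (above t)"
proof -
 have n: "a ~= t j" "a ~= opp t j" using lm_upd_mem[OF t y refl, of j a] y' by auto
 show ?thesis
 proof (cases "y j = t j")
  case True
  have a: "\<bar>a - t j\<bar> = 1" using j(2) True by simp
  show ?thesis unfolding leave_right[OF t y j(1) True a n(2)]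
   by (rule IU_right[OF above_X p_closed g_above_right[OF t j(1) a n(2)]])
 next
  case False
  have yj: "\<bar>y j - t j\<bar> = 1" using lm_dir[OF t y False] by simp
  have c: "close r t y" by (rule lm_close[OF t lm_self(1) y])
  let ?y = "y(j := t j)"
  have "p t y = p t ?y **.A g ?y y" by (rule p_step_right[OF c]) (use False in simp)
  hence "p t y **.A g y (y(j := a)) = p t ?y **.A (g ?y y **.A g y (y(j := a)))" by (simp add: mult_assoc)
  also have "g ?y y **.A g y (y(j := a)) = \<zero>.A"
  proof -
   have "g ?y (?y(j := y j)) **.A g (?y(j := y j)) (?y(j := a)) = \<zero>.A"
   proof (rule g_straight'[OF j(1)])
    show "\<bar>y j - ?y j\<bar> = 1" using yj by simp
    show "a - y j = y j - ?y j" using yj j(2) n(1) by auto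
   qed
   moreover have "?y(j := y j) = y" "?y(j := a) = y(j := a)" by auto
   ultimately show ?thesis by simp
  qed
  also have "p t ?y **.A \<zero>.A = \<zero>.A" by simp
  finally show ?thesis using A.submoduleD(2)[OF IU_submodule[OF above_X]] by (simp only:)
 qed
qed

end

section \<open>The complex on the points of a cone\<close>

locale cubist_cone = cubist_algebra r I X K A g
 for r I X and K :: "'k ring" (structure) and A :: "('k, 'a, point) galgebra" (structure) and g +
 fixes z :: point
 assumes z: "z : X"
begin

text \<open>The distance from \<open>z\<close> is the homological degree. Differentials are
  therefore made of single arrows, which is what linearity asks for.\<close>

definition layer :: "nat => point set" where "layer n = {y : cone z. vdist r z y = n}"

lemma layer_X: "y : layer n ==> y : X" by (simp add: layer_def cone_def)

lemma finite_layer [simp]: "finite (layer n)"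
 by (rule finite_subset[OF _ finite_vdist[of z n]]) (auto simp: layer_def cone_def X_lattice)

lemma layer_0: "layer 0 = {z}"
proof -
 have "vdist r z z = 0" by (simp add: vdist_def)
 hence "z : layer 0" using cone_self[OF z] by (simp add: layer_def)
 moreover have "y = z" if y: "y : layer 0" for y
  by (rule vdist_0[OF X_lattice[OF layer_X[OF y]] X_lattice[OF z]]) (use y in \<open>simp add: layer_def\<close>)
 ultimately show ?thesis by blast
qed

text \<open>An element of the direct sum of the \<open>A e_y\<close>; values of the family off the
  layer are disregarded.\<close>

definition chain :: "nat => (point => 'a) => bool" where
 "chain n \<xi> \<longleftrightarrow> (ALL y:layer n. \<xi> y : lid y)"

definition bd :: "nat => (point => 'a) => point => 'a" where
 "bd n \<xi> y = (\<Oplus>.A y'\<in>layer (Suc n). \<xi> y' **.A arr y' y)"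

lemma chain_closed: "[|chain n \<xi>; y : layer n|] ==> \<xi> y : carrier A"
 using lid_carrier by (auto simp: chain_def)

lemma bd_closed [simp]: "chain (Suc n) \<xi> ==> bd n \<xi> y : carrier A"
 unfolding bd_def using chain_closed by (intro A.M.finsum_closed) auto

lemma bd_lid: assumes "chain (Suc n) \<xi>" "y : X" shows "bd n \<xi> y : lid y"
 unfolding bd_def by (rule A.submodule_finsum[OF lid_submodule]) (use assms arr_lid chain_closed in \<open>auto simp: idxA\<close>)

lemma bd_chain: "chain (Suc n) \<xi> ==> chain n (bd n \<xi>)"
 using bd_lid layer_X by (simp add: chain_def)

lemma bd_add: assumes "chain (Suc n) \<xi>" "chain (Suc n) \<eta>"
 shows "bd n (%y. \<xi> y \<oplus>.A \<eta> y) y = bd n \<xi> y \<oplus>.A bd n \<eta> y"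
proof -
 have "bd n \<xi> y \<oplus>.A bd n \<eta> y = (\<Oplus>.A y'\<in>layer (Suc n). \<xi> y' **.A arr y' y \<oplus>.A \<eta> y' **.A arr y' y)"
  unfolding bd_def by (rule A.M.finsum_addf[symmetric]) (use assms chain_closed in auto)
 also have "... = bd n (%y. \<xi> y \<oplus>.A \<eta> y) y" unfolding bd_def
  by (rule A.M.finsum_cong') (use assms chain_closed in \<open>auto simp: mult_add_left\<close>)
 finally show ?thesis ..
qed

lemma bd_left: assumes "chain (Suc n) \<xi>" "a : carrier A" shows "bd n (%y. a **.A \<xi> y) y = a **.A bd n \<xi> y"
proof -
 have "a **.A bd n \<xi> y = (\<Oplus>.A y'\<in>layer (Suc n). a **.A (\<xi> y' **.A arr y' y))"
  unfolding bd_def by (rule mult_finsum_right) (use assms chain_closed in auto)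
 also have "... = bd n (%y. a **.A \<xi> y) y" unfolding bd_def
  by (rule A.M.finsum_cong') (use assms chain_closed in \<open>auto simp: mult_assoc\<close>)
 finally show ?thesis ..
qed

lemma bd_smult: assumes "chain (Suc n) \<xi>" "c : carrier K" shows "bd n (%y. c \<odot>.A \<xi> y) y = c \<odot>.A bd n \<xi> y"
proof -
 have "c \<odot>.A bd n \<xi> y = (\<Oplus>.A y'\<in>layer (Suc n). c \<odot>.A (\<xi> y' **.A arr y' y))"
  unfolding bd_def by (rule additive_finsum[OF agA agA, of "%y. c \<odot>.A y"]) (use assms chain_closed in \<open>auto simp: A.smult_r_distr\<close>)
 also have "... = bd n (%y. c \<odot>.A \<xi> y) y" unfolding bd_def
  by (rule A.M.finsum_cong') (use assms chain_closed in \<open>auto simp: mult_smult_left\<close>)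
 finally show ?thesis ..
qed

lemma bd_diff: assumes \<xi>: "chain (Suc n) \<xi>" and \<eta>: "chain (Suc n) \<eta>"
 shows "bd n (%y. \<xi> y \<ominus>.A \<eta> y) y = bd n \<xi> y \<ominus>.A bd n \<eta> y"
proof -
 have "chain (Suc n) (%y. \<ominus>.K \<one>.K \<odot>.A \<eta> y)"
  unfolding chain_def using \<eta> A.submoduleD(4)[OF lid_submodule] layer_X by (simp add: chain_def idxA)
 hence "bd n (%y. \<xi> y \<oplus>.A \<ominus>.K \<one>.K \<odot>.A \<eta> y) y = bd n \<xi> y \<oplus>.A \<ominus>.K \<one>.K \<odot>.A bd n \<eta> y"
  using bd_add[OF \<xi>] bd_smult[OF \<eta>, of "\<ominus>.K \<one>.K"] by simp
 moreover have "bd n (%y. \<xi> y \<oplus>.A \<ominus>.K \<one>.K \<odot>.A \<eta> y) y = bd n (%y. \<xi> y \<ominus>.A \<eta> y) y"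
  unfolding bd_def by (rule A.M.finsum_cong')
   (use chain_closed[OF \<xi>] chain_closed[OF \<eta>] in \<open>auto simp: a_minus_def A.smult_l_minus\<close>)
 ultimately show ?thesis using bd_closed[OF \<eta>] by (simp add: a_minus_def A.smult_l_minus)
qed

text \<open>A nonzero path of length two from \<open>y2\<close> to \<open>y\<close> changes two
  different coordinates, as two steps in one direction vanish or return to \<open>y2\<close>. The
  only other path changes them in the opposite order and cancels the first; its middle point lies in
  the cone unless it is outside \<open>X\<close>.\<close>

lemma bd_bd_arr: assumes y2: "y2 : layer (Suc (Suc n))" and y: "y : layer n"
 shows "(\<Oplus>.A y1\<in>layer (Suc n). arr y2 y1 **.A arr y1 y) = \<zero>.A"
proof (cases "EX y1:layer (Suc n). arr y2 y1 **.A arr y1 y ~= \<zero>.A")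
 case False
 hence "(\<Oplus>.A y1\<in>layer (Suc n). arr y2 y1 **.A arr y1 y) = (\<Oplus>.A y1\<in>layer (Suc n). \<zero>.A)"
  by (intro A.M.finsum_cong') auto
 thus ?thesis by simp
next
 case True
 let ?F = "%y1. arr y2 y1 **.A arr y1 y"
 obtain y1 where y1: "y1 : layer (Suc n)" "?F y1 ~= \<zero>.A" using True by blast
 have path: "EX i j a b. i : {1..r} & j : {1..r} & i ~= j & \<bar>a - y2 i\<bar> = 1 & \<bar>b - y2 j\<bar> = 1 & v = y2(i := a) & y = y2(i := a, j := b)"
  if F: "?F v ~= \<zero>.A" for v
 proof -
  have "arr y2 v ~= \<zero>.A" "arr v y ~= \<zero>.A" using F by auto
  then obtain i d j e where v: "i : {1..r}" "\<bar>d\<bar> = 1" "v = y2(i := y2 i + d)" and yv: "j : {1..r}" "\<bar>e\<bar> = 1" "y = v(j := v j + e)"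
   using arr_adj by metis
  have "i ~= j"
  proof
   assume ij: "i = j"
   show False
   proof (cases "e = d")
    case True
    have "arr y2 (y2(i := y2 i + d)) **.A arr (y2(i := y2 i + d)) (y2(i := y2 i + d + d)) = \<zero>.A"
     by (rule arr_straight[OF v(1)]) (use v(2) in auto)
    moreover have "y = y2(i := y2 i + d + d)" using yv(3) v(3) ij True by auto
    ultimately show False using F v(3) by simp
   next
    case False
    hence "e = - d" using v(2) yv(2) by auto
    hence "y = y2" using yv(3) v(3) ij by auto
    thus False using y y2 by (simp add: layer_def)
   qed
  qed
  moreover have "y = y2(i := y2 i + d, j := y2 j + e)" using yv(3) v(3) \<open>i ~= j\<close> by auto
  ultimately show ?thesis using v yv(1,2)
   by (intro exI[of _ i] exI[of _ j] exI[of _ "y2 i + d"] exI[of _ "y2 j + e"]) simp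
 qed
 obtain i j a b where ij: "i : {1..r}" "j : {1..r}" "i ~= j" "\<bar>a - y2 i\<bar> = 1" "\<bar>b - y2 j\<bar> = 1"
  and y1e: "y1 = y2(i := a)" and ye: "y = y2(i := a, j := b)" using path[OF y1(2)] by blast
 let ?w = "y2(j := b)"
 have neg: "?F y1 = \<ominus>.A ?F ?w" unfolding y1e ye by (rule arr_square[OF ij])
 have ny: "y1 ~= ?w" using ij unfolding y1e by (auto simp: fun_eq_iff)
 have sup: "v : {y1, ?w}" if Fv: "?F v ~= \<zero>.A" for v
 proof -
  obtain k l c c' where kl: "k ~= l" "\<bar>c - y2 k\<bar> = 1" "v = y2(k := c)" "y = y2(k := c, l := c')" using path[OF Fv] by blast
  have yk: "y k = c" "y k ~= y2 k" using kl by auto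
  hence "k = i \<or> k = j" unfolding ye by (auto split: if_splits)
  thus ?thesis using yk(1) kl(3) ij(3) unfolding y1e ye by auto
 qed
 have "?F ?w ~= \<zero>.A" using y1(2) neg by auto
 hence "arr y2 ?w ~= \<zero>.A" by auto
 hence wX: "?w : X" using arr_out[of ?w y2] by blast
 \<comment> \<open>Each step changes the distance from \<open>z\<close> by one and the two together
   lower it by two, so the middle point lies in the layer between.\<close>
 have w: "?w : layer (Suc n)"
 proof -
  have "vdist r z ?w + nat \<bar>z j - y2 j\<bar> = vdist r z y2 + nat \<bar>z j - b\<bar>" by (rule vdist_upd[OF ij(2)])
  moreover have "vdist r z (?w(i := a)) + nat \<bar>z i - ?w i\<bar> = vdist r z ?w + nat \<bar>z i - a\<bar>" by (rule vdist_upd[OF ij(1)])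
  moreover have "?w(i := a) = y" unfolding ye using ij(3) by (rule fun_upd_twist[symmetric])
  moreover have "?w i = y2 i" using ij(3) by simp
  moreover have "nat \<bar>z j - b\<bar> = nat \<bar>z j - y2 j\<bar> + 1 \<or> nat \<bar>z j - y2 j\<bar> = nat \<bar>z j - b\<bar> + 1" using ij(5) by arith
  moreover have "nat \<bar>z i - a\<bar> = nat \<bar>z i - y2 i\<bar> + 1 \<or> nat \<bar>z i - y2 i\<bar> = nat \<bar>z i - a\<bar> + 1" using ij(4) by arith
  moreover have "vdist r z y = n" "vdist r z y2 = Suc (Suc n)" using y y2 unfolding layer_def by simp_all
  ultimately have "vdist r z ?w = Suc n" by (elim disjE) simp_all
  moreover have "?w : cone z"
  proof -
   have "?w k = y2 k \<or> ?w k = y k" for k unfolding ye by auto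
   hence "(k < ty z --> ?w k <= z k) & (k > ty z --> z k <= ?w k)" for k
    using y y2 unfolding layer_def cone_def mem_Collect_eq by metis
   thus ?thesis unfolding cone_def using wX by blast
  qed
  ultimately show ?thesis by (simp add: layer_def)
 qed
 have "(\<Oplus>.A v\<in>layer (Suc n). ?F v) = (\<Oplus>.A v\<in>{y1, ?w}. ?F v)"
  by (rule A.M.add.finprod_mono_neutral_cong_right) (use sup y1(1) w in auto)
 also have "... = ?F y1 \<oplus>.A ?F ?w" using ny by (simp del: fun_upd_apply)
 also have "... = \<zero>.A" unfolding neg by (simp add: A.M.l_neg)
 finally show ?thesis .
qed

lemma bd_bd: assumes \<xi>: "chain (Suc (Suc n)) \<xi>" and y: "y : layer n" shows "bd n (bd (Suc n) \<xi>) y = \<zero>.A"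
proof -
 let ?L1 = "layer (Suc n)" and ?L2 = "layer (Suc (Suc n))"
 note c = chain_closed[OF \<xi>]
 have "bd n (bd (Suc n) \<xi>) y = (\<Oplus>.A y1\<in>?L1. \<Oplus>.A y2\<in>?L2. \<xi> y2 **.A (arr y2 y1 **.A arr y1 y))"
  unfolding bd_def
 proof (rule A.M.finsum_cong'[OF refl])
  fix y1 assume "y1 : ?L1"
  have "(\<Oplus>.A y2\<in>?L2. \<xi> y2 **.A arr y2 y1) **.A arr y1 y = (\<Oplus>.A y2\<in>?L2. (\<xi> y2 **.A arr y2 y1) **.A arr y1 y)"
   by (rule mult_finsum_left) (use c in auto)
  also have "... = (\<Oplus>.A y2\<in>?L2. \<xi> y2 **.A (arr y2 y1 **.A arr y1 y))"
   by (rule A.M.finsum_cong') (use c in \<open>auto simp: mult_assoc\<close>)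
  finally show "(\<Oplus>.A y2\<in>?L2. \<xi> y2 **.A arr y2 y1) **.A arr y1 y = (\<Oplus>.A y2\<in>?L2. \<xi> y2 **.A (arr y2 y1 **.A arr y1 y))" .
 qed (use c in \<open>auto intro!: A.M.finsum_closed\<close>)
 also have "... = (\<Oplus>.A y2\<in>?L2. \<Oplus>.A y1\<in>?L1. \<xi> y2 **.A (arr y2 y1 **.A arr y1 y))"
  by (rule finsum_swap) (use c in auto)
 also have "... = (\<Oplus>.A y2\<in>?L2. \<zero>.A)"
 proof (rule A.M.finsum_cong'[OF refl])
  fix y2 assume y2: "y2 : ?L2"
  have "(\<Oplus>.A y1\<in>?L1. \<xi> y2 **.A (arr y2 y1 **.A arr y1 y)) = \<xi> y2 **.A (\<Oplus>.A y1\<in>?L1. arr y2 y1 **.A arr y1 y)"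
   by (rule mult_finsum_right[symmetric]) (use c[OF y2] in auto)
  thus "(\<Oplus>.A y1\<in>?L1. \<xi> y2 **.A (arr y2 y1 **.A arr y1 y)) = \<zero>.A" using bd_bd_arr[OF y2 y] c[OF y2] by simp
 qed simp
 finally show ?thesis by simp
qed

end

section \<open>Exactness of the complex\<close>

context cubist_cone begin

lemma arr_adjE:
 assumes "arr x y ~= \<zero>.A"
 obtains j where "j : {1..r}" "\<bar>y j - x j\<bar> = 1" "y = x(j := y j)" "x = y(j := x j)"
proof -
 obtain j d where "j : {1..r}" "\<bar>d\<bar> = 1" "y = x(j := x j + d)" using arr_adj[OF assms] by blast
 thus ?thesis using that[of j] by auto
qed

lemma arr_IU: "[|U \<subseteq> X; w : carrier A; w **.A g x y : IU U|] ==> w **.A arr x y : IU U"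
 using A.submoduleD(4)[OF IU_submodule] by (simp add: arr_def mult_smult_right)

lemma bd_IU: assumes U: "U \<subseteq> X" and \<xi>: "!!y. y : layer (Suc n) ==> \<xi> y : IU U" shows "bd n \<xi> y : IU U"
 unfolding bd_def by (rule A.submodule_finsum[OF IU_submodule[OF U]]) (rule IU_right[OF U arr_closed \<xi>])

text \<open>The tiles \<open>t \<noteq> z\<close> are removed one after the other, the lowest first.  The layer of \<open>t\<close> contributes a
  complex whose terms are indexed by the points of a tile; moving along an active coordinate \<open>j\<close> of \<open>t\<close>
  pairs them off and provides a contracting homotopy.\<close>

lemma exact_step:
 assumes U: "upset U" and t: "t : U" "t ~= z" and y0: "y0 : layer n" "y0 : lm t"
  and min: "!!u y. [|u : U; y : layer n; y : lm u; (u, t) : leq|] ==> u = t"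
  and W: "W = {u : U. (u, t) ~: leq}"
  and \<xi>: "chain n \<xi>" "!!y. y : layer n ==> \<xi> y : IU U"
  and ker: "!!m y. [|n = Suc m; y : layer m|] ==> bd m \<xi> y = \<zero>.A"
 shows "EX \<eta>. chain (Suc n) \<eta> & (ALL y:layer n. \<xi> y \<ominus>.A bd n \<eta> y : IU W)"
proof -
 have UX: "U \<subseteq> X" and WX: "W \<subseteq> X" using U W by (auto simp: upset_def)
 have tX: "t : X" using t UX by auto
 have aW: "above t \<subseteq> W" using U t leq_antisym unfolding W upset_def above_def by blast
 have uW: "upset W" using U leq_trans unfolding W upset_def by blast
 have tW: "t ~: W" using leq_refl[OF tX] by (simp add: W)
 have skip: "v : IU W" if "y : layer n" "y ~: lm t" "v : IU U" "v : lid y" for v y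
  by (rule layer_skip[OF U WX layer_X[OF that(1)] _ that(3,4)]) (use min[OF _ that(1)] that(2) W in auto)
 have dec: "EX w:lid t. v \<ominus>.A w **.A p t y : IU W" if "y : layer n" "y : lm t" "v : IU U" "v : lid y" for v y
  by (rule layer_decomp[OF U WX tX that(2) _ that(3,4)]) (use min[OF _ that(1)] W in auto)
 have "y0 : cone z" using y0(1) by (simp add: layer_def)
 then obtain j where act: "active z t j" using active_ex[OF z tX t(2) _ y0(2)] by blast
 note aj = active_opp[OF tX act]
 let ?o = "opp t j"
 have ne: "?o ~= t j" using aj(3) by auto
 note DW = A.submoduleD[OF IU_submodule[OF WX]] and DU = A.submoduleD[OF IU_submodule[OF UX]]
 have IWU: "IU W \<subseteq> IU U" by (rule IU_mono[OF _ UX]) (auto simp: W)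
 have vd: "vdist r z (y(j := t j)) = Suc (vdist r z (y(j := ?o)))" if "y : lm t" for y
 proof -
  have "vdist r z (y(j := t j)) + nat \<bar>z j - y j\<bar> = vdist r z y + nat \<bar>z j - t j\<bar>"
   "vdist r z (y(j := ?o)) + nat \<bar>z j - y j\<bar> = vdist r z y + nat \<bar>z j - ?o\<bar>" using vdist_upd[OF aj(1)] by blast+
  moreover have "nat \<bar>z j - t j\<bar> = Suc (nat \<bar>z j - ?o\<bar>)" using aj(4) by simp
  ultimately show ?thesis by simp
 qed
 have far: "y(j := t j) : layer (Suc n)" "y(j := t j) : lm t" if "y : layer n" "y : lm t" "y j = ?o" for y
 proof -
  have "y(j := ?o) = y" using that(3) by auto
  thus "y(j := t j) : layer (Suc n)" using vd[OF that(2)] that(1) active_cone[OF tX act that(2), of "t j"] by (simp add: layer_def)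
  show "y(j := t j) : lm t" by (rule active_lm[OF that(2)]) simp
 qed
 have near: "y(j := ?o) : layer m" "y(j := ?o) : lm t" if "y : layer (Suc m)" "y : lm t" "y j = t j" for y m
 proof -
  have "y(j := t j) = y" using that(3) by auto
  thus "y(j := ?o) : layer m" using vd[OF that(2)] that(1) active_cone[OF tX act that(2), of ?o] by (simp add: layer_def)
  show "y(j := ?o) : lm t" by (rule active_lm[OF that(2)]) simp
 qed
 have oj: "y j = t j \<or> y j = ?o" if "y : lm t" for y using lm_dir[OF tX that, of j] by auto
 have stay: "p t y **.A arr y (y(j := ?o)) = ksign K (qexp r y (y(j := ?o))) \<odot>.A p t (y(j := ?o))"
  if "y : lm t" "y j = t j" for y
  using right_stay[OF tX that(1) active_lm[OF that(1)] that(2) ne] unfolding arr_def by (simp add: mult_smult_right)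
 have leave: "w **.A p t y **.A arr y y' : IU W" if w: "w : carrier A" and y: "y : lm t" and y': "y' ~: lm t" for w y y'
 proof (cases "arr y y' = \<zero>.A")
  case True thus ?thesis using DW(2) w by simp
 next
  case False
  then obtain k where k: "k : {1..r}" "\<bar>y' k - y k\<bar> = 1" "y' = y(k := y' k)" by (rule arr_adjE)
  have "p t y **.A g y (y(k := y' k)) : IU (above t)" by (rule right_leave[OF tX y k(1,2)]) (use y' k(3) in simp)
  hence "p t y **.A g y y' : IU (above t)" unfolding k(3)[symmetric] .
  hence "p t y **.A g y y' : IU W" using IU_mono[OF aW WX] by blast
  hence "p t y **.A arr y y' : IU W" by (rule arr_IU[OF WX p_closed])
  hence "w **.A (p t y **.A arr y y') : IU W" by (rule IU_left[OF WX w])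
  thus ?thesis using w by (simp add: mult_assoc)
 qed
 have "ALL y. EX w. y : layer n & y : lm t --> w : lid t & \<xi> y \<ominus>.A w **.A p t y : IU W"
  using dec \<xi> unfolding chain_def by metis
 then obtain w where w: "!!y. [|y : layer n; y : lm t|] ==> w y : lid t"
  "!!y. [|y : layer n; y : lm t|] ==> \<xi> y \<ominus>.A w y **.A p t y : IU W" by metis
 \<comment> \<open>The homotopy puts the coefficient of the near point on the far point, with
   \<open>j\<close>th coordinate \<open>t j\<close>. Its sign equals that of the arrow between them,
   so that the two signs cancel in the boundary.\<close>
 define \<eta> where "\<eta> y = (if y : layer (Suc n) & y : lm t & y j = t j
  then ksign K (qexp r y (y(j := ?o))) \<odot>.A (w (y(j := ?o)) **.A p t y) else \<zero>.A)" for y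
 have wc: "w (y(j := ?o)) : carrier A" if "y : layer (Suc n)" "y : lm t" "y j = t j" for y
  using w(1)[OF near[OF that]] lid_carrier by blast
 have \<eta>c: "chain (Suc n) \<eta>" unfolding chain_def
 proof
  fix y assume y: "y : layer (Suc n)"
  have yi: "y : idx A" using layer_X[OF y] by (simp add: idxA)
  have pl: "p t y : lid y" using p_right[OF layer_X[OF y], of t] by (simp add: lid_def)
  show "\<eta> y : lid y"
  proof (cases "y : lm t & y j = t j")
   case True
   hence "w (y(j := ?o)) **.A p t y : lid y" using lid_left[OF yi pl wc[OF y]] by blast
   thus ?thesis using True y A.submoduleD(4)[OF lid_submodule[OF yi]] by (simp add: \<eta>_def)
  qed (use A.submoduleD(2)[OF lid_submodule[OF yi]] in \<open>auto simp: \<eta>_def\<close>)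
 qed
 have \<eta>U: "\<eta> y : IU U" for y
 proof (cases "y : layer (Suc n) & y : lm t & y j = t j")
  case True
  hence "w (y(j := ?o)) **.A p t y : IU U" using layer_through[OF UX tX t(1) _ wc] by blast
  thus ?thesis using True DU(4) by (simp add: \<eta>_def)
 qed (use DU(2) in \<open>auto simp: \<eta>_def\<close>)
 define \<zeta> where "\<zeta> y = \<xi> y \<ominus>.A bd n \<eta> y" for y
 have \<zeta>c: "chain n \<zeta>" unfolding chain_def \<zeta>_def
  using \<xi>(1) bd_chain[OF \<eta>c] A.submoduleD(6)[OF lid_submodule] layer_X by (simp add: chain_def idxA)
 have \<zeta>U: "\<zeta> y : IU U" if "y : layer n" for y
  unfolding \<zeta>_def by (intro DU(6) \<xi>(2) that bd_IU[OF UX \<eta>U])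
 have out: "\<zeta> y : IU W" if "y : layer n" "y ~: lm t" for y
  by (rule skip[OF that \<zeta>U[OF that(1)]]) (use \<zeta>c that in \<open>simp add: chain_def\<close>)
 \<comment> \<open>Only the far neighbour contributes to the boundary of \<open>\<eta>\<close> at a
   near point, so subtracting it removes the layer of \<open>t\<close> there exactly.\<close>
 have nearW: "\<zeta> y : IU W" if y: "y : layer n" "y : lm t" "y j = ?o" for y
 proof -
  let ?f = "y(j := t j)"
  note F = far[OF y]
  have fj: "?f j = t j" by simp
  have fo: "?f(j := ?o) = y" using y(3) by auto
  have "bd n \<eta> y = (\<Oplus>.A y'\<in>{?f}. \<eta> y' **.A arr y' y)"
   unfolding bd_def
  proof (rule A.M.add.finprod_mono_neutral_cong_right)
   fix y' assume y': "y' : layer (Suc n) - {?f}"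
   show "\<eta> y' **.A arr y' y = \<zero>.A"
   proof (cases "y' j = t j & arr y' y ~= \<zero>.A")
    case True
    then obtain k where k: "y' = y(k := y' k)" using arr_adjE by metis
    have "y' j ~= y j" using True y(3) ne by simp
    hence "k = j" using fun_cong[OF k, of j] by (auto split: if_splits)
    hence "y' = ?f" using k True by simp
    thus ?thesis using y' by simp
   next
    case False
    thus ?thesis using chain_closed[OF \<eta>c, of y'] y' by (auto simp: \<eta>_def)
   qed
  qed (use F chain_closed[OF \<eta>c] in auto)
  also have "... = \<eta> ?f **.A arr ?f y" using chain_closed[OF \<eta>c F(1)] by simp
  also have "... = (ksign K (qexp r ?f y) \<odot>.A (w y **.A p t ?f)) **.A arr ?f y"
  proof -
   have "\<eta> ?f = ksign K (qexp r ?f y) \<odot>.A (w y **.A p t ?f)" unfolding \<eta>_def fo using F by simp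
   thus ?thesis by (simp only:)
  qed
  also have "... = ksign K (qexp r ?f y) \<odot>.A (w y **.A (p t ?f **.A arr ?f y))"
   using lid_carrier[OF w(1)[OF y(1,2)]] by (simp add: mult_smult_left mult_assoc del: fun_upd_apply)
  also have "p t ?f **.A arr ?f y = ksign K (qexp r ?f y) \<odot>.A p t y"
   using stay[OF F(2) fj] unfolding fo .
  also have "ksign K (qexp r ?f y) \<odot>.A (w y **.A (ksign K (qexp r ?f y) \<odot>.A p t y)) = w y **.A p t y"
   using lid_carrier[OF w(1)[OF y(1,2)]] by (simp add: mult_smult_right A.smult_assoc1[symmetric] ksign_square del: fun_upd_apply)
  finally show ?thesis using w(2)[OF y(1,2)] by (simp add: \<zeta>_def)
 qed
 \<comment> \<open>At a far point the cycle condition takes over. In the boundary of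
   \<open>\<zeta>\<close> at the near neighbour \<open>?v\<close> all other terms are already in the
   ideal of \<open>W\<close>, hence so is this one, and \<open>layer_inj\<close> carries the
   conclusion back to the coefficient.\<close>
 have farW: "\<zeta> y : IU W" if y: "y : layer n" "y : lm t" "y j = t j" for y
 proof -
  have "y(j := t j) = y" using y(3) by auto
  hence "n = Suc (vdist r z (y(j := ?o)))" using vd[OF y(2)] y(1) by (simp add: layer_def)
  then obtain m where m: "n = Suc m" by blast
  let ?v = "y(j := ?o)"
  have N: "?v : layer m" "?v : lm t" using near[of y m] y m by auto
  have vj: "?v j = ?o" by simp
  have \<zeta>s: "chain (Suc m) \<zeta>" using \<zeta>c m by simp
  have "bd m \<zeta> ?v = bd m \<xi> ?v \<ominus>.A bd m (bd n \<eta>) ?v"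
   unfolding \<zeta>_def by (rule bd_diff) (use \<xi>(1) bd_chain[OF \<eta>c] m in auto)
  also have "... = \<zero>.A \<ominus>.A \<zero>.A"
   using ker[OF m N(1)] bd_bd[of m \<eta> ?v] \<eta>c N(1) m by (simp del: fun_upd_apply)
  finally have k0: "bd m \<zeta> ?v = \<zero>.A" by (simp add: a_minus_def)
  have rest: "(\<Oplus>.A y'\<in>layer n - {y}. \<zeta> y' **.A arr y' ?v) : IU W"
  proof (rule A.submodule_finsum[OF IU_submodule[OF WX]])
   fix y' assume y': "y' : layer n - {y}"
   show "\<zeta> y' **.A arr y' ?v : IU W"
   proof (cases "arr y' ?v = \<zero>.A \<or> y' ~: lm t \<or> y' j = ?o")
    case True
    hence "arr y' ?v = \<zero>.A \<or> \<zeta> y' : IU W" using out nearW y' by blast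
    thus ?thesis using IU_right[OF WX arr_closed] DW(2) chain_closed[OF \<zeta>c, of y'] y' by auto
   next
    case False
    then obtain k where k: "y' = ?v(k := y' k)" using arr_adjE by metis
    have y'j: "y' j = t j" using False oj by blast
    hence "k = j" using fun_cong[OF k, of j] ne by (auto split: if_splits)
    hence "y' = y" using k y'j y(3) by auto
    thus ?thesis using y' by simp
   qed
  qed
  have yc: "\<zeta> y : carrier A" by (rule chain_closed[OF \<zeta>c y(1)])
  have rc: "(\<Oplus>.A y'\<in>layer n - {y}. \<zeta> y' **.A arr y' ?v) : carrier A" using rest DW(1) by blast
  have "bd m \<zeta> ?v = (\<Oplus>.A y'\<in>insert y (layer n - {y}). \<zeta> y' **.A arr y' ?v)"
   unfolding bd_def m[symmetric] using y(1) by (simp only: insert_Diff)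
  also have "... = \<zeta> y **.A arr y ?v \<oplus>.A (\<Oplus>.A y'\<in>layer n - {y}. \<zeta> y' **.A arr y' ?v)"
   by (rule A.M.finsum_insert) (use chain_closed[OF \<zeta>c] y(1) in auto)
  finally have "\<zeta> y **.A arr y ?v \<oplus>.A (\<Oplus>.A y'\<in>layer n - {y}. \<zeta> y' **.A arr y' ?v) = \<zero>.A" using k0 by simp
  hence "\<zeta> y **.A arr y ?v = \<ominus>.A (\<Oplus>.A y'\<in>layer n - {y}. \<zeta> y' **.A arr y' ?v)"
   using rc yc by (intro A.M.minus_equality[symmetric]) (simp_all add: A.M.a_comm del: fun_upd_apply)
  hence 1: "\<zeta> y **.A arr y ?v : IU W" using DW(5)[OF rest] by (simp only:)
  have "\<zeta> y : lid y" using \<zeta>c y(1) by (simp add: chain_def)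
  then obtain w' where w': "w' : lid t" "\<zeta> y \<ominus>.A w' **.A p t y : IU W" using dec[OF y(1,2) \<zeta>U[OF y(1)]] by blast
  have w'c: "w' : carrier A" by (rule lid_carrier[OF w'(1)])
  let ?s = "ksign K (qexp r y ?v)"
  have "(\<zeta> y \<ominus>.A w' **.A p t y) **.A arr y ?v = \<zeta> y **.A arr y ?v \<ominus>.A w' **.A (p t y **.A arr y ?v)"
   using yc w'c mult_minus_left[of "\<zeta> y" "w' **.A p t y" "arr y ?v"] by (simp add: mult_assoc del: fun_upd_apply)
  also have "p t y **.A arr y ?v = ?s \<odot>.A p t ?v" by (rule stay[OF y(2,3)])
  finally have "\<zeta> y **.A arr y ?v \<ominus>.A w' **.A (?s \<odot>.A p t ?v) : IU W" using IU_right[OF WX arr_closed w'(2), of y ?v] by (simp only:)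
  from DW(6)[OF 1 this] have "w' **.A (?s \<odot>.A p t ?v) : IU W"
   using yc w'c by (simp add: a_minus_def A.M.minus_add A.M.a_assoc[symmetric] A.M.r_neg del: fun_upd_apply)
  from DW(4)[OF ksign_closed[of "qexp r y ?v"] this] have "w' **.A p t ?v : IU W"
   using w'c by (simp add: mult_smult_right A.smult_assoc1[symmetric] ksign_square del: fun_upd_apply)
  hence "w' : IU (above t)" by (rule layer_inj[OF uW aW tX tW N(2) w'(1)])
  hence "w' : IU W" using IU_mono[OF aW WX] by blast
  hence "w' **.A p t y : IU W" by (rule IU_right[OF WX p_closed])
  from DW(3)[OF w'(2) this] show ?thesis using yc w'c by (simp add: a_minus_def A.M.a_assoc A.M.l_neg)
 qed
 have "\<zeta> y : IU W" if "y : layer n" for y using out nearW farW oj that by blast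
 thus ?thesis using \<eta>c unfolding \<zeta>_def by blast
qed

text \<open>\<open>exact_step\<close> is repeated until no tile of \<open>U\<close> meets the layer;
  a chain with values in the ideal of such an upset is zero. The hypothesis on \<open>z\<close>
  excludes its own tile, which has no active coordinate.\<close>

lemma exact:
 assumes U: "upset U" and nz: "!!y. y : layer n ==> y : lm z ==> z ~: U"
  and \<xi>: "chain n \<xi>" "!!y. y : layer n ==> \<xi> y : IU U"
  and ker: "!!m y. [|n = Suc m; y : layer m|] ==> bd m \<xi> y = \<zero>.A"
 shows "EX \<eta>. chain (Suc n) \<eta> & (ALL y:layer n. \<xi> y = bd n \<eta> y)"
 using assms
proof (induction "card {t : U. EX y:layer n. y : lm t}" arbitrary: U \<xi> rule: less_induct)
 case less
 let ?T = "%U. {t : U. EX y:layer n. y : lm t}"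
 have UX: "U \<subseteq> X" using less.prems(1) by (simp add: upset_def)
 have fin: "finite (?T U)"
  by (rule finite_subset[of _ "\<Union>y\<in>layer n. {t : X. y : lm t}"]) (use UX finite_tiles in auto)
 show ?case
 proof (cases "?T U = {}")
  case True
  have z0: "submodule {\<zero>.A} K A" by (rule A.submoduleI') auto
  have "\<xi> y = \<zero>.A" if y: "y : layer n" for y
  proof -
   have "\<xi> y : {\<zero>.A}"
    by (rule IU_elim_left[OF less.prems(1) layer_X[OF y] z0 _ less.prems(4)[OF y]])
     (use True y less.prems(3) in \<open>auto simp: chain_def\<close>)
   thus ?thesis by simp
  qed
  moreover have "bd n (%_. \<zero>.A) y = \<zero>.A" for y by (simp add: bd_def)
  moreover have "chain (Suc n) (%_. \<zero>.A)"
   unfolding chain_def using A.submoduleD(2)[OF lid_submodule] layer_X by (simp add: idxA)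
  ultimately show ?thesis by (intro exI[of _ "%_. \<zero>.A"]) simp
 next
  case False
  obtain t where t: "t : ?T U" and min: "!!u. u : ?T U ==> (u, t) : leq ==> u = t"
   by (rule minimal_ex[OF fin False]) (use UX in blast)+
  obtain y0 where y0: "y0 : layer n" "y0 : lm t" using t by blast
  have tU: "t : U" "t : X" using t UX by auto
  have tz: "t ~= z" using less.prems(2) y0 tU by blast
  define W where "W = {u : U. (u, t) ~: leq}"
  have uW: "upset W" using less.prems(1) leq_trans unfolding W_def upset_def by blast
  have WX: "W \<subseteq> X" using UX by (auto simp: W_def)
  obtain \<eta> where \<eta>: "chain (Suc n) \<eta>" "ALL y:layer n. \<xi> y \<ominus>.A bd n \<eta> y : IU W"
   using exact_step[OF less.prems(1) tU(1) tz y0 _ W_def less.prems(3-5)] min by blast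
  define \<zeta> where "\<zeta> y = \<xi> y \<ominus>.A bd n \<eta> y" for y
  have \<zeta>c: "chain n \<zeta>" unfolding chain_def \<zeta>_def
   using less.prems(3) bd_chain[OF \<eta>(1)] A.submoduleD(6)[OF lid_submodule] layer_X by (simp add: chain_def idxA)
  have "?T W \<subseteq> ?T U" by (auto simp: W_def)
  moreover have "t ~: ?T W" using leq_refl[OF tU(2)] by (simp add: W_def)
  ultimately have "?T W \<subset> ?T U" using t by blast
  hence lt: "card (?T W) < card (?T U)" by (rule psubset_card_mono[OF fin])
  have "EX \<eta>'. chain (Suc n) \<eta>' & (ALL y:layer n. \<zeta> y = bd n \<eta>' y)"
  proof (rule less.hyps[OF lt uW _ \<zeta>c])
   show "z ~: W" if "y : layer n" "y : lm z" for y using less.prems(2)[OF that] by (simp add: W_def)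
   show "\<zeta> y : IU W" if "y : layer n" for y using \<eta>(2) that by (simp add: \<zeta>_def)
   fix m y assume m: "n = Suc m" and y: "y : layer m"
   have "bd m \<zeta> y = bd m \<xi> y \<ominus>.A bd m (bd n \<eta>) y"
    unfolding \<zeta>_def by (rule bd_diff) (use less.prems(3) bd_chain[OF \<eta>(1)] m in auto)
   also have "... = \<zero>.A \<ominus>.A \<zero>.A" using less.prems(5)[OF m y] bd_bd[of m \<eta> y] \<eta>(1) y m by simp
   finally show "bd m \<zeta> y = \<zero>.A" by (simp add: a_minus_def)
  qed
  then obtain \<eta>' where \<eta>': "chain (Suc n) \<eta>'" "ALL y:layer n. \<zeta> y = bd n \<eta>' y" by blast
  have "chain (Suc n) (%y. \<eta>' y \<oplus>.A \<eta> y)"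
   unfolding chain_def using \<eta>(1) \<eta>'(1) A.submoduleD(3)[OF lid_submodule] layer_X by (simp add: chain_def idxA)
  moreover have "\<xi> y = bd n (%y. \<eta>' y \<oplus>.A \<eta> y) y" if y: "y : layer n" for y
  proof -
   have "bd n (%y. \<eta>' y \<oplus>.A \<eta> y) y = (\<xi> y \<ominus>.A bd n \<eta> y) \<oplus>.A bd n \<eta> y"
    using bd_add[OF \<eta>'(1) \<eta>(1), of y] \<eta>'(2) y by (simp add: \<zeta>_def)
   also have "... = \<xi> y" using chain_closed[OF less.prems(3) y] bd_closed[OF \<eta>(1), of y]
    by (simp add: a_minus_def A.M.a_assoc A.M.l_neg)
   finally show ?thesis ..
  qed
  ultimately show ?thesis by blast
 qed
qed

text \<open>Each point of the layer occurs once as an index, so the second component, which counts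
  repetitions, is always \<open>0\<close>.\<close>

abbreviation (input) index :: "nat => (point \<times> nat) set" where "index n \<equiv> layer n \<times> {0}"

definition res_proj :: "nat => ('k, 'a, point \<times> nat => 'a) gmodule" where
 "res_proj n = dsum_mod (index n) (%j. shift_mod (proj_mod A (fst j)) (int n))"

definition res_diff :: "nat => (point \<times> nat => 'a) => point \<times> nat => 'a" where
 "res_diff n f = (\<lambda>j\<in>index n. bd n (%y. f (y, 0)) (fst j))"

definition res_aug :: "(point \<times> nat => 'a) => 'a set" where
 "res_aug f = std_kernel A leq z +>.A f (z, 0)"

lemma index_ok: "finite (index n)" "fst ` index n \<subseteq> idx A"
 using layer_X by (auto simp: idxA)

lemmas res_simps = dsum_proj_simps[where n = "int n" and J = "index n" and v = fst, OF index_ok, folded res_proj_def] for n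

lemma res_carrier: "f : carrier (res_proj n) \<longleftrightarrow> f : extensional (index n) & chain n (%y. f (y, 0))"
 unfolding res_simps(1) by (auto simp: PiE_def Pi_def chain_def)

lemma res_chain: "f : carrier (res_proj n) ==> chain n (%y. f (y, 0))"
 by (simp add: res_carrier)

lemma res_eqI: "[|f : extensional (index n); h : extensional (index n); !!y. y : layer n ==> f (y, 0) = h (y, 0)|] ==> f = h"
 by (rule extensionalityI) auto

lemma bd_cong: "[|chain (Suc n) \<eta>; !!y. y : layer (Suc n) ==> \<xi> y = \<eta> y|] ==> bd n \<xi> y = bd n \<eta> y"
 unfolding bd_def using chain_closed by (intro A.M.finsum_cong') auto

lemma res_diff_hom: "res_diff n : mod_hom K A (res_proj (Suc n)) (res_proj n)"
 unfolding mod_hom_def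
proof (intro CollectI conjI ballI allI)
 show "res_diff n : carrier (res_proj (Suc n)) \<rightarrow> carrier (res_proj n)"
 proof
  fix f assume "f : carrier (res_proj (Suc n))"
  from bd_chain[OF res_chain[OF this]] show "res_diff n f : carrier (res_proj n)"
   unfolding res_carrier by (simp add: res_diff_def chain_def)
 qed
next
 fix f h assume fh: "f : carrier (res_proj (Suc n))" "h : carrier (res_proj (Suc n))"
 have c: "chain (Suc n) (%y. f (y, 0) \<oplus>.A h (y, 0))"
  unfolding chain_def using res_chain[OF fh(1)] res_chain[OF fh(2)] A.submoduleD(3)[OF lid_submodule] layer_X
  by (simp add: chain_def idxA)
 show "res_diff n (f \<oplus>\<^bsub>res_proj (Suc n)\<^esub> h) = res_diff n f \<oplus>\<^bsub>res_proj n\<^esub> res_diff n h"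
  unfolding res_simps(2)
 proof (rule res_eqI)
  fix y assume y: "y : layer n"
  have "bd n (%y. (\<lambda>j\<in>index (Suc n). f j \<oplus>.A h j) (y, 0)) y = bd n (%y. f (y, 0) \<oplus>.A h (y, 0)) y"
   by (rule bd_cong[OF c]) simp
  also have "... = bd n (%y. f (y, 0)) y \<oplus>.A bd n (%y. h (y, 0)) y" by (rule bd_add[OF res_chain[OF fh(1)] res_chain[OF fh(2)]])
  finally show "res_diff n (\<lambda>j\<in>index (Suc n). f j \<oplus>.A h j) (y, 0) = (\<lambda>j\<in>index n. res_diff n f j \<oplus>.A res_diff n h j) (y, 0)"
   using y by (simp add: res_diff_def)
 qed (simp_all add: res_diff_def)
next
 fix c f assume cf: "c : carrier K" "f : carrier (res_proj (Suc n))"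
 have ch: "chain (Suc n) (%y. c \<odot>.A f (y, 0))"
  unfolding chain_def using res_chain[OF cf(2)] cf(1) A.submoduleD(4)[OF lid_submodule] layer_X
  by (simp add: chain_def idxA)
 show "res_diff n (c \<odot>\<^bsub>res_proj (Suc n)\<^esub> f) = c \<odot>\<^bsub>res_proj n\<^esub> res_diff n f"
  unfolding res_simps(4)
 proof (rule res_eqI)
  fix y assume y: "y : layer n"
  have "bd n (%y. (\<lambda>j\<in>index (Suc n). c \<odot>.A f j) (y, 0)) y = bd n (%y. c \<odot>.A f (y, 0)) y"
   by (rule bd_cong[OF ch]) simp
  also have "... = c \<odot>.A bd n (%y. f (y, 0)) y" by (rule bd_smult[OF res_chain[OF cf(2)] cf(1)])
  finally show "res_diff n (\<lambda>j\<in>index (Suc n). c \<odot>.A f j) (y, 0) = (\<lambda>j\<in>index n. c \<odot>.A res_diff n f j) (y, 0)"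
   using y by (simp add: res_diff_def)
 qed (simp_all add: res_diff_def)
next
 fix a f assume af: "a : carrier A" "f : carrier (res_proj (Suc n))"
 have ch: "chain (Suc n) (%y. a **.A f (y, 0))"
  unfolding chain_def using res_chain[OF af(2)] af(1) lid_left layer_X by (simp add: chain_def idxA)
 show "res_diff n (act (res_proj (Suc n)) a f) = act (res_proj n) a (res_diff n f)"
  unfolding res_simps(5)
 proof (rule res_eqI)
  fix y assume y: "y : layer n"
  have "bd n (%y. (\<lambda>j\<in>index (Suc n). a **.A f j) (y, 0)) y = bd n (%y. a **.A f (y, 0)) y"
   by (rule bd_cong[OF ch]) simp
  also have "... = a **.A bd n (%y. f (y, 0)) y" by (rule bd_left[OF res_chain[OF af(2)] af(1)])
  finally show "res_diff n (\<lambda>j\<in>index (Suc n). a **.A f j) (y, 0) = (\<lambda>j\<in>index n. a **.A res_diff n f j) (y, 0)"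
   using y by (simp add: res_diff_def)
 qed (simp_all add: res_diff_def)
next
 fix i
 show "res_diff n ` mgrade (res_proj (Suc n)) i \<subseteq> mgrade (res_proj n) i"
 proof (rule image_subsetI)
  fix f assume f: "f : mgrade (res_proj (Suc n)) i"
  have fc: "f : carrier (res_proj (Suc n))" and fg: "f (y, 0) : zgrade (i - int (Suc n))" if "y : layer (Suc n)" for y
   using f that unfolding res_simps(1,6) by auto
  have fc: "f : carrier (res_proj (Suc n))" using f unfolding res_simps(1,6) by simp
  have "bd n (%y. f (y, 0)) y : zgrade (i - int n)" for y
   unfolding bd_def
  proof (rule A.submodule_finsum[OF zgrade_submodule])
   fix y' assume y': "y' : layer (Suc n)"
   show "f (y', 0) **.A arr y' y : zgrade (i - int n)"
   proof (cases "i - int (Suc n) < 0")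
    case True
    hence "f (y', 0) = \<zero>.A" using fg[OF y'] by (simp add: zgrade_def)
    thus ?thesis using A.submoduleD(2)[OF zgrade_submodule] by simp
   next
    case False
    hence e: "nat (i - int (Suc n)) + 1 = nat (i - int n)" "\<not> i - int n < 0" by auto
    have "f (y', 0) : agrade A (nat (i - int (Suc n)))" using fg[OF y'] False by (simp add: zgrade_def)
    from agrade_mult[OF this arr_grade[of y' y]] show ?thesis unfolding e(1) using e(2) by (simp add: zgrade_def)
   qed
  qed
  moreover have "res_diff n f : carrier (res_proj n)"
   using bd_chain[OF res_chain[OF fc]] unfolding res_carrier by (simp add: res_diff_def chain_def)
  ultimately show "res_diff n f : mgrade (res_proj n) i" unfolding res_simps(1,6) by (auto simp: res_diff_def)
 qed
qed

lemma kernel_props: "submodule (std_kernel A leq z) K A" "!!a x. [|a : carrier A; x : std_kernel A leq z|] ==> a **.A x : std_kernel A leq z"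
 using IU_lid_ideal[OF above_X z] unfolding std_kernel_eq[OF z] homog_left_ideal_def by blast+

lemma z_layer: "z : layer 0" by (simp add: layer_0)

lemma aug_lid: "f : carrier (res_proj 0) ==> f (z, 0) : lid z"
 using res_chain z_layer by (auto simp: chain_def)

lemma std_carrier: "carrier (std_mod A leq z) = (%x. std_kernel A leq z +>.A x) ` lid z"
 unfolding std_mod_def by (rule quot_carrier(2)) (simp add: idxA z)

lemma res_aug_hom: "res_aug : mod_hom K A (res_proj 0) (std_mod A leq z)"
 unfolding mod_hom_def
proof (intro CollectI conjI ballI allI)
 note Q = quot_ops[where s = z, OF disjI1[OF refl] kernel_props(1), folded std_mod_def]
 have zi: "(z, 0) : index 0" using z_layer by simp
 note c = lid_carrier[OF aug_lid]
 show "res_aug : carrier (res_proj 0) \<rightarrow> carrier (std_mod A leq z)"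
  unfolding std_carrier res_aug_def using aug_lid by blast
 show "res_aug (f \<oplus>\<^bsub>res_proj 0\<^esub> h) = res_aug f \<oplus>\<^bsub>std_mod A leq z\<^esub> res_aug h" if "f : carrier (res_proj 0)" "h : carrier (res_proj 0)" for f h
  unfolding res_aug_def res_simps(2) using zi Q(1)[OF kernel_props(2) c[OF that(1)] c[OF that(2)]] by simp
 show "res_aug (k \<odot>\<^bsub>res_proj 0\<^esub> f) = k \<odot>\<^bsub>std_mod A leq z\<^esub> res_aug f" if "k : carrier K" "f : carrier (res_proj 0)" for k f
  unfolding res_aug_def res_simps(4) using zi Q(2)[OF kernel_props(2) c[OF that(2)] c[OF that(2)] that(1)] by simp
 show "res_aug (act (res_proj 0) a f) = act (std_mod A leq z) a (res_aug f)" if "a : carrier A" "f : carrier (res_proj 0)" for a f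
  unfolding res_aug_def res_simps(5) using zi Q(3)[OF kernel_props(2) c[OF that(2)] c[OF that(2)] that(1)] by simp
 show "res_aug ` mgrade (res_proj 0) i \<subseteq> mgrade (std_mod A leq z) i" for i
 proof (rule image_subsetI)
  fix f assume f: "f : mgrade (res_proj 0) i"
  have "f (z, 0) : zgrade i" using f zi unfolding res_simps(6) by auto
  moreover have "f (z, 0) : lid z" by (rule aug_lid) (use f in \<open>simp add: res_simps(1,6)\<close>)
  ultimately have "f (z, 0) : zgrade i \<inter> lid z" ..
  thus "res_aug f : mgrade (std_mod A leq z) i"
   unfolding res_aug_def std_mod_def quot_mod_def using proj_grade[of z i] z by (simp add: idxA coset_proj)
 qed
qed

text \<open>A neighbour of \<open>z\<close> in the cone is not in the tile of \<open>z\<close>, so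
  its arrow to \<open>z\<close> lies in the ideal of \<open>above z\<close>.\<close>

lemma bd_kernel: assumes "chain 1 \<xi>" shows "bd 0 \<xi> z : IU (above z)"
 unfolding bd_def
proof (rule A.submodule_finsum[OF IU_submodule[OF above_X]])
 fix y assume y: "y : layer (Suc 0)"
 show "\<xi> y **.A arr y z : IU (above z)"
 proof (cases "arr y z = \<zero>.A")
  case True
  thus ?thesis using chain_closed[OF assms, of y] y A.submoduleD(2)[OF IU_submodule[OF above_X]] by simp
 next
  case False
  then obtain j where j: "j : {1..r}" "\<bar>z j - y j\<bar> = 1" "y = z(j := y j)" by (rule arr_adjE)
  have "y ~: lm z"
  proof
   assume "y : lm z"
   hence "y = z" using cone_lm[OF z] y by (simp add: layer_def)
   thus False using j(2) by simp
  qed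
  hence "y j ~= opp z j" using lm_upd_mem[OF z lm_self(1) j(3)] by simp
  hence "g (z(j := y j)) z : IU (above z)" using g_above_left[OF z j(1)] j(2) by (simp add: abs_minus_commute)
  hence "g y z : IU (above z)" unfolding j(3)[symmetric] .
  hence "arr y z : IU (above z)" unfolding arr_def by (rule A.submoduleD(4)[OF IU_submodule[OF above_X] ksign_closed])
  thus ?thesis using IU_left[OF above_X _] chain_closed[OF assms, of y] y by simp
 qed
qed

lemma res_diff_image:
 assumes f: "f : carrier (res_proj n)" and \<eta>: "chain (Suc n) \<eta>" "!!y. y : layer n ==> f (y, 0) = bd n \<eta> y"
 shows "f : res_diff n ` carrier (res_proj (Suc n))"
proof
 let ?h = "\<lambda>j\<in>index (Suc n). \<eta> (fst j)"
 show "?h : carrier (res_proj (Suc n))" using \<eta>(1) unfolding res_carrier by (simp add: chain_def)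
 show "f = res_diff n ?h"
 proof (rule res_eqI)
  fix y assume y: "y : layer n"
  have "bd n (%y. ?h (y, 0)) y = bd n \<eta> y" by (rule bd_cong[OF \<eta>(1)]) simp
  thus "f (y, 0) = res_diff n ?h (y, 0)" using \<eta>(2)[OF y] y by (simp add: res_diff_def)
 qed (use f in \<open>auto simp: res_carrier res_diff_def\<close>)
qed

lemma res_exact_0: "res_diff 0 ` carrier (res_proj 1) = a_kernel (res_proj 0) (std_mod A leq z) res_aug"
proof -
 have ker: "f : a_kernel (res_proj 0) (std_mod A leq z) res_aug \<longleftrightarrow> f : carrier (res_proj 0) & f (z, 0) : IU (above z)" for f
 proof -
  have "\<zero>\<^bsub>std_mod A leq z\<^esub> = std_kernel A leq z" by (simp add: std_mod_def quot_mod_def)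
  moreover have "std_kernel A leq z +>.A f (z, 0) = std_kernel A leq z \<longleftrightarrow> f (z, 0) : std_kernel A leq z" if "f : carrier (res_proj 0)"
   by (rule A.coset_mem[OF kernel_props(1) lid_carrier[OF aug_lid[OF that]]])
  ultimately show ?thesis using aug_lid[of f] unfolding a_kernel_def' res_aug_def std_kernel_eq[OF z] by auto
 qed
 have "f : res_diff 0 ` carrier (res_proj 1) \<longleftrightarrow> f : carrier (res_proj 0) & f (z, 0) : IU (above z)" for f
 proof
  assume "f : res_diff 0 ` carrier (res_proj 1)"
  then obtain h where h: "f = res_diff 0 h" "h : carrier (res_proj (Suc 0))" by auto
  have "f : carrier (res_proj 0)" using res_diff_hom[of 0] h by (auto simp: mod_hom_def)
  moreover have "f (z, 0) : IU (above z)" using bd_kernel[of "%y. h (y, 0)"] res_chain[OF h(2)] z_layer by (simp add: h(1) res_diff_def)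
  ultimately show "f : carrier (res_proj 0) & f (z, 0) : IU (above z)" ..
 next
  assume f: "f : carrier (res_proj 0) & f (z, 0) : IU (above z)"
  \<comment> \<open>The layer in degree zero is \<open>z\<close> itself, which
    \<open>above z\<close> omits.\<close>
  have "EX \<eta>. chain (Suc 0) \<eta> & (ALL y:layer 0. f (y, 0) = bd 0 \<eta> y)"
   by (rule exact[OF upset_above[of z] _ res_chain]) (use f in \<open>auto simp: layer_0 above_def\<close>)
  then obtain \<eta> where "chain (Suc 0) \<eta>" "ALL y:layer 0. f (y, 0) = bd 0 \<eta> y" by blast
  thus "f : res_diff 0 ` carrier (res_proj 1)" using res_diff_image[of f 0 \<eta>] f by simp
 qed
 thus ?thesis using ker by (intro equalityI subsetI) simp_all
qed

lemma res_exact_Suc: "res_diff (Suc n) ` carrier (res_proj (Suc (Suc n))) = a_kernel (res_proj (Suc n)) (res_proj n) (res_diff n)"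
proof (unfold a_kernel_def', intro equalityI subsetI CollectI)
 fix f assume "f : res_diff (Suc n) ` carrier (res_proj (Suc (Suc n)))"
 then obtain h where h: "f = res_diff (Suc n) h" "h : carrier (res_proj (Suc (Suc n)))" by blast
 have "res_diff n f = \<zero>\<^bsub>res_proj n\<^esub>" unfolding res_simps(3)
 proof (rule res_eqI)
  fix y assume y: "y : layer n"
  have "bd n (%y. f (y, 0)) y = bd n (bd (Suc n) (%y. h (y, 0))) y"
   by (rule bd_cong[OF bd_chain[OF res_chain[OF h(2)]]]) (simp add: h(1) res_diff_def)
  also have "... = \<zero>.A" by (rule bd_bd[OF res_chain[OF h(2)] y])
  finally show "res_diff n f (y, 0) = (\<lambda>j\<in>index n. \<zero>.A) (y, 0)" using y by (simp add: res_diff_def)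
 qed (simp_all add: res_diff_def)
 thus "f : carrier (res_proj (Suc n)) & res_diff n f = \<zero>\<^bsub>res_proj n\<^esub>"
  using res_diff_hom[of "Suc n"] h by (auto simp: mod_hom_def)
next
 fix f assume "f : {f : carrier (res_proj (Suc n)). res_diff n f = \<zero>\<^bsub>res_proj n\<^esub>}"
 hence f: "f : carrier (res_proj (Suc n)) & res_diff n f = \<zero>\<^bsub>res_proj n\<^esub>" by simp
 \<comment> \<open>In positive degree the layer does not meet the tile of \<open>z\<close>, so all
   of \<open>X\<close> may serve as the upset.\<close>
 have "EX \<eta>. chain (Suc (Suc n)) \<eta> & (ALL y:layer (Suc n). f (y, 0) = bd (Suc n) \<eta> y)"
 proof (rule exact[OF upset_X])
  show "chain (Suc n) (%y. f (y, 0))" using f res_chain by blast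
  fix y assume y: "y : layer (Suc n)"
  have "f (y, 0) : lid y" using f res_chain y by (auto simp: chain_def)
  thus "f (y, 0) : IU X" using IU_through_right[OF subset_refl layer_X[OF y]] by (simp add: lid_def)
  assume "y : lm z"
  hence "y = z" using cone_lm[OF z] y by (simp add: layer_def)
  thus "z ~: X" using y by (simp add: layer_def vdist_def)
 next
  fix m y assume m: "Suc n = Suc m" and y: "y : layer m"
  have "res_diff n f (y, 0) = \<zero>.A" using f m y unfolding res_simps(3) by simp
  thus "bd m (%y. f (y, 0)) y = \<zero>.A" using m y by (simp add: res_diff_def)
 qed
 then obtain \<eta> where "chain (Suc (Suc n)) \<eta>" "ALL y:layer (Suc n). f (y, 0) = bd (Suc n) \<eta> y" by blast
 thus "f : res_diff (Suc n) ` carrier (res_proj (Suc (Suc n)))" using res_diff_image f by blast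
qed

lemma linear_resolution: "has_linear_projective_resolution K A (std_mod A leq z)"
 unfolding has_linear_projective_resolution_def linear_projective_resolution_def
proof (intro exI[of _ res_proj] exI[of _ res_diff] exI[of _ res_aug] conjI allI)
 fix n
 show "in_mod K A (res_proj n)" unfolding res_proj_def by (rule dsum_proj_in_mod[OF index_ok])
 show "EX J v. v ` J \<subseteq> idx A & res_proj n = dsum_mod J (%j. shift_mod (proj_mod A (v j)) (int n))"
  using index_ok(2) res_proj_def by blast
next
 show "res_aug ` carrier (res_proj 0) = carrier (std_mod A leq z)"
  unfolding std_carrier
 proof (intro equalityI image_subsetI)
  fix f assume "f : carrier (res_proj 0)"
  thus "res_aug f : (%x. std_kernel A leq z +>.A x) ` lid z" unfolding res_aug_def using aug_lid by blast
 next
  fix x assume x: "x : lid z"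
  have "(\<lambda>j\<in>index 0. x) : carrier (res_proj 0)" using x unfolding res_carrier by (simp add: chain_def layer_0)
  moreover have "res_aug (\<lambda>j\<in>index 0. x) = std_kernel A leq z +>.A x" using z_layer by (simp add: res_aug_def)
  ultimately show "std_kernel A leq z +>.A x : res_aug ` carrier (res_proj 0)" by (metis imageI)
 qed
qed (rule res_aug_hom res_diff_hom res_exact_0 res_exact_Suc)+

end

section \<open>Path algebras\<close>

lemma direct_sum_cong: "ALL i:J. V i = W i ==> direct_sum M J V \<longleftrightarrow> direct_sum M J W"
 unfolding direct_sum_def by (simp cong: ball_cong)

locale locally_finite_quiver = field K + wf_digraph Q
 for K :: "'k ring" (structure) and Q :: "('v, 'e) pre_digraph" +
 assumes out_finite: "v : verts Q ==> finite {e : arcs Q. tail Q e = v}"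
begin

abbreviation (input) "PA \<equiv> path_algebra K Q"

abbreviation (input) C :: "(('v, 'e) path => 'k) set" where "C \<equiv> carrier (path_algebra K Q)"

definition delta :: "('v, 'e) path => ('v, 'e) path => 'k" where
 "delta p = (%q. if q = p then \<one>.K else \<zero>.K)"

definition src :: "('v, 'e) path => 'v" where "src p = fst p"
definition trg :: "('v, 'e) path => 'v" where "trg p = snd (snd p)"
definition cat :: "('v, 'e) path => ('v, 'e) path => ('v, 'e) path" where
 "cat p q = (fst p, fst (snd p) @ fst (snd q), snd (snd q))"

definition splits :: "('v, 'e) path => (('v, 'e) path \<times> ('v, 'e) path) set" where
 "splits x = {(p, q). p : qpaths Q & q : qpaths Q & trg p = src q & cat p q = x}"

lemma qpaths_iff: "(u, es, v) : qpaths Q \<longleftrightarrow> awalk u es v" by (simp add: qpaths_def)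

lemma pa_carrier: "f : C \<longleftrightarrow> (ALL p. f p : carrier K) & (ALL p. p ~: qpaths Q --> f p = \<zero>.K) & finite {p. f p ~= \<zero>.K}"
 by (simp add: path_algebra_def Let_def)

lemma pa_ops: "f \<oplus>.PA h = (%p. f p \<oplus>.K h p)" "\<zero>.PA = (%p. \<zero>.K)" "c \<odot>.PA f = (%p. c **.K f p)"
 "idx PA = verts Q" "idem PA v = delta (v, [], v)"
 "agrade PA n = {f : C. ALL p. f p ~= \<zero>.K --> length (fst (snd p)) = n}"
 by (simp_all add: path_algebra_def Let_def delta_def)

text \<open>Paths are triples; quantifiers over them are to be kept as quantifiers over
  paths.\<close>

declare split_paired_All [simp del] split_paired_Ex [simp del]

lemma pa_val [simp]: "f : C ==> f p : carrier K" using pa_carrier by blast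

lemma pa_finite: "f : C ==> finite {p. f p ~= \<zero>.K}" using pa_carrier by blast

lemma pa_zero_outside: "[|f : C; p ~: qpaths Q|] ==> f p = \<zero>.K" using pa_carrier by blast

lemma pa_closedI: "[|!!p. f p : carrier K; !!p. p ~: qpaths Q ==> f p = \<zero>.K ; finite {p. f p ~= \<zero>.K}|] ==> f : C"
 using pa_carrier by blast

lemma pa_out: "[|f : C; f p ~= \<zero>.K |] ==> p : qpaths Q" using pa_carrier by blast

lemma pa_mult: "(f **.PA h) x = finsum K (%(p, q). f p **.K h q) (splits x)"
proof -
 obtain u es w where x: "x = (u, es, w)" by (cases x) auto
 have S: "{(p, q). EX v es1 es2. p = (u, es1, v) & q = (v, es2, w) & es = es1 @ es2 & p : qpaths Q & q : qpaths Q} = splits x"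
  unfolding splits_def x src_def trg_def cat_def by auto
 have "(f **.PA h) (u, es, w) = finsum K (%(p, q). f p **.K h q)
   {(p, q). EX v es1 es2. p = (u, es1, v) & q = (v, es2, w) & es = es1 @ es2 & p : qpaths Q & q : qpaths Q}"
  unfolding path_algebra_def Let_def monoid.select_convs prod.case ..
 thus ?thesis unfolding S unfolding x .
qed

lemma finite_splits [simp]: "finite (splits x)"
proof -
 obtain u es w where x: "x = (u, es, w)" by (cases x) auto
 let ?f = "%k. ((u, take k es, awlast u (take k es)), (awlast u (take k es), drop k es, w))"
 have "splits x \<subseteq> ?f ` {..length es}"
 proof
  fix z assume "z : splits x"
  then obtain es1 v es2 where z: "z = ((u, es1, v), (v, es2, w))" "awalk u es1 v" "es = es1 @ es2"
   unfolding splits_def x src_def trg_def cat_def qpaths_def by auto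
  have "awlast u es1 = v" using z(2) by (rule awalkE)
  hence "z = ?f (length es1)" using z by simp
  thus "z : ?f ` {..length es}" by (rule image_eqI[of _ _ "length es1"]) (use z(3) in simp)
 qed
 thus ?thesis by (rule finite_subset) simp
qed

lemma pa_mult_supp:
 assumes "f : C" "h : C" "(f **.PA h) x ~= \<zero>.K"
 obtains p q where "(p, q) : splits x" "f p ~= \<zero>.K" "h q ~= \<zero>.K"
proof -
 have "EX p q. (p, q) : splits x & f p ~= \<zero>.K & h q ~= \<zero>.K"
 proof (rule ccontr)
 assume n': "\<not> ?thesis"
 have n: "f p = \<zero>.K \<or> h q = \<zero>.K" if "(p, q) : splits x" for p q using that n' by blast
 have "(f **.PA h) x = (\<Oplus>.K z\<in>splits x. \<zero>.K)" unfolding pa_mult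
 proof (rule finsum_cong'[OF refl])
  fix z assume z: "z : splits x"
  obtain p q where pq: "z = (p, q)" by (cases z)
  show "(case z of (p, q) => f p **.K h q) = \<zero>.K" using n[of p q] z assms(1,2) unfolding pq by auto
 qed simp
 thus False using assms(3) by simp
 qed
 thus ?thesis using that by blast
qed

lemma mult_fun: "[|f : C; h : C|] ==> (%(p, q). f p **.K h q) : S \<rightarrow> carrier K" by auto

lemma splits_qpaths: "(p, q) : splits x ==> x : qpaths Q"
 unfolding splits_def src_def trg_def cat_def qpaths_def by (auto intro: awalk_appendI)

lemma pa_mult_closed: assumes f: "f : C" and h: "h : C" shows "f **.PA h : C"
 unfolding pa_carrier
proof (intro conjI allI impI)
 show "(f **.PA h) x : carrier K" for x unfolding pa_mult by (rule finsum_closed[OF mult_fun[OF f h]])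
 show "(f **.PA h) x = \<zero>.K" if "x ~: qpaths Q" for x
  using pa_mult_supp[OF f h, of x] splits_qpaths that by blast
 have "{x. (f **.PA h) x ~= \<zero>.K} \<subseteq> (%(p, q). cat p q) ` ({p. f p ~= \<zero>.K} \<times> {q. h q ~= \<zero>.K})"
 proof
  fix x assume "x : {x. (f **.PA h) x ~= \<zero>.K}"
  hence "(f **.PA h) x ~= \<zero>.K" by simp
  then obtain p q where "(p, q) : splits x" "f p ~= \<zero>.K" "h q ~= \<zero>.K" by (rule pa_mult_supp[OF f h])
  thus "x : (%(p, q). cat p q) ` ({p. f p ~= \<zero>.K} \<times> {q. h q ~= \<zero>.K})"
   by (intro image_eqI[of _ _ "(p, q)"]) (auto simp: splits_def)
 qed
 thus "finite {x. (f **.PA h) x ~= \<zero>.K}" by (rule finite_subset) (simp add: pa_finite f h)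
qed

lemma pa_add_closed: assumes "f : C" "h : C" shows "(%p. f p \<oplus>.K h p) : C"
proof -
 have "{p. f p \<oplus>.K h p ~= \<zero>.K} \<subseteq> {p. f p ~= \<zero>.K} \<union> {p. h p ~= \<zero>.K}" by auto
 hence "finite {p. f p \<oplus>.K h p ~= \<zero>.K}" by (rule finite_subset) (simp add: pa_finite assms)
 thus ?thesis by (intro pa_closedI) (simp_all add: assms pa_zero_outside)
qed

lemma pa_zero_closed: "(%p. \<zero>.K) : C" by (simp add: pa_carrier)

lemma pa_smult_closed: assumes "c : carrier K" "f : C" shows "(%p. c **.K f p) : C"
proof -
 have "{p. c **.K f p ~= \<zero>.K} \<subseteq> {p. f p ~= \<zero>.K}" using assms by auto
 hence "finite {p. c **.K f p ~= \<zero>.K}" by (rule finite_subset) (simp add: pa_finite assms)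
 thus ?thesis by (intro pa_closedI) (simp_all add: assms pa_zero_outside)
qed

lemma pa_abelian: "abelian_group PA"
proof (rule abelian_groupI)
 fix f assume f: "f : C"
 have "(%p. \<ominus>.K \<one>.K **.K f p) : C" by (rule pa_smult_closed[OF _ f]) simp
 moreover have "(%p. \<ominus>.K \<one>.K **.K f p) \<oplus>.PA f = \<zero>.PA"
  unfolding pa_ops using f by (simp add: l_minus l_neg)
 ultimately show "EX h:C. h \<oplus>.PA f = \<zero>.PA" by blast
qed (simp_all add: pa_ops(1,2) pa_add_closed pa_zero_closed a_ac)

lemma pa_module: "Module.module K PA"
 by (rule moduleI[OF is_cring pa_abelian]) (simp_all add: pa_ops(1-3) pa_smult_closed l_distr r_distr m_assoc)

sublocale A: Module.module K PA by (rule pa_module)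

lemma pa_add [simp]: "(f \<oplus>.PA h) p = f p \<oplus>.K h p" by (simp add: pa_ops)
lemma pa_smult [simp]: "(c \<odot>.PA f) p = c **.K f p" by (simp add: pa_ops)
lemma pa_zero [simp]: "\<zero>.PA p = \<zero>.K" by (simp add: pa_ops)

lemma pa_finsum: "[|finite S; f : S \<rightarrow> C|] ==> (\<Oplus>.PA i\<in>S. f i) p = (\<Oplus>.K i\<in>S. f i p)"
 by (rule additive_finsum[OF A.M.abelian_group_axioms abelian_group_axioms, of "%f. f p"]) auto

lemma pa_add_left: "[|x : C; y : C; z : C|] ==> (x \<oplus>.PA y) **.PA z = x **.PA z \<oplus>.PA y **.PA z"
proof
 fix s assume c: "x : C" "y : C" "z : C"
 show "((x \<oplus>.PA y) **.PA z) s = (x **.PA z \<oplus>.PA y **.PA z) s"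
  unfolding pa_add pa_mult finsum_addf[OF mult_fun[OF c(1,3)] mult_fun[OF c(2,3)], symmetric]
  by (rule finsum_cong') (use c in \<open>auto simp: l_distr\<close>)
qed

lemma pa_add_right: "[|x : C; y : C; z : C|] ==> x **.PA (y \<oplus>.PA z) = x **.PA y \<oplus>.PA x **.PA z"
proof
 fix s assume c: "x : C" "y : C" "z : C"
 show "(x **.PA (y \<oplus>.PA z)) s = (x **.PA y \<oplus>.PA x **.PA z) s"
  unfolding pa_add pa_mult finsum_addf[OF mult_fun[OF c(1,2)] mult_fun[OF c(1,3)], symmetric]
  by (rule finsum_cong') (use c in \<open>auto simp: r_distr\<close>)
qed

lemma pa_smult_left: "[|c : carrier K; x : C; y : C|] ==> (c \<odot>.PA x) **.PA y = c \<odot>.PA (x **.PA y)"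
proof
 fix s assume c: "c : carrier K" "x : C" "y : C"
 show "((c \<odot>.PA x) **.PA y) s = (c \<odot>.PA (x **.PA y)) s"
  unfolding pa_smult pa_mult finsum_rdistr[OF finite_splits c(1) mult_fun[OF c(2,3)]]
  by (rule finsum_cong') (use c in \<open>auto simp: m_assoc\<close>)
qed

lemma pa_smult_right: "[|c : carrier K; x : C; y : C|] ==> x **.PA (c \<odot>.PA y) = c \<odot>.PA (x **.PA y)"
proof
 fix s assume c: "c : carrier K" "x : C" "y : C"
 show "(x **.PA (c \<odot>.PA y)) s = (c \<odot>.PA (x **.PA y)) s"
  unfolding pa_smult pa_mult finsum_rdistr[OF finite_splits c(1) mult_fun[OF c(2,3)]]
  by (rule finsum_cong') (use c in \<open>auto simp: m_lcomm\<close>)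
qed

lemma delta_closed [simp]: "p : qpaths Q ==> delta p : C"
 by (rule pa_closedI) (auto simp: delta_def)

text \<open>Induction on a finite set containing the support, with one path split off at a
  time.\<close>

lemma delta_span:
 assumes V: "submodule V K PA" and f: "f : C" and d: "!!p. f p ~= \<zero>.K ==> delta p : V"
 shows "f : V"
proof -
 note D = A.submoduleD[OF V]
 have "f : V" if "finite S" "f : C" "{p. f p ~= \<zero>.K} \<subseteq> S" "ALL p. f p ~= \<zero>.K --> delta p : V" for f S
  using that
 proof (induction S arbitrary: f)
  case empty
  have "f p = \<zero>.K" for p using empty.prems(2) by blast
  hence "f = \<zero>.PA" unfolding pa_ops(2) by (rule ext)
  thus ?case using D(2) by (simp only:)
 next
  case (insert p S)
  let ?f = "f(p := \<zero>.K)"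
  have "{q. ?f q ~= \<zero>.K} \<subseteq> {q. f q ~= \<zero>.K}" by (rule subsetI) (simp split: if_split_asm)
  hence "finite {q. ?f q ~= \<zero>.K}" by (rule finite_subset) (rule pa_finite[OF insert.prems(1)])
  hence fc: "?f : C" by (intro pa_closedI) (simp_all add: insert.prems(1) pa_zero_outside)
  have "q : S" if "?f q ~= \<zero>.K" for q
  proof -
   have "q ~= p" "f q ~= \<zero>.K" using that by (simp_all split: if_split_asm)
   thus ?thesis using insert.prems(2) by blast
  qed
  hence 1: "{q. ?f q ~= \<zero>.K} \<subseteq> S" by blast
  have 2: "ALL q. ?f q ~= \<zero>.K --> delta q : V" using insert.prems(3) by simp
  have fV: "?f : V" by (rule insert.IH[OF fc 1 2])
  show ?case
  proof (cases "f p = \<zero>.K")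
   case True
   hence "?f = f" by (intro ext) simp
   thus ?thesis using fV by (simp only:)
  next
   case False
   have "f = ?f \<oplus>.PA f p \<odot>.PA delta p" 
    by (intro ext) (simp add: pa_ops(1,3) delta_def insert.prems(1))
   moreover have "f p \<odot>.PA delta p : V" by (rule D(4)) (use insert.prems(1,3) False in simp_all)
   ultimately show ?thesis using D(3)[OF fV] by metis
  qed
 qed
 from this[OF pa_finite[OF f] f subset_refl] d show ?thesis by blast
qed

lemma cat_qpaths: "[|p : qpaths Q; q : qpaths Q; trg p = src q|] ==> cat p q : qpaths Q"
 by (rule splits_qpaths[of p q]) (simp add: splits_def)

lemma delta_mult: assumes p: "p : qpaths Q" and q: "q : qpaths Q"
 shows "delta p **.PA delta q = (if trg p = src q then delta (cat p q) else \<zero>.PA)"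
proof
 fix x
 have "(delta p **.PA delta q) x = (\<Oplus>.K z\<in>splits x. if (p, q) = z then \<one>.K else \<zero>.K)"
  unfolding pa_mult
 proof (rule finsum_cong'[OF refl])
  fix z :: "('v, 'e) path \<times> ('v, 'e) path"
  obtain a b where z: "z = (a, b)" by (cases z)
  show "(case z of (a, b) => delta p a **.K delta q b) = (if (p, q) = z then \<one>.K else \<zero>.K)"
   unfolding z by (cases "a = p"; cases "b = q") (simp_all add: delta_def)
 qed simp
 also have "... = (if (p, q) : splits x then \<one>.K else \<zero>.K)"
 proof (cases "(p, q) : splits x")
  case True
  thus ?thesis using add.finprod_singleton[of "(p, q)" "splits x" "%_. \<one>.K"] by simp
 next
  case False
  have "(\<Oplus>.K z\<in>splits x. if (p, q) = z then \<one>.K else \<zero>.K) = (\<Oplus>.K z\<in>splits x. \<zero>.K)"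
   by (rule finsum_cong') (use False in auto)
  thus ?thesis using False by simp
 qed
 also have "... = (if trg p = src q then delta (cat p q) else \<zero>.PA) x"
  using p q by (cases "cat p q = x"; cases "trg p = src q") (simp_all add: splits_def delta_def)
 finally show "(delta p **.PA delta q) x = (if trg p = src q then delta (cat p q) else \<zero>.PA) x" .
qed

lemma cat_simps: "src (cat p q) = src p" "trg (cat p q) = trg q" "cat (cat p q) s = cat p (cat q s)"
 by (simp_all add: src_def trg_def cat_def)

lemma pa_mult_zero: assumes x: "x : C" shows "\<zero>.PA **.PA x = \<zero>.PA" "x **.PA \<zero>.PA = \<zero>.PA"
proof -
 note z = A.smult_l_null[OF A.M.zero_closed] and c = pa_mult_closed[OF A.M.zero_closed x] pa_mult_closed[OF x A.M.zero_closed]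
 show "\<zero>.PA **.PA x = \<zero>.PA" using pa_smult_left[OF zero_closed A.M.zero_closed x] unfolding z A.smult_l_null[OF c(1)] .
 show "x **.PA \<zero>.PA = \<zero>.PA" using pa_smult_right[OF zero_closed x A.M.zero_closed] unfolding z A.smult_l_null[OF c(2)] .
qed

lemma delta_assoc: assumes p: "p : qpaths Q" "q : qpaths Q" "s : qpaths Q"
 shows "(delta p **.PA delta q) **.PA delta s = delta p **.PA (delta q **.PA delta s)"
 using p cat_qpaths[OF p(1,2)] cat_qpaths[OF p(2,3)]
 by (cases "trg p = src q"; cases "trg q = src s") (simp_all add: delta_mult cat_simps pa_mult_zero)

text \<open>Reduces associativity and the laws for idempotents to the concatenation of single
  paths.\<close>

lemma linear_ext:
 assumes x: "x : C" and c: "!!a. a : C ==> h a : C" "!!a. a : C ==> k a : C"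
  and add: "!!a b. [|a : C; b : C|] ==> h (a \<oplus>.PA b) = h a \<oplus>.PA h b" "!!a b. [|a : C; b : C|] ==> k (a \<oplus>.PA b) = k a \<oplus>.PA k b"
  and sm: "!!c a. [|c : carrier K; a : C|] ==> h (c \<odot>.PA a) = c \<odot>.PA h a" "!!c a. [|c : carrier K; a : C|] ==> k (c \<odot>.PA a) = c \<odot>.PA k a"
  and d: "!!p. p : qpaths Q ==> h (delta p) = k (delta p)"
 shows "h x = k x"
proof -
 have 0: "l \<zero>.PA = \<zero>.PA" if l: "l (\<zero>.K \<odot>.PA \<zero>.PA) = \<zero>.K \<odot>.PA l \<zero>.PA" "l \<zero>.PA : C" for l
  using l(1) unfolding A.smult_l_null[OF l(2)] A.smult_l_null[OF A.M.zero_closed] .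
 have z: "h \<zero>.PA = k \<zero>.PA"
  using 0[of h, OF sm(1)[OF zero_closed A.M.zero_closed] c(1)[OF A.M.zero_closed]]
   0[of k, OF sm(2)[OF zero_closed A.M.zero_closed] c(2)[OF A.M.zero_closed]] by (rule trans[OF _ sym])
 have "x : {x : C. h x = k x}"
 proof (rule delta_span[OF A.submoduleI' x])
  fix p assume "x p ~= \<zero>.K"
  hence "p : qpaths Q" by (rule pa_out[OF x])
  thus "delta p : {x : C. h x = k x}" using d by simp
 qed (auto simp: z add sm)
 thus ?thesis by blast
qed

lemma pa_assoc: assumes x: "x : C" and y: "y : C" and z: "z : C"
 shows "(x **.PA y) **.PA z = x **.PA (y **.PA z)"
proof -
 note lin = pa_mult_closed pa_add_left pa_add_right pa_smult_left pa_smult_right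
 have 1: "(x **.PA delta q) **.PA delta s = x **.PA (delta q **.PA delta s)" if q: "q : qpaths Q" and s: "s : qpaths Q" and x: "x : C" for x q s
  by (rule linear_ext[OF x, of "%x. (x **.PA delta q) **.PA delta s" "%x. x **.PA (delta q **.PA delta s)"])
   (simp_all add: q s lin delta_assoc)
 have 2: "(x **.PA y) **.PA delta s = x **.PA (y **.PA delta s)" if s: "s : qpaths Q" and x: "x : C" and y: "y : C" for x y s
  by (rule linear_ext[OF y, of "%y. (x **.PA y) **.PA delta s" "%y. x **.PA (y **.PA delta s)"])
   (simp_all add: s x lin 1)
 show ?thesis
  by (rule linear_ext[OF z, of "%z. (x **.PA y) **.PA z" "%z. x **.PA (y **.PA z)"])
   (simp_all add: x y lin 2)
qed

lemma pa_restrict: assumes "f : C" shows "(%p. if P p then f p else \<zero>.K) : C"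
proof -
 have "{p. (if P p then f p else \<zero>.K) ~= \<zero>.K} \<subseteq> {p. f p ~= \<zero>.K}" by (rule subsetI) (simp split: if_split_asm)
 hence "finite {p. (if P p then f p else \<zero>.K) ~= \<zero>.K}" by (rule finite_subset) (simp add: pa_finite assms)
 thus ?thesis by (intro pa_closedI) (simp_all add: assms pa_zero_outside)
qed

lemma trivial_path [simp]: "(v, [], v) : qpaths Q \<longleftrightarrow> v : verts Q"
 by (simp add: qpaths_iff awalk_Nil_iff)

lemma idem_mult_left: assumes s: "s : verts Q" and x: "x : C"
 shows "idem PA s **.PA x = (%p. if src p = s then x p else \<zero>.K)"
 unfolding pa_ops(5)
proof (rule linear_ext[OF x, of "%x. delta (s, [], s) **.PA x" "%x. (%p. if src p = s then x p else \<zero>.K)"])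
 fix p assume p: "p : qpaths Q"
 have "delta (s, [], s) **.PA delta p = (if src p = s then delta p else \<zero>.PA)"
  using delta_mult[of "(s, [], s)" p] p s by (cases p; cases "src p = s") (simp_all add: src_def trg_def cat_def)
 thus "delta (s, [], s) **.PA delta p = (%q. if src q = s then delta p q else \<zero>.K)"
  by (intro ext) (simp add: delta_def)
qed (use s in \<open>simp_all add: pa_mult_closed pa_add_left pa_add_right pa_smult_left pa_smult_right pa_restrict fun_eq_iff\<close>)

lemma idem_mult_right: assumes s: "s : verts Q" and x: "x : C"
 shows "x **.PA idem PA s = (%p. if trg p = s then x p else \<zero>.K)"
 unfolding pa_ops(5)
proof (rule linear_ext[OF x, of "%x. x **.PA delta (s, [], s)" "%x. (%p. if trg p = s then x p else \<zero>.K)"])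
 fix p assume p: "p : qpaths Q"
 have "delta p **.PA delta (s, [], s) = (if trg p = s then delta p else \<zero>.PA)"
  using delta_mult[of p "(s, [], s)"] p s by (cases p; cases "trg p = s") (simp_all add: src_def trg_def cat_def)
 thus "delta p **.PA delta (s, [], s) = (%q. if trg q = s then delta p q else \<zero>.K)"
  by (intro ext) (simp add: delta_def)
qed (use s in \<open>simp_all add: pa_mult_closed pa_add_left pa_add_right pa_smult_left pa_smult_right pa_restrict fun_eq_iff\<close>)

lemma support_submodule: "submodule {f : C. ALL p. f p ~= \<zero>.K --> P p} K PA"
proof (rule A.submoduleI')
 fix a b assume "a : {f : C. ALL p. f p ~= \<zero>.K --> P p}" "b : {f : C. ALL p. f p ~= \<zero>.K --> P p}"
 hence ab: "a : C" "b : C" "!!p. a p ~= \<zero>.K ==> P p" "!!p. b p ~= \<zero>.K ==> P p" by auto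
 have "P p" if "a p \<oplus>.K b p ~= \<zero>.K" for p using ab(3,4)[of p] that pa_val[OF ab(2), of p] by (cases "a p = \<zero>.K") auto
 thus "a \<oplus>.PA b : {f : C. ALL p. f p ~= \<zero>.K --> P p}" using ab(1,2) by simp
next
 fix c a assume c: "c : carrier K" and "a : {f : C. ALL p. f p ~= \<zero>.K --> P p}"
 hence a: "a : C" "!!p. a p ~= \<zero>.K ==> P p" by auto
 have "P p" if "c **.K a p ~= \<zero>.K" for p using a(2)[of p] that c by (cases "a p = \<zero>.K") auto
 thus "c \<odot>.PA a : {f : C. ALL p. f p ~= \<zero>.K --> P p}" using a(1) c by simp
qed auto

text \<open>Every labelling of paths splits the algebra. Labelled by length this is the grading;
  labelled by the pair of ends it is the decomposition by idempotents.\<close>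

lemma support_direct_sum:
 assumes c: "!!p. p : qpaths Q ==> c p : J"
 shows "direct_sum PA J (%i. {f : C. ALL p. f p ~= \<zero>.K --> c p = i})"
proof -
 let ?\<pi> = "%i f p. if c p = i then f p else \<zero>.K"
 have "projections PA J (%i. {f : C. ALL p. f p ~= \<zero>.K --> c p = i}) ?\<pi>"
  unfolding projections_def
 proof (intro conjI ballI)
  fix f assume f: "f : C"
  let ?F = "c ` {p. f p ~= \<zero>.K}"
  have fin: "finite ?F" by (rule finite_imageI[OF pa_finite[OF f]])
  have "f p = (\<Oplus>.PA i\<in>?F. ?\<pi> i f) p" for p
  proof -
   have "(\<Oplus>.PA i\<in>?F. ?\<pi> i f) p = (\<Oplus>.K i\<in>?F. if c p = i then f p else \<zero>.K)"
    by (rule pa_finsum[OF fin]) (use f pa_restrict in auto)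
   also have "... = f p"
   proof (cases "f p = \<zero>.K")
    case True
    have "(\<Oplus>.K i\<in>?F. if c p = i then f p else \<zero>.K) = (\<Oplus>.K i\<in>?F. \<zero>.K)"
     by (rule finsum_cong') (simp_all add: True)
    thus ?thesis using True by simp
   next
    case False
    thus ?thesis using add.finprod_singleton[OF _ fin, of "c p" "%_. f p"] f by auto
   qed
   finally show ?thesis ..
  qed
  hence "f = (\<Oplus>.PA i\<in>?F. ?\<pi> i f)" by (rule ext)
  moreover have "?F \<subseteq> J" using c pa_out[OF f] by auto
  ultimately show "EX F. finite F & F \<subseteq> J & f = (\<Oplus>.PA i\<in>F. ?\<pi> i f)" using fin by blast
 next
  fix i j x assume x: "x : {f : C. ALL p. f p ~= \<zero>.K --> c p = i}"
  show "?\<pi> j x = (if j = i then x else \<zero>.PA)"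
  proof
   fix p
   have "x p = \<zero>.K \<or> c p = i" using x by blast
   thus "?\<pi> j x p = (if j = i then x else \<zero>.PA) p" by auto
  qed
 qed (auto simp: pa_restrict fun_eq_iff split: if_split_asm)
 moreover have "subgroup {f : C. ALL p. f p ~= \<zero>.K --> c p = i} (add_monoid PA)" for i
  by (rule A.submodule_subgroup[OF support_submodule])
 ultimately show ?thesis unfolding direct_sum_iff[OF A.M.abelian_group_axioms] by blast
qed

lemma finite_walks: "s : verts Q ==> finite {p : qpaths Q. src p = s & length (fst (snd p)) = n}"
proof (induction n arbitrary: s)
 case 0
 have "{p : qpaths Q. src p = s & length (fst (snd p)) = 0} \<subseteq> {(s, [], s)}"
  by (auto simp: src_def qpaths_def awalk_Nil_iff)
 thus ?case by (rule finite_subset) simp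
next
 case (Suc n)
 let ?E = "{e : arcs Q. tail Q e = s}" and ?W = "%s. {p : qpaths Q. src p = s & length (fst (snd p)) = n}"
 have "{p : qpaths Q. src p = s & length (fst (snd p)) = Suc n} \<subseteq> (\<Union>e\<in>?E. (%p. (s, e # fst (snd p), snd (snd p))) ` ?W (head Q e))"
 proof
  fix p assume "p : {p : qpaths Q. src p = s & length (fst (snd p)) = Suc n}"
  then obtain e es v where p: "p = (s, e # es, v)" "awalk s (e # es) v" "length es = n"
   by (cases p) (auto simp: src_def qpaths_def length_Suc_conv)
  have e: "e : ?E" "awalk (head Q e) es v" using p(2) by (auto simp: awalk_Cons_iff)
  have "(head Q e, es, v) : ?W (head Q e)" using e p(3) by (simp add: src_def qpaths_def)
  moreover have "p = (%p. (s, e # fst (snd p), snd (snd p))) (head Q e, es, v)" using p by simp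
  ultimately have "p : (%p. (s, e # fst (snd p), snd (snd p))) ` ?W (head Q e)" by (rule rev_image_eqI)
  thus "p : (\<Union>e\<in>?E. (%p. (s, e # fst (snd p), snd (snd p))) ` ?W (head Q e))" using e(1) by blast
 qed
 thus ?case by (rule finite_subset) (use Suc out_finite in auto)
qed

lemma path_algebra_graded: "graded_algebra K PA"
proof (rule graded_algebra.intro[OF field_axioms pa_module graded_algebra_axioms.intro])
 fix x y z assume "x : C" "y : C" "z : C"
 thus "(x **.PA y) **.PA z = x **.PA (y **.PA z)" by (rule pa_assoc)
next
 show "submodule (agrade PA i) K PA" for i unfolding pa_ops(6) by (rule support_submodule)
next
 have "agrade PA = (%i. {f : C. ALL p. f p ~= \<zero>.K --> length (fst (snd p)) = i})" by (rule ext) (rule pa_ops(6))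
 thus "direct_sum PA UNIV (agrade PA)" using support_direct_sum[of "%p. length (fst (snd p))" UNIV] by simp
next
 fix x y i j assume xy: "x : agrade PA i" "y : agrade PA j"
 have c: "x : C" "y : C" using xy by (auto simp: pa_ops)
 have "length (fst (snd p)) = i + j" if nz: "(x **.PA y) p ~= \<zero>.K" for p
 proof -
  obtain q q' where q: "(q, q') : splits p" "x q ~= \<zero>.K" "y q' ~= \<zero>.K" using nz by (rule pa_mult_supp[OF c])
  have "length (fst (snd q)) = i" "length (fst (snd q')) = j" using q(2,3) xy unfolding pa_ops(6) by auto
  moreover have "p = cat q q'" using q(1) by (simp add: splits_def)
  ultimately show ?thesis by (simp add: cat_def)
 qed
 thus "x **.PA y : agrade PA (i + j)" unfolding pa_ops(6) using pa_mult_closed[OF c] by blast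
next
 fix s t assume st: "s : idx PA" "t : idx PA"
 hence v: "s : verts Q" "t : verts Q" by (simp_all add: pa_ops)
 have "idem PA s **.PA idem PA t = (%p. if src p = s then delta (t, [], t) p else \<zero>.K)"
  using idem_mult_left[OF v(1), of "delta (t, [], t)"] v by (simp add: pa_ops(5))
 thus "idem PA s **.PA idem PA t = (if s = t then idem PA s else \<zero>.PA)"
  by (auto simp: pa_ops delta_def src_def fun_eq_iff)
next
 show "is_basis K PA (agrade PA 0) (idx PA) (idem PA)"
  unfolding is_basis_def
 proof (intro conjI ballI)
  fix s assume "s : idx PA"
  thus "idem PA s : agrade PA 0" by (auto simp: pa_ops delta_def split: if_splits) (simp add: delta_closed[unfolded delta_def])
 next
  fix x assume "x : agrade PA 0"
  hence x: "x : C" "!!p. x p ~= \<zero>.K ==> fst (snd p) = []" by (auto simp: pa_ops(6))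
  have triv: "EX s:verts Q. p = (s, [], s)" if "x p ~= \<zero>.K" for p
   using pa_out[OF x(1) that] x(2)[OF that] by (cases p) (auto simp: qpaths_iff awalk_Nil_iff)
  have ev: "(\<Oplus>.PA s\<in>{s. c s ~= \<zero>.K}. c s \<odot>.PA idem PA s) (t, es, t') = (if es = [] & t = t' then c t else \<zero>.K)"
   if c: "ALL s:idx PA. c s : carrier K" "ALL s. s ~: idx PA --> c s = \<zero>.K" "finite {s. c s ~= \<zero>.K}" for c t es t'
  proof -
   have cK: "c s : carrier K" for s using c(1,2) by (cases "s : idx PA") auto
   have "c s \<odot>.PA idem PA s : C" if "c s ~= \<zero>.K" for s
   proof -
    have "s : verts Q" using c(2) that by (auto simp: pa_ops(4))
    thus ?thesis using cK by (simp add: pa_ops(5))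
   qed
   hence "(\<Oplus>.PA s\<in>{s. c s ~= \<zero>.K}. c s \<odot>.PA idem PA s) (t, es, t') = (\<Oplus>.K s\<in>{s. c s ~= \<zero>.K}. (c s \<odot>.PA idem PA s) (t, es, t'))"
    by (intro pa_finsum[OF c(3)]) auto
   also have "... = (\<Oplus>.K s\<in>{s. c s ~= \<zero>.K}. if t = s then (if es = [] & t = t' then c s else \<zero>.K) else \<zero>.K)"
    by (rule finsum_cong') (use cK in \<open>auto simp: pa_ops(5) delta_def\<close>)
   also have "... = (if es = [] & t = t' then c t else \<zero>.K)"
   proof (cases "c t = \<zero>.K")
    case True
    have "(\<Oplus>.K s\<in>{s. c s ~= \<zero>.K}. if t = s then (if es = [] & t = t' then c s else \<zero>.K) else \<zero>.K) = (\<Oplus>.K s\<in>{s. c s ~= \<zero>.K}. \<zero>.K)"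
     by (rule finsum_cong') (use True in auto)
    thus ?thesis using True by auto
   next
    case False
    thus ?thesis using add.finprod_singleton[OF _ c(3), of t "%s. if es = [] & t = t' then c s else \<zero>.K"] cK by auto
   qed
   finally show ?thesis .
  qed
  let ?c = "%s. x (s, [], s)"
  have inj: "inj (%s. (s, [] :: 'e list, s))" by (rule injI) simp
  have c: "ALL s:idx PA. ?c s : carrier K" "ALL s. s ~: idx PA --> ?c s = \<zero>.K"
   using x(1) pa_zero_outside[OF x(1)] by (simp_all add: pa_ops(4))
  have "finite ((%s. (s, [] :: 'e list, s)) -` {p. x p ~= \<zero>.K})"
   by (rule finite_vimageI[OF _ inj]) (rule pa_finite[OF x(1)])
  hence fin: "finite {s. ?c s ~= \<zero>.K}" by (simp add: vimage_def)
  show "EX! c. (ALL s:idx PA. c s : carrier K) & (ALL s. s ~: idx PA --> c s = \<zero>.K) & finite {s. c s ~= \<zero>.K} &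
    x = (\<Oplus>.PA s\<in>{s. c s ~= \<zero>.K}. c s \<odot>.PA idem PA s)"
  proof (rule ex1I[of _ ?c], intro conjI c fin)
   show "x = (\<Oplus>.PA s\<in>{s. ?c s ~= \<zero>.K}. ?c s \<odot>.PA idem PA s)"
   proof
    fix p :: "('v, 'e) path"
    obtain t es t' where p: "p = (t, es, t')" by (cases p)
    show "x p = (\<Oplus>.PA s\<in>{s. ?c s ~= \<zero>.K}. ?c s \<odot>.PA idem PA s) p"
     unfolding p ev[OF c fin] using triv[of "(t, es, t')"] by auto
   qed
  next
   fix c assume c': "(ALL s:idx PA. c s : carrier K) & (ALL s. s ~: idx PA --> c s = \<zero>.K) & finite {s. c s ~= \<zero>.K} &
    x = (\<Oplus>.PA s\<in>{s. c s ~= \<zero>.K}. c s \<odot>.PA idem PA s)"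
   hence c1: "ALL s:idx PA. c s : carrier K" and c2: "ALL s. s ~: idx PA --> c s = \<zero>.K" and c3: "finite {s. c s ~= \<zero>.K}"
    and c4: "x = (\<Oplus>.PA s\<in>{s. c s ~= \<zero>.K}. c s \<odot>.PA idem PA s)" by simp_all
   show "c = ?c"
   proof
    fix s
    show "c s = ?c s" using ev[OF c1 c2 c3, of s "[]" s] c4 by simp
   qed
  qed
 qed
next
 have eq0: "(%(s, t). {idem PA s **.PA x **.PA idem PA t | x. x : C}) (s, t) = {f : C. ALL p. f p ~= \<zero>.K --> (src p, trg p) = (s, t)}"
  if v: "s : verts Q" "t : verts Q" for s t
 proof -
  have e: "idem PA s **.PA x **.PA idem PA t = (%p. if src p = s & trg p = t then x p else \<zero>.K)" if x: "x : C" for x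
   unfolding idem_mult_left[OF v(1) x] using idem_mult_right[OF v(2) pa_restrict[OF x, of "%p. src p = s"]] by auto
  have "{idem PA s **.PA x **.PA idem PA t | x. x : C} \<subseteq> {f : C. ALL p. f p ~= \<zero>.K --> (src p, trg p) = (s, t)}"
   using e pa_restrict by (auto split: if_split_asm)
  moreover have "f : {idem PA s **.PA x **.PA idem PA t | x. x : C}"
   if f: "f : C" "ALL p. f p ~= \<zero>.K --> (src p, trg p) = (s, t)" for f
  proof -
   have "f = (%p. if src p = s & trg p = t then f p else \<zero>.K)"
   proof
    fix p
    have "f p = \<zero>.K \<or> src p = s & trg p = t" using f(2) by blast
    thus "f p = (if src p = s & trg p = t then f p else \<zero>.K)" by auto
   qed
   hence "f = idem PA s **.PA f **.PA idem PA t" unfolding e[OF f(1)] .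
   thus ?thesis using f(1) by blast
  qed
  ultimately show ?thesis by auto
 qed
 have eq: "ALL i:verts Q \<times> verts Q. (%(s, t). {idem PA s **.PA x **.PA idem PA t | x. x : C}) i = {f : C. ALL p. f p ~= \<zero>.K --> (src p, trg p) = i}"
 proof (intro ballI)
  fix i assume "i : verts Q \<times> verts Q"
  then obtain s t where st: "s : verts Q" "t : verts Q" "i = (s, t)" by (rule SigmaE)
  show "(%(s, t). {idem PA s **.PA x **.PA idem PA t | x. x : C}) i = {f : C. ALL p. f p ~= \<zero>.K --> (src p, trg p) = i}"
   unfolding st(3) by (rule eq0[OF st(1,2)])
 qed
 have "direct_sum PA (verts Q \<times> verts Q) (%i. {f : C. ALL p. f p ~= \<zero>.K --> (src p, trg p) = i})"
  by (rule support_direct_sum) (auto simp: qpaths_def src_def trg_def dest: awalk_hd_in_verts awalk_last_in_verts)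
 thus "direct_sum PA (idx PA \<times> idx PA) (%(s, t). {idem PA s **.PA x **.PA idem PA t | x. x : C})"
  unfolding pa_ops(4) direct_sum_cong[OF eq] .
next
 fix s i assume "s : idx PA"
 hence s: "s : verts Q" by (simp add: pa_ops(4))
 let ?F = "{p : qpaths Q. src p = s & length (fst (snd p)) = i}"
 let ?V = "{idem PA s **.PA x | x. x : agrade PA i}"
 have V: "f : C & (ALL p. f p ~= \<zero>.K --> p : ?F)" if f: "f : ?V" for f
 proof -
  obtain x where x: "x : agrade PA i" "f = idem PA s **.PA x" using f by blast
  have xC: "x : C" "!!p. x p ~= \<zero>.K ==> length (fst (snd p)) = i" using x(1) by (auto simp: pa_ops(6))
  have FF: "p : ?F" if "(if src p = s then x p else \<zero>.K) ~= \<zero>.K" for p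
  proof -
   have "src p = s" "x p ~= \<zero>.K" using that by (simp_all split: if_split_asm)
   thus ?thesis using xC(2)[of p] pa_out[OF xC(1), of p] by simp
  qed
  show ?thesis unfolding x(2) idem_mult_left[OF s xC(1)]
   by (intro conjI allI impI) (rule pa_restrict[OF xC(1)], rule FF, assumption)
 qed
 have "delta ` ?F \<subseteq> ?V"
 proof
  fix f assume "f : delta ` ?F"
  then obtain p where p: "p : ?F" "f = delta p" by blast
  have dv: "delta p q = \<zero>.K" if "q ~= p" for q using that by (simp add: delta_def)
  have dC: "delta p : C" using p(1) by simp
  have "ALL q. delta p q ~= \<zero>.K --> length (fst (snd q)) = i"
  proof (intro allI impI)
   fix q assume "delta p q ~= \<zero>.K"
   hence "q = p" using dv[of q] by (cases "q = p") simp_all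
   thus "length (fst (snd q)) = i" using p(1) by simp
  qed
  hence "delta p : agrade PA i" unfolding pa_ops(6) using dC by blast
  moreover have "delta p = idem PA s **.PA delta p"
   unfolding idem_mult_left[OF s dC]
  proof
   fix q show "delta p q = (if src q = s then delta p q else \<zero>.K)" using p(1) dv[of q] by (cases "q = p") simp_all
  qed
  ultimately show "f : ?V" unfolding p(2) by blast
 qed
 moreover have "?V \<subseteq> W" if W: "submodule W K PA" "delta ` ?F \<subseteq> W" for W
 proof
  fix f assume "f : ?V"
  from V[OF this] show "f : W" using delta_span[OF W(1)] W(2) by blast
 qed
 moreover have "?V \<subseteq> C" using V by blast
 ultimately show "fin_dim K PA ?V" unfolding A.fin_dim_iff[OF \<open>?V \<subseteq> C\<close>] using finite_walks[OF s, of i]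
  by (intro exI[of _ "delta ` ?F"]) simp
qed (simp_all add: pa_mult_closed pa_add_left pa_add_right pa_smult_left pa_smult_right)

end

section \<open>Ideals of path algebras\<close>

context graded_algebra begin

lemma gen_ideal_mem: "x : gen_ideal K A S \<longleftrightarrow> (ALL J. submodule J K A --> S \<subseteq> J --> (ALL a:carrier A. ALL x:J. a **.A x : J & x **.A a : J) --> x : J)"
 by (simp add: gen_ideal_def imp_conjL)

lemma gen_ideal_least: assumes "submodule J K A" "S \<subseteq> J" "ALL a:carrier A. ALL x:J. a **.A x : J & x **.A a : J"
 shows "gen_ideal K A S \<subseteq> J"
proof
 fix x assume "x : gen_ideal K A S"
 from this[unfolded gen_ideal_mem, rule_format, OF assms(1,2)] show "x : J" using assms(3) by blast
qed

lemma gen_ideal_incl: "S \<subseteq> gen_ideal K A S"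
proof
 fix x assume x: "x : S"
 show "x : gen_ideal K A S" unfolding gen_ideal_mem by (intro allI impI) (erule subsetD, rule x)
qed

lemma gen_ideal_submodule: assumes S: "S \<subseteq> carrier A" shows "submodule (gen_ideal K A S) K A"
proof -
 have c: "gen_ideal K A S \<subseteq> carrier A" by (rule gen_ideal_least[OF A.carrier_is_submodule S]) simp
 show ?thesis
 proof (rule A.submoduleI'[OF c])
  show "\<zero>.A : gen_ideal K A S" unfolding gen_ideal_mem by (intro allI impI) (rule A.submoduleD(2))
 next
  fix a b assume ab: "a : gen_ideal K A S" "b : gen_ideal K A S"
  show "a \<oplus>.A b : gen_ideal K A S" unfolding gen_ideal_mem
  proof (intro allI impI)
   fix J assume J: "submodule J K A" "S \<subseteq> J" "ALL a:carrier A. ALL x:J. a **.A x : J & x **.A a : J"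
   have "gen_ideal K A S \<subseteq> J" by (rule gen_ideal_least[OF J])
   thus "a \<oplus>.A b : J" using ab by (intro A.submoduleD(3)[OF J(1)]) (erule subsetD, assumption)+
  qed
 next
  fix k a assume k: "k : carrier K" and a: "a : gen_ideal K A S"
  show "k \<odot>.A a : gen_ideal K A S" unfolding gen_ideal_mem
  proof (intro allI impI)
   fix J assume J: "submodule J K A" "S \<subseteq> J" "ALL a:carrier A. ALL x:J. a **.A x : J & x **.A a : J"
   have "gen_ideal K A S \<subseteq> J" by (rule gen_ideal_least[OF J])
   thus "k \<odot>.A a : J" using a by (intro A.submoduleD(4)[OF J(1) k]) (erule subsetD)
  qed
 qed
qed

lemma gen_ideal_mult: "ALL a:carrier A. ALL x:gen_ideal K A S. a **.A x : gen_ideal K A S & x **.A a : gen_ideal K A S"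
proof (intro ballI)
 fix a x assume a: "a : carrier A" and x: "x : gen_ideal K A S"
 have "a **.A x : J & x **.A a : J" if J: "submodule J K A" "S \<subseteq> J" "ALL a:carrier A. ALL x:J. a **.A x : J & x **.A a : J" for J
  using J(3)[rule_format, OF a subsetD[OF gen_ideal_least[OF J] x]] .
 thus "a **.A x : gen_ideal K A S & x **.A a : gen_ideal K A S" unfolding gen_ideal_mem by metis
qed

text \<open>The elements with all components in the ideal form a two-sided ideal themselves; for the
  closure under products it is enough to take a homogeneous factor.\<close>

lemma gen_ideal_comp:
 assumes S: "!!x. x : S ==> EX n. x : agrade A n" and x: "x : gen_ideal K A S"
 shows "comp n x : gen_ideal K A S"
proof -
 let ?J = "gen_ideal K A S"
 let ?W = "{x : carrier A. ALL n. comp n x : ?J}"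
 have Sc: "S \<subseteq> carrier A" using S agrade_carrier by blast
 note D = A.submoduleD[OF gen_ideal_submodule[OF Sc]]
 have W: "submodule ?W K A" by (rule A.submoduleI') (use D in \<open>auto simp: comp_add comp_smult\<close>)
 have "?J \<subseteq> ?W"
 proof (rule gen_ideal_least[OF W])
  show "S \<subseteq> ?W"
  proof
   fix x assume x: "x : S"
   then obtain m where m: "x : agrade A m" using S by blast
   have "x : ?J" using gen_ideal_incl x by blast
   hence "comp n x : ?J" for n using comp_homog[OF m, of n] D(2) by simp
   thus "x : ?W" using agrade_carrier[OF m] by blast
  qed
  show "ALL a:carrier A. ALL x:?W. a **.A x : ?W & x **.A a : ?W"
  proof (intro ballI conjI)
   fix a x assume a: "a : carrier A" and x: "x : ?W"
   have xc: "x : carrier A" and xn: "!!n. comp n x : ?J" using x by auto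
   have "a : {a : carrier A. a **.A x : ?W}"
   proof (rule homog_split[OF vimage_right[OF W xc] a])
    fix i
    have "comp n (comp i a **.A x) : ?J" for n
     using comp_mult_left[OF comp_grade[OF a, of i] xc, of n] gen_ideal_mult xn comp_closed[OF a] D(2) by simp
    thus "comp i a : {a : carrier A. a **.A x : ?W}" using a xc by simp
   qed
   thus "a **.A x : ?W" by blast
   have "a : {a : carrier A. x **.A a : ?W}"
   proof (rule homog_split[OF vimage_left[OF W xc] a])
    fix i
    have "comp n (x **.A comp i a) : ?J" for n
     using comp_mult_right[OF comp_grade[OF a, of i] xc, of n] gen_ideal_mult xn comp_closed[OF a] D(2) by simp
    thus "comp i a : {a : carrier A. x **.A a : ?W}" using a xc by simp
   qed
   thus "x **.A a : ?W" by blast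
  qed
 qed
 thus ?thesis using x by blast
qed

end

section \<open>Functionals on path algebras given by integer weights\<close>

context locally_finite_quiver begin

sublocale P: graded_algebra K PA by (rule path_algebra_graded)

text \<open>Weights of paths are integers mapped into the field, so the combinatorial identities are
  proved once for all fields.\<close>

definition emb :: "int => 'k" where "emb n = [n] \<cdot>.K \<one>.K"

lemma emb_closed [simp]: "emb n : carrier K"
 unfolding emb_def by (rule add.int_pow_closed) simp

lemma emb_add: "emb (m + n) = emb m \<oplus>.K emb n"
 unfolding emb_def by (rule add.int_pow_mult) simp

lemma emb_0: "emb 0 = \<zero>.K"
 unfolding emb_def add_pow_def by simp

lemma emb_1: "emb 1 = \<one>.K"
 unfolding emb_def by (rule add.int_pow_1) simp

lemma emb_uminus: "emb n = \<zero>.K ==> emb (- n) = \<zero>.K"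
 using emb_add[of n "- n"] emb_0 by simp

lemma emb_unit: "n = 1 \<or> n = - 1 ==> emb n ~= \<zero>.K"
 using emb_1 one_not_zero emb_uminus[of n] by auto

definition functional :: "(('v, 'e) path => int) => (('v, 'e) path => 'k) => 'k" where
 "functional \<phi> f = (\<Oplus>.K p\<in>{p. f p ~= \<zero>.K}. f p **.K emb (\<phi> p))"

lemma functional_closed [simp]: "f : C ==> functional \<phi> f : carrier K"
 unfolding functional_def by (rule finsum_closed) simp

lemma functional_super:
 assumes f: "f : C" and T: "finite T" "{p. f p ~= \<zero>.K} \<subseteq> T"
 shows "functional \<phi> f = (\<Oplus>.K p\<in>T. f p **.K emb (\<phi> p))"
 unfolding functional_def by (rule add.finprod_mono_neutral_cong_left[OF T]) (use f in auto)

lemma functional_add: assumes f: "f : C" and h: "h : C"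
 shows "functional \<phi> (f \<oplus>.PA h) = functional \<phi> f \<oplus>.K functional \<phi> h"
proof -
 let ?T = "{p. f p ~= \<zero>.K} \<union> {p. h p ~= \<zero>.K}"
 have T: "finite ?T" using pa_finite[OF f] pa_finite[OF h] by simp
 have "functional \<phi> (f \<oplus>.PA h) = (\<Oplus>.K p\<in>?T. (f \<oplus>.PA h) p **.K emb (\<phi> p))"
 proof (rule functional_super[OF _ T])
  show "f \<oplus>.PA h : C" using f h by simp
  show "{p. (f \<oplus>.PA h) p ~= \<zero>.K} \<subseteq> ?T"
  proof (rule subsetI, rule ccontr)
   fix p assume "p : {p. (f \<oplus>.PA h) p ~= \<zero>.K}" "p ~: ?T"
   thus False by simp
  qed
 qed
 also have "... = (\<Oplus>.K p\<in>?T. f p **.K emb (\<phi> p) \<oplus>.K h p **.K emb (\<phi> p))"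
  by (rule finsum_cong'[OF refl]) (use f h in \<open>simp_all add: l_distr\<close>)
 also have "... = (\<Oplus>.K p\<in>?T. f p **.K emb (\<phi> p)) \<oplus>.K (\<Oplus>.K p\<in>?T. h p **.K emb (\<phi> p))"
  by (rule finsum_addf) (use f h in auto)
 also have "... = functional \<phi> f \<oplus>.K functional \<phi> h"
  using functional_super[OF f T] functional_super[OF h T] by simp
 finally show ?thesis .
qed

lemma functional_smult: assumes c: "c : carrier K" and f: "f : C"
 shows "functional \<phi> (c \<odot>.PA f) = c **.K functional \<phi> f"
proof -
 let ?T = "{p. f p ~= \<zero>.K}"
 have "functional \<phi> (c \<odot>.PA f) = (\<Oplus>.K p\<in>?T. (c \<odot>.PA f) p **.K emb (\<phi> p))"
 proof (rule functional_super[OF _ pa_finite[OF f]])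
  show "c \<odot>.PA f : C" using c f by simp
  show "{p. (c \<odot>.PA f) p ~= \<zero>.K} \<subseteq> ?T"
  proof (rule subsetI, rule ccontr)
   fix p assume "p : {p. (c \<odot>.PA f) p ~= \<zero>.K}" "p ~: ?T"
   thus False using c by simp
  qed
 qed
 also have "... = (\<Oplus>.K p\<in>?T. c **.K (f p **.K emb (\<phi> p)))"
  by (rule finsum_cong'[OF refl]) (use f c in \<open>simp_all add: m_assoc\<close>)
 also have "... = c **.K functional \<phi> f"
  unfolding functional_def by (rule finsum_rdistr[symmetric, OF pa_finite[OF f] c]) (use f in auto)
 finally show ?thesis .
qed

lemma functional_delta: assumes "p : qpaths Q" shows "functional \<phi> (delta p) = emb (\<phi> p)"
proof -
 have "functional \<phi> (delta p) = (\<Oplus>.K q\<in>{p}. delta p q **.K emb (\<phi> q))"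
  by (rule functional_super[OF delta_closed[OF assms]]) (simp_all add: delta_def)
 thus ?thesis by (simp add: delta_def)
qed

lemma functional_zero [simp]: "functional \<phi> \<zero>.PA = \<zero>.K"
proof -
 have "{p. \<zero>.PA p ~= \<zero>.K} = ({} :: ('v, 'e) path set)" by simp
 thus ?thesis unfolding functional_def by (simp only: finsum_empty)
qed

text \<open>The largest two-sided ideal on which the functional vanishes.\<close>

definition killed :: "(('v, 'e) path => int) => (('v, 'e) path => 'k) set" where
 "killed \<phi> = {f : C. ALL p:qpaths Q. ALL q:qpaths Q. functional \<phi> (delta p **.PA f **.PA delta q) = \<zero>.K}"

lemma killedD: "[|f : killed \<phi>; p : qpaths Q; q : qpaths Q|] ==> functional \<phi> (delta p **.PA f **.PA delta q) = \<zero>.K"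
 unfolding killed_def by blast

lemma killed_submodule: "submodule (killed \<phi>) K PA"
 by (rule A.submoduleI') (auto simp: killed_def P.mult_add_left P.mult_add_right P.mult_smult_left P.mult_smult_right
   functional_add functional_smult)

lemma killed_mult: "ALL a:C. ALL f:killed \<phi>. a **.PA f : killed \<phi> & f **.PA a : killed \<phi>"
proof (intro ballI conjI)
 fix a f assume a: "a : C" and f: "f : killed \<phi>"
 have fc: "f : C" using f by (simp add: killed_def)
 note D = A.submoduleD[OF killed_submodule[of \<phi>]]
 have dl: "delta s **.PA f : killed \<phi>" if s: "s : qpaths Q" for s
  unfolding killed_def
 proof (intro CollectI conjI ballI)
  show "delta s **.PA f : C" using s fc by simp
  fix p q assume p: "p : qpaths Q" and q: "q : qpaths Q"
  have e: "delta p **.PA (delta s **.PA f) = (if trg p = src s then delta (cat p s) else \<zero>.PA) **.PA f"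
   unfolding delta_mult[OF p s, symmetric] using p s fc by (simp add: P.mult_assoc)
  show "functional \<phi> (delta p **.PA (delta s **.PA f) **.PA delta q) = \<zero>.K"
   unfolding e using killedD[OF f cat_qpaths[OF p s] q] fc q by simp
 qed
 have dr: "f **.PA delta s : killed \<phi>" if s: "s : qpaths Q" for s
  unfolding killed_def
 proof (intro CollectI conjI ballI)
  show "f **.PA delta s : C" using s fc by simp
  fix p q assume p: "p : qpaths Q" and q: "q : qpaths Q"
  have e: "delta p **.PA (f **.PA delta s) **.PA delta q = delta p **.PA f **.PA (if trg s = src q then delta (cat s q) else \<zero>.PA)"
   unfolding delta_mult[OF s q, symmetric] using p s q fc by (simp add: P.mult_assoc)
  show "functional \<phi> (delta p **.PA (f **.PA delta s) **.PA delta q) = \<zero>.K"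
   unfolding e using killedD[OF f p cat_qpaths[OF s q]] fc p by simp
 qed
 have "a : {a : C. a **.PA f : killed \<phi>}"
  by (rule delta_span[OF P.vimage_right[OF killed_submodule fc] a]) (use dl pa_out[OF a] in simp)
 thus "a **.PA f : killed \<phi>" by blast
 have "a : {a : C. f **.PA a : killed \<phi>}"
  by (rule delta_span[OF P.vimage_left[OF killed_submodule fc] a]) (use dr pa_out[OF a] in simp)
 thus "f **.PA a : killed \<phi>" by blast
qed

lemma delta_sandwich:
 assumes m: "m : qpaths Q" and p: "p : qpaths Q" and q: "q : qpaths Q"
 shows "functional \<phi> (delta p **.PA delta m **.PA delta q) =
  (if trg p = src m & trg m = src q then emb (\<phi> (cat (cat p m) q)) else \<zero>.K)"
 using delta_mult[OF p m] cat_qpaths[OF p m] delta_mult[OF cat_qpaths[OF p m] q]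
  functional_delta[OF cat_qpaths[OF cat_qpaths[OF p m] q]] q
 by (simp add: cat_simps)

text \<open>This lemma and the next two match the shapes of the relations: a path, a sum of two
  paths, and a difference of two such sums.\<close>

lemma killed_delta:
 assumes m: "m : qpaths Q"
  and z: "!!p q. [|p : qpaths Q; q : qpaths Q; trg p = src m; trg m = src q|] ==> \<phi> (cat (cat p m) q) = 0"
 shows "delta m : killed \<phi>"
 unfolding killed_def using m z by (simp add: delta_sandwich emb_0)

lemma killed_delta2:
 assumes m: "m : qpaths Q" "m' : qpaths Q" "src m' = src m" "trg m' = trg m"
  and z: "!!p q. [|p : qpaths Q; q : qpaths Q; trg p = src m; trg m = src q|] ==> \<phi> (cat (cat p m) q) + \<phi> (cat (cat p m') q) = 0"
 shows "delta m \<oplus>.PA delta m' : killed \<phi>"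
 unfolding killed_def
proof (intro CollectI conjI ballI)
 fix p q assume p: "p : qpaths Q" and q: "q : qpaths Q"
 have "functional \<phi> (delta p **.PA (delta m \<oplus>.PA delta m') **.PA delta q)
   = functional \<phi> (delta p **.PA delta m **.PA delta q) \<oplus>.K functional \<phi> (delta p **.PA delta m' **.PA delta q)"
  using m p q by (simp add: P.mult_add_left P.mult_add_right functional_add)
 also have "... = \<zero>.K" unfolding delta_sandwich[OF m(1) p q] delta_sandwich[OF m(2) p q] m(3,4)
  using z[OF p q] by (simp add: emb_add[symmetric] emb_0)
 finally show "functional \<phi> (delta p **.PA (delta m \<oplus>.PA delta m') **.PA delta q) = \<zero>.K" .
qed (use m in simp)

lemma killed_delta4:
 assumes m: "m1 : qpaths Q" "m2 : qpaths Q" "m3 : qpaths Q" "m4 : qpaths Q"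
  and st: "src m2 = src m1" "src m3 = src m1" "src m4 = src m1" "trg m2 = trg m1" "trg m3 = trg m1" "trg m4 = trg m1"
  and z: "!!p q. [|p : qpaths Q; q : qpaths Q; trg p = src m1; trg m1 = src q|] ==>
   \<phi> (cat (cat p m1) q) + \<phi> (cat (cat p m2) q) = \<phi> (cat (cat p m3) q) + \<phi> (cat (cat p m4) q)"
 shows "(delta m1 \<oplus>.PA delta m2) \<ominus>.PA (delta m3 \<oplus>.PA delta m4) : killed \<phi>"
 unfolding killed_def
proof (intro CollectI conjI ballI)
 fix p q assume p: "p : qpaths Q" and q: "q : qpaths Q"
 let ?s = "%f. delta p **.PA f **.PA delta q"
 let ?e = "%m. if trg p = src m1 & trg m1 = src q then emb (\<phi> (cat (cat p m) q)) else \<zero>.K"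
 have k: "\<ominus>.K \<one>.K : carrier K" by simp
 have c: "delta m1 \<oplus>.PA delta m2 : C" "delta m3 \<oplus>.PA delta m4 : C" using m by simp_all
 have n: "f \<ominus>.PA h = f \<oplus>.PA (\<ominus>.K \<one>.K) \<odot>.PA h" if "f : C" "h : C" for f h
  using that by (simp add: a_minus_def A.smult_l_minus)
 have "functional \<phi> (?s ((delta m1 \<oplus>.PA delta m2) \<ominus>.PA (delta m3 \<oplus>.PA delta m4)))
  = (functional \<phi> (?s (delta m1)) \<oplus>.K functional \<phi> (?s (delta m2))) \<oplus>.K
   (\<ominus>.K \<one>.K) **.K (functional \<phi> (?s (delta m3)) \<oplus>.K functional \<phi> (?s (delta m4)))"
  unfolding n[OF c] using m p q k
  by (simp add: P.mult_add_left P.mult_add_right P.mult_smult_left P.mult_smult_right functional_add functional_smult)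
 also have "... = (?e m1 \<oplus>.K ?e m2) \<oplus>.K (\<ominus>.K \<one>.K) **.K (?e m3 \<oplus>.K ?e m4)"
  unfolding delta_sandwich[OF m(1) p q] delta_sandwich[OF m(2) p q] delta_sandwich[OF m(3) p q] delta_sandwich[OF m(4) p q] st ..
 also have "?e m1 \<oplus>.K ?e m2 = ?e m3 \<oplus>.K ?e m4"
  using z[OF p q] by (simp add: emb_add[symmetric])
 also have "(?e m3 \<oplus>.K ?e m4) \<oplus>.K (\<ominus>.K \<one>.K) **.K (?e m3 \<oplus>.K ?e m4) = \<zero>.K"
 proof -
  have "w \<oplus>.K (\<ominus>.K \<one>.K) **.K w = \<zero>.K" if "w : carrier K" for w using that by (simp add: l_minus r_neg)
  thus ?thesis by simp
 qed
 finally show "functional \<phi> (?s ((delta m1 \<oplus>.PA delta m2) \<ominus>.PA (delta m3 \<oplus>.PA delta m4))) = \<zero>.K" .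
qed (use m in simp)

text \<open>The elements with coefficient zero at every trivial path form a two-sided ideal, as a
  trivial path is only a product of trivial ones.\<close>

lemma positive_ideal_idem:
 assumes S: "!!x. x : S ==> EX n>0. x : agrade PA n" and v: "v : verts Q"
 shows "idem PA v ~: gen_ideal K PA S"
proof -
 let ?W = "{f : C. ALL v. f (v, [], v) = \<zero>.K}"
 have "gen_ideal K PA S \<subseteq> ?W"
 proof (rule P.gen_ideal_least)
  show "submodule ?W K PA" by (rule A.submoduleI') auto
  show "S \<subseteq> ?W"
  proof
   fix x assume "x : S"
   then obtain n where n: "n > 0" "x : agrade PA n" using S by blast
   have "x (v, [], v) = \<zero>.K" for v
   proof (rule ccontr)
    assume "x (v, [], v) ~= \<zero>.K"
    hence "length (fst (snd (v, [] :: 'e list, v))) = n" using n(2) unfolding pa_ops(6) by blast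
    thus False using n(1) by simp
   qed
   thus "x : ?W" using n(2) unfolding pa_ops(6) by blast
  qed
  show "ALL a:C. ALL x:?W. a **.PA x : ?W & x **.PA a : ?W"
  proof (intro ballI)
   fix a x assume a: "a : C" and x: "x : ?W"
   have xc: "x : C" and x0: "!!v. x (v, [], v) = \<zero>.K" using x by auto
   have triv: "p = (v, [], v) & q = (v, [], v)" if "(p, q) : splits (v, [], v)" for p q v
   proof -
    have h: "p : qpaths Q" "q : qpaths Q" "cat p q = (v, [], v)" using that by (simp_all add: splits_def)
    obtain a b c where p: "p = (a, b, c)" by (cases p)
    obtain a' b' c' where q: "q = (a', b', c')" by (cases q)
    have e: "a = v" "b = []" "b' = []" "c' = v" using h(3) unfolding p q cat_def by simp_all
    have "a = c" "a' = c'" using h(1,2) unfolding p q e(2,3) qpaths_iff awalk_Nil_iff by simp_all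
    thus ?thesis using e unfolding p q by simp
   qed
   have "(a **.PA x) (v, [], v) = \<zero>.K" for v
   proof (rule ccontr)
    assume "(a **.PA x) (v, [], v) ~= \<zero>.K"
    then obtain p q where "(p, q) : splits (v, [], v)" "a p ~= \<zero>.K" "x q ~= \<zero>.K" by (rule pa_mult_supp[OF a xc])
    thus False using triv x0 by metis
   qed
   moreover have "(x **.PA a) (v, [], v) = \<zero>.K" for v
   proof (rule ccontr)
    assume "(x **.PA a) (v, [], v) ~= \<zero>.K"
    then obtain p q where "(p, q) : splits (v, [], v)" "x p ~= \<zero>.K" "a q ~= \<zero>.K" by (rule pa_mult_supp[OF xc a])
    thus False using triv x0 by metis
   qed
   ultimately show "a **.PA x : ?W & x **.PA a : ?W" using a xc by (simp add: pa_mult_closed)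
  qed
 qed
 moreover have "idem PA v (v, [], v) ~= \<zero>.K" by (simp add: pa_ops(5) delta_def)
 ultimately show ?thesis by blast
qed

end

section \<open>The algebras \<open>U\<^sub>r\<close> and \<open>U\<^sub>X\<close>\<close>

text \<open>Both kinds of arrows in one notation, with \<open>d\<close> equal to \<open>1\<close> or
  \<open>- 1\<close>; relations that differ only in directions then coincide.\<close>

definition step :: "point => nat => int => arrow" where "step x j d = (if d = 1 then ArrA x j else ArrB x j)"

definition isg :: "int => int" where "isg n = (if even n then 1 else - 1)"

lemma isg_add: "isg (m + n) = isg m * isg n" by (simp add: isg_def)

lemma plus_eps: "x + eps i = x(i := x i + 1)" "x - eps i = x(i := x i - 1)"
 by (auto simp: eps_def fun_eq_iff)

lemma step_simps: "step x j 1 = ArrA x j" "step x j (- 1) = ArrB x j" "arrow_tail (step x j d) = x"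
 "\<bar>d\<bar> = 1 ==> arrow_head (step x j d) = x(j := x j + d)"
proof -
 show "step x j 1 = ArrA x j" "step x j (- 1) = ArrB x j" "arrow_tail (step x j d) = x" by (simp_all add: step_def)
 assume "\<bar>d\<bar> = 1"
 hence "d = 1 \<or> d = - 1" by auto
 thus "arrow_head (step x j d) = x(j := x j + d)" by (auto simp: step_def plus_eps)
qed

lemma step_cases:
 assumes "e : arcs (U_quiver r)"
 obtains x j d where "x : lattice_pts r" "j : {1..r}" "\<bar>d\<bar> = 1" "e = step x j d"
proof -
 have "(EX x j. x : lattice_pts r & j : {1..r} & e = step x j 1) \<or> (EX x j. x : lattice_pts r & j : {1..r} & e = step x j (- 1))"
  using assms by (auto simp: U_quiver_def step_simps)
 thus ?thesis using that by (metis abs_1 abs_minus_cancel)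
qed

lemma step_arc: "[|x : lattice_pts r; j : {1..r}; \<bar>d\<bar> = 1|] ==> step x j d : arcs (U_quiver r)"
 by (auto simp: U_quiver_def step_def)

lemma U_quiver_simps: "verts (U_quiver r) = lattice_pts r" "tail (U_quiver r) = arrow_tail" "head (U_quiver r) = arrow_head"
 by (simp_all add: U_quiver_def)

lemma U_quiver_locally_finite: assumes "field K" shows "locally_finite_quiver K (U_quiver r)"
proof (intro locally_finite_quiver.intro locally_finite_quiver_axioms.intro assms wf_digraph.intro)
 fix e assume "e : arcs (U_quiver r)"
 then obtain x j d where e: "x : lattice_pts r" "j : {1..r}" "\<bar>d\<bar> = 1" "e = step x j d" by (rule step_cases)
 show "tail (U_quiver r) e : verts (U_quiver r)" unfolding U_quiver_simps e(4) step_simps(3) by (rule e(1))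
 show "head (U_quiver r) e : verts (U_quiver r)" unfolding U_quiver_simps e(4) step_simps(4)[OF e(3)] by (rule lattice_upd[OF e(1,2)])
next
 fix v
 have "{e : arcs (U_quiver r). tail (U_quiver r) e = v} \<subseteq> ArrA v ` {1..r} \<union> ArrB v ` {1..r}"
  by (auto simp: U_quiver_def)
 thus "finite {e : arcs (U_quiver r). tail (U_quiver r) e = v}" by (rule finite_subset) simp
qed

locale cubist_quiver = cubist_ideal r I X + field K for r I X and K :: "'k ring" (structure)
begin

sublocale Q: locally_finite_quiver K "U_quiver r"
 by (rule U_quiver_locally_finite) (rule field_axioms)

abbreviation (input) "PA \<equiv> path_algebra K (U_quiver r)"
abbreviation (input) "R \<equiv> U_relations K r"

text \<open>All relations are combinations of such paths of length two, the middle factor in a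
  longer path.\<close>

definition mid :: "point => nat => int => nat => int => (point, arrow) path" where
 "mid x i d j e = (x, [step x i d, step (x(i := x i + d)) j e], (x(i := x i + d))(j := (x(i := x i + d)) j + e))"

lemma walk_step: "[|x : lattice_pts r; j : {1..r}; \<bar>d\<bar> = 1|] ==> Q.awalk x (step x j d # es) w \<longleftrightarrow> Q.awalk (x(j := x j + d)) es w"
 using step_arc by (simp add: Q.awalk_Cons_iff U_quiver_simps step_simps)

lemma walk_Nil: "Q.awalk u [] w \<longleftrightarrow> u = w & u : lattice_pts r"
 by (simp add: Q.awalk_Nil_iff U_quiver_simps)

lemma mid_path: "[|x : lattice_pts r; i : {1..r}; \<bar>d\<bar> = 1; j : {1..r}; \<bar>e\<bar> = 1|] ==> mid x i d j e : qpaths (U_quiver r)"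
 unfolding mid_def Q.qpaths_iff by (simp add: walk_step walk_Nil lattice_upd del: fun_upd_apply)

lemma step_path: "[|x : lattice_pts r; i : {1..r}; \<bar>d\<bar> = 1|] ==> (x, [step x i d], x(i := x i + d)) : qpaths (U_quiver r)"
 unfolding Q.qpaths_iff by (simp add: walk_step walk_Nil lattice_upd del: fun_upd_apply)

lemma arrow_elem_step: "\<bar>d\<bar> = 1 ==> arrow_elem K (U_quiver r) (step x j d) = Q.delta (x, [step x j d], x(j := x j + d))"
 by (simp add: arrow_elem_def Q.delta_def U_quiver_simps step_simps del: fun_upd_apply)

lemma delta_mid:
 assumes "x : lattice_pts r" "i : {1..r}" "\<bar>d\<bar> = 1" "j : {1..r}" "\<bar>e\<bar> = 1" "x' = x(i := x i + d)"
 shows "Q.delta (x, [step x i d], x') **.PA Q.delta (x', [step x' j e], x'(j := x' j + e)) = Q.delta (mid x i d j e)"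
proof -
 have x': "x' : lattice_pts r" unfolding assms(6) by (rule lattice_upd[OF assms(1,2)])
 show ?thesis
  using Q.delta_mult[OF step_path[OF assms(1-3)] step_path[OF x' assms(4,5)]]
  unfolding mid_def assms(6) by (simp add: Q.src_def Q.trg_def Q.cat_def del: fun_upd_apply)
qed

lemma arrow_mid:
 assumes "x : lattice_pts r" "i : {1..r}" "\<bar>d\<bar> = 1" "j : {1..r}" "\<bar>e\<bar> = 1"
 shows "arrow_elem K (U_quiver r) (step x i d) **.PA arrow_elem K (U_quiver r) (step (x(i := x i + d)) j e) = Q.delta (mid x i d j e)"
 unfolding arrow_elem_step[OF assms(3)] arrow_elem_step[OF assms(5)] by (rule delta_mid[OF assms refl])

lemma arrow_products:
 assumes "x : lattice_pts r" "i : {1..r}" "j : {1..r}"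
 shows "arrow_elem K (U_quiver r) (ArrA x i) **.PA arrow_elem K (U_quiver r) (ArrA (x + eps i) j) = Q.delta (mid x i 1 j 1)"
  "arrow_elem K (U_quiver r) (ArrB x i) **.PA arrow_elem K (U_quiver r) (ArrB (x - eps i) j) = Q.delta (mid x i (-1) j (-1))"
  "arrow_elem K (U_quiver r) (ArrA x i) **.PA arrow_elem K (U_quiver r) (ArrB (x + eps i) j) = Q.delta (mid x i 1 j (-1))"
  "arrow_elem K (U_quiver r) (ArrB x i) **.PA arrow_elem K (U_quiver r) (ArrA (x - eps i) j) = Q.delta (mid x i (-1) j 1)"
 using arrow_mid[of x i 1 j 1] arrow_mid[of x i "-1" j "-1"] arrow_mid[of x i 1 j "-1"] arrow_mid[of x i "-1" j 1] assms
 by (simp_all add: step_simps plus_eps)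

lemma relation_cases:
 assumes "\<rho> : R"
 obtains (straight) x i d where "x : lattice_pts r" "i : {1..r}" "\<bar>d\<bar> = 1" "\<rho> = Q.delta (mid x i d i d)"
 | (square) x i d j e where "x : lattice_pts r" "i : {1..r}" "\<bar>d\<bar> = 1" "j : {1..r}" "\<bar>e\<bar> = 1" "i ~= j"
   "\<rho> = Q.delta (mid x i d j e) \<oplus>.PA Q.delta (mid x j e i d)"
 | (loop) x i j where "x : lattice_pts r" "i : {1..r}" "j : {1..r}"
   "\<rho> = (Q.delta (mid x i (-1) i 1) \<oplus>.PA Q.delta (mid x i 1 i (-1))) \<ominus>.PA (Q.delta (mid x j (-1) j 1) \<oplus>.PA Q.delta (mid x j 1 j (-1)))"
proof -
 note P = arrow_products
 from assms show thesis unfolding U_relations_def Let_def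
 proof (elim UnE CollectE exE conjE)
  fix x i assume "x : lattice_pts r" "i : {1..r}" and e: "\<rho> = arrow_elem K (U_quiver r) (ArrA x i) **.PA arrow_elem K (U_quiver r) (ArrA (x + eps i) i)"
  thus thesis using straight[of x i 1] P(1)[of x i i] by simp
 next
  fix x i assume "x : lattice_pts r" "i : {1..r}" and e: "\<rho> = arrow_elem K (U_quiver r) (ArrB x i) **.PA arrow_elem K (U_quiver r) (ArrB (x - eps i) i)"
  thus thesis using straight[of x i "-1"] P(2)[of x i i] by simp
 next
  fix x i j assume a: "x : lattice_pts r" "i : {1..r}" "j : {1..r}" "i ~= j" and e: "\<rho> = arrow_elem K (U_quiver r) (ArrA x i) **.PA arrow_elem K (U_quiver r) (ArrA (x + eps i) j)
   \<oplus>.PA arrow_elem K (U_quiver r) (ArrA x j) **.PA arrow_elem K (U_quiver r) (ArrA (x + eps j) i)"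
  thus thesis using square[of x i 1 j 1] P(1)[of x i j] P(1)[of x j i] by simp
 next
  fix x i j assume a: "x : lattice_pts r" "i : {1..r}" "j : {1..r}" "i ~= j" and e: "\<rho> = arrow_elem K (U_quiver r) (ArrB x i) **.PA arrow_elem K (U_quiver r) (ArrB (x - eps i) j)
   \<oplus>.PA arrow_elem K (U_quiver r) (ArrB x j) **.PA arrow_elem K (U_quiver r) (ArrB (x - eps j) i)"
  thus thesis using square[of x i "-1" j "-1"] P(2)[of x i j] P(2)[of x j i] by simp
 next
  fix x i j assume a: "x : lattice_pts r" "i : {1..r}" "j : {1..r}" "i ~= j" and e: "\<rho> = arrow_elem K (U_quiver r) (ArrA x i) **.PA arrow_elem K (U_quiver r) (ArrB (x + eps i) j)
   \<oplus>.PA arrow_elem K (U_quiver r) (ArrB x j) **.PA arrow_elem K (U_quiver r) (ArrA (x - eps j) i)"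
  thus thesis using square[of x i 1 j "-1"] P(3)[of x i j] P(4)[of x j i] by simp
 next
  fix x i assume a: "x : lattice_pts r" "1 <= i" "i < r" and e: "\<rho> =
   (arrow_elem K (U_quiver r) (ArrB x i) **.PA arrow_elem K (U_quiver r) (ArrA (x - eps i) i)
    \<oplus>.PA arrow_elem K (U_quiver r) (ArrA x i) **.PA arrow_elem K (U_quiver r) (ArrB (x + eps i) i)) \<ominus>.PA
   (arrow_elem K (U_quiver r) (ArrB x (i + 1)) **.PA arrow_elem K (U_quiver r) (ArrA (x - eps (i + 1)) (i + 1))
    \<oplus>.PA arrow_elem K (U_quiver r) (ArrA x (i + 1)) **.PA arrow_elem K (U_quiver r) (ArrB (x + eps (i + 1)) (i + 1)))"
  have i: "i : {1..r}" "i + 1 : {1..r}" using a by auto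
  show thesis using loop[OF a(1) i] e P(3,4)[OF a(1) i(1) i(1)] P(3,4)[OF a(1) i(2) i(2)] by simp
 qed
qed

lemma relations:
 assumes x: "x : lattice_pts r"
 shows "[|i : {1..r}; \<bar>d\<bar> = 1|] ==> Q.delta (mid x i d i d) : R"
  "[|i : {1..r}; j : {1..r}; i ~= j; \<bar>d\<bar> = 1; \<bar>e\<bar> = 1|] ==> Q.delta (mid x i d j e) \<oplus>.PA Q.delta (mid x j e i d) : R"
  "[|1 <= i; i < r|] ==> (Q.delta (mid x i (-1) i 1) \<oplus>.PA Q.delta (mid x i 1 i (-1))) \<ominus>.PA
   (Q.delta (mid x (i+1) (-1) (i+1) 1) \<oplus>.PA Q.delta (mid x (i+1) 1 (i+1) (-1))) : R"
proof -
 note P = arrow_products[OF x, symmetric]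
 assume i: "i : {1..r}" "\<bar>d\<bar> = 1"
 hence "d = 1 \<or> d = -1" by auto
 thus "Q.delta (mid x i d i d) : R"
 proof
  assume d: "d = 1"
  show ?thesis unfolding d P(1)[OF i(1) i(1)] U_relations_def Let_def using x i(1) by blast
 next
  assume d: "d = -1"
  show ?thesis unfolding d P(2)[OF i(1) i(1)] U_relations_def Let_def using x i(1) by blast
 qed
next
 note P = arrow_products[OF x, symmetric]
 assume i: "i : {1..r}" and j: "j : {1..r}" and n: "i ~= j" and de: "\<bar>d\<bar> = 1" "\<bar>e\<bar> = 1"
 have "d = 1 & e = 1 \<or> d = -1 & e = -1 \<or> d = 1 & e = -1 \<or> d = -1 & e = 1" using de by auto
 thus "Q.delta (mid x i d j e) \<oplus>.PA Q.delta (mid x j e i d) : R"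
 proof (elim disjE conjE)
  assume d: "d = 1" "e = 1"
  show ?thesis unfolding d P(1)[OF i j] P(1)[OF j i] U_relations_def Let_def using x i j n by blast
 next
  assume d: "d = -1" "e = -1"
  show ?thesis unfolding d P(2)[OF i j] P(2)[OF j i] U_relations_def Let_def using x i j n by blast
 next
  assume d: "d = 1" "e = -1"
  show ?thesis unfolding d P(3)[OF i j] P(4)[OF j i] U_relations_def Let_def using x i j n by blast
 next
  assume d: "d = -1" "e = 1"
  have "Q.delta (mid x i (-1) j 1) \<oplus>.PA Q.delta (mid x j 1 i (-1)) = Q.delta (mid x j 1 i (-1)) \<oplus>.PA Q.delta (mid x i (-1) j 1)"
   by (rule Q.A.M.a_comm) (intro Q.delta_closed mid_path x i j; simp)+
  moreover have "Q.delta (mid x j 1 i (-1)) \<oplus>.PA Q.delta (mid x i (-1) j 1) : R"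
   unfolding P(3)[OF j i] P(4)[OF i j] U_relations_def Let_def using x i j n by blast
  ultimately show ?thesis unfolding d by simp
 qed
next
 note P = arrow_products[OF x, symmetric]
 assume i: "1 <= i" "i < r"
 have ir: "i : {1..r}" "i + 1 : {1..r}" using i by auto
 show "(Q.delta (mid x i (-1) i 1) \<oplus>.PA Q.delta (mid x i 1 i (-1))) \<ominus>.PA
   (Q.delta (mid x (i+1) (-1) (i+1) 1) \<oplus>.PA Q.delta (mid x (i+1) 1 (i+1) (-1))) : R"
  unfolding P(3)[OF ir(1) ir(1)] P(4)[OF ir(1) ir(1)] P(3)[OF ir(2) ir(2)] P(4)[OF ir(2) ir(2)] U_relations_def Let_def using x i by blast
qed

lemma mid_grade: assumes "x : lattice_pts r" "i : {1..r}" "\<bar>d\<bar> = 1" "j : {1..r}" "\<bar>e\<bar> = 1"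
 shows "Q.delta (mid x i d j e) : agrade PA 2"
proof -
 have "length (fst (snd q)) = 2" if "Q.delta (mid x i d j e) q ~= \<zero>.K" for q
 proof -
  have "q = mid x i d j e" using that by (simp add: Q.delta_def split: if_split_asm)
  thus ?thesis by (simp add: mid_def)
 qed
 thus ?thesis unfolding Q.pa_ops(6) using Q.delta_closed[OF mid_path[OF assms]] by simp
qed

lemma relation_grade: assumes "\<rho> : R" shows "\<rho> : agrade PA 2"
proof -
 note D = Q.A.submoduleD[OF Q.P.agrade_submodule[of 2]]
 show ?thesis using assms
 proof (cases rule: relation_cases)
  case straight thus ?thesis using mid_grade by simp
 next
  case square thus ?thesis using mid_grade D(3) by simp
 next
  case (loop x i j)
  have "Q.delta (mid x k (-1) k 1) : agrade PA 2" "Q.delta (mid x k 1 k (-1)) : agrade PA 2" if "k : {1..r}" for k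
   using mid_grade[OF loop(1) that, of "-1" k 1] mid_grade[OF loop(1) that, of 1 k "-1"] that by simp_all
  thus ?thesis unfolding loop(4) using loop(2,3) by (intro D(6) D(3)) simp_all
 qed
qed

text \<open>The numbers of arrows of the path that point in the positive and in the negative \<open>i\<close>th direction.\<close>

fun ups :: "nat => arrow list => nat" where
 "ups i [] = 0" | "ups i (ArrA x j # es) = (if j = i then 1 else 0) + ups i es" | "ups i (ArrB x j # es) = ups i es"

fun downs :: "nat => arrow list => nat" where
 "downs i [] = 0" | "downs i (ArrB x j # es) = (if j = i then 1 else 0) + downs i es" | "downs i (ArrA x j # es) = downs i es"

lemma ups_append: "ups i (as @ bs) = ups i as + ups i bs"
proof (induction as)
 case (Cons a as) thus ?case by (cases a) simp_all
qed simp

lemma downs_append: "downs i (as @ bs) = downs i as + downs i bs"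
proof (induction as)
 case (Cons a as) thus ?case by (cases a) simp_all
qed simp

lemma walk_induct [consumes 1, case_names Nil Cons]:
 assumes "Q.awalk u es w"
  and "w : lattice_pts r ==> P w []"
  and "!!u j d es. [|u : lattice_pts r; j : {1..r}; \<bar>d\<bar> = 1; Q.awalk (u(j := u j + d)) es w; P (u(j := u j + d)) es|] ==> P u (step u j d # es)"
 shows "P u es"
 using assms(1)
proof (induction es arbitrary: u)
 case Nil thus ?case using assms(2) by (auto simp: walk_Nil)
next
 case (Cons e es)
 have e: "e : arcs (U_quiver r)" "u = arrow_tail e" "Q.awalk (arrow_head e) es w" using Cons.prems by (auto simp: Q.awalk_Cons_iff U_quiver_simps)
 obtain x j d where x: "x : lattice_pts r" "j : {1..r}" "\<bar>d\<bar> = 1" "e = step x j d" using e(1) by (rule step_cases)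
 have xu: "x = u" using x(4) e(2) by (simp add: step_simps)
 have a: "Q.awalk (u(j := u j + d)) es w" using e(3) unfolding x(4) xu step_simps(4)[OF x(3)] .
 have u: "u : lattice_pts r" using x(1) unfolding xu .
 show ?case unfolding x(4) xu by (rule assms(3)[OF u x(2,3) a Cons.IH[OF a]])
qed

lemma ups_downs_step: "\<bar>d\<bar> = 1 ==> int (ups i (step u j d # es)) - int (downs i (step u j d # es)) = (if j = i then d else 0) + (int (ups i es) - int (downs i es))"
 "ups i (step u j d # es) + downs i (step u j d # es) = (if j = i then 1 else 0) + (ups i es + downs i es)"
 by (auto simp: step_def)

lemma walk_coord: "Q.awalk u es w ==> w i = u i + (int (ups i es) - int (downs i es))"
proof (induction rule: walk_induct)
 case (Cons u j d es)
 show ?case unfolding ups_downs_step(1)[OF Cons.hyps(3)] Cons.IH by simp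
qed simp

lemma walk_length: "Q.awalk u es w ==> length es = (\<Sum>i\<in>{1..r}. ups i es + downs i es)"
proof (induction rule: walk_induct)
 case (Cons u j d es)
 have "(\<Sum>i\<in>{1..r}. ups i (step u j d # es) + downs i (step u j d # es)) = (\<Sum>i\<in>{1..r}. if j = i then 1 else 0) + (\<Sum>i\<in>{1..r}. ups i es + downs i es)"
  unfolding ups_downs_step(2) by (rule sum.distrib)
 also have "(\<Sum>i\<in>{1..r}. if j = i then 1 else (0::nat)) = 1" using Cons.hyps(2) by simp
 finally show ?case using Cons.IH by simp
qed simp

text \<open>A closed walk uses every direction as often upwards as downwards, so each moved
  coordinate costs at least two arrows, too many for all \<open>r\<close> coordinates.\<close>

lemma unmoved_ex:
 assumes w: "Q.awalk u es u" and l: "length es = 2 * (r - 1)"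
 shows "EX i:{1..r}. ups i es + downs i es = 0"
proof (rule ccontr)
 assume n: "\<not> ?thesis"
 have "2 <= ups i es + downs i es" if "i : {1..r}" for i
 proof -
  have e: "ups i es = downs i es" using walk_coord[OF w, of i] by simp
  have "ups i es + downs i es ~= 0" using bexI[of "%i. ups i es + downs i es = 0" i "{1..r}"] n that by metis
  hence "downs i es ~= 0" unfolding e by simp
  thus ?thesis unfolding e by simp
 qed
 hence "(\<Sum>i\<in>{1..r}. 2) <= (\<Sum>i\<in>{1..r}. ups i es + downs i es)" by (rule sum_mono)
 thus False using walk_length[OF w] l r1 by simp
qed

subsection \<open>A weight that detects the tile of a point\<close>

context
 fixes s :: point
 assumes s: "s : lattice_pts r"
begin

text \<open>The box of side one with corner \<open>s\<close> that extends upwards in the directions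
  of \<open>E\<close> and downwards in all others.\<close>

definition inbox :: "nat set => point => bool" where
 "inbox E x \<longleftrightarrow> (ALL j:{1..r}. x j = s j \<or> x j = s j + (if j : E then 1 else - 1))"

text \<open>The matrix entry of the arrow in the representation on the vertices of the box; the
  signs from \<open>qexp\<close> make squares anticommute.\<close>

definition arrow_wt :: "nat set => arrow => int" where
 "arrow_wt E e = (if inbox E (arrow_tail e) & inbox E (arrow_head e) then isg (qexp r (arrow_tail e) (arrow_head e)) else 0)"

definition wt :: "nat set => arrow list => int" where "wt E es = prod_list (map (arrow_wt E) es)"

text \<open>The top vertex of the box of \<open>E\<close>.\<close>

definition bump :: "nat set => point" where "bump E = (%j. if j : E then s j + 1 else s j)"

text \<open>A box counts if its top vertex is outside the ideal; only through this condition does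
  the weight depend on \<open>X\<close>.\<close>

definition signs :: "nat set set" where "signs = {E. E \<subseteq> {1..r} & bump E ~: I}"

definition loop_wt :: "(point, arrow) path => int" where
 "loop_wt = (%(u, es, w). if u = s & w = s & length es = 2 * (r - 1) then (\<Sum>E\<in>signs. (- 1) ^ card E * wt E es) else 0)"

lemma finite_signs: "finite signs"
 by (rule finite_subset[of _ "Pow {1..r}"]) (auto simp: signs_def)

lemma wt_append: "wt E (as @ bs) = wt E as * wt E bs" by (simp add: wt_def)

lemma arrow_wt_step: "\<bar>d\<bar> = 1 ==> arrow_wt E (step x j d) =
 (if inbox E x & inbox E (x(j := x j + d)) then isg (qexp r x (x(j := x j + d))) else 0)"
 by (simp add: arrow_wt_def step_simps del: fun_upd_apply)

lemma wt_mid: "[|\<bar>d\<bar> = 1; \<bar>e\<bar> = 1; x' = x(i := x i + d); x'' = x'(j := x' j + e)|] ==> wt E (fst (snd (mid x i d j e))) =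
 (if inbox E x & inbox E x' & inbox E x'' then isg (qexp r x x' + qexp r x' x'') else 0)"
 by (simp add: wt_def mid_def arrow_wt_step isg_add del: fun_upd_apply)

lemma inboxD: "[|inbox E y; i : {1..r}|] ==> y i = s i \<or> y i = s i + (if i : E then 1 else - 1)"
 unfolding inbox_def by blast

text \<open>A box has side one in every direction, so it cannot contain three points in a
  row.\<close>

lemma wt_straight: assumes "i : {1..r}" "\<bar>d\<bar> = 1" shows "wt E (fst (snd (mid x i d i d))) = 0"
proof -
 let ?y = "x(i := x i + d)"
 let ?z = "?y(i := ?y i + d)"
 have "\<not> (inbox E x & inbox E ?y & inbox E ?z)"
 proof
  assume h: "inbox E x & inbox E ?y & inbox E ?z"
  define c :: int where "c = (if i : E then 1 else - 1)"
  have c: "c = 1 \<or> c = - 1" and d: "d = 1 \<or> d = - 1" using assms(2) by (auto simp: c_def)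
  have "x i = s i \<or> x i = s i + c" "x i + d = s i \<or> x i + d = s i + c" "x i + d + d = s i \<or> x i + d + d = s i + c"
   using inboxD[of E x, OF _ assms(1)] inboxD[of E ?y, OF _ assms(1)] inboxD[of E ?z, OF _ assms(1)] h unfolding c_def by simp_all
  thus False using c d by auto
 qed
 thus ?thesis using wt_mid[OF assms(2) assms(2) refl refl, of E x i i] by auto
qed

text \<open>Membership in a box is tested coordinate by coordinate. So if two opposite corners of
  the square are in the box, both middle points are, and the two signs are opposite by
  \<open>qexp_square\<close>.\<close>

lemma wt_square: assumes "i : {1..r}" "j : {1..r}" "i ~= j" "\<bar>d\<bar> = 1" "\<bar>e\<bar> = 1"
 shows "wt E (fst (snd (mid x i d j e))) + wt E (fst (snd (mid x j e i d))) = 0"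
proof -
 let ?i = "x(i := x i + d)" and ?j = "x(j := x j + e)" and ?ij = "x(i := x i + d, j := x j + e)"
 have ij: "?i(j := ?i j + e) = ?ij" "?j(i := ?j i + d) = ?ij" "x(j := x j + e, i := x i + d) = ?ij" using assms(3) by (auto simp: fun_eq_iff)
 have o: "odd (qexp r x ?i + qexp r ?i ?ij - (qexp r x ?j + qexp r ?j ?ij))"
  using qexp_square[OF assms(1-3), of "x i + d" x "x j + e"] assms(4,5) unfolding ij(3) by simp
 have b: "inbox E ?i \<longleftrightarrow> inbox E ?j" if "inbox E x" "inbox E ?ij"
 proof -
  have "inbox E ?i & inbox E ?j" unfolding inbox_def
  proof (intro conjI ballI)
   fix k assume k: "k : {1..r}"
   have 1: "x k = s k \<or> x k = s k + (if k : E then 1 else - 1)" using that(1) k unfolding inbox_def by blast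
   have 2: "?ij k = s k \<or> ?ij k = s k + (if k : E then 1 else - 1)" using that(2) k unfolding inbox_def by blast
   show "?i k = s k \<or> ?i k = s k + (if k : E then 1 else - 1)" using 1 2 assms(3) by (cases "k = i") simp_all
   show "?j k = s k \<or> ?j k = s k + (if k : E then 1 else - 1)" using 1 2 by (cases "k = j") simp_all
  qed
  thus ?thesis by simp
 qed
 have "isg (qexp r x ?i + qexp r ?i ?ij) + isg (qexp r x ?j + qexp r ?j ?ij) = 0" using o by (auto simp: isg_def)
 thus ?thesis using b unfolding wt_mid[OF assms(4,5) refl ij(1)[symmetric]] wt_mid[OF assms(5,4) refl ij(2)[symmetric]] by auto
qed

text \<open>Exactly one of the two neighbours in direction \<open>i\<close> is in the box, and going
  there and back has sign one; the value is the same for all \<open>i\<close>, as the loop relations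
  require.\<close>

lemma wt_loop: assumes i: "i : {1..r}"
 shows "wt E (fst (snd (mid x i (-1) i 1))) + wt E (fst (snd (mid x i 1 i (-1)))) = (if inbox E x then 1 else 0)"
proof -
 let ?m = "x(i := x i + -1)" and ?p = "x(i := x i + 1)"
 have b: "?m(i := ?m i + 1) = x" "?p(i := ?p i + -1) = x" by auto
 have q: "even (qexp r x (x(i := x i + d)) + qexp r (x(i := x i + d)) x)" for d
 proof -
  let ?x = "x(i := x i + d)"
  have e: "?x(i := x i) = x" by auto
  have "qexp r ?x (?x(i := x i)) = (x i - ?x i) * (\<Sum>l\<in>{1..<i}. ?x l)" by (rule qexp_upd[OF i])
  moreover have "(\<Sum>l\<in>{1..<i}. ?x l) = (\<Sum>l\<in>{1..<i}. x l)" by (rule sum.cong) auto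
  ultimately have "qexp r ?x x = - d * (\<Sum>l\<in>{1..<i}. x l)" unfolding e by simp
  moreover have "qexp r x ?x = d * (\<Sum>l\<in>{1..<i}. x l)" using qexp_upd[OF i, of x "x i + d"] by simp
  ultimately show ?thesis by simp
 qed
 have io: "inbox E (x(i := a)) \<longleftrightarrow> a = s i \<or> a = s i + (if i : E then 1 else - 1)" if "inbox E x" for a
 proof
  assume "inbox E (x(i := a))"
  thus "a = s i \<or> a = s i + (if i : E then 1 else - 1)" using i unfolding inbox_def by (metis fun_upd_same)
 next
  assume a: "a = s i \<or> a = s i + (if i : E then 1 else - 1)"
  show "inbox E (x(i := a))" unfolding inbox_def
  proof
   fix k assume "k : {1..r}"
   hence "x k = s k \<or> x k = s k + (if k : E then 1 else - 1)" using that unfolding inbox_def by blast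
   thus "(x(i := a)) k = s k \<or> (x(i := a)) k = s k + (if k : E then 1 else - 1)" using a by (cases "k = i") simp_all
  qed
 qed
 have "wt E (fst (snd (mid x i (-1) i 1))) = (if inbox E x & inbox E ?m then 1 else 0)"
  using wt_mid[of "-1" 1 ?m x i x i E] b q[of "-1"] by (auto simp: isg_def)
 moreover have "wt E (fst (snd (mid x i 1 i (-1)))) = (if inbox E x & inbox E ?p then 1 else 0)"
  using wt_mid[of 1 "-1" ?p x i x i E] b q[of 1] by (auto simp: isg_def)
 moreover have "(inbox E ?m & \<not> inbox E ?p) \<or> (\<not> inbox E ?m & inbox E ?p)" if ix: "inbox E x"
 proof -
  have "x i = s i \<or> x i = s i + (if i : E then 1 else - 1)" using ix i unfolding inbox_def by blast
  thus ?thesis unfolding io[OF ix] by (auto split: if_splits)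
 qed
 ultimately show ?thesis by auto
qed

lemma loop_wt_mid: "loop_wt (Q.cat (Q.cat p m) q) =
 (if fst p = s & snd (snd q) = s & length (fst (snd p)) + length (fst (snd m)) + length (fst (snd q)) = 2 * (r - 1)
  then (\<Sum>E\<in>signs. ((- 1) ^ card E * wt E (fst (snd p)) * wt E (fst (snd q))) * wt E (fst (snd m))) else 0)"
proof -
 have "loop_wt (Q.cat (Q.cat p m) q) = (if fst p = s & snd (snd q) = s & length (fst (snd p)) + length (fst (snd m)) + length (fst (snd q)) = 2 * (r - 1)
  then (\<Sum>E\<in>signs. (- 1) ^ card E * wt E ((fst (snd p) @ fst (snd m)) @ fst (snd q))) else 0)"
  by (simp add: loop_wt_def Q.cat_def)
 also have "(\<Sum>E\<in>signs. (- 1) ^ card E * wt E ((fst (snd p) @ fst (snd m)) @ fst (snd q)))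
   = (\<Sum>E\<in>signs. ((- 1) ^ card E * wt E (fst (snd p)) * wt E (fst (snd q))) * wt E (fst (snd m)))"
  by (rule sum.cong) (simp_all add: wt_append)
 finally show ?thesis .
qed

lemma mid_ends: "Q.src (mid x i d j e) = x" "length (fst (snd (mid x i d j e))) = 2"
 by (simp_all add: mid_def Q.src_def)

lemma mid_trg: "Q.trg (mid x i d j e) = (x(i := x i + d))(j := (x(i := x i + d)) j + e)"
 by (simp add: mid_def Q.trg_def)

lemma relation_killed: assumes "\<rho> : R" shows "\<rho> : Q.killed loop_wt"
 using assms
proof (cases rule: relation_cases)
 case (straight x i d)
 show ?thesis unfolding straight(4)
  by (rule Q.killed_delta[OF mid_path[OF straight(1-3) straight(2,3)]]) (simp add: loop_wt_mid wt_straight[OF straight(2,3)])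
next
 case (square x i d j e)
 have t: "Q.trg (mid x j e i d) = Q.trg (mid x i d j e)" unfolding mid_trg using square(6) by (auto simp: fun_eq_iff)
 show ?thesis unfolding square(7)
 proof (rule Q.killed_delta2[OF mid_path[OF square(1-5)] mid_path[OF square(1,4,5,2,3)] _ t])
  fix p q :: "(point, arrow) path"
  have e: "(\<Sum>E\<in>signs. c E * wt E (fst (snd (mid x i d j e)))) + (\<Sum>E\<in>signs. c E * wt E (fst (snd (mid x j e i d)))) = 0" for c
  proof -
   have "c E * wt E (fst (snd (mid x i d j e))) + c E * wt E (fst (snd (mid x j e i d))) = 0" for E
    using wt_square[OF square(2,4,6,3,5), of E x] by (simp only: distrib_left[symmetric] mult_zero_right)
   hence "(\<Sum>E\<in>signs. c E * wt E (fst (snd (mid x i d j e))) + c E * wt E (fst (snd (mid x j e i d)))) = 0" by (simp only: sum.neutral_const)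
   thus ?thesis by (simp only: sum.distrib)
  qed
  show "loop_wt (Q.cat (Q.cat p (mid x i d j e)) q) + loop_wt (Q.cat (Q.cat p (mid x j e i d)) q) = 0"
   unfolding loop_wt_mid mid_ends using e[of "%E. (- 1) ^ card E * wt E (fst (snd p)) * wt E (fst (snd q))"] by simp
 qed (simp add: mid_ends)
next
 case (loop x i j)
 have t: "Q.trg (mid x k 1 k (-1)) = x" "Q.trg (mid x k (-1) k 1) = x" for k unfolding mid_trg by auto
 have mp: "mid x k (-1) k 1 : qpaths (U_quiver r)" "mid x k 1 k (-1) : qpaths (U_quiver r)" if "k : {1..r}" for k
  using mid_path[OF loop(1) that, of "-1" k 1] mid_path[OF loop(1) that, of 1 k "-1"] that by simp_all
 show ?thesis unfolding loop(4)
 proof (rule Q.killed_delta4[OF mp(1)[OF loop(2)] mp(2)[OF loop(2)] mp(1)[OF loop(3)] mp(2)[OF loop(3)]])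
  fix p q :: "(point, arrow) path"
  have e: "(\<Sum>E\<in>signs. c E * wt E (fst (snd (mid x k (-1) k 1)))) + (\<Sum>E\<in>signs. c E * wt E (fst (snd (mid x k 1 k (-1)))))
    = (\<Sum>E\<in>signs. c E * (if inbox E x then 1 else 0))" if k: "k : {1..r}" for c k
  proof -
   have "c E * wt E (fst (snd (mid x k (-1) k 1))) + c E * wt E (fst (snd (mid x k 1 k (-1)))) = c E * (if inbox E x then 1 else 0)" for E
    by (simp only: distrib_left[symmetric] wt_loop[OF k])
   thus ?thesis by (simp only: sum.distrib[symmetric])
  qed
  show "loop_wt (Q.cat (Q.cat p (mid x i (-1) i 1)) q) + loop_wt (Q.cat (Q.cat p (mid x i 1 i (-1))) q) =
    loop_wt (Q.cat (Q.cat p (mid x j (-1) j 1)) q) + loop_wt (Q.cat (Q.cat p (mid x j 1 j (-1))) q)"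
   unfolding loop_wt_mid mid_ends using e[OF loop(2), of "%E. (- 1) ^ card E * wt E (fst (snd p)) * wt E (fst (snd q))"] e[OF loop(3), of "%E. (- 1) ^ card E * wt E (fst (snd p)) * wt E (fst (snd q))"] by simp
 qed (simp_all add: mid_ends t)
qed

definition toggle :: "nat => nat set => nat set" where "toggle i E = (if i : E then E - {i} else insert i E)"

lemma toggle_toggle: "toggle i (toggle i E) = E" by (auto simp: toggle_def)

lemma inbox_toggle: "x i = s i ==> inbox (toggle i E) x \<longleftrightarrow> inbox E x"
proof -
 assume a: "x i = s i"
 have "(x j = s j \<or> x j = s j + (if j : toggle i E then 1 else - 1)) \<longleftrightarrow> (x j = s j \<or> x j = s j + (if j : E then 1 else - 1))" for j
  using a by (cases "j = i") (auto simp: toggle_def)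
 thus ?thesis unfolding inbox_def by simp
qed

lemma wt_toggle: "[|Q.awalk u es w; ups i es + downs i es = 0; u i = s i|] ==> wt (toggle i E) es = wt E es"
proof (induction rule: walk_induct)
 case (Cons u j d es)
 have z: "ups i es + downs i es = 0" "j ~= i" using Cons.prems(1) unfolding ups_downs_step(2) by (auto split: if_splits)
 have u: "(u(j := u j + d)) i = s i" using z(2) Cons.prems(2) by simp
 have "wt (toggle i E) es = wt E es" by (rule Cons.IH[OF z(1) u])
 thus ?case using arrow_wt_step[OF Cons.hyps(3)] inbox_toggle[of "u(j := u j + d)" i E, OF u] inbox_toggle[of u i E] Cons.prems(2) by (simp add: wt_def del: fun_upd_apply)
qed (simp add: wt_def)

lemma wt_inbox: "[|Q.awalk u es w; inbox E u; wt E es ~= 0|] ==> inbox E w"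
proof (induction rule: walk_induct)
 case (Cons u j d es)
 have "arrow_wt E (step u j d) ~= 0" "wt E es ~= 0" using Cons.prems(2) by (auto simp: wt_def)
 thus ?case using Cons.IH arrow_wt_step[OF Cons.hyps(3)] by (auto split: if_splits simp del: fun_upd_apply)
qed simp

lemma bump_lattice: "E \<subseteq> {1..r} ==> bump E : lattice_pts r"
 using s by (auto simp: bump_def lattice_pts_def)

lemma inbox_self: "inbox E s" by (simp add: inbox_def)

text \<open>A loop of the relevant length leaves some coordinate \<open>i\<close> fixed.  If it passes through a point outside \<open>X\<close>, then
  switching the sign at \<open>i\<close> does not affect whether a box containing the loop occurs in the sum.\<close>

lemma loop_wt_outside:
 assumes w1: "Q.awalk s es1 x" and w2: "Q.awalk x es2 s" and l: "length (es1 @ es2) = 2 * (r - 1)" and x: "x : lattice_pts r" "x ~: X"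
 shows "(\<Sum>E\<in>signs. (- 1) ^ card E * wt E (es1 @ es2)) = 0"
proof -
 let ?es = "es1 @ es2"
 have w: "Q.awalk s ?es s" by (rule Q.awalk_appendI[OF w1 w2])
 from unmoved_ex[OF w l] obtain i where i: "i : {1..r}" "ups i ?es + downs i ?es = 0" by (rule bexE)
 note app = ups_append downs_append
 have "ups i es1 = 0" "downs i es1 = 0" using i(2) unfolding app by simp_all
 hence xi: "x i = s i" using walk_coord[OF w1, of i] by simp
 define h where "h E = (if bump E ~: I then (- 1) ^ card E * wt E ?es else 0)" for E
 \<comment> \<open>As \<open>x\<close> is in the box and \<open>x i = s i\<close>, both top vertices
   lie between \<open>x\<close> and \<open>raise r x\<close>. Since \<open>x\<close> is not in
   \<open>X\<close>, either \<open>x\<close> is outside the ideal or \<open>raise r x\<close> is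
   inside, and this decides both alike.\<close>
 have stable: "(bump E : I) = (bump (toggle i E) : I)" if E: "E \<subseteq> {1..r}" and nz: "wt E ?es ~= 0" for E
 proof -
  have "wt E es1 ~= 0"
  proof
   assume "wt E es1 = 0"
   hence "wt E ?es = 0" by (simp only: wt_append mult_zero_left)
   thus False using nz by contradiction
  qed
  hence ix: "inbox E x" by (rule wt_inbox[OF w1 inbox_self])
  have T: "toggle i E \<subseteq> {1..r}" using E i(1) by (auto simp: toggle_def)
  have xj: "x j = s j \<or> x j = s j + (if j : E then 1 else - 1)" if "j : {1..r}" for j using ix that unfolding inbox_def by blast
  have out: "x j = 0" "s j = 0" if "j ~: {1..r}" for j using lattice_out[OF x(1) that] lattice_out[OF s that] by simp_all
  show ?thesis
  proof (cases "x : I")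
   case False
   have "bump F ~: I" if "F = E \<or> F = toggle i E" for F
   proof
    assume F: "bump F : I"
    have "x j <= bump F j" for j
    proof (cases "j : {1..r} & j ~= i")
     case True
     have "j : F \<longleftrightarrow> j : E" using that True by (auto simp: toggle_def split: if_split_asm)
     thus ?thesis using xj[of j] True by (cases "j : E") (auto simp: bump_def)
    next
     case False
     hence "x j = s j" using xi out[of j] by (cases "j = i") simp_all
     thus ?thesis by (simp add: bump_def)
    qed
    thus False using I_down[OF F x(1)] False by blast
   qed
   thus ?thesis by blast
  next
   case True
   hence R: "raise r x : I" using x(2) mem_X by blast
   have "bump F : I" if "F = E \<or> F = toggle i E" for F
   proof (rule I_down[OF R])
    show "bump F : lattice_pts r" using that bump_lattice E T by blast
    fix j
    show "bump F j <= raise r x j"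
    proof (cases "j : {1..r}")
     case True
     hence rj: "raise r x j = x j + 1" by (simp add: raise_def)
     show ?thesis
     proof (cases "j = i")
      case True
      thus ?thesis unfolding rj using xi by (simp add: bump_def)
     next
      case False
      hence "j : F \<longleftrightarrow> j : E" using that by (auto simp: toggle_def split: if_split_asm)
      thus ?thesis unfolding rj using xj[OF True] by (cases "j : E") (auto simp: bump_def)
     qed
    next
     case False
     hence "j ~: F" using that E T by blast
     thus ?thesis using out[OF False] False by (auto simp: bump_def raise_def)
    qed
   qed
   thus ?thesis by blast
  qed
 qed
 have flip: "h (toggle i E) = - h E" if E: "E \<subseteq> {1..r}" for E
 proof -
  have f: "finite E" using E finite_subset by blast
  have c: "(- 1) ^ card (toggle i E) = - ((- 1 :: int) ^ card E)"
  proof (cases "i : E")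
   case True
   have tE: "toggle i E = E - {i}" using True by (simp add: toggle_def)
   obtain m where m: "card (E - {i}) = m" by blast
   have cE: "card E = Suc m" unfolding m[symmetric] by (rule card.remove[OF f True])
   show ?thesis unfolding tE m cE by (simp only: power_Suc mult_minus1)
  qed (use f in \<open>simp add: toggle_def\<close>)
  have t: "wt (toggle i E) ?es = wt E ?es" by (rule wt_toggle[OF w i(2) refl])
  show ?thesis unfolding h_def t c using stable[OF E] by (cases "wt E ?es = 0") auto
 qed
 have TP: "toggle i E : Pow {1..r}" if "E : Pow {1..r}" for E using that i(1) by (auto simp: toggle_def)
 have "(\<Sum>E\<in>Pow {1..r}. h E) = (\<Sum>E\<in>Pow {1..r}. h (toggle i E))"
  by (rule sum.reindex_bij_witness[of _ "toggle i" "toggle i"]) (assumption | rule TP | simp only: toggle_toggle)+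
 also have "... = (\<Sum>E\<in>Pow {1..r}. - h E)" by (rule sum.cong) (use flip in auto)
 finally have z: "(\<Sum>E\<in>Pow {1..r}. h E) = 0" by (simp add: sum_negf)
 have "(\<Sum>E\<in>signs. (- 1) ^ card E * wt E ?es) = (\<Sum>E\<in>signs. h E)" by (rule sum.cong) (auto simp: h_def signs_def)
 also have "... = (\<Sum>E\<in>Pow {1..r}. h E)" by (rule sum.mono_neutral_left) (auto simp: h_def signs_def)
 finally show ?thesis using z by simp
qed

lemma idem_killed: assumes x: "x : lattice_pts r" "x ~: X" shows "idem PA x : Q.killed loop_wt"
 unfolding Q.pa_ops(5)
proof (rule Q.killed_delta)
 show "(x, [], x) : qpaths (U_quiver r)" using x by (simp add: U_quiver_simps)
 fix p q :: "(point, arrow) path"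
 assume p: "p : qpaths (U_quiver r)" and q: "q : qpaths (U_quiver r)" and t: "Q.trg p = Q.src (x, [], x)" "Q.trg (x, [], x) = Q.src q"
 obtain u es1 where pe: "p = (u, es1, x)" using t(1) by (cases p) (auto simp: Q.trg_def Q.src_def)
 obtain w es2 where qe: "q = (x, es2, w)" using t(2) by (cases q) (auto simp: Q.trg_def Q.src_def)
 have w1: "Q.awalk u es1 x" "Q.awalk x es2 w" using p q unfolding pe qe Q.qpaths_iff by simp_all
 show "loop_wt (Q.cat (Q.cat p (x, [], x)) q) = 0"
  using loop_wt_outside[of es1 x es2] w1 x unfolding pe qe by (auto simp: loop_wt_def Q.cat_def)
qed

end

text \<open>A box containing the walk contains \<open>t\<close>, which prescribes all its directions
  except \<open>ty t\<close>. The top vertices of the two candidates are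
  \<open>raise (ty t - 1) t\<close>, in the ideal, and \<open>raise (ty t) t\<close>, outside. So
  exactly one box is counted.\<close>

lemma loop_wt_tile:
 assumes t: "t : X" and w1: "Q.awalk (opp t) es1 t" and w2: "Q.awalk t es2 (opp t)" and l: "length (es1 @ es2) = 2 * (r - 1)"
  and b: "!!e. e : set (es1 @ es2) ==> arrow_tail e : lm t & arrow_head e : lm t"
 shows "loop_wt (opp t) (opp t, es1 @ es2, opp t) = 1 \<or> loop_wt (opp t) (opp t, es1 @ es2, opp t) = - 1"
proof -
 let ?s = "opp t" and ?i = "ty t" and ?es = "es1 @ es2"
 have sl: "?s : lattice_pts r" by (rule X_lattice[OF opp_X[OF t]])
 note i = ty[OF t]
 let ?E0 = "{?i<..r}" and ?E1 = "{?i..r}"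
 have sj: "?s j = (if 1 <= j & j < ?i then t j + 1 else if ?i < j & j <= r then t j - 1 else t j)" for j by (simp add: opp_def opp_at_def)
 have E1: "bump ?s ?E1 = raise ?i t" "bump ?s ?E0 = raise (?i - 1) t"
  using i(1) by (auto simp: bump_def[OF sl] raise_def sj fun_eq_iff)
 have in1: "?E1 : signs ?s" using i by (auto simp: signs_def[OF sl] E1)
 have out0: "?E0 ~: signs ?s" using i by (auto simp: signs_def[OF sl] E1)
 have ib: "inbox ?s ?E1 v" if "v : lm t" for v unfolding inbox_def[OF sl]
 proof
  fix j assume j: "j : {1..r}"
  have "v j = t j \<or> v j = ?s j" using that unfolding lm_def box_def by blast
  thus "v j = ?s j \<or> v j = ?s j + (if j : ?E1 then 1 else - 1)" using j sj[of j] by auto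
 qed
 have one: "wt ?s ?E1 as = 1 \<or> wt ?s ?E1 as = - 1" if "!!e. e : set as ==> arrow_tail e : lm t & arrow_head e : lm t" for as
  using that
 proof (induction as)
  case Nil thus ?case by (simp add: wt_def[OF sl])
 next
  case (Cons e as)
  have "arrow_wt ?s ?E1 e = isg (qexp r (arrow_tail e) (arrow_head e))" using ib Cons.prems by (simp add: arrow_wt_def[OF sl])
  hence "arrow_wt ?s ?E1 e = 1 \<or> arrow_wt ?s ?E1 e = - 1" by (simp add: isg_def)
  thus ?case using Cons by (auto simp: wt_def[OF sl])
 qed
 have other: "wt ?s E ?es = 0" if E: "E : signs ?s" "E ~= ?E1" for E
 proof (rule ccontr)
  assume "wt ?s E ?es ~= 0"
  hence "wt ?s E es1 ~= 0" unfolding wt_append[OF sl] by simp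
  hence it: "inbox ?s E t" by (rule wt_inbox[OF sl w1 inbox_self[OF sl]])
  have mem: "j : E \<longleftrightarrow> ?i < j" if j: "j : {1..r}" "j ~= ?i" for j
  proof -
   have "t j = ?s j \<or> t j = ?s j + (if j : E then 1 else - 1)" using it j(1) unfolding inbox_def[OF sl] by blast
   thus ?thesis using j sj[of j] by (auto split: if_splits)
  qed
  have sub: "E \<subseteq> {1..r}" using E(1) by (simp add: signs_def[OF sl])
  have "E = ?E0 \<or> E = ?E1"
  proof (cases "?i : E")
   case True
   have "E = ?E1"
   proof
    show "E \<subseteq> ?E1" using mem sub by fastforce
    show "?E1 \<subseteq> E"
    proof
     fix j assume "j : ?E1"
     thus "j : E" using mem[of j] True i(1) by (cases "j = ?i") auto
    qed
   qed
   thus ?thesis ..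
  next
   case False
   have "E = ?E0"
   proof
    show "E \<subseteq> ?E0" using mem sub False by fastforce
    show "?E0 \<subseteq> E"
    proof
     fix j assume "j : ?E0"
     thus "j : E" using mem[of j] i(1) by auto
    qed
   qed
   thus ?thesis ..
  qed
  thus False using E out0 by blast
 qed
 have "(\<Sum>E\<in>signs ?s. (- 1) ^ card E * wt ?s E ?es) = (\<Sum>E\<in>{?E1}. (- 1) ^ card E * wt ?s E ?es)"
  by (rule sum.mono_neutral_right[OF finite_signs[OF sl]]) (use in1 other in auto)
 also have "... = (- 1) ^ card ?E1 * wt ?s ?E1 ?es" by simp
 finally have v: "loop_wt ?s (?s, ?es, ?s) = (- 1) ^ card ?E1 * wt ?s ?E1 ?es" using l by (simp add: loop_wt_def[OF sl])
 have "(- 1 :: int) ^ card ?E1 = 1 \<or> (- 1 :: int) ^ card ?E1 = - 1" by (cases "even (card ?E1)") simp_all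
 moreover have "wt ?s ?E1 ?es = 1 \<or> wt ?s ?E1 ?es = - 1" by (rule one) (rule b)
 ultimately show ?thesis unfolding v by (elim disjE) simp_all
qed

end

section \<open>From the path algebra to its quotients, and the verification of the
  presentation\<close>

context cubist_quiver begin

abbreviation (input) "U \<equiv> U_alg K r"
abbreviation (input) "B \<equiv> U_cubist K r X"

lemma R_carrier: "R \<subseteq> carrier PA"
 using relation_grade Q.P.agrade_carrier by blast

definition J :: "((point, arrow) path => 'k) set" where "J = gen_ideal K PA R"

lemma J_submodule: "submodule J K PA" unfolding J_def by (rule Q.P.gen_ideal_submodule[OF R_carrier])

lemma J_mult: "ALL a:carrier PA. ALL x:J. a **.PA x : J & x **.PA a : J"
 unfolding J_def by (rule Q.P.gen_ideal_mult)

lemma U_eq: "U = quot_algebra PA J (lattice_pts r)"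
 by (simp add: U_alg_def J_def Let_def)

lemma U_graded: "graded_algebra K U"
 unfolding U_eq
proof (rule quot_algebra_graded[OF Q.path_algebra_graded J_submodule J_mult])
 fix n x assume "x : J"
 thus "Q.P.comp n x : J" unfolding J_def using relation_grade by (intro Q.P.gen_ideal_comp) blast+
next
 show "lattice_pts r \<subseteq> idx PA" by (simp add: Q.pa_ops(4) U_quiver_simps)
 show "idem PA s : J" if "s : idx PA - lattice_pts r" for s using that by (simp add: Q.pa_ops(4) U_quiver_simps)
 fix s assume "s : lattice_pts r"
 hence v: "s : verts (U_quiver r)" by (simp add: U_quiver_simps)
 show "idem PA s ~: J" unfolding J_def
 proof (rule Q.positive_ideal_idem[OF _ v])
  fix x assume "x : R"
  hence "x : agrade PA 2" by (rule relation_grade)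
  thus "EX n>0. x : agrade PA n" by (intro exI[of _ 2]) simp
 qed
qed

sublocale U: graded_algebra K U by (rule U_graded)

definition quo :: "((point, arrow) path => 'k) => ((point, arrow) path => 'k) set" where "quo x = J +>.PA x"

lemmas quo_ops = quot_algebra_ops[OF Q.path_algebra_graded J_submodule J_mult, where S = "lattice_pts r", folded quo_def U_eq]

abbreviation (input) "N \<equiv> U.IU (lattice_pts r - X)"

lemma idxU: "idx U = lattice_pts r" by (rule quo_ops(8))

lemma outside_idx: "lattice_pts r - X \<subseteq> idx U" unfolding idxU by blast

lemma N_submodule: "submodule N K U" by (rule U.IU_submodule[OF outside_idx])

lemma N_mult: "ALL a:carrier U. ALL x:N. a **.U x : N & x **.U a : N"
 using U.IU_left[OF outside_idx] U.IU_right[OF outside_idx] by blast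

lemma B_eq: "B = quot_algebra U N X"
 unfolding U_cubist_def Let_def U.IU_def ..

definition pr :: "((point, arrow) path => 'k) => ((point, arrow) path => 'k) set set" where "pr x = N +>.U quo x"

lemmas pr'_ops = quot_algebra_ops[OF U_graded N_submodule N_mult, where S = X, folded B_eq]

lemma quo_closed: "x : carrier PA ==> quo x : carrier U" unfolding quo_ops(1) by (rule imageI)

lemma pr_ops:
 "carrier B = pr ` carrier PA"
 "[|x : carrier PA; y : carrier PA|] ==> pr (x \<oplus>.PA y) = pr x \<oplus>.B pr y"
 "[|x : carrier PA; y : carrier PA|] ==> pr (x **.PA y) = pr x **.B pr y"
 "[|c : carrier K; x : carrier PA|] ==> pr (c \<odot>.PA x) = c \<odot>.B pr x"
 "pr \<zero>.PA = \<zero>.B" "x : carrier PA ==> pr x = \<zero>.B \<longleftrightarrow> quo x : N"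
 "x : agrade PA n ==> pr x : agrade B n" "idx B = X" "idem B s = pr (idem PA s)"
proof -
 show "carrier B = pr ` carrier PA" unfolding pr'_ops(1) quo_ops(1) pr_def by (simp only: image_image)
 show "pr (x \<oplus>.PA y) = pr x \<oplus>.B pr y" if "x : carrier PA" "y : carrier PA"
  unfolding pr_def quo_ops(2)[OF that] by (rule pr'_ops(2)[OF quo_closed[OF that(1)] quo_closed[OF that(2)]])
 show "pr (x **.PA y) = pr x **.B pr y" if "x : carrier PA" "y : carrier PA"
  unfolding pr_def quo_ops(3)[OF that] by (rule pr'_ops(3)[OF quo_closed[OF that(1)] quo_closed[OF that(2)]])
 show "pr (c \<odot>.PA x) = c \<odot>.B pr x" if "c : carrier K" "x : carrier PA"
  unfolding pr_def quo_ops(4)[OF that] by (rule pr'_ops(4)[OF that(1) quo_closed[OF that(2)]])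
 show "pr \<zero>.PA = \<zero>.B" unfolding pr_def quo_ops(5) by (rule pr'_ops(5))
 show "pr x = \<zero>.B \<longleftrightarrow> quo x : N" if "x : carrier PA" unfolding pr_def by (rule pr'_ops(6)[OF quo_closed[OF that]])
 show "pr x : agrade B n" if "x : agrade PA n" unfolding pr'_ops(7) quo_ops(7) pr_def using that by blast
 show "idx B = X" by (rule pr'_ops(8))
 show "idem B s = pr (idem PA s)" unfolding pr'_ops(9) quo_ops(9) pr_def ..
qed

text \<open>\<open>Z\<close> contains the kernel of the first quotient map, and its image contains
  the generators of the second ideal. Applied with \<open>Z\<close> the ideal killed by the weight,
  this detects nonzero elements of the double quotient.\<close>

lemma pr_kernel:
 assumes x: "x : carrier PA" "pr x = \<zero>.B" and Z: "submodule Z K PA"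
  "ALL a:carrier PA. ALL x:Z. a **.PA x : Z & x **.PA a : Z" "R \<subseteq> Z" "!!y. y : lattice_pts r - X ==> idem PA y : Z"
 shows "x : Z"
proof -
 note D = Q.A.submoduleD[OF Z(1)]
 have zc: "z : Z ==> z : carrier PA" for z using D(1) by blast
 have JZ: "J \<subseteq> Z" unfolding J_def by (rule Q.P.gen_ideal_least[OF Z(1,3,2)])
 have sub: "submodule (quo ` Z) K U"
 proof (rule U.A.submoduleI')
  show "quo ` Z \<subseteq> carrier U" using quo_closed zc by blast
  show "\<zero>.U : quo ` Z" unfolding quo_ops(5)[symmetric] by (rule imageI[OF D(2)])
 next
  fix a b assume "a : quo ` Z" "b : quo ` Z"
  then obtain a' b' where ab: "a' : Z" "b' : Z" "a = quo a'" "b = quo b'" by blast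
  show "a \<oplus>.U b : quo ` Z" unfolding ab(3,4) quo_ops(2)[OF zc[OF ab(1)] zc[OF ab(2)], symmetric] by (rule imageI[OF D(3)[OF ab(1,2)]])
 next
  fix c a assume c: "c : carrier K" and "a : quo ` Z"
  then obtain a' where a: "a' : Z" "a = quo a'" by blast
  show "c \<odot>.U a : quo ` Z" unfolding a(2) quo_ops(4)[OF c zc[OF a(1)], symmetric] by (rule imageI[OF D(4)[OF c a(1)]])
 qed
 have "N \<subseteq> quo ` Z"
 proof (rule U.IU_least[OF sub])
  fix a b t assume a: "a : carrier U" and b: "b : carrier U" and t: "t : lattice_pts r - X"
  obtain a' where a': "a' : carrier PA" "a = quo a'" using a unfolding quo_ops(1) by blast
  obtain b' where b': "b' : carrier PA" "b = quo b'" using b unfolding quo_ops(1) by blast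
  have tz: "idem PA t : Z" by (rule Z(4)[OF t])
  have az: "a' **.PA idem PA t : Z" using Z(2) a'(1) tz by blast
  have abz: "a' **.PA idem PA t **.PA b' : Z" using Z(2) b'(1) az by blast
  have "a **.U idem U t **.U b = quo (a' **.PA idem PA t **.PA b')"
   unfolding a'(2) b'(2) quo_ops(9) quo_ops(3)[OF zc[OF az] b'(1)] quo_ops(3)[OF a'(1) zc[OF tz]] ..
  thus "a **.U idem U t **.U b : quo ` Z" using abz by blast
 qed
 moreover have "quo x : N" using x pr_ops(6) by blast
 ultimately obtain z where z: "z : Z" "quo x = quo z" by blast
 have "x \<ominus>.PA z : J" using z(2) Q.A.coset_eq_iff[OF J_submodule x(1) zc[OF z(1)]] unfolding quo_def by blast
 hence "(x \<ominus>.PA z) \<oplus>.PA z : Z" using D(3) JZ z(1) by blast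
 moreover have "(x \<ominus>.PA z) \<oplus>.PA z = x" using x(1) zc[OF z(1)] by (simp only: a_minus_def Q.A.M.a_assoc Q.A.M.a_inv_closed Q.A.M.l_neg Q.A.M.r_zero)
 ultimately show ?thesis by simp
qed

lemma pr_relation: "x : R ==> pr x = \<zero>.B"
proof -
 assume x: "x : R"
 have xc: "x : carrier PA" using R_carrier x by blast
 have "x : J" unfolding J_def using Q.P.gen_ideal_incl x by blast
 hence "quo x = \<zero>.U" using quo_ops(6)[OF xc] by blast
 thus "pr x = \<zero>.B" unfolding pr_ops(6)[OF xc] using U.A.submoduleD(2)[OF N_submodule] by simp
qed

lemma walk_tile: "close r x y ==> EX es. Q.awalk x es y & length es = vdist r x y & (ALL e:set es. arrow_tail e : box x y & arrow_head e : box x y)"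
proof (induction "vdist r x y" arbitrary: x rule: less_induct)
 case less
 have xl: "x : lattice_pts r" and yl: "y : lattice_pts r" using less.prems by (simp_all add: close_def)
 show ?case
 proof (cases "x = y")
  case True
  thus ?thesis using xl by (intro exI[of _ "[]"]) (simp add: walk_Nil vdist_def)
 next
  case False
  then obtain j where j: "j : {1..r}" "x j ~= y j" using lattice_eqI[OF xl yl] by blast
  have b: "\<bar>y j - x j\<bar> = 1"
  proof -
   have "\<bar>x j - y j\<bar> <= 1" using less.prems by (simp add: close_def)
   thus ?thesis using j(2) by linarith
  qed
  let ?x = "x(j := x j + (y j - x j))"
  have xb: "?x : box x y" "?x = x(j := y j)" by (auto simp: box_def)
  have c: "close r ?x y" by (rule close_box[OF less.prems xb(1)]) simp
  have sy: "vdist r a c = vdist r c a" for a c by (simp add: vdist_def abs_minus_commute)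
  have "vdist r y (x(j := y j)) + nat \<bar>y j - x j\<bar> = vdist r y x + nat \<bar>y j - y j\<bar>" by (rule vdist_upd[OF j(1)])
  hence v: "vdist r x y = Suc (vdist r ?x y)" using b sy unfolding xb(2) by simp
  then obtain es where es: "Q.awalk ?x es y" "length es = vdist r ?x y" "ALL e:set es. arrow_tail e : box ?x y & arrow_head e : box ?x y"
   using less.hyps[OF _ c] by auto
  have bs: "box ?x y \<subseteq> box x y" by (rule box_mono[OF xb(1)]) simp
  have w: "Q.awalk x (step x j (y j - x j) # es) y" using es(1) unfolding walk_step[OF xl j(1) b] .
  show ?thesis
  proof (intro exI[of _ "step x j (y j - x j) # es"] conjI ballI w)
   show "length (step x j (y j - x j) # es) = vdist r x y" using es(2) v by simp
   fix e assume "e : set (step x j (y j - x j) # es)"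
   hence "e = step x j (y j - x j) \<or> e : set es" by simp
   thus "arrow_tail e : box x y" using es(3) bs step_simps(3)[of x j "y j - x j"] by auto
   from \<open>e = step x j (y j - x j) \<or> e : set es\<close> show "arrow_head e : box x y"
    using es(3) bs xb(1) step_simps(4)[OF b, of x j] by (elim disjE) (simp_all only:, blast)
  qed
 qed
qed

lemma tile_loop_nonzero:
 assumes t: "t : X" and w1: "Q.awalk (opp t) es1 t" and w2: "Q.awalk t es2 (opp t)" and l: "length (es1 @ es2) = 2 * (r - 1)"
  and b: "!!e. e : set (es1 @ es2) ==> arrow_tail e : lm t & arrow_head e : lm t"
 shows "Q.delta (opp t, es1 @ es2, opp t) ~: Q.killed (loop_wt (opp t))"
proof
 let ?s = "opp t" and ?m = "(opp t, es1 @ es2, opp t)"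
 have sl: "?s : lattice_pts r" by (rule X_lattice[OF opp_X[OF t]])
 have e: "(?s, [], ?s) : qpaths (U_quiver r)" using sl by (simp add: U_quiver_simps)
 have m: "?m : qpaths (U_quiver r)" unfolding Q.qpaths_iff by (rule Q.awalk_appendI[OF w1 w2])
 assume "Q.delta ?m : Q.killed (loop_wt ?s)"
 from Q.killedD[OF this e e] have "Q.emb (loop_wt ?s (Q.cat (Q.cat (?s, [], ?s) ?m) (?s, [], ?s))) = \<zero>.K"
  unfolding Q.delta_sandwich[OF m e e] by (simp add: Q.src_def Q.trg_def)
 moreover have "Q.cat (Q.cat (?s, [], ?s) ?m) (?s, [], ?s) = ?m" by (simp add: Q.cat_def)
 ultimately show False using Q.emb_unit[OF loop_wt_tile[OF t w1 w2 l b]] by simp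
qed

lemma vdist_opp_tile: assumes t: "t : X" shows "vdist r (opp t) t = r - 1" "vdist r t (opp t) = r - 1"
proof -
 have "vdist r (opp t) t = (\<Sum>j\<in>{1..r}. if j = ty t then 0 else 1)"
  unfolding vdist_def by (rule sum.cong) (auto simp: opp_def opp_at_def)
 also have "... = card ({1..r} - {ty t})" by (simp add: sum.If_cases Diff_eq)
 also have "... = r - 1" using ty(1)[OF t] by simp
 finally show "vdist r (opp t) t = r - 1" .
 thus "vdist r t (opp t) = r - 1" by (simp add: vdist_def abs_minus_commute)
qed

text \<open>Were the class of the loop zero, \<open>pr_kernel\<close> would put the loop into the
  ideal killed by the weight. The second claim is needed already to know that the quotient is a
  graded algebra: its idempotents must not vanish.\<close>

lemma pr_tile_loop:
 assumes t: "t : X" and w1: "Q.awalk (opp t) es1 t" "length es1 = vdist r (opp t) t" "ALL e:set es1. arrow_tail e : box (opp t) t & arrow_head e : box (opp t) t"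
  and w2: "Q.awalk t es2 (opp t)" "length es2 = vdist r t (opp t)" "ALL e:set es2. arrow_tail e : box t (opp t) & arrow_head e : box t (opp t)"
 shows "pr (Q.delta (opp t, es1, t)) **.B pr (Q.delta (t, es2, opp t)) ~= \<zero>.B" "pr (idem PA t) ~= \<zero>.B"
proof -
 let ?s = "opp t" and ?Z = "Q.killed (loop_wt (opp t))"
 have sl: "?s : lattice_pts r" by (rule X_lattice[OF opp_X[OF t]])
 have p: "(?s, es1, t) : qpaths (U_quiver r)" "(t, es2, ?s) : qpaths (U_quiver r)" using w1(1) w2(1) unfolding Q.qpaths_iff by simp_all
 have e: "Q.delta (?s, es1, t) **.PA Q.delta (t, es2, ?s) = Q.delta (?s, es1 @ es2, ?s)"
  using Q.delta_mult[OF p] by (simp add: Q.trg_def Q.src_def Q.cat_def)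
 have n: "Q.delta (?s, es1 @ es2, ?s) ~: ?Z"
 proof (rule tile_loop_nonzero[OF t w1(1) w2(1)])
  show "length (es1 @ es2) = 2 * (r - 1)" using w1(2) w2(2) vdist_opp_tile[OF t] by simp
  fix e assume "e : set (es1 @ es2)"
  thus "arrow_tail e : lm t & arrow_head e : lm t" unfolding lm_def using w1(3) w2(3) box_sym[of t ?s] by auto
 qed
 have K: "x : ?Z" if "x : carrier PA" "pr x = \<zero>.B" for x
 proof (rule pr_kernel[OF that Q.killed_submodule Q.killed_mult])
  show "R \<subseteq> ?Z" using relation_killed[OF sl] by blast
  show "idem PA y : ?Z" if "y : lattice_pts r - X" for y using idem_killed[OF sl, of y] that by blast
 qed
 show "pr (Q.delta (?s, es1, t)) **.B pr (Q.delta (t, es2, ?s)) ~= \<zero>.B"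
  unfolding pr_ops(3)[OF Q.delta_closed[OF p(1)] Q.delta_closed[OF p(2)], symmetric]
  using K[OF Q.pa_mult_closed[OF Q.delta_closed[OF p(1)] Q.delta_closed[OF p(2)]]] n unfolding e by blast
 show "pr (idem PA t) ~= \<zero>.B"
 proof
  have tv: "t : verts (U_quiver r)" using X_lattice[OF t] by (simp add: U_quiver_simps)
  have ic: "idem PA t : carrier PA" unfolding Q.pa_ops(5) by (rule Q.delta_closed) (use tv in simp)
  assume "pr (idem PA t) = \<zero>.B"
  hence "idem PA t : ?Z" by (rule K[OF ic])
  hence "idem PA t **.PA Q.delta (t, es2, ?s) : ?Z" using Q.killed_mult Q.delta_closed[OF p(2)] by blast
  moreover have "idem PA t **.PA Q.delta (t, es2, ?s) = Q.delta (t, es2, ?s)"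
   unfolding Q.pa_ops(5) using Q.delta_mult[of "(t, [], t)" "(t, es2, ?s)"] p(2) tv by (simp add: Q.trg_def Q.src_def Q.cat_def)
  ultimately have "Q.delta (t, es2, ?s) : ?Z" by simp
  hence "Q.delta (?s, es1, t) **.PA Q.delta (t, es2, ?s) : ?Z" using Q.killed_mult Q.delta_closed[OF p(1)] by blast
  thus False using n unfolding e by blast
 qed
qed

lemma pr_idem_nonzero: assumes t: "t : X" shows "pr (idem PA t) ~= \<zero>.B"
proof -
 have c: "close r (opp t) t" "close r t (opp t)" using close_opp[OF t] close_sym by blast+
 obtain es1 where 1: "Q.awalk (opp t) es1 t" "length es1 = vdist r (opp t) t" "ALL e:set es1. arrow_tail e : box (opp t) t & arrow_head e : box (opp t) t"
  using walk_tile[OF c(1)] by blast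
 obtain es2 where 2: "Q.awalk t es2 (opp t)" "length es2 = vdist r t (opp t)" "ALL e:set es2. arrow_tail e : box t (opp t) & arrow_head e : box t (opp t)"
  using walk_tile[OF c(2)] by blast
 show ?thesis by (rule pr_tile_loop(2)[OF t 1 2])
qed

lemma idem_PA_closed: "x : lattice_pts r ==> idem PA x : carrier PA"
 unfolding Q.pa_ops(5) by (rule Q.delta_closed) (simp add: U_quiver_simps)

lemma pr_idem_outside: "[|x : lattice_pts r; x ~: X|] ==> pr (idem PA x) = \<zero>.B"
proof -
 assume x: "x : lattice_pts r" "x ~: X"
 have xo: "x : lattice_pts r - X" using x by blast
 have i: "idem U x : carrier U" by (rule U.idem_closed) (use x in \<open>simp add: idxU\<close>)
 have "idem U x **.U idem U x **.U idem U x : N" by (rule U.IU_memI[OF i i xo])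
 hence "idem U x : N" using U.idem_orthogonal[of x x] x by (simp add: idxU)
 thus ?thesis unfolding pr_ops(6)[OF idem_PA_closed[OF x(1)]] quo_ops(9) .
qed

lemma B_graded: "graded_algebra K B"
 unfolding B_eq
proof (rule quot_algebra_graded[OF U_graded N_submodule N_mult])
 show "U.comp n x : N" if "x : N" for n x by (rule U.IU_comp[OF outside_idx that])
 show "X \<subseteq> idx U" unfolding idxU using X_lattice by blast
 show "idem U s : N" if "s : idx U - X" for s
  using pr_idem_outside[of s] that pr_ops(6)[OF idem_PA_closed[of s]] unfolding idxU quo_ops(9) by blast
 show "idem U s ~: N" if "s : X" for s
  using pr_idem_nonzero[OF that] pr_ops(6)[OF idem_PA_closed[OF X_lattice[OF that]]] unfolding quo_ops(9) by blast
qed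

sublocale B: graded_algebra K B by (rule B_graded)

lemma pr_closed: "x : carrier PA ==> pr x : carrier B" unfolding pr_ops(1) by (rule imageI)

lemma ksign_facts: "ksign K n : carrier K" "ksign K m **.K ksign K n = ksign K (m + n)" "odd (m - n) ==> ksign K m = \<ominus>.K ksign K n"
 "even n ==> ksign K n = \<one>.K"
 by (auto simp: ksign_def l_minus r_minus)

definition arrow_to :: "point => point => arrow" where
 "arrow_to x y = (SOME e. EX j:{1..r}. EX d. \<bar>d\<bar> = 1 & y = x(j := x j + d) & e = step x j d)"

lemma arrow_to_step: assumes "j : {1..r}" "\<bar>d\<bar> = 1" shows "arrow_to x (x(j := x j + d)) = step x j d"
 unfolding arrow_to_def
proof (rule some_equality)
 show "EX i:{1..r}. EX e. \<bar>e\<bar> = 1 & x(j := x j + d) = x(i := x i + e) & step x j d = step x i e" using assms by blast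
 fix e assume "EX i:{1..r}. EX c. \<bar>c\<bar> = 1 & x(j := x j + d) = x(i := x i + c) & e = step x i c"
 then obtain i c where i: "\<bar>c\<bar> = 1" "x(j := x j + d) = x(i := x i + c)" "e = step x i c" by blast
 have "i = j"
 proof (rule ccontr)
  assume "i ~= j"
  hence "x j + d = x j" using fun_cong[OF i(2), of j] by simp
  thus False using assms(2) by simp
 qed
 moreover have "c = d" using fun_cong[OF i(2), of j] \<open>i = j\<close> by simp
 ultimately show "e = step x j d" using i(3) by simp
qed

text \<open>The sign from \<open>qexp\<close> turns anticommuting squares into commuting ones; pairs
  that are not neighbours in \<open>X\<close> get zero.\<close>

definition gen_arrow :: "point => point => ((point, arrow) path => 'k) set set" where
 "gen_arrow x y = (if x : X & y : X & (EX j:{1..r}. EX d. \<bar>d\<bar> = 1 & y = x(j := x j + d))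
  then ksign K (qexp r x y) \<odot>.B pr (Q.delta (x, [arrow_to x y], y)) else \<zero>.B)"

lemma delta_idem: assumes "(u, es, w) : qpaths (U_quiver r)"
 shows "idem PA u **.PA Q.delta (u, es, w) = Q.delta (u, es, w)" "Q.delta (u, es, w) **.PA idem PA w = Q.delta (u, es, w)"
  "u : lattice_pts r" "w : lattice_pts r"
proof -
 have a: "Q.awalk u es w" using assms by (simp add: Q.qpaths_iff)
 have v: "u : verts (U_quiver r)" "w : verts (U_quiver r)" by (rule Q.awalk_hd_in_verts[OF a], rule Q.awalk_last_in_verts[OF a])
 thus "u : lattice_pts r" "w : lattice_pts r" by (simp_all add: U_quiver_simps)
 show "idem PA u **.PA Q.delta (u, es, w) = Q.delta (u, es, w)" "Q.delta (u, es, w) **.PA idem PA w = Q.delta (u, es, w)"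
  unfolding Q.pa_ops(5) using Q.delta_mult[of "(u, [], u)" "(u, es, w)"] Q.delta_mult[of "(u, es, w)" "(w, [], w)"] assms v
  by (simp_all add: Q.trg_def Q.src_def Q.cat_def)
qed

lemma pr_delta_outside: assumes p: "(u, es, w) : qpaths (U_quiver r)" and n: "u ~: X \<or> w ~: X" shows "pr (Q.delta (u, es, w)) = \<zero>.B"
proof -
 note D = delta_idem[OF p] and c = Q.delta_closed[OF p]
 have "pr (Q.delta (u, es, w)) = pr (idem PA u) **.B pr (Q.delta (u, es, w))" "pr (Q.delta (u, es, w)) = pr (Q.delta (u, es, w)) **.B pr (idem PA w)"
  using pr_ops(3)[OF idem_PA_closed[OF D(3)] c] pr_ops(3)[OF c idem_PA_closed[OF D(4)]] unfolding D(1,2) by simp_all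
 thus ?thesis using n pr_idem_outside[OF D(3)] pr_idem_outside[OF D(4)] pr_closed[OF c] B.mult_zero_left B.mult_zero_right by metis
qed

lemma gen_arrow_step:
 assumes x: "x : lattice_pts r" and j: "j : {1..r}" and d: "\<bar>d\<bar> = 1" and y: "y = x(j := x j + d)"
 shows "gen_arrow x y = ksign K (qexp r x y) \<odot>.B pr (Q.delta (x, [step x j d], y))"
proof (cases "x : X & y : X")
 case True
 have "EX j:{1..r}. EX d. \<bar>d\<bar> = 1 & y = x(j := x j + d)" using j d y by blast
 thus ?thesis unfolding gen_arrow_def using True arrow_to_step[OF j d, of x] unfolding y by (simp only: if_True simp_thms)
next
 case False
 have "pr (Q.delta (x, [step x j d], y)) = \<zero>.B" unfolding y by (rule pr_delta_outside[OF step_path[OF x j d]]) (use False y in blast)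
 thus ?thesis unfolding gen_arrow_def using False ksign_facts(1) by (simp only: if_False simp_thms B.A.smult_r_null) auto
qed

lemma gen_arrow_mid:
 assumes x: "x : lattice_pts r" and i: "i : {1..r}" "\<bar>d\<bar> = 1" and j: "j : {1..r}" "\<bar>e\<bar> = 1" and y: "y = x(i := x i + d)" "w = y(j := y j + e)"
 shows "gen_arrow x y **.B gen_arrow y w = ksign K (qexp r x y + qexp r y w) \<odot>.B pr (Q.delta (mid x i d j e))"
proof -
 have yl: "y : lattice_pts r" unfolding y(1) by (rule lattice_upd[OF x i(1)])
 have p: "(x, [step x i d], y) : qpaths (U_quiver r)" "(y, [step y j e], w) : qpaths (U_quiver r)"
  unfolding y(2) using step_path[OF x i] step_path[OF yl j] unfolding y(1) by simp_all
 note c = pr_closed[OF Q.delta_closed[OF p(1)]] pr_closed[OF Q.delta_closed[OF p(2)]]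
 have "pr (Q.delta (x, [step x i d], y)) **.B pr (Q.delta (y, [step y j e], w)) = pr (Q.delta (mid x i d j e))"
 proof -
  have "pr (Q.delta (x, [step x i d], y)) **.B pr (Q.delta (y, [step y j e], w)) = pr (Q.delta (x, [step x i d], y) **.PA Q.delta (y, [step y j e], w))"
   by (rule pr_ops(3)[OF Q.delta_closed[OF p(1)] Q.delta_closed[OF p(2)], symmetric])
  also have "... = pr (Q.delta (mid x i d j e))" unfolding y(2) delta_mid[OF x i j y(1)] ..
  finally show ?thesis .
 qed
 hence e: "pr (Q.delta (x, [step x i d], y)) **.B pr (Q.delta (y, [step y j e], w)) = pr (Q.delta (mid x i d j e))" .
 note k = ksign_facts(1)[of "qexp r x y"] ksign_facts(1)[of "qexp r y w"]
 have mc: "pr (Q.delta (mid x i d j e)) : carrier B" unfolding e[symmetric] by (rule B.mult_closed[OF c])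
 show ?thesis unfolding gen_arrow_step[OF x i y(1)] gen_arrow_step[OF yl j y(2)]
  B.mult_smult_left[OF k(1) c(1) B.A.smult_closed[OF k(2) c(2)]] B.mult_smult_right[OF k(2) c] e
  by (simp only: B.A.smult_assoc1[OF k mc, symmetric] ksign_facts(2) | simp add: B.A.smult_assoc1[OF k mc, symmetric] ksign_facts(2))
qed

text \<open>The same partial sum is multiplied by \<open>d\<close> on the way out and by
  \<open>- d\<close> on the way back.\<close>

lemma qexp_back: assumes i: "i : {1..r}" shows "even (qexp r x (x(i := x i + d)) + qexp r (x(i := x i + d)) x)"
proof -
 let ?x = "x(i := x i + d)"
 have e: "?x(i := x i) = x" by auto
 have "qexp r ?x (?x(i := x i)) = (x i - ?x i) * (\<Sum>l\<in>{1..<i}. ?x l)" by (rule qexp_upd[OF i])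
 moreover have "(\<Sum>l\<in>{1..<i}. ?x l) = (\<Sum>l\<in>{1..<i}. x l)" by (rule sum.cong) auto
 ultimately have "qexp r ?x x = - d * (\<Sum>l\<in>{1..<i}. x l)" unfolding e by simp
 moreover have "qexp r x ?x = d * (\<Sum>l\<in>{1..<i}. x l)" using qexp_upd[OF i, of x "x i + d"] by simp
 ultimately show ?thesis by simp
qed

lemma gen_arrow_cases:
 obtains "gen_arrow x y = \<zero>.B"
 | j d where "x : X" "y : X" "j : {1..r}" "\<bar>d\<bar> = 1" "y = x(j := x j + d)" "(x, [step x j d], y) : qpaths (U_quiver r)"
   "gen_arrow x y = ksign K (qexp r x y) \<odot>.B pr (Q.delta (x, [step x j d], y))"
proof (cases "x : X & y : X & (EX j:{1..r}. EX d. \<bar>d\<bar> = 1 & y = x(j := x j + d))")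
 case True
 then obtain j d where jd: "x : X" "y : X" "j : {1..r}" "\<bar>d\<bar> = 1" "y = x(j := x j + d)" by blast
 have xl: "x : lattice_pts r" by (rule X_lattice[OF jd(1)])
 have p: "(x, [step x j d], y) : qpaths (U_quiver r)" unfolding jd(5) by (rule step_path[OF xl jd(3,4)])
 show thesis by (rule that(2)[OF jd p gen_arrow_step[OF xl jd(3-5)]])
next
 case False
 have "gen_arrow x y = \<zero>.B" unfolding gen_arrow_def by (rule if_not_P[OF False])
 thus thesis by (rule that(1))
qed

lemma delta_grade: assumes p: "p : qpaths (U_quiver r)" shows "Q.delta p : agrade PA (length (fst (snd p)))"
proof -
 have "length (fst (snd q)) = length (fst (snd p))" if "Q.delta p q ~= \<zero>.K" for q
 proof -
  have "q = p" using that by (simp add: Q.delta_def split: if_split_asm)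
  thus ?thesis by simp
 qed
 thus ?thesis unfolding Q.pa_ops(6) using Q.delta_closed[OF p] by simp
qed

text \<open>The relations compare consecutive directions only; chaining them reaches direction
  \<open>1\<close>.\<close>

lemma pr_loops_eq:
 assumes x: "x : lattice_pts r" and i: "1 <= i" "i <= r"
 shows "pr (Q.delta (mid x i (-1) i 1) \<oplus>.PA Q.delta (mid x i 1 i (-1))) = pr (Q.delta (mid x 1 (-1) 1 1) \<oplus>.PA Q.delta (mid x 1 1 1 (-1)))"
 using i
proof (induction i rule: nat_induct_at_least)
 case (Suc n)
 have n: "n : {1..r}" "n + 1 : {1..r}" "1 <= n" "n < r" using Suc.hyps Suc.prems by auto
 let ?l = "%i. Q.delta (mid x i (-1) i 1) \<oplus>.PA Q.delta (mid x i 1 i (-1))"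
 have c: "?l i : carrier PA" if "i : {1..r}" for i
  using mid_path[OF x that, of "-1" i 1] mid_path[OF x that, of 1 i "-1"] that by simp
 have rc: "?l n \<ominus>.PA ?l (n + 1) : R" by (rule relations(3)[OF x n(3,4)])
 have e: "(?l n \<ominus>.PA ?l (n + 1)) \<oplus>.PA ?l (n + 1) = ?l n"
  using c[OF n(1)] c[OF n(2)] by (simp only: a_minus_def Q.A.M.a_assoc Q.A.M.a_inv_closed Q.A.M.l_neg Q.A.M.r_zero)
 have "pr (?l n) = pr (?l n \<ominus>.PA ?l (n + 1)) \<oplus>.B pr (?l (n + 1))"
  using pr_ops(2)[OF subsetD[OF R_carrier rc] c[OF n(2)]] unfolding e .
 also have "... = pr (?l (n + 1))" unfolding pr_relation[OF rc] by (rule B.A.M.l_zero[OF pr_closed[OF c[OF n(2)]]])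
 finally have f: "pr (?l n) = pr (?l (n + 1))" .
 have ih: "pr (?l n) = pr (?l 1)" by (rule Suc.IH) (use n(4) in arith)
 show ?case unfolding Suc_eq_plus1 using f[symmetric] ih by (rule trans)
qed simp

lemma presentation: "cubist_presentation r I X K B gen_arrow"
proof (intro cubist_presentation.intro cubist_presentation_axioms.intro)
 show "cubist_ideal r I X" by (rule cubist_ideal_axioms)
 show "graded_algebra K B" by (rule B_graded)
 show "idx B = X" by (rule pr_ops(8))
 note Z = B.A.submoduleD[OF B.agrade_submodule]
 show "gen_arrow x y : agrade B 1" for x y
 proof (cases x y rule: gen_arrow_cases)
  case 1 thus ?thesis using Z(2) by simp
 next
  case (2 j d)
  have "pr (Q.delta (x, [step x j d], y)) : agrade B 1" using pr_ops(7)[OF delta_grade[OF 2(6)]] by simp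
  thus ?thesis unfolding 2(7) by (rule Z(4)[OF ksign_facts(1)])
 qed
 show "idem B x **.B gen_arrow x y = gen_arrow x y" if x: "x : X" for x y
 proof (cases x y rule: gen_arrow_cases)
  case 1 thus ?thesis using pr_closed[OF idem_PA_closed[OF X_lattice[OF x]]] by (simp add: pr_ops(9))
 next
  case (2 j d)
  note c = Q.delta_closed[OF 2(6)] and i = idem_PA_closed[OF X_lattice[OF x]]
  have "pr (idem PA x) **.B pr (Q.delta (x, [step x j d], y)) = pr (Q.delta (x, [step x j d], y))"
   unfolding pr_ops(3)[OF i c, symmetric] delta_idem(1)[OF 2(6)] ..
  thus ?thesis unfolding 2(7) pr_ops(9) B.mult_smult_right[OF ksign_facts(1) pr_closed[OF i] pr_closed[OF c]] by simp
 qed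
 show "gen_arrow x y **.B idem B y = gen_arrow x y" if y: "y : X" for x y
 proof (cases x y rule: gen_arrow_cases)
  case 1 thus ?thesis using pr_closed[OF idem_PA_closed[OF X_lattice[OF y]]] by (simp add: pr_ops(9))
 next
  case (2 j d)
  note c = Q.delta_closed[OF 2(6)] and i = idem_PA_closed[OF X_lattice[OF y]]
  have "pr (Q.delta (x, [step x j d], y)) **.B pr (idem PA y) = pr (Q.delta (x, [step x j d], y))"
   unfolding pr_ops(3)[OF c i, symmetric] delta_idem(2)[OF 2(6)] ..
  thus ?thesis unfolding 2(7) pr_ops(9) B.mult_smult_left[OF ksign_facts(1) pr_closed[OF c] pr_closed[OF i]] by simp
 qed
 show "gen_arrow x y = \<zero>.B" if "x ~: X \<or> y ~: X" for x y
  by (cases x y rule: gen_arrow_cases) (use that in auto)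
 show "EX j:{1..r}. EX d. \<bar>d\<bar> = 1 & y = x(j := x j + d)" if "gen_arrow x y ~= \<zero>.B" for x y
  by (cases x y rule: gen_arrow_cases) (use that in blast)+
 show "gen_arrow x (x(j := x j + d)) **.B gen_arrow (x(j := x j + d)) (x(j := x j + d + d)) = \<zero>.B"
  if j: "j : {1..r}" "\<bar>d\<bar> = 1" and x: "x : X" for x j d
 proof -
  have w: "x(j := x j + d + d) = (x(j := x j + d))(j := (x(j := x j + d)) j + d)" by simp
  show ?thesis unfolding gen_arrow_mid[OF X_lattice[OF x] j j refl w] pr_relation[OF relations(1)[OF X_lattice[OF x] j]]
   by (rule B.A.smult_r_null[OF ksign_facts(1)])
 qed
 show "gen_arrow x (x(i := a)) **.B gen_arrow (x(i := a)) (x(i := a, j := b)) = gen_arrow x (x(j := b)) **.B gen_arrow (x(j := b)) (x(i := a, j := b))"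
  if i: "i : {1..r}" and j: "j : {1..r}" and n: "i ~= j" and a: "\<bar>a - x i\<bar> = 1" and b: "\<bar>b - x j\<bar> = 1" and x: "x : X" for x i j a b
 proof -
  note xl = X_lattice[OF x]
  let ?d = "a - x i" and ?e = "b - x j"
  have y: "x(i := a) = x(i := x i + ?d)" "x(i := a, j := b) = (x(i := a))(j := (x(i := a)) j + ?e)" using n by simp_all
  have y': "x(j := b) = x(j := x j + ?e)" "x(i := a, j := b) = (x(j := b))(i := (x(j := b)) i + ?d)" using n by (simp_all add: fun_upd_twist)
  have m: "mid x i ?d j ?e : qpaths (U_quiver r)" "mid x j ?e i ?d : qpaths (U_quiver r)" by (rule mid_path[OF xl i a j b], rule mid_path[OF xl j b i a])
  let ?m = "pr (Q.delta (mid x i ?d j ?e))" and ?m' = "pr (Q.delta (mid x j ?e i ?d))"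
  note c = pr_closed[OF Q.delta_closed[OF m(1)]] pr_closed[OF Q.delta_closed[OF m(2)]]
  have "?m \<oplus>.B ?m' = \<zero>.B"
   unfolding pr_ops(2)[OF Q.delta_closed[OF m(1)] Q.delta_closed[OF m(2)], symmetric] by (rule pr_relation[OF relations(2)[OF xl i j n a b]])
  hence me: "?m = \<ominus>.B ?m'" using c by (intro B.A.M.minus_equality[symmetric]) simp_all
  have tw: "x(j := b, i := a) = x(i := a, j := b)" using n by (simp add: fun_upd_twist)
  have sg: "ksign K (qexp r x (x(i := a)) + qexp r (x(i := a)) (x(i := a, j := b)))
    = \<ominus>.K ksign K (qexp r x (x(j := b)) + qexp r (x(j := b)) (x(i := a, j := b)))"
   by (rule ksign_facts(3)) (use qexp_square[OF i j n a b] in \<open>simp only: tw not_False_eq_True\<close>)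
  have kc: "ksign K n : carrier K" for n by (rule ksign_facts(1))
  show ?thesis unfolding gen_arrow_mid[OF xl i a j b y] gen_arrow_mid[OF xl j b i a y'] sg me
   using c kc by (simp only: B.A.smult_l_minus B.A.smult_r_minus B.A.M.a_inv_closed B.A.smult_closed B.A.M.minus_minus)
 qed
 show "gen_arrow x (x(i := x i + 1)) **.B gen_arrow (x(i := x i + 1)) x \<oplus>.B gen_arrow x (x(i := x i - 1)) **.B gen_arrow (x(i := x i - 1)) x
   = gen_arrow x (x(j := x j + 1)) **.B gen_arrow (x(j := x j + 1)) x \<oplus>.B gen_arrow x (x(j := x j - 1)) **.B gen_arrow (x(j := x j - 1)) x"
  if i: "i : {1..r}" and j: "j : {1..r}" and x: "x : X" for x i j
 proof -
  note xl = X_lattice[OF x]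
  have l: "gen_arrow x (x(i := x i + 1)) **.B gen_arrow (x(i := x i + 1)) x \<oplus>.B gen_arrow x (x(i := x i - 1)) **.B gen_arrow (x(i := x i - 1)) x
    = pr (Q.delta (mid x i (-1) i 1) \<oplus>.PA Q.delta (mid x i 1 i (-1)))" if i: "i : {1..r}" for i
  proof -
   have ab: "\<bar>1 :: int\<bar> = 1" "\<bar>- 1 :: int\<bar> = 1" by simp_all
   note m = Q.delta_closed[OF mid_path[OF xl i ab(1) i ab(2)]] Q.delta_closed[OF mid_path[OF xl i ab(2) i ab(1)]]
   have y: "x(i := x i - 1) = x(i := x i + - 1)" by simp
   have w: "x = (x(i := x i + 1))(i := (x(i := x i + 1)) i + - 1)" "x = (x(i := x i - 1))(i := (x(i := x i - 1)) i + 1)" by simp_all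
   have "even (qexp r x (x(i := x i + 1)) + qexp r (x(i := x i + 1)) x)" by (rule qexp_back[OF i])
   hence 1: "gen_arrow x (x(i := x i + 1)) **.B gen_arrow (x(i := x i + 1)) x = pr (Q.delta (mid x i 1 i (-1)))"
    unfolding gen_arrow_mid[OF xl i ab(1) i ab(2) refl w(1)] by (simp only: ksign_facts(4) B.A.smult_one pr_closed[OF m(1)])
   have "even (qexp r x (x(i := x i - 1)) + qexp r (x(i := x i - 1)) x)" using qexp_back[OF i, of x "-1"] unfolding y .
   hence 2: "gen_arrow x (x(i := x i - 1)) **.B gen_arrow (x(i := x i - 1)) x = pr (Q.delta (mid x i (-1) i 1))"
    unfolding gen_arrow_mid[OF xl i ab(2) i ab(1) y w(2)] by (simp only: ksign_facts(4) B.A.smult_one pr_closed[OF m(2)])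
   show ?thesis unfolding 1 2 pr_ops(2)[OF m(2,1)] by (rule B.A.M.a_comm[OF pr_closed[OF m(1)] pr_closed[OF m(2)]])
  qed
  have "pr (Q.delta (mid x i (-1) i 1) \<oplus>.PA Q.delta (mid x i 1 i (-1))) = pr (Q.delta (mid x j (-1) j 1) \<oplus>.PA Q.delta (mid x j 1 j (-1)))"
   by (rule trans[OF pr_loops_eq[OF xl] pr_loops_eq[OF xl, symmetric]]) (use i j in auto)
  thus ?thesis unfolding l[OF i] l[OF j] .
 qed
 show "carrier B \<subseteq> V" if V: "submodule V K B" and e: "!!x. x : X ==> idem B x : V"
  and g: "!!x y v. v : V ==> gen_arrow x y **.B v : V" for V
 proof -
  note D = B.A.submoduleD[OF V]
  \<comment> \<open>Paths are built from their right end by prepending arrows, which fits closure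
    under left multiplication.\<close>
  have d: "Q.awalk u es w ==> pr (Q.delta (u, es, w)) : V" for u es w
  proof (induction rule: walk_induct)
   case Nil
   have "Q.delta (w, [], w) = idem PA w" by (simp only: Q.pa_ops(5))
   thus ?case using e[of w] pr_idem_outside[OF Nil] D(2) unfolding pr_ops(9) by (cases "w : X") simp_all
  next
   case (Cons u j d es)
   let ?u = "u(j := u j + d)"
   have p: "(u, [step u j d], ?u) : qpaths (U_quiver r)" "(?u, es, w) : qpaths (U_quiver r)"
    using step_path[OF Cons.hyps(1-3)] Cons.hyps(4) by (simp_all only: Q.qpaths_iff)
   note c = Q.delta_closed[OF p(1)] Q.delta_closed[OF p(2)]
   let ?k = "ksign K (qexp r u ?u)"
   have k: "?k : carrier K" "?k **.K ?k = \<one>.K" using ksign_facts(1)[of "qexp r u ?u"] ksign_facts(2)[of "qexp r u ?u" "qexp r u ?u"] ksign_facts(4) by simp_all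
   have "?k \<odot>.B (gen_arrow u ?u **.B pr (Q.delta (?u, es, w))) : V" by (rule D(4)[OF k(1) g[OF Cons.IH]])
   moreover have "?k \<odot>.B (gen_arrow u ?u **.B pr (Q.delta (?u, es, w))) = pr (Q.delta (u, [step u j d], ?u)) **.B pr (Q.delta (?u, es, w))"
    unfolding gen_arrow_step[OF Cons.hyps(1-3) refl]
    using pr_closed[OF c(1)] pr_closed[OF c(2)] k by (simp add: B.mult_smult_left B.A.smult_assoc1[symmetric] del: fun_upd_apply)
   moreover have "... = pr (Q.delta (u, step u j d # es, w))"
    unfolding pr_ops(3)[OF c, symmetric] using Q.delta_mult[OF p] by (simp add: Q.trg_def Q.src_def Q.cat_def del: fun_upd_apply)
   ultimately show ?case by simp
  qed
  have S: "submodule {x : carrier PA. pr x : V} K PA"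
   by (rule Q.A.submodule_vimage[OF B.A.module_axioms _ pr_ops(2) pr_ops(4) V]) (use pr_closed in auto)
  show ?thesis unfolding pr_ops(1)
  proof (rule image_subsetI)
   fix f assume f: "f : carrier PA"
   have "f : {x : carrier PA. pr x : V}"
   proof (rule Q.delta_span[OF S f])
    fix p assume "f p ~= \<zero>.K"
    hence p: "p : qpaths (U_quiver r)" by (rule Q.pa_out[OF f])
    obtain u es w where pe: "p = (u, es, w)" by (cases p)
    have "pr (Q.delta p) : V" unfolding pe by (rule d) (use p pe in \<open>simp add: Q.qpaths_iff\<close>)
    thus "Q.delta p : {x : carrier PA. pr x : V}" using Q.delta_closed[OF p] by blast
   qed
   thus "pr f : V" by blast
  qed
 qed
qed

sublocale M: cubist_presentation r I X K B gen_arrow by (rule presentation)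

text \<open>Unfolding the monotone path arrow by arrow collects a product of signs. All that is kept
  of it is that its square is one, hence that it can be cancelled.\<close>

lemma path_representation:
 "[|close r x y; y : X|] ==> EX c es. c : carrier K & c **.K c = \<one>.K & Q.awalk x es y & length es = vdist r x y &
  (ALL e:set es. arrow_tail e : box x y & arrow_head e : box x y) & M.p x y = c \<odot>.B pr (Q.delta (x, es, y))"
proof (induction "vdist r x y" arbitrary: x rule: less_induct)
 case less
 have xl: "x : lattice_pts r" and yl: "y : lattice_pts r" using less.prems by (simp_all add: close_def)
 show ?case
 proof (cases "x = y")
  case True
  have "M.p y y = \<one>.K \<odot>.B pr (Q.delta (y, [], y))"
   using M.p_self[of y] less.prems(2) pr_closed[OF idem_PA_closed[OF yl]] unfolding pr_ops(9) Q.pa_ops(5) by (simp add: B.A.smult_one)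
  thus ?thesis unfolding True using yl by (intro exI[of _ "\<one>.K"] exI[of _ "[]"]) (simp add: walk_Nil vdist_def)
 next
  case False
  then obtain j where j: "j : {1..r}" "x j ~= y j" using lattice_eqI[OF xl yl] by metis
  have b: "\<bar>y j - x j\<bar> = 1"
  proof -
   have "\<bar>x j - y j\<bar> <= 1" using less.prems by (simp add: close_def)
   thus ?thesis using j(2) by linarith
  qed
  let ?d = "y j - x j"
  let ?x = "x(j := x j + ?d)"
  have xb: "?x : box x y" "?x = x(j := y j)" by (auto simp: box_def)
  have c: "close r ?x y" by (rule close_box[OF less.prems(1) xb(1)]) simp
  have sy: "vdist r a c = vdist r c a" for a c by (simp add: vdist_def abs_minus_commute)
  have "vdist r y (x(j := y j)) + nat \<bar>y j - x j\<bar> = vdist r y x + nat \<bar>y j - y j\<bar>" by (rule vdist_upd[OF j(1)])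
  hence v: "vdist r x y = Suc (vdist r ?x y)" using b sy[of x y] sy[of "x(j := y j)" y] unfolding xb(2) by simp
  have lt: "vdist r ?x y < vdist r x y" unfolding v by simp
  from less.hyps[OF lt c less.prems(2)] obtain k es where es: "k : carrier K" "k **.K k = \<one>.K" "Q.awalk ?x es y" "length es = vdist r ?x y"
   "ALL e:set es. arrow_tail e : box ?x y & arrow_head e : box ?x y" "M.p ?x y = k \<odot>.B pr (Q.delta (?x, es, y))" by (elim exE conjE)
  have bs: "box ?x y \<subseteq> box x y" by (rule box_mono[OF xb(1)]) simp
  let ?s = "step x j ?d"
  have w: "Q.awalk x (?s # es) y" using es(3) unfolding walk_step[OF xl j(1) b] .
  have p: "(x, [?s], ?x) : qpaths (U_quiver r)" "(?x, es, y) : qpaths (U_quiver r)"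
   using step_path[OF xl j(1) b] es(3) by (simp_all only: Q.qpaths_iff)
  note dc = Q.delta_closed[OF p(1)] Q.delta_closed[OF p(2)]
  let ?k = "ksign K (qexp r x ?x)"
  have k: "?k : carrier K" "?k **.K ?k = \<one>.K" using ksign_facts(1)[of "qexp r x ?x"] ksign_facts(2)[of "qexp r x ?x" "qexp r x ?x"] ksign_facts(4) by simp_all
  have "M.p x y = gen_arrow x ?x **.B M.p ?x y" unfolding xb(2) by (rule M.p_step[OF less.prems(1) j(2)])
  also have "... = (?k **.K k) \<odot>.B (pr (Q.delta (x, [?s], ?x)) **.B pr (Q.delta (?x, es, y)))"
   unfolding es(6) gen_arrow_step[OF xl j(1) b refl]
    B.mult_smult_left[OF k(1) pr_closed[OF dc(1)] B.A.smult_closed[OF es(1) pr_closed[OF dc(2)]]]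
    B.mult_smult_right[OF es(1) pr_closed[OF dc(1)] pr_closed[OF dc(2)]]
    B.A.smult_assoc1[OF k(1) es(1) B.mult_closed[OF pr_closed[OF dc(1)] pr_closed[OF dc(2)]]] ..
  also have "pr (Q.delta (x, [?s], ?x)) **.B pr (Q.delta (?x, es, y)) = pr (Q.delta (x, ?s # es, y))"
   unfolding pr_ops(3)[OF dc, symmetric] using Q.delta_mult[OF p] by (simp add: Q.trg_def Q.src_def Q.cat_def del: fun_upd_apply)
  finally have pe: "M.p x y = (?k **.K k) \<odot>.B pr (Q.delta (x, ?s # es, y))" .
  have kk: "(?k **.K k) **.K (?k **.K k) = (?k **.K ?k) **.K (k **.K k)" using k(1) es(1) by (simp only: m_ac m_closed)
  show ?thesis
  proof (intro exI[of _ "?k **.K k"] exI[of _ "?s # es"] conjI ballI w pe)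
   show "?k **.K k : carrier K" by (rule m_closed[OF k(1) es(1)])
   show "(?k **.K k) **.K (?k **.K k) = \<one>.K" unfolding kk k(2) es(2) by (rule l_one[OF one_closed])
   show "length (?s # es) = vdist r x y" using es(4) v by simp
   fix e assume "e : set (?s # es)"
   hence e: "e = ?s \<or> e : set es" by simp
   show "arrow_tail e : box x y" using e
   proof
    assume "e = ?s" thus ?thesis using step_simps(3)[of x j ?d] by simp
   qed (use es(5) bs in blast)
   show "arrow_head e : box x y" using e
   proof
    assume "e = ?s" thus ?thesis using step_simps(4)[OF b, of x j] xb(1) by (simp only:)
   qed (use es(5) bs in blast)
  qed
 qed
qed

text \<open>Up to invertible scalars both factors are classes of walks inside the tile, so
  \<open>pr_tile_loop\<close> applies.\<close>

lemma cubist_algebra_B: "cubist_algebra r I X K B gen_arrow"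
proof (intro cubist_algebra.intro cubist_algebra_axioms.intro presentation)
 fix t assume t: "t : X"
 let ?s = "opp t"
 have c: "close r ?s t" "close r t ?s" using close_opp[OF t] close_sym by blast+
 from path_representation[OF c(1) t] obtain k es where 1: "k : carrier K" "k **.K k = \<one>.K" "Q.awalk ?s es t" "length es = vdist r ?s t"
  "ALL e:set es. arrow_tail e : box ?s t & arrow_head e : box ?s t" "M.p ?s t = k \<odot>.B pr (Q.delta (?s, es, t))" by (elim exE conjE)
 from path_representation[OF c(2) opp_X[OF t]] obtain k' es' where 2: "k' : carrier K" "k' **.K k' = \<one>.K" "Q.awalk t es' ?s" "length es' = vdist r t ?s"
  "ALL e:set es'. arrow_tail e : box t ?s & arrow_head e : box t ?s" "M.p t ?s = k' \<odot>.B pr (Q.delta (t, es', ?s))" by (elim exE conjE)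
 let ?a = "pr (Q.delta (?s, es, t))" and ?b = "pr (Q.delta (t, es', ?s))"
 have ac: "?a : carrier B" "?b : carrier B" using 1(3) 2(3) by (intro pr_closed Q.delta_closed; simp add: Q.qpaths_iff)+
 have nz: "?a **.B ?b ~= \<zero>.B" by (rule pr_tile_loop(1)[OF t 1(3-5) 2(3-5)])
 show "M.p ?s t **.B M.p t ?s ~= \<zero>.B"
 proof
  assume z: "M.p ?s t **.B M.p t ?s = \<zero>.B"
  have e: "M.p ?s t **.B M.p t ?s = k \<odot>.B (k' \<odot>.B (?a **.B ?b))"
   unfolding 1(6) 2(6) B.mult_smult_left[OF 1(1) ac(1) B.A.smult_closed[OF 2(1) ac(2)]] B.mult_smult_right[OF 2(1) ac] ..
  have abc: "?a **.B ?b : carrier B" by (rule B.mult_closed[OF ac])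
  have h: "k \<odot>.B (k' \<odot>.B (?a **.B ?b)) = \<zero>.B" using z unfolding e .
  have kk: "c \<odot>.B (c \<odot>.B u) = u" if "u : carrier B" "c : carrier K" "c **.K c = \<one>.K" for u c
   unfolding B.A.smult_assoc1[OF that(2) that(2) that(1), symmetric] that(3) by (rule B.A.smult_one[OF that(1)])
  have "k' \<odot>.B (?a **.B ?b) = \<zero>.B"
   using kk[OF B.A.smult_closed[OF 2(1) abc] 1(1,2)] unfolding h B.A.smult_r_null[OF 1(1)] by (rule sym)
  hence "\<zero>.B = ?a **.B ?b" using kk[OF abc 2(1,2)] by (simp only: B.A.smult_r_null[OF 2(1)])
  thus False using nz by simp
 qed
qed

end

theorem corollary56:
  fixes K :: "'k ring" and r :: nat and X :: "point set"
  assumes "field K" and "r \<ge> 1" and "cubist r X"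
  shows "graded_highest_weight K (U_cubist K r X) (std_order r X) \<and>
    (\<forall>x\<in>X. has_linear_projective_resolution K (U_cubist K r X)
       (std_mod (U_cubist K r X) (std_order r X) x))"
proof -
  from assms(3) obtain I where I: "I \<subseteq> lattice_pts r" "\<forall>x\<in>I. \<forall>y\<in>lattice_pts r. y \<le> x \<longrightarrow> y \<in> I" "X = I - (\<lambda>x. diag_shift r x (- 1)) ` I"
    unfolding cubist_def by (elim exE conjE)
  have ideal: "cubist_ideal r I X"
    by (rule cubist_ideal.intro[OF assms(2) I(1) _ I(3)]) (use I(2) in \<open>simp add: le_fun_def\<close>)
  interpret cubist_quiver r I X K by (rule cubist_quiver.intro[OF ideal assms(1)])
  have alg: "cubist_algebra r I X K (U_cubist K r X) gen_arrow" by (rule cubist_algebra_B)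
  show ?thesis
  proof (intro conjI ballI)
    show "graded_highest_weight K (U_cubist K r X) (std_order r X)" by (rule cubist_algebra.highest_weight[OF alg])
    fix z assume "z \<in> X"
    hence "cubist_cone r I X K (U_cubist K r X) gen_arrow z" by (intro cubist_cone.intro cubist_cone_axioms.intro alg)
    thus "has_linear_projective_resolution K (U_cubist K r X) (std_mod (U_cubist K r X) (std_order r X) z)" by (rule cubist_cone.linear_resolution)
  qed
qed

end
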